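(* There exists a Sidon automorphism $T$ (a rank-one automorphism of an infinite measure space $(X,\mu)$ having the Sidon property) whose Poisson suspension $\mathbf P(T)$ is mixing and asymmetric; that is, $\mathbf P(T)$ is a mixing automorphism of the Poisson probability space $(X_\circ,\mu_\circ)$ and $\mathbf P(T)$ is not isomorphic to its inverse $\mathbf P(T)^{-1}=\mathbf P(T^{-1})$.
   Context: Rank-one automorphisms. The parameters are $h_1=1$, integers $r_j\ge 2$, and vectors $\bar s_j=(s_j(1),\dots,s_j(r_j))$ of integers $s_j(i)\ge 0$, $j\in\mathbf N$. At stage $j$ there is a tower $X_j=\bigcup_{i=0}^{h_j-1}T^iE_j$, where the sets $T^iE_j$ ($0\le i<h_j$), called floors, are disjoint half-intervals of equal finite length; $T$ moves each floor to the next one by translation and is not yet defined on the top floor $T^{h_j-1}E_j$. (The initial tower $X_1=E_1$ is a single half-interval.) At stage $j+1$, the tower $X_j$ is cut into $r_j$ identical narrow subtowers $X_{j,1},\dots,X_{j,r_j}$ (columns) of height $h_j$, by cutting $E_j$ into $r_j$ half-intervals of equal length. Above each column $X_{j,i}$ one adds $s_j(i)$ new disjoint floors (half-intervals of the same length as the column's floors). $T$ moves points up one floor, and the last floor above column number $i$ (the column's own top floor if $s_j(i)=0$) is sent to the bottom floor of column number $i+1$, $1\le i<r_j$. This gives the new tower $X_{j+1}=\bigcup_{i=0}^{h_{j+1}-1}T^iE_{j+1}$ with $h_{j+1}=r_jh_j+\sum_{i=1}^{r_j}s_j(i)$, where $E_{j+1}$ is the bottom floor of $X_{j,1}$. Earlier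 definitions of $T$ are preserved at each stage, and in the limit one obtains an invertible transformation $T$ (modulo null sets) of $X=\bigcup_jX_j$ preserving Lebesgue measure $\mu$. Sidon automorphisms. A rank-one automorphism $T$ as described is called Sidon if for every $j$ and every integer $m$ with $h_j<m\le h_{j+1}$ the intersection $X_j\cap T^mX_j$ is contained in a single one of the columns $X_{j,i}$ of the tower $X_j$. The measure $\mu(X)$ is infinite in this case. Poisson suspensions. Let $(X,\mu)$ be a space with infinite sigma-finite Lebesgue measure, where $X$ is a union of disjoint intervals. The configuration space $X_\circ$ consists of all infinite countable sets $x_\circ\subset X$ such that each of these intervals contains only finitely many elements of $x_\circ$. For measurable $A\subset X$ of finite measure and $k=0,1,2,\dots$ put $C(A,k)=\{x_\circ\in X_\circ: |x_\circ\cap A|=k\}$. The Poisson measure $\mu_\circ$ is the probability measure on $X_\circ$ (on the completed sigma-algebra generated by the sets $C(A,k)$) determined by $$\mu_\circ\Bigl(\bigcap_{i=1}^N C(A_i,k_i)\Bigr)=\prod_{i=1}^N\frac{\mu(A_i)^{k_i}}{k_i!}e^{-\mu(A_i)}$$ for pairwise disjoint measurable sets $A_1,\dots,A_N$ of finite measure. An automorphism $T$ of $(X,\mu)$ induces the automorphism $\mathbf P(T)$ of $(X_\circ,\mu_\circ)$, called the Poisson suspension over $T$, given (modulo null sets) by $\mathbf P(T)\{x_1,x_2,\dots\}=\{Tx_1,Tx_2,\dots\}$. $\mathbf P(T)$ is mixing if $\mu_\circ(\mathbf P(T)^nC\cap C')\to\mu_\circ(C)\mu_\circ(C')$ as $n\to\infty$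 for all measurable $C,C'\subset X_\circ$. An automorphism $R$ of a measure space is asymmetric if it is not isomorphic to its inverse, i.e. there is no invertible measure-preserving transformation $S$ of the space with $SRS^{-1}=R^{-1}$ (modulo null sets). *)

theory Defs
  imports "HOL-Probability.Probability"
begin

section \<open>Rank-one transformations by cutting and stacking\<close>

text \<open>
  Stages and columns are numbered from 0, so the initial tower is the tower of stage 0 and the
  columns of stage \<open>j\<close> are those with index \<open>i < r j\<close>. All half-intervals are closed on the left.
  The data of a construction are the numbers of columns \<open>r j\<close>, the numbers of spacers \<open>s j i\<close>, the
  common length \<open>w j\<close> of the floors of stage \<open>j\<close>, and the left endpoint \<open>a j l\<close> of the floor number
  \<open>l\<close> of stage \<open>j\<close>. The spacers may be placed anywhere on the line.
\<close>

primrec height :: "(nat \<Rightarrow> nat) \<Rightarrow> (nat \<Rightarrow> nat \<Rightarrow> nat) \<Rightarrow> nat \<Rightarrow> nat" where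
  "height r s 0 = 1"
| "height r s (Suc j) = r j * height r s j + (\<Sum>i<r j. s j i)"

text \<open>The floor number, in the tower of stage \<open>Suc j\<close>, of the bottom of column \<open>i\<close> of stage \<open>j\<close>.\<close>

definition column_start :: "(nat \<Rightarrow> nat) \<Rightarrow> (nat \<Rightarrow> nat \<Rightarrow> nat) \<Rightarrow> nat \<Rightarrow> nat \<Rightarrow> nat" where
  "column_start r s j i = i * height r s j + (\<Sum>k<i. s j k)"

definition tower_floor :: "(nat \<Rightarrow> real) \<Rightarrow> (nat \<Rightarrow> nat \<Rightarrow> real) \<Rightarrow> nat \<Rightarrow> nat \<Rightarrow> real set" where
  "tower_floor w a j l = {a j l ..< a j l + w j}"

definition tower ::
  "(nat \<Rightarrow> nat) \<Rightarrow> (nat \<Rightarrow> nat \<Rightarrow> nat) \<Rightarrow> (nat \<Rightarrow> real) \<Rightarrow> (nat \<Rightarrow> nat \<Rightarrow> real) \<Rightarrow> nat \<Rightarrow> real set" where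
  "tower r s w a j = (\<Union>l<height r s j. tower_floor w a j l)"

definition column ::
  "(nat \<Rightarrow> nat) \<Rightarrow> (nat \<Rightarrow> nat \<Rightarrow> nat) \<Rightarrow> (nat \<Rightarrow> real) \<Rightarrow> (nat \<Rightarrow> nat \<Rightarrow> real) \<Rightarrow>
    nat \<Rightarrow> nat \<Rightarrow> real set" where
  "column r s w a j i = (\<Union>l<height r s j.
     {a j l + real i * w (Suc j) ..< a j l + real (Suc i) * w (Suc j)})"

definition phase_space ::
  "(nat \<Rightarrow> nat) \<Rightarrow> (nat \<Rightarrow> nat \<Rightarrow> nat) \<Rightarrow> (nat \<Rightarrow> real) \<Rightarrow> (nat \<Rightarrow> nat \<Rightarrow> real) \<Rightarrow> real set" where
  "phase_space r s w a = (\<Union>j. tower r s w a j)"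

text \<open>
  Disjointness of the floors of stage \<open>Suc j\<close> contains the requirement that the spacers added
  at that stage are disjoint from each other and from the tower of stage \<open>j\<close>. The equations in
  \<open>rank_one_map\<close> determine \<open>T\<close> at every point of the phase space, because a point cannot lie in the
  top floor (half-open, and cut at its right end) at all late stages; \<open>T\<close> is injective there, and its
  image misses only the left endpoint of the initial floor. Values off the phase space are irrelevant.
\<close>

definition rank_one_construction ::
  "(nat \<Rightarrow> nat) \<Rightarrow> (nat \<Rightarrow> nat \<Rightarrow> nat) \<Rightarrow> (nat \<Rightarrow> real) \<Rightarrow> (nat \<Rightarrow> nat \<Rightarrow> real) \<Rightarrow> bool" where
  "rank_one_construction r s w a \<longleftrightarrow>
     (\<forall>j. r j \<ge> 2) \<and>
     w 0 > 0 \<and> (\<forall>j. w (Suc j) = w j / real (r j)) \<and>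
     (\<forall>j. disjoint_family_on (tower_floor w a j) {..<height r s j}) \<and>
     (\<forall>j. \<forall>i<r j. \<forall>l<height r s j.
        a (Suc j) (column_start r s j i + l) = a j l + real i * w (Suc j))"

definition rank_one_map ::
  "(nat \<Rightarrow> nat) \<Rightarrow> (nat \<Rightarrow> nat \<Rightarrow> nat) \<Rightarrow> (nat \<Rightarrow> real) \<Rightarrow> (nat \<Rightarrow> nat \<Rightarrow> real) \<Rightarrow>
    (real \<Rightarrow> real) \<Rightarrow> bool" where
  "rank_one_map r s w a T \<longleftrightarrow>
     rank_one_construction r s w a \<and>
     (\<forall>j l. Suc l < height r s j \<longrightarrow>
        (\<forall>x \<in> tower_floor w a j l. T x = x + (a j (Suc l) - a j l)))"

definition sidon ::
  "(nat \<Rightarrow> nat) \<Rightarrow> (nat \<Rightarrow> nat \<Rightarrow> nat) \<Rightarrow> (nat \<Rightarrow> real) \<Rightarrow> (nat \<Rightarrow> nat \<Rightarrow> real) \<Rightarrow>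
    (real \<Rightarrow> real) \<Rightarrow> bool" where
  "sidon r s w a T \<longleftrightarrow>
     (\<forall>j m. height r s j < m \<and> m \<le> height r s (Suc j) \<longrightarrow>
        (\<exists>i<r j. tower r s w a j \<inter> (T ^^ m) ` tower r s w a j \<subseteq> column r s w a j i))"

text \<open>
  The disjoint intervals of which the phase space is made: the initial floor and all spacers, the
  latter being the floors of stage \<open>Suc j\<close> that do not meet the tower of stage \<open>j\<close>.
\<close>

definition phase_intervals ::
  "(nat \<Rightarrow> nat) \<Rightarrow> (nat \<Rightarrow> nat \<Rightarrow> nat) \<Rightarrow> (nat \<Rightarrow> real) \<Rightarrow> (nat \<Rightarrow> nat \<Rightarrow> real) \<Rightarrow>
    real set set" where
  "phase_intervals r s w a = insert (tower_floor w a 0 0)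
     {tower_floor w a (Suc j) l | j l.
        l < height r s (Suc j) \<and> tower_floor w a (Suc j) l \<inter> tower r s w a j = {}}"

section \<open>Automorphisms modulo null sets\<close>

definition measure_preserving :: "'a measure \<Rightarrow> ('a \<Rightarrow> 'a) \<Rightarrow> bool" where
  "measure_preserving M f \<longleftrightarrow> f \<in> M \<rightarrow>\<^sub>M M \<and> distr M M f = M"

definition inverse_mod0 :: "'a measure \<Rightarrow> ('a \<Rightarrow> 'a) \<Rightarrow> ('a \<Rightarrow> 'a) \<Rightarrow> bool" where
  "inverse_mod0 M f g \<longleftrightarrow> measure_preserving M f \<and> measure_preserving M g \<and>
     (AE x in M. g (f x) = x) \<and> (AE x in M. f (g x) = x)"

definition automorphism :: "'a measure \<Rightarrow> ('a \<Rightarrow> 'a) \<Rightarrow> bool" where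
  "automorphism M f \<longleftrightarrow> (\<exists>g. inverse_mod0 M f g)"

text \<open>
  For an automorphism \<open>f\<close> the set below has the same measure as \<open>f\<^sup>n C \<inter> C'\<close>. The preimage is used
  because forward images are not stable under changing \<open>f\<close> on a null set.
\<close>

definition mixing :: "'a measure \<Rightarrow> ('a \<Rightarrow> 'a) \<Rightarrow> bool" where
  "mixing M f \<longleftrightarrow> (\<forall>C\<in>sets M. \<forall>C'\<in>sets M.
     (\<lambda>n. measure M (C \<inter> ((f ^^ n) -` C' \<inter> space M))) \<longlonglongrightarrow> measure M C * measure M C')"

definition isomorphic_mod0 :: "'a measure \<Rightarrow> ('a \<Rightarrow> 'a) \<Rightarrow> ('a \<Rightarrow> 'a) \<Rightarrow> bool" where
  "isomorphic_mod0 M f g \<longleftrightarrow>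
     (\<exists>S S'. inverse_mod0 M S S' \<and> (AE x in M. S (f (S' x)) = g x))"

text \<open>The inverse \<open>g\<close> is unique modulo null sets.\<close>

definition asymmetric :: "'a measure \<Rightarrow> ('a \<Rightarrow> 'a) \<Rightarrow> bool" where
  "asymmetric M f \<longleftrightarrow> (\<exists>g. inverse_mod0 M f g \<and> \<not> isomorphic_mod0 M f g)"

section \<open>Poisson suspensions\<close>

text \<open>In this section \<open>\<I>\<close> is the given family of disjoint intervals with union the base space.\<close>

definition configurations :: "real set set \<Rightarrow> real set set" where
  "configurations \<I> =
     {x. x \<subseteq> \<Union>\<I> \<and> infinite x \<and> countable x \<and> (\<forall>I\<in>\<I>. finite (x \<inter> I))}"

text \<open>
  Finiteness has to be stated, as \<open>card\<close> is 0 on infinite sets and a configuration may meet a set of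
  finite measure in infinitely many points.
\<close>

definition count_event :: "real set set \<Rightarrow> real set \<Rightarrow> nat \<Rightarrow> real set set" where
  "count_event \<I> A k = {x \<in> configurations \<I>. finite (x \<inter> A) \<and> card (x \<inter> A) = k}"

text \<open>
  At most one measure space satisfies this predicate, since the finite disjoint unions of the
  intersections in the last clause form a generating family closed under intersection.
\<close>

definition poisson_space :: "real set set \<Rightarrow> real set measure \<Rightarrow> bool" where
  "poisson_space \<I> M \<longleftrightarrow>
     (\<exists>N. M = completion N \<and> prob_space N \<and>
       space N = configurations \<I> \<and>
       sets N = sigma_sets (configurations \<I>)
         {count_event \<I> A k | A k. A \<in> fmeasurable (lebesgue_on (\<Union>\<I>))}) \<and>
     (\<forall>n (A :: nat \<Rightarrow> real set) k.
        0 < n \<and> disjoint_family_on A {..<n} \<and>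
        (\<forall>i<n. A i \<in> fmeasurable (lebesgue_on (\<Union>\<I>))) \<longrightarrow>
        measure M (\<Inter>i<n. count_event \<I> (A i) (k i)) =
          (\<Prod>i<n. measure lebesgue (A i) ^ k i / fact (k i) * exp (- measure lebesgue (A i))))"

text \<open>
  The image of a configuration is again a configuration only almost surely; the exceptional
  null set is left fixed.
\<close>

definition suspension :: "real set set \<Rightarrow> (real \<Rightarrow> real) \<Rightarrow> real set \<Rightarrow> real set" where
  "suspension \<I> T x = (if T ` x \<in> configurations \<I> then T ` x else x)"

end

theory Submission
  imports Defs
begin

text \<open>
  At stage \<open>j\<close> there are \<open>j + 2\<close> columns, and column \<open>i\<close> starts at the floor \<open>2 h\<^sub>j (4\<^sup>i - 1)\<close>. Since the differences
  of powers of 4 are distinct, a time \<open>m\<close> with \<open>h\<^sub>j < m \<le> h\<^sub>j\<^sub>+\<^sub>1\<close> can return points of the tower from one column only. This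
  is the Sidon property; it also gives \<open>\<mu> (A \<inter> T\<^sup>-\<^sup>m B) \<rightarrow> 0\<close>, whence mixing of the suspension on void events.

  The times \<open>p = c\<^sub>i\<^sub>+\<^sub>1 - c\<^sub>i\<close> and \<open>q = c\<^sub>i\<^sub>+\<^sub>2 - c\<^sub>i\<close> between the starts of three consecutive columns distinguish \<open>T\<close> from its
  inverse: for a union \<open>E\<close> of floors, \<open>E \<inter> T\<^sup>-\<^sup>p E \<inter> T\<^sup>-\<^sup>q E\<close> is the part of \<open>E\<close> in one column, while
  \<open>E \<inter> T\<^sup>-\<^sup>(\<^sup>q\<^sup>-\<^sup>p\<^sup>) E \<inter> T\<^sup>-\<^sup>q E\<close> is empty.

  Suppose that \<open>S\<close> conjugates the suspension to its inverse, and let \<open>h\<close> be the centred number of points in \<open>E\<close>, composed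
  with \<open>S\<close>. It has the autocorrelations \<open>\<mu> (E \<inter> T\<^sup>-\<^sup>n E)\<close>. Averaging over the differences of the column starts extracts
  from an approximation of \<open>h\<close> by void events its linear part, and these autocorrelations then force \<open>h\<close> to be a
  limit of linear combinations of centred counts. As \<open>h\<close> is distributed as a centred count, the characteristic
  function at \<open>\<pi>\<close> shows that the coefficients tend to 0 or 1, so \<open>h\<close> is the centred count of a set \<open>G\<close>. The void
  probabilities turn the triple intersections of \<open>G\<close> into those of \<open>E\<close> for the reversed time, which are empty. But
  \<open>G\<close> is close to a union of floors of some stage, and those return along the three columns. This is a contradiction.
\<close>

section \<open>The Poisson measure\<close>

subsection \<open>A Poisson number of uniform points in each unit interval\<close>

definition unif :: "nat \<Rightarrow> real measure" where "unif n = lebesgue_on {real n..<real n + 1}"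

lemma space_unif [simp]: "space (unif n) = {real n..<real n + 1}" by (simp add: unif_def)

lemma unif_sets: "A \<in> sets (unif n) \<longleftrightarrow> A \<in> sets lebesgue \<and> A \<subseteq> {real n..<real n + 1}"
  by (auto simp: unif_def sets_restrict_space_iff)

lemma emeasure_unif: "A \<subseteq> {real n..<real n + 1} \<Longrightarrow> emeasure (unif n) A = emeasure lebesgue A"
  unfolding unif_def by (rule emeasure_restrict_space) auto

lemma prob_space_unif: "prob_space (unif n)"
  by (rule prob_spaceI) (simp add: emeasure_unif)

interpretation U: prob_space "unif n" for n by (rule prob_space_unif)

definition pts :: "nat \<Rightarrow> (nat \<Rightarrow> real) measure" where "pts n = (\<Pi>\<^sub>M i\<in>UNIV. unif n)"

interpretation UP: product_prob_space "\<lambda>i::nat. unif n" UNIV for n by unfold_locales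

lemma prob_space_pts: "prob_space (pts n)" unfolding pts_def by (rule UP.prob_space_axioms)

lemma (in product_prob_space) indep_components:
  assumes "I \<noteq> {}" shows "prob_space.indep_vars (PiM I M) M (\<lambda>i \<omega>. \<omega> i) I"
proof -
  have "distr (PiM I M) (PiM I M) (\<lambda>x. \<lambda>i\<in>I. x i) = distr (PiM I M) (PiM I M) (\<lambda>x. x)"
    by (rule distr_cong) (auto simp: space_PiM PiE_def extensional_restrict)
  moreover have "PiM I (\<lambda>i. distr (PiM I M) (M i) (\<lambda>\<omega>. \<omega> i)) = PiM I M"
    by (rule PiM_cong) (auto simp: PiM_component)
  ultimately show ?thesis
    by (subst prob_space.indep_vars_iff_distr_eq_PiM'[OF prob_space_axioms assms]) auto
qed

lemma (in product_prob_space) integral_prod_components: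
  fixes f :: "'i \<Rightarrow> 'a \<Rightarrow> complex"
  assumes J: "finite J" "J \<subseteq> I" and f: "\<And>i. i \<in> J \<Longrightarrow> f i \<in> borel_measurable (M i)"
    and b: "\<And>i x. i \<in> J \<Longrightarrow> x \<in> space (M i) \<Longrightarrow> norm (f i x) \<le> 1"
  shows "(\<integral>\<omega>. (\<Prod>i\<in>J. f i (\<omega> i)) \<partial>PiM I M) = (\<Prod>i\<in>J. \<integral>x. f i x \<partial>M i)"
proof (cases "J = {}")
  case True
  then show ?thesis by (simp add: P.prob_space)
next
  case False
  then have "I \<noteq> {}" using J by auto
  have c: "(\<lambda>\<omega>. \<omega> i) \<in> PiM I M \<rightarrow>\<^sub>M M i" if "i \<in> J" for i
    using that J by (intro measurable_component_singleton) auto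
  have "indep_vars (\<lambda>_. borel) (\<lambda>i \<omega>. f i (\<omega> i)) J"
    using indep_vars_compose2[OF indep_vars_subset[OF indep_components[OF \<open>I \<noteq> {}\<close>] J(2)], of f "\<lambda>_. borel"] f by simp
  moreover have "integrable (PiM I M) (\<lambda>\<omega>. f i (\<omega> i))" if "i \<in> J" for i
  proof (rule integrable_const_bound[of _ 1])
    show "AE x in PiM I M. norm (f i (x i)) \<le> 1"
      by (rule AE_I2) (use b that J in \<open>auto simp: space_PiM PiE_iff\<close>)
    show "(\<lambda>\<omega>. f i (\<omega> i)) \<in> borel_measurable (PiM I M)" using measurable_compose[OF c[OF that] f[OF that]] .
  qed
  ultimately have "(\<integral>\<omega>. (\<Prod>i\<in>J. f i (\<omega> i)) \<partial>PiM I M) = (\<Prod>i\<in>J. \<integral>\<omega>. f i (\<omega> i) \<partial>PiM I M)"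
    using J(1) by (intro indep_vars_lebesgue_integral) auto
  also have "\<dots> = (\<Prod>i\<in>J. \<integral>x. f i x \<partial>M i)"
  proof (rule prod.cong[OF refl])
    fix i assume i: "i \<in> J"
    have "(\<integral>x. f i x \<partial>M i) = (\<integral>x. f i x \<partial>distr (PiM I M) (M i) (\<lambda>\<omega>. \<omega> i))"
      using PiM_component[of i] i J by (simp add: subset_iff)
    also have "\<dots> = (\<integral>\<omega>. f i (\<omega> i) \<partial>PiM I M)" by (rule integral_distr[OF c[OF i] f[OF i]])
    finally show "(\<integral>\<omega>. f i (\<omega> i) \<partial>PiM I M) = (\<integral>x. f i x \<partial>M i)" by simp
  qed
  finally show ?thesis .
qed

definition cell_space :: "nat \<Rightarrow> (nat \<times> (nat \<Rightarrow> real)) measure" where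
  "cell_space n = measure_pmf (poisson_pmf 1) \<Otimes>\<^sub>M pts n"

lemma prob_space_cell_space: "prob_space (cell_space n)"
proof -
  interpret A: prob_space "measure_pmf (poisson_pmf 1)" by (rule measure_pmf.prob_space_axioms)
  interpret B: prob_space "pts n" by (rule prob_space_pts)
  interpret pair_prob_space "measure_pmf (poisson_pmf 1)" "pts n" by unfold_locales
  show ?thesis unfolding cell_space_def by (rule prob_space_axioms)
qed

interpretation C: product_prob_space cell_space UNIV
  using prob_space_cell_space by (intro product_prob_spaceI)

definition Om :: "(nat \<Rightarrow> nat \<times> (nat \<Rightarrow> real)) measure" where "Om = (\<Pi>\<^sub>M n\<in>UNIV. cell_space n)"

lemma prob_space_Om: "prob_space Om" unfolding Om_def by (rule C.prob_space_axioms)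

lemma sets_cell_space: "sets (cell_space n) = sets (count_space UNIV \<Otimes>\<^sub>M pts n)"
  unfolding cell_space_def by (rule sets_pair_measure_cong) auto

lemma pts_component [measurable]: "(\<lambda>\<omega>. \<omega> i) \<in> pts n \<rightarrow>\<^sub>M unif n"
  unfolding pts_def by (rule measurable_component_singleton) simp

lemma Om_component [measurable]: "(\<lambda>\<omega>. \<omega> n) \<in> Om \<rightarrow>\<^sub>M cell_space n"
  unfolding Om_def by (rule measurable_component_singleton) simp

lemma cell_space_fst [measurable]: "fst \<in> cell_space n \<rightarrow>\<^sub>M count_space UNIV"
  unfolding measurable_cong_sets[OF sets_cell_space refl] by simp

lemma cell_space_snd [measurable]: "snd \<in> cell_space n \<rightarrow>\<^sub>M pts n"
  unfolding cell_space_def by simp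

lemma cell_prod_measurable:
  fixes v :: "real \<Rightarrow> complex"
  assumes [measurable]: "v \<in> borel_measurable (unif n)"
  shows "(\<lambda>(k, u). \<Prod>i<k. v (u i)) \<in> borel_measurable (cell_space n)"
proof -
  have "(\<lambda>p. (\<lambda>k p. \<Prod>i<k. v (snd p i)) (fst p) p) \<in> borel_measurable (cell_space n)"
  proof (rule measurable_compose_countable)
    fix k :: nat
    have "(\<lambda>p. v (snd p i)) \<in> borel_measurable (cell_space n)" for i
      by (rule measurable_compose[OF _ assms], rule measurable_compose[OF cell_space_snd pts_component])
    then show "(\<lambda>p. \<Prod>i<k. v (snd p i)) \<in> borel_measurable (cell_space n)" by simp
  qed simp
  then show ?thesis by (simp add: case_prod_beta)
qed

lemma integral_poisson_power:
  assumes "norm (z::complex) \<le> 1"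
  shows "(\<integral>k. z ^ k \<partial>measure_pmf (poisson_pmf 1)) = exp (z - 1)"
proof -
  define q where "q k = pmf (poisson_pmf 1) k" for k
  have q: "q k = exp (-1) / fact k" for k by (simp add: q_def)
  have sm: "summable (\<lambda>k. norm (q k *\<^sub>R z ^ k))"
  proof (rule summable_comparison_test)
    show "\<exists>N. \<forall>k\<ge>N. norm (norm (q k *\<^sub>R z ^ k)) \<le> exp (-1) * (1 / fact k)"
    proof (intro exI allI impI)
      fix k
      have "norm z ^ k \<le> 1" using assms by (simp add: power_le_one)
      then show "norm (norm (q k *\<^sub>R z ^ k)) \<le> exp (-1) * (1 / fact k)"
        by (simp add: q norm_power mult_left_le divide_right_mono)
    qed
    show "summable (\<lambda>k. exp (-1) * (1 / fact k) :: real)"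
      using summable_exp[of "1::real"] by (intro summable_mult) (simp add: divide_inverse)
  qed
  have "(\<integral>k. z ^ k \<partial>measure_pmf (poisson_pmf 1)) = (\<integral>k. q k *\<^sub>R z ^ k \<partial>count_space UNIV)"
    unfolding measure_pmf_eq_density q_def by (rule integral_density) auto
  also have "\<dots> = (\<Sum>k. q k *\<^sub>R z ^ k)"
    by (rule integral_count_space_nat) (use sm in \<open>simp add: integrable_count_space_nat_iff\<close>)
  also have "\<dots> = exp (z - 1)"
  proof (rule sums_unique[symmetric])
    have "(\<lambda>k. exp (-1) * (z ^ k /\<^sub>R fact k)) sums (exp (-1) * exp z)"
      by (intro sums_mult exp_converges)
    moreover have "exp (-1) * (z ^ k /\<^sub>R fact k) = q k *\<^sub>R z ^ k" for k
      by (simp add: q scaleR_conv_of_real divide_inverse exp_of_real[symmetric])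
    moreover have "exp (-1) * exp z = exp (z - 1)" by (simp add: exp_add[symmetric])
    ultimately show "(\<lambda>k. q k *\<^sub>R z ^ k) sums exp (z - 1)" by simp
  qed
  finally show ?thesis .
qed

lemma integral_cell_prod:
  fixes v :: "real \<Rightarrow> complex"
  assumes v: "v \<in> borel_measurable (unif n)" and b: "\<And>x. norm (v x) \<le> 1"
  shows "(\<integral>p. (case p of (k, u) \<Rightarrow> \<Prod>i<k. v (u i)) \<partial>cell_space n) = exp ((\<integral>x. v x \<partial>unif n) - 1)"
    "norm (\<Prod>i<k. v (u i)) \<le> 1"
proof -
  interpret A: prob_space "measure_pmf (poisson_pmf 1)" by (rule measure_pmf.prob_space_axioms)
  interpret B: prob_space "pts n" by (rule prob_space_pts)
  interpret P: pair_prob_space "measure_pmf (poisson_pmf 1)" "pts n" by unfold_locales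
  show nb: "norm (\<Prod>i<k. v (u i)) \<le> 1" for k u
    unfolding prod_norm[symmetric] by (rule prod_le_1) (use b in auto)
  have int: "integrable (measure_pmf (poisson_pmf 1) \<Otimes>\<^sub>M pts n) (\<lambda>(k, u). \<Prod>i<k. v (u i))"
    using cell_prod_measurable[OF v] nb unfolding cell_space_def
    by (intro P.P.integrable_const_bound[of _ 1]) (auto simp: case_prod_beta)
  have "(\<integral>p. (case p of (k, u) \<Rightarrow> \<Prod>i<k. v (u i)) \<partial>cell_space n)
      = (\<integral>k. (\<integral>u. (\<Prod>i<k. v (u i)) \<partial>pts n) \<partial>measure_pmf (poisson_pmf 1))"
    unfolding cell_space_def using P.integral_fst'[OF int] by simp
  also have "\<dots> = (\<integral>k. (\<integral>x. v x \<partial>unif n) ^ k \<partial>measure_pmf (poisson_pmf 1))"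
  proof (rule Bochner_Integration.integral_cong[OF refl])
    fix k
    have "(\<integral>u. (\<Prod>i<k. v (u i)) \<partial>pts n) = (\<Prod>i<k. (\<integral>x. v x \<partial>unif n))"
      unfolding pts_def by (rule UP.integral_prod_components) (use v b in auto)
    then show "(\<integral>u. (\<Prod>i<k. v (u i)) \<partial>pts n) = (\<integral>x. v x \<partial>unif n) ^ k" by simp
  qed
  also have "\<dots> = exp ((\<integral>x. v x \<partial>unif n) - 1)"
  proof (rule integral_poisson_power)
    have "norm (\<integral>x. v x \<partial>unif n) \<le> (\<integral>x. norm (v x) \<partial>unif n)" by simp
    also have "\<dots> \<le> (\<integral>x. 1 \<partial>unif n)"
      by (rule integral_mono) (use v b in \<open>auto intro!: U.integrable_const_bound[of _ 1]\<close>)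
    also have "\<dots> = 1" using U.prob_space[of n] by simp
    finally show "norm (\<integral>x. v x \<partial>unif n) \<le> 1" .
  qed
  finally show "(\<integral>p. (case p of (k, u) \<Rightarrow> \<Prod>i<k. v (u i)) \<partial>cell_space n) = exp ((\<integral>x. v x \<partial>unif n) - 1)" .
qed

lemma integral_Om_prod:
  fixes v :: "real \<Rightarrow> complex"
  assumes v: "\<And>n. v \<in> borel_measurable (unif n)" and b: "\<And>x. norm (v x) \<le> 1"
  shows "(\<integral>\<omega>. (\<Prod>n<m. case \<omega> n of (k, u) \<Rightarrow> \<Prod>i<k. v (u i)) \<partial>Om) = exp (\<Sum>n<m. (\<integral>x. v x \<partial>unif n) - 1)"
proof -
  have "(\<integral>\<omega>. (\<Prod>n<m. case \<omega> n of (k, u) \<Rightarrow> \<Prod>i<k. v (u i)) \<partial>Om)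
      = (\<Prod>n<m. \<integral>p. (case p of (k, u) \<Rightarrow> \<Prod>i<k. v (u i)) \<partial>cell_space n)"
    unfolding Om_def
    using C.integral_prod_components[of "{..<m}" "\<lambda>n (k, u). \<Prod>i<k. v (u i)"]
      cell_prod_measurable[OF v] integral_cell_prod(2)[OF v b] by (auto simp: case_prod_beta)
  also have "\<dots> = (\<Prod>n<m. exp ((\<integral>x. v x \<partial>unif n) - 1))"
    by (rule prod.cong[OF refl]) (rule integral_cell_prod(1)[OF v b])
  finally show ?thesis by (simp add: exp_sum)
qed

subsection \<open>The random configuration\<close>

definition good :: "(nat \<Rightarrow> nat \<times> (nat \<Rightarrow> real)) \<Rightarrow> bool" where
  "good \<omega> \<longleftrightarrow> (\<forall>n i j. i \<noteq> j \<longrightarrow> snd (\<omega> n) i \<noteq> snd (\<omega> n) j) \<and> (\<forall>m. \<exists>n\<ge>m. 0 < fst (\<omega> n))"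

definition cfg :: "(nat \<Rightarrow> nat \<times> (nat \<Rightarrow> real)) \<Rightarrow> real set" where
  "cfg \<omega> = (\<Union>n. snd (\<omega> n) ` {..<fst (\<omega> n)})"

lemma AE_pts_distinct: "i \<noteq> j \<Longrightarrow> AE u in pts n. u i \<noteq> u j"
proof -
  assume ij: "i \<noteq> j"
  interpret B: prob_space "pts n" by (rule prob_space_pts)
  have idm: "(\<lambda>x. x) \<in> borel_measurable (unif n)"
    using id_borel_measurable_lebesgue_on[of "{real n..<real n + 1}"] unfolding unif_def id_def .
  define D where "D = {u \<in> space (pts n). u i = u j}"
  have D: "D \<in> sets (pts n)" unfolding D_def
    by (rule borel_measurable_eq) (rule measurable_compose[OF pts_component idm])+
  have le: "emeasure (pts n) D \<le> ennreal (1 / real p)" if p: "0 < p" for p :: nat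
  proof -
    define c where "c q = {real n + real q / real p..<real n + real (Suc q) / real p}" for q
    have cs: "c q \<subseteq> {real n..<real n + 1}" if "q < p" for q
      using that p by (auto simp: c_def field_simps)
    have csets: "c q \<in> sets (unif n)" if "q < p" for q using cs[OF that] by (auto simp: unif_sets c_def)
    have ec: "emeasure (unif n) (c q) = ennreal (1 / p)" if "q < p" for q
      unfolding emeasure_unif[OF cs[OF that]] using p by (simp add: c_def field_simps)
    define F where "F q = {u \<in> space (PiM UNIV (\<lambda>i::nat. unif n)). \<forall>t\<in>{i,j}. u t \<in> c q}" for q
    have eF: "emeasure (pts n) (F q) = ennreal (1 / p) * ennreal (1 / p)" if "q < p" for q
      unfolding F_def pts_def using UP.emeasure_PiM_Collect[of "{i,j}" "\<lambda>_. c q" n] csets[OF that] ec[OF that] ij by simp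
    have Fs: "F q \<in> sets (pts n)" if "q < p" for q
    proof -
      have "F q = (\<lambda>u. u i) -` c q \<inter> space (pts n) \<inter> ((\<lambda>u. u j) -` c q \<inter> space (pts n))"
        by (auto simp: F_def pts_def)
      then show ?thesis using measurable_sets[OF pts_component csets[OF that]] by (metis sets.Int)
    qed
    have "D \<subseteq> (\<Union>q<p. F q)"
    proof
      fix u assume u: "u \<in> D"
      then have ui: "real n \<le> u i" "u i < real n + 1" "u i = u j"
        by (auto simp: D_def pts_def space_PiM)
      define q where "q = nat \<lfloor>(u i - real n) * p\<rfloor>"
      have fl: "real q \<le> (u i - real n) * p" "(u i - real n) * p < real q + 1"
        using ui by (simp_all add: q_def)
      have "(u i - real n) * real p < 1 * real p" using ui p by (intro mult_strict_right_mono) auto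
      then have "q < p" using fl by simp
      moreover have "u i \<in> c q" using fl p by (simp add: c_def field_simps)
      ultimately show "u \<in> (\<Union>q<p. F q)" using u ui by (auto simp: F_def D_def pts_def)
    qed
    then have "emeasure (pts n) D \<le> emeasure (pts n) (\<Union>q<p. F q)" using Fs by (intro emeasure_mono) auto
    also have "\<dots> \<le> (\<Sum>q<p. emeasure (pts n) (F q))" using Fs by (intro emeasure_subadditive_finite) auto
    also have "\<dots> = (\<Sum>q<p. ennreal (1 / p) * ennreal (1 / p))" by (rule sum.cong) (auto simp: eF)
    also have "\<dots> = ennreal (1 / p)" using p by (simp add: ennreal_mult[symmetric] ennreal_of_nat_eq_real_of_nat)
    finally show ?thesis .
  qed
  have "emeasure (pts n) D = 0"
  proof (rule ccontr)
    assume "emeasure (pts n) D \<noteq> 0"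
    then have pos: "0 < measure (pts n) D" by (simp add: B.emeasure_eq_measure zero_less_measure_iff)
    obtain p :: nat where "0 < p" "1 / p < measure (pts n) D"
      using reals_Archimedean[OF pos] by (metis inverse_eq_divide zero_less_Suc)
    then show False using le[of p] by (simp add: B.emeasure_eq_measure ennreal_le_iff)
  qed
  then show ?thesis using D by (intro AE_I[of _ _ D]) (auto simp: D_def)
qed

lemma AE_cell_space: assumes "AE u in pts n. Q u" shows "AE p in cell_space n. Q (snd p)"
proof -
  interpret A: prob_space "measure_pmf (poisson_pmf 1)" by (rule measure_pmf.prob_space_axioms)
  interpret B: prob_space "pts n" by (rule prob_space_pts)
  interpret P: pair_prob_space "measure_pmf (poisson_pmf 1)" "pts n" by unfold_locales
  have d: "distr (cell_space n) (pts n) snd = pts n" unfolding cell_space_def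
  proof (rule measure_eqI)
    fix X assume "X \<in> sets (distr (measure_pmf (poisson_pmf 1) \<Otimes>\<^sub>M pts n) (pts n) snd)"
    then have X: "X \<in> sets (pts n)" by simp
    have "snd -` X \<inter> space (measure_pmf (poisson_pmf 1) \<Otimes>\<^sub>M pts n) = UNIV \<times> X"
      using sets.sets_into_space[OF X] by (auto simp: space_pair_measure)
    then show "emeasure (distr (measure_pmf (poisson_pmf 1) \<Otimes>\<^sub>M pts n) (pts n) snd) X = emeasure (pts n) X"
      using X measure_pmf.emeasure_space_1[of "poisson_pmf 1"]
      by (simp add: emeasure_distr B.emeasure_pair_measure_Times)
  qed simp
  have "AE u in distr (cell_space n) (pts n) snd. Q u" using assms by (simp only: d)
  then show ?thesis by (rule AE_distrD[OF cell_space_snd])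
qed

lemma AE_good: "AE \<omega> in Om. good \<omega>"
proof -
  interpret O: prob_space Om by (rule prob_space_Om)
  have 1: "AE \<omega> in Om. \<forall>n i j. i \<noteq> j \<longrightarrow> snd (\<omega> n) i \<noteq> snd (\<omega> n) j"
  proof (subst AE_all_countable, intro allI, subst AE_all_countable, intro allI, subst AE_all_countable, intro allI)
    fix n i j :: nat
    show "AE \<omega> in Om. i \<noteq> j \<longrightarrow> snd (\<omega> n) i \<noteq> snd (\<omega> n) j"
    proof (cases "i = j")
      case False
      from AE_cell_space[OF AE_pts_distinct[OF False, of n]]
      have "AE p in cell_space n. snd p i \<noteq> snd p j" .
      then show ?thesis unfolding Om_def using C.AE_component[of n "\<lambda>p. snd p i \<noteq> snd p j"] by auto
    qed simp
  qed
  have 2: "AE \<omega> in Om. \<forall>m. \<exists>n\<ge>m. 0 < fst (\<omega> n)"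
  proof (subst AE_all_countable, intro allI)
    fix m :: nat
    define D where "D = {\<omega> \<in> space Om. \<forall>n\<ge>m. fst (\<omega> n) = 0}"
    have fm: "(\<lambda>\<omega>. fst (\<omega> n)) \<in> Om \<rightarrow>\<^sub>M count_space UNIV" for n
      by (rule measurable_compose[OF Om_component cell_space_fst])
    have D: "D \<in> sets Om" unfolding D_def
      using fm by measurable
    define K where "K n = {0::nat} \<times> space (pts n)" for n
    have Ks: "K n \<in> sets (cell_space n)" for n unfolding K_def cell_space_def by simp
    have eK: "emeasure (cell_space n) (K n) = ennreal (exp (-1))" for n
    proof -
      interpret B: prob_space "pts n" by (rule prob_space_pts)
      show ?thesis unfolding K_def cell_space_def
        by (subst B.emeasure_pair_measure_Times) (auto simp: emeasure_pmf_single B.emeasure_space_1)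
    qed
    have le: "emeasure Om D \<le> ennreal (exp (- real M))" for M :: nat
    proof -
      have "D \<subseteq> {\<omega> \<in> space Om. \<forall>n\<in>{m..<m+M}. \<omega> n \<in> K n}"
      proof
        fix \<omega> assume "\<omega> \<in> D"
        then have w: "\<omega> \<in> space Om" "\<forall>n\<ge>m. fst (\<omega> n) = 0" by (auto simp: D_def)
        have "\<omega> n \<in> space (cell_space n)" for n using measurable_space[OF Om_component w(1)] .
        then have "snd (\<omega> n) \<in> space (pts n)" for n by (metis cell_space_snd measurable_space)
        then show "\<omega> \<in> {\<omega> \<in> space Om. \<forall>n\<in>{m..<m+M}. \<omega> n \<in> K n}" using w by (auto simp: K_def mem_Times_iff)
      qed
      then have "emeasure Om D \<le> emeasure Om {\<omega> \<in> space Om. \<forall>n\<in>{m..<m+M}. \<omega> n \<in> K n}"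
      proof (intro emeasure_mono)
        have "{\<omega> \<in> space Om. \<omega> n \<in> K n} \<in> sets Om" for n
          using measurable_sets[OF Om_component Ks[of n]] by (simp add: vimage_def Int_def conj_commute)
        then show "{\<omega> \<in> space Om. \<forall>n\<in>{m..<m+M}. \<omega> n \<in> K n} \<in> sets Om"
          by (intro sets.sets_Collect_finite_All) auto
      qed
      also have "\<dots> = (\<Prod>n\<in>{m..<m+M}. emeasure (cell_space n) (K n))"
        unfolding Om_def by (rule C.emeasure_PiM_Collect) (use Ks in auto)
      also have "\<dots> = ennreal (exp (-1) ^ M)" by (simp add: eK ennreal_power)
      also have "exp (-1) ^ M = exp (- real M)" by (simp add: exp_of_nat_mult[symmetric])
      finally show ?thesis .
    qed
    have "emeasure Om D = 0"
    proof (rule ccontr)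
      assume "emeasure Om D \<noteq> 0"
      then have pos: "0 < measure Om D" by (simp add: O.emeasure_eq_measure zero_less_measure_iff)
      obtain M :: nat where "- ln (measure Om D) < real M" using reals_Archimedean2 by blast
      then have "exp (- real M) < exp (ln (measure Om D))" by simp
      then have "exp (- real M) < measure Om D" using pos by simp
      then show False using le[of M] by (simp add: O.emeasure_eq_measure ennreal_le_iff)
    qed
    then show "AE \<omega> in Om. \<exists>n\<ge>m. 0 < fst (\<omega> n)" using D by (intro AE_I[of _ _ D]) (auto simp: D_def)
  qed
  show ?thesis using 1 2 unfolding good_def by eventually_elim simp
qed

definition Cf :: "real set set" where
  "Cf = {x. x \<subseteq> {0..} \<and> infinite x \<and> (\<forall>m::nat. finite (x \<inter> {0..<real m}))}"

definition FM :: "real set set" where "FM = {A. A \<in> lmeasurable \<and> A \<subseteq> {0..}}"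

definition cev :: "real set \<Rightarrow> nat \<Rightarrow> real set set" where
  "cev A k = {x \<in> Cf. finite (x \<inter> A) \<and> card (x \<inter> A) = k}"

definition conf_sigma :: "real set measure" where
  "conf_sigma = sigma Cf {cev A k | A k. A \<in> FM}"

lemma FM_trunc: "A \<in> FM \<Longrightarrow> A \<inter> {0..<real m} \<in> FM"
  by (auto simp: FM_def fmeasurable_Int_fmeasurable intro: fmeasurable_Int_fmeasurable)

lemma cev_sub: "{cev A k | A k. A \<in> FM} \<subseteq> Pow Cf" by (auto simp: cev_def)

lemma space_conf [simp]: "space conf_sigma = Cf" unfolding conf_sigma_def by (rule space_measure_of[OF cev_sub])

lemma cev_sets [intro]: "A \<in> FM \<Longrightarrow> cev A k \<in> sets conf_sigma"
  unfolding conf_sigma_def using cev_sub by (subst sets_measure_of) auto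

lemma finite_subset_trunc:
  assumes "finite F" "F \<subseteq> {0::real..}" shows "\<exists>m0::nat. \<forall>m\<ge>m0. F \<subseteq> {0..<real m}"
proof -
  obtain m0 :: nat where m0: "Max (insert 0 F) < real m0" using reals_Archimedean2 by blast
  have "F \<subseteq> {0..<real m}" if "m0 \<le> m" for m
  proof
    fix y assume y: "y \<in> F"
    then have "y \<le> Max (insert 0 F)" using assms by auto
    then show "y \<in> {0..<real m}" using m0 that y assms(2) by auto
  qed
  then show ?thesis by blast
qed

lemma card_trunc_ev:
  assumes "finite (x \<inter> A)" "A \<subseteq> {0..}"
  shows "\<exists>m0. \<forall>m\<ge>m0. card (x \<inter> A \<inter> {0..<real m}) = card (x \<inter> A)"
proof -
  obtain m0 where "\<forall>m\<ge>m0. x \<inter> A \<subseteq> {0..<real m}" using finite_subset_trunc[OF assms(1)] assms(2) by blast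
  then show ?thesis by (metis Int_absorb2)
qed

lemma card_trunc_infinite:
  assumes "x \<in> Cf" "infinite (x \<inter> A)" "A \<subseteq> {0..}"
  shows "\<exists>m0. \<forall>m\<ge>m0. K \<le> card (x \<inter> A \<inter> {0..<real m})"
proof -
  obtain B where B: "finite B" "card B = K" "B \<subseteq> x \<inter> A" using infinite_arbitrarily_large[OF assms(2)] by metis
  obtain m0 where m0: "\<forall>m\<ge>m0. B \<subseteq> {0..<real m}" using finite_subset_trunc[OF B(1)] B(3) assms(3) by blast
  have "K \<le> card (x \<inter> A \<inter> {0..<real m})" if "m0 \<le> m" for m
  proof -
    have "finite (x \<inter> {0..<real m})" using assms(1) by (simp add: Cf_def)
    then have "finite (x \<inter> A \<inter> {0..<real m})" by (rule rev_finite_subset) auto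
    moreover have "B \<subseteq> x \<inter> A \<inter> {0..<real m}" using m0 that B by auto
    ultimately show ?thesis using card_mono B(2) by metis
  qed
  then show ?thesis by blast
qed

lemma cev_trunc:
  assumes "x \<in> Cf" "A \<subseteq> {0..}"
  shows "x \<in> cev A k \<longleftrightarrow> (\<exists>m0. \<forall>m\<ge>m0. card (x \<inter> A \<inter> {0..<real m}) = k)"
proof
  assume "x \<in> cev A k"
  then show "\<exists>m0. \<forall>m\<ge>m0. card (x \<inter> A \<inter> {0..<real m}) = k" using card_trunc_ev[OF _ assms(2)] by (auto simp: cev_def)
next
  assume "\<exists>m0. \<forall>m\<ge>m0. card (x \<inter> A \<inter> {0..<real m}) = k"
  then obtain m0 where m0: "\<forall>m\<ge>m0. card (x \<inter> A \<inter> {0..<real m}) = k" by blast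
  have fin: "finite (x \<inter> A)"
  proof (rule ccontr)
    assume "infinite (x \<inter> A)"
    from card_trunc_infinite[OF assms(1) this assms(2), of "Suc k"] obtain m1 where
      "\<forall>m\<ge>m1. Suc k \<le> card (x \<inter> A \<inter> {0..<real m})" by blast
    then show False using m0 by (metis Suc_n_not_le_n nle_le)
  qed
  then obtain m1 where "\<forall>m\<ge>m1. card (x \<inter> A \<inter> {0..<real m}) = card (x \<inter> A)" using card_trunc_ev[OF _ assms(2)] by blast
  then have "card (x \<inter> A) = k" using m0 by (metis nle_le)
  then show "x \<in> cev A k" using fin assms by (simp add: cev_def)
qed

definition cell_count :: "real set \<Rightarrow> nat \<times> (nat \<Rightarrow> real) \<Rightarrow> nat" where
  "cell_count A p = card {i. i < fst p \<and> snd p i \<in> A}"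

lemma Om_range: "\<omega> \<in> space Om \<Longrightarrow> snd (\<omega> n) i \<in> {real n..<real n + 1}"
  using measurable_space[OF measurable_compose[OF measurable_compose[OF Om_component cell_space_snd] pts_component]] by fastforce

lemma cfg_card:
  assumes g: "good \<omega>" and w: "\<omega> \<in> space Om" and A: "A \<subseteq> {0..}"
  shows "card (cfg \<omega> \<inter> A \<inter> {0..<real m}) = (\<Sum>n<m. cell_count A (\<omega> n))"
proof -
  define S where "S n = {i. i < fst (\<omega> n) \<and> snd (\<omega> n) i \<in> A}" for n
  have S: "finite (S n)" for n by (rule finite_subset[of _ "{..<fst (\<omega> n)}"]) (auto simp: S_def)
  have e: "cfg \<omega> \<inter> A \<inter> {0..<real m} = (\<Union>n<m. snd (\<omega> n) ` S n)"
  proof (intro set_eqI iffI)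
    fix y assume "y \<in> cfg \<omega> \<inter> A \<inter> {0..<real m}"
    then obtain n i where ni: "i < fst (\<omega> n)" "y = snd (\<omega> n) i" "y \<in> A" "y < real m" by (auto simp: cfg_def)
    then have "real n < real m" using Om_range[OF w, of n i] by auto
    then show "y \<in> (\<Union>n<m. snd (\<omega> n) ` S n)" using ni by (auto simp: S_def)
  next
    fix y assume "y \<in> (\<Union>n<m. snd (\<omega> n) ` S n)"
    then obtain n i where ni: "n < m" "i \<in> S n" "y = snd (\<omega> n) i" by auto
    then have "real n + 1 \<le> real m" by linarith
    then have "y < real m" using Om_range[OF w, of n i] ni by auto
    then show "y \<in> cfg \<omega> \<inter> A \<inter> {0..<real m}" using ni A by (auto simp: S_def cfg_def)
  qed
  have "card (\<Union>n<m. snd (\<omega> n) ` S n) = (\<Sum>n<m. card (snd (\<omega> n) ` S n))"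
  proof (rule card_UN_disjoint)
    show "\<forall>i\<in>{..<m}. \<forall>j\<in>{..<m}. i \<noteq> j \<longrightarrow> snd (\<omega> i) ` S i \<inter> snd (\<omega> j) ` S j = {}"
    proof (intro ballI impI)
      fix i j :: nat assume ij: "i \<noteq> j"
      { fix y assume "y \<in> snd (\<omega> i) ` S i" "y \<in> snd (\<omega> j) ` S j"
        then obtain a b where ab: "y = snd (\<omega> i) a" "y = snd (\<omega> j) b" by blast
        have "y \<in> {real i..<real i + 1}" unfolding ab(1) by (rule Om_range[OF w])
        moreover have "y \<in> {real j..<real j + 1}" unfolding ab(2) by (rule Om_range[OF w])
        ultimately have "i = j" by auto
        then have False using ij by simp }
      then show "snd (\<omega> i) ` S i \<inter> snd (\<omega> j) ` S j = {}" by blast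
    qed
  qed (use S in auto)
  also have "\<dots> = (\<Sum>n<m. cell_count A (\<omega> n))"
  proof (rule sum.cong[OF refl])
    fix n
    have "inj_on (snd (\<omega> n)) (S n)" using g unfolding good_def inj_on_def by blast
    then show "card (snd (\<omega> n) ` S n) = cell_count A (\<omega> n)" by (simp add: card_image cell_count_def S_def)
  qed
  finally show ?thesis using e by simp
qed

lemma cfg_Cf: assumes g: "good \<omega>" and w: "\<omega> \<in> space Om" shows "cfg \<omega> \<in> Cf"
  unfolding Cf_def
proof (intro CollectI conjI allI)
  show sub: "cfg \<omega> \<subseteq> {0..}"
  proof
    fix y assume "y \<in> cfg \<omega>"
    then obtain n i where "y = snd (\<omega> n) i" by (auto simp: cfg_def)
    then show "y \<in> {0..}" using Om_range[OF w, of n i] by auto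
  qed
  show "infinite (cfg \<omega>)"
  proof
    assume "finite (cfg \<omega>)"
    then obtain m0 where m0: "\<forall>m\<ge>m0. cfg \<omega> \<subseteq> {0..<real m}" using finite_subset_trunc sub by blast
    obtain n where n: "n \<ge> m0" "0 < fst (\<omega> n)" using g unfolding good_def by blast
    then have "snd (\<omega> n) 0 \<in> cfg \<omega>" by (auto simp: cfg_def)
    then show False using m0 Om_range[OF w, of n 0] n by fastforce
  qed
  fix m :: nat
  have "cfg \<omega> \<inter> {0..<real m} \<subseteq> (\<Union>n<m. snd (\<omega> n) ` {..<fst (\<omega> n)})"
  proof
    fix y assume "y \<in> cfg \<omega> \<inter> {0..<real m}"
    then obtain n i where ni: "i < fst (\<omega> n)" "y = snd (\<omega> n) i" "y < real m" by (auto simp: cfg_def)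
    then have "real n < real m" using Om_range[OF w, of n i] by auto
    then show "y \<in> (\<Union>n<m. snd (\<omega> n) ` {..<fst (\<omega> n)})" using ni by auto
  qed
  then show "finite (cfg \<omega> \<inter> {0..<real m})" by (rule finite_subset) auto
qed

text \<open>The value \<open>range real\<close> on the exceptional null set is an arbitrary configuration.\<close>

definition conf :: "(nat \<Rightarrow> nat \<times> (nat \<Rightarrow> real)) \<Rightarrow> real set" where
  "conf \<omega> = (if good \<omega> then cfg \<omega> else range real)"

lemma range_real_Cf: "range real \<in> Cf"
proof -
  have "infinite (range real)" by (rule range_inj_infinite) (auto simp: inj_on_def)
  moreover have "finite (range real \<inter> {0..<real m})" for m
    by (rule finite_subset[of _ "real ` {..<m}"]) auto
  ultimately show ?thesis by (auto simp: Cf_def)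
qed

lemma cell_count_real: "real (cell_count A p) = (\<Sum>i<fst p. indicator A (snd p i))"
proof -
  have "(\<Sum>i<fst p. indicator A (snd p i) :: real) = (\<Sum>i<fst p. if snd p i \<in> A then 1 else 0)"
    by (rule sum.cong) (auto simp: indicator_def)
  also have "\<dots> = (\<Sum>i\<in>{i\<in>{..<fst p}. snd p i \<in> A}. 1)" by (rule sum.inter_filter[symmetric]) simp
  finally have "(\<Sum>i<fst p. indicator A (snd p i) :: real) = (\<Sum>i\<in>{i\<in>{..<fst p}. snd p i \<in> A}. 1)" .
  then show ?thesis by (simp add: cell_count_def)
qed

lemma cell_count_measurable: assumes A: "A \<in> sets lebesgue" shows "(\<lambda>p. real (cell_count A p)) \<in> borel_measurable (cell_space n)"
proof -
  have i: "(indicator A :: real \<Rightarrow> real) \<in> borel_measurable (unif n)"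
    using A unfolding unif_def by (intro measurable_restrict_space1) auto
  have "(\<lambda>p. (\<lambda>k p. \<Sum>i<k. indicator A (snd p i) :: real) (fst p) p) \<in> borel_measurable (cell_space n)"
  proof (rule measurable_compose_countable)
    fix k :: nat
    have "(\<lambda>p. indicator A (snd p i) :: real) \<in> borel_measurable (cell_space n)" for i
      by (rule measurable_compose[OF _ i], rule measurable_compose[OF cell_space_snd pts_component])
    then show "(\<lambda>p. \<Sum>i<k. indicator A (snd p i) :: real) \<in> borel_measurable (cell_space n)" by simp
  qed simp
  then show ?thesis by (simp add: cell_count_real)
qed

lemma good_measurable: "{\<omega> \<in> space Om. good \<omega>} \<in> sets Om"
proof -
  have idm: "(\<lambda>x. x) \<in> borel_measurable (unif n)" for n
    using id_borel_measurable_lebesgue_on[of "{real n..<real n + 1}"] unfolding unif_def id_def .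
  have 1: "(\<lambda>\<omega>. snd (\<omega> n) i) \<in> borel_measurable Om" for n i
    using measurable_compose[OF measurable_compose[OF measurable_compose[OF Om_component cell_space_snd] pts_component] idm] .
  have [measurable]: "{\<omega> \<in> space Om. snd (\<omega> n) i = snd (\<omega> n) j} \<in> sets Om" for n i j
    by (rule borel_measurable_eq[OF 1 1])
  have [measurable]: "Measurable.pred Om (\<lambda>\<omega>. snd (\<omega> n) i = snd (\<omega> n) j)" for n i j
    unfolding pred_def by measurable
  have [measurable]: "(\<lambda>\<omega>. fst (\<omega> n)) \<in> Om \<rightarrow>\<^sub>M count_space UNIV" for n
    by (rule measurable_compose[OF Om_component cell_space_fst])
  show ?thesis unfolding good_def by measurable
qed

lemma conf_measurable: "conf \<in> Om \<rightarrow>\<^sub>M conf_sigma"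
  unfolding conf_sigma_def
proof (rule measurable_measure_of[OF cev_sub])
  show "conf \<in> space Om \<rightarrow> Cf" using cfg_Cf range_real_Cf by (auto simp: conf_def)
  fix y assume "y \<in> {cev A k | A k. A \<in> FM}"
  then obtain A k where y: "y = cev A k" and A: "A \<in> sets lebesgue" "A \<subseteq> {0..}" by (auto simp: FM_def)
  have m: "(\<lambda>\<omega>. \<Sum>n<m. real (cell_count A (\<omega> n))) \<in> borel_measurable Om" for m
    by (intro borel_measurable_sum measurable_compose[OF Om_component cell_count_measurable[OF A(1)]])
  have [measurable]: "{\<omega> \<in> space Om. (\<Sum>n<m. real (cell_count A (\<omega> n))) = real k} \<in> sets Om" for m
    by (rule borel_measurable_eq[OF m]) simp
  have [measurable]: "{\<omega> \<in> space Om. good \<omega>} \<in> sets Om" by (rule good_measurable)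
  have eq: "conf -` y \<inter> space Om = {\<omega> \<in> space Om. good \<omega>} \<inter>
      {\<omega> \<in> space Om. \<exists>m0. \<forall>m\<ge>m0. (\<Sum>n<m. real (cell_count A (\<omega> n))) = real k}
      \<union> (if range real \<in> cev A k then space Om - {\<omega> \<in> space Om. good \<omega>} else {})" (is "_ = ?R")
  proof (intro set_eqI)
    fix \<omega>
    show "\<omega> \<in> conf -` y \<inter> space Om \<longleftrightarrow> \<omega> \<in> ?R"
    proof (cases "\<omega> \<in> space Om \<and> good \<omega>")
      case True
      then show ?thesis using cev_trunc[OF cfg_Cf A(2), of \<omega> k] cfg_card[of \<omega>, OF _ _ A(2)]
        by (simp add: conf_def y flip: of_nat_sum)
    next
      case False
      then show ?thesis by (auto simp: conf_def y)
    qed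
  qed
  have m1: "{\<omega> \<in> space Om. \<exists>m0. \<forall>m\<ge>m0. (\<Sum>n<m. real (cell_count A (\<omega> n))) = real k} \<in> sets Om"
  proof -
    have [measurable]: "Measurable.pred Om (\<lambda>\<omega>. (\<Sum>n<m. real (cell_count A (\<omega> n))) = real k)" for m
      unfolding pred_def by measurable
    show ?thesis by measurable
  qed
  have m2: "(if range real \<in> cev A k then space Om - {\<omega> \<in> space Om. good \<omega>} else {}) \<in> sets Om" by auto
  show "conf -` y \<inter> space Om \<in> sets Om" unfolding eq by (intro sets.Un sets.Int good_measurable m1 m2)
qed

definition PN :: "real set measure" where "PN = distr Om conf_sigma conf"

lemma prob_space_PN: "prob_space PN"
  unfolding PN_def by (rule prob_space.prob_space_distr[OF prob_space_Om conf_measurable])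

lemma space_PN [simp]: "space PN = Cf" by (simp add: PN_def)
lemma sets_PN [measurable_cong]: "sets PN = sets conf_sigma" by (simp add: PN_def)

interpretation PN: prob_space PN by (rule prob_space_PN)

lemma card_measurable: assumes "A \<in> FM" shows "(\<lambda>x. card (x \<inter> A)) \<in> conf_sigma \<rightarrow>\<^sub>M count_space UNIV"
  unfolding measurable_count_space_eq2_countable
proof (intro conjI ballI)
  fix k :: nat
  have u: "(\<Union>k\<in>{1..}. cev A k) \<in> sets conf_sigma" using cev_sets[OF assms] by auto
  show "(\<lambda>x. card (x \<inter> A)) -` {k} \<inter> space conf_sigma \<in> sets conf_sigma"
  proof (cases "k = 0")
    case True
    have "(\<lambda>x. card (x \<inter> A)) -` {k} \<inter> space conf_sigma = space conf_sigma - (\<Union>k\<in>{1..}. cev A k)"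
      using True by (auto simp: cev_def Suc_le_eq)
    then show ?thesis using sets.Diff[OF sets.top u] by simp
  next
    case False
    then have "(\<lambda>x. card (x \<inter> A)) -` {k} \<inter> space conf_sigma = cev A k"
      by (auto simp: cev_def intro: card_ge_0_finite)
    then show ?thesis using cev_sets[OF assms] by simp
  qed
qed auto

lemma power_card_measurable:
  "A \<in> FM \<Longrightarrow> (\<lambda>x. (u::complex) ^ card (x \<inter> A)) \<in> borel_measurable conf_sigma"
  by (rule measurable_compose[OF card_measurable]) auto

lemma prod_if_disjoint:
  fixes u :: "nat \<Rightarrow> complex"
  assumes "disjoint_family_on A {..<p}"
  shows "(\<Prod>l<p. if y \<in> A l then u l else 1) = 1 + (\<Sum>l<p. (u l - 1) * indicator (A l) y)"
proof (cases "\<exists>l<p. y \<in> A l")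
  case True
  then obtain l0 where l0: "l0 < p" "y \<in> A l0" by blast
  have o: "y \<in> A l \<longleftrightarrow> l = l0" if "l < p" for l
    using disjoint_family_onD[OF assms, of l l0] l0 that by auto
  have "(\<Prod>l<p. if y \<in> A l then u l else 1) = (\<Prod>l<p. if l = l0 then u l else 1)"
    by (rule prod.cong) (simp_all add: o)
  moreover have "(\<Sum>l<p. (u l - 1) * indicator (A l) y) = (\<Sum>l<p. if l = l0 then u l - 1 else 0)"
    by (rule sum.cong) (simp_all add: o indicator_def)
  ultimately show ?thesis using l0 by (simp add: prod.delta sum.delta)
next
  case False
  then have "(\<Prod>l<p. if y \<in> A l then u l else 1) = 1" "(\<Sum>l<p. (u l - 1) * indicator (A l) y) = 0"
    by (auto intro!: prod.neutral sum.neutral simp: indicator_def)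
  then show ?thesis by simp
qed

lemma norm_prod_power_le:
  fixes u :: "nat \<Rightarrow> complex"
  assumes "\<And>l. l < p \<Longrightarrow> norm (u l) \<le> 1" shows "norm (\<Prod>l<p. u l ^ c l) \<le> 1"
  unfolding prod_norm[symmetric] norm_power by (rule prod_le_1) (use assms in \<open>auto intro: power_le_one\<close>)

lemma gf_trunc:
  fixes u :: "nat \<Rightarrow> complex"
  assumes A: "\<And>l. l < p \<Longrightarrow> A l \<in> FM" and d: "disjoint_family_on A {..<p}"
    and u: "\<And>l. l < p \<Longrightarrow> norm (u l) \<le> 1"
  shows "(\<integral>x. (\<Prod>l<p. u l ^ card (x \<inter> (A l \<inter> {0..<real m}))) \<partial>PN)
     = exp (\<Sum>l<p. (u l - 1) * measure lebesgue (A l \<inter> {0..<real m}))"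
proof -
  define v where "v y = (\<Prod>l<p. if y \<in> A l then u l else 1)" for y
  have As: "A l \<in> sets lebesgue" "A l \<in> lmeasurable" "A l \<subseteq> {0..}" if "l < p" for l using A[OF that] by (auto simp: FM_def)
  have v: "v \<in> borel_measurable (unif n)" for n
    unfolding v_def unif_def
  proof (intro borel_measurable_prod measurable_restrict_space1)
    fix l assume l: "l \<in> {..<p}"
    show "(\<lambda>y. if y \<in> A l then u l else 1) \<in> borel_measurable lebesgue"
      using As l by (intro measurable_If_set) auto
  qed
  have vb: "norm (v y) \<le> 1" for y
    unfolding v_def prod_norm[symmetric] by (rule prod_le_1) (use u in auto)
  have int: "(\<integral>y. v y \<partial>unif n) - 1 = (\<Sum>l<p. (u l - 1) * measure lebesgue (A l \<inter> {real n..<real n + 1}))" for n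
  proof -
    have As': "A l \<inter> {real n..<real n + 1} \<in> sets (unif n)" if "l < p" for l using As[OF that] by (auto simp: unif_sets)
    have ii: "integrable (unif n) (\<lambda>y. (u l - 1) * indicator (A l) y)" 
      "(\<integral>y. (u l - 1) * indicator (A l) y \<partial>unif n) = (u l - 1) * measure lebesgue (A l \<inter> {real n..<real n + 1})" if l: "l < p" for l
    proof -
      have e: "indicator (A l) y = (of_real (indicator (A l \<inter> {real n..<real n + 1}) y) :: complex)" if "y \<in> space (unif n)" for y
        using that by (auto simp: indicator_def)
      have 1: "integrable (unif n) (\<lambda>y. indicator (A l \<inter> {real n..<real n + 1}) y :: real)"
        using As'[OF l] by (intro integrable_real_indicator) (auto simp: U.emeasure_eq_measure)
      have 2: "(\<integral>y. indicator (A l \<inter> {real n..<real n + 1}) y \<partial>unif n) = measure lebesgue (A l \<inter> {real n..<real n + 1})"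
        using As'[OF l] by (simp add: measure_def emeasure_unif Int_absorb1)
      have "integrable (unif n) (\<lambda>y. (u l - 1) * of_real (indicator (A l \<inter> {real n..<real n + 1}) y))"
        using 1 by (intro integrable_mult_right integrable_of_real)
      then show "integrable (unif n) (\<lambda>y. (u l - 1) * indicator (A l) y)"
        by (subst Bochner_Integration.integrable_cong[OF refl, of _ _ "\<lambda>y. (u l - 1) * of_real (indicator (A l \<inter> {real n..<real n + 1}) y)"]) (simp add: e)
      have "(\<integral>y. (u l - 1) * indicator (A l) y \<partial>unif n) = (\<integral>y. (u l - 1) * of_real (indicator (A l \<inter> {real n..<real n + 1}) y) \<partial>unif n)"
        by (rule Bochner_Integration.integral_cong[OF refl]) (simp add: e)
      also have "\<dots> = (u l - 1) * of_real (\<integral>y. indicator (A l \<inter> {real n..<real n + 1}) y \<partial>unif n)"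
        by (simp only: integral_mult_right_zero integral_complex_of_real)
      finally show "(\<integral>y. (u l - 1) * indicator (A l) y \<partial>unif n) = (u l - 1) * measure lebesgue (A l \<inter> {real n..<real n + 1})"
        unfolding 2 .
    qed
    have "(\<integral>y. v y \<partial>unif n) = (\<integral>y. 1 + (\<Sum>l<p. (u l - 1) * indicator (A l) y) \<partial>unif n)"
      unfolding v_def prod_if_disjoint[OF d] ..
    also have "\<dots> = (\<integral>y. 1 \<partial>unif n) + (\<integral>y. (\<Sum>l<p. (u l - 1) * indicator (A l) y) \<partial>unif n)"
      by (intro Bochner_Integration.integral_add Bochner_Integration.integrable_sum) (simp_all add: ii(1) del: sum_mult_indicator)
    also have "(\<integral>y. (\<Sum>l<p. (u l - 1) * indicator (A l) y) \<partial>unif n) = (\<Sum>l<p. (\<integral>y. (u l - 1) * indicator (A l) y \<partial>unif n))"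
      by (rule Bochner_Integration.integral_sum) (simp add: ii(1))
    also have "\<dots> = (\<Sum>l<p. (u l - 1) * measure lebesgue (A l \<inter> {real n..<real n + 1}))"
      by (rule sum.cong) (use ii in auto)
    finally show ?thesis using U.prob_space[of n] by simp
  qed
  have fm: "(\<lambda>x. \<Prod>l<p. u l ^ card (x \<inter> (A l \<inter> {0..<real m}))) \<in> borel_measurable conf_sigma"
    by (intro borel_measurable_prod power_card_measurable FM_trunc) (use A in auto)
  have "(\<integral>x. (\<Prod>l<p. u l ^ card (x \<inter> (A l \<inter> {0..<real m}))) \<partial>PN)
     = (\<integral>\<omega>. (\<Prod>l<p. u l ^ card (conf \<omega> \<inter> (A l \<inter> {0..<real m}))) \<partial>Om)"
    unfolding PN_def by (rule integral_distr[OF conf_measurable fm])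
  also have "\<dots> = (\<integral>\<omega>. (\<Prod>n<m. case \<omega> n of (k, u) \<Rightarrow> \<Prod>i<k. v (u i)) \<partial>Om)"
  proof (rule integral_cong_AE)
    show "(\<lambda>\<omega>. \<Prod>l<p. u l ^ card (conf \<omega> \<inter> (A l \<inter> {0..<real m}))) \<in> borel_measurable Om"
      by (rule measurable_compose[OF conf_measurable fm])
    show "(\<lambda>\<omega>. \<Prod>n<m. case \<omega> n of (k, u) \<Rightarrow> \<Prod>i<k. v (u i)) \<in> borel_measurable Om"
      by (intro borel_measurable_prod measurable_compose[OF Om_component cell_prod_measurable[OF v]])
    show "AE \<omega> in Om. (\<Prod>l<p. u l ^ card (conf \<omega> \<inter> (A l \<inter> {0..<real m}))) = (\<Prod>n<m. case \<omega> n of (k, u) \<Rightarrow> \<Prod>i<k. v (u i))"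
      using AE_good AE_space
    proof eventually_elim
      case (elim \<omega>)
      have "(\<Prod>l<p. u l ^ card (conf \<omega> \<inter> (A l \<inter> {0..<real m}))) = (\<Prod>l<p. u l ^ (\<Sum>n<m. cell_count (A l) (\<omega> n)))"
        using cfg_card[OF elim] As by (intro prod.cong) (auto simp: conf_def elim Int_assoc)
      also have "\<dots> = (\<Prod>l<p. \<Prod>n<m. u l ^ cell_count (A l) (\<omega> n))" by (simp add: power_sum)
      also have "\<dots> = (\<Prod>n<m. \<Prod>l<p. u l ^ cell_count (A l) (\<omega> n))" by (rule prod.swap)
      also have "\<dots> = (\<Prod>n<m. case \<omega> n of (k, u) \<Rightarrow> \<Prod>i<k. v (u i))"
      proof (rule prod.cong[OF refl])
        fix n
        have "(\<Prod>i<fst (\<omega> n). v (snd (\<omega> n) i)) = (\<Prod>l<p. \<Prod>i<fst (\<omega> n). if snd (\<omega> n) i \<in> A l then u l else 1)"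
          unfolding v_def by (rule prod.swap)
        also have "\<dots> = (\<Prod>l<p. u l ^ cell_count (A l) (\<omega> n))"
        proof (rule prod.cong[OF refl])
          fix l
          have "(\<Prod>i<fst (\<omega> n). if snd (\<omega> n) i \<in> A l then u l else 1) = (\<Prod>i\<in>{i\<in>{..<fst (\<omega> n)}. snd (\<omega> n) i \<in> A l}. u l)"
            by (subst prod.inter_filter) auto
          then show "(\<Prod>i<fst (\<omega> n). if snd (\<omega> n) i \<in> A l then u l else 1) = u l ^ cell_count (A l) (\<omega> n)"
            by (simp add: cell_count_def)
        qed
        finally show "(\<Prod>l<p. u l ^ cell_count (A l) (\<omega> n)) = (case \<omega> n of (k, u) \<Rightarrow> \<Prod>i<k. v (u i))"
          by (simp add: case_prod_beta)
      qed
      finally show ?case .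
    qed
  qed
  also have "\<dots> = exp (\<Sum>n<m. (\<integral>x. v x \<partial>unif n) - 1)" by (rule integral_Om_prod[OF v vb])
  also have "(\<Sum>n<m. (\<integral>x. v x \<partial>unif n) - 1) = (\<Sum>l<p. (u l - 1) * measure lebesgue (A l \<inter> {0..<real m}))"
  proof -
    have "(\<Sum>n<m. measure lebesgue (A l \<inter> {real n..<real n + 1})) = measure lebesgue (A l \<inter> {0..<real m})" if l: "l < p" for l
    proof (induct m)
      case (Suc m)
      have e: "A l \<inter> {0..<real (Suc m)} = (A l \<inter> {0..<real m}) \<union> (A l \<inter> {real m..<real m + 1})" by auto
      have fi: "emeasure lebesgue (A l \<inter> T) \<noteq> \<infinity>" if "T \<in> sets lebesgue" for T
        unfolding infinity_ennreal_def by (rule fmeasurableD2[OF fmeasurable_Int_fmeasurable[OF As(2)[OF l] that]])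
      have "measure lebesgue (A l \<inter> {0..<real (Suc m)}) = measure lebesgue (A l \<inter> {0..<real m}) + measure lebesgue (A l \<inter> {real m..<real m + 1})"
        unfolding e by (rule measure_Union[OF fi fi]) (use As(1)[OF l] in auto)
      then show ?case using Suc by simp
    qed simp
    note s = this
    have "(\<Sum>n<m. (\<integral>x. v x \<partial>unif n) - 1) = (\<Sum>l<p. \<Sum>n<m. (u l - 1) * of_real (measure lebesgue (A l \<inter> {real n..<real n + 1})))"
      unfolding int by (rule sum.swap)
    also have "\<dots> = (\<Sum>l<p. (u l - 1) * of_real (measure lebesgue (A l \<inter> {0..<real m})))"
      by (intro sum.cong refl) (simp add: s[symmetric] sum_distrib_left)
    finally show ?thesis .
  qed
  finally show ?thesis .
qed

subsection \<open>The law of the counts\<close>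

lemma FM_measure_trunc:
  assumes "A \<in> FM" shows "(\<lambda>m. measure lebesgue (A \<inter> {0..<real m})) \<longlonglongrightarrow> measure lebesgue A"
proof -
  have A: "A \<in> lmeasurable" "A \<in> sets lebesgue" "A \<subseteq> {0..}" using assms by (auto simp: FM_def)
  have e: "(\<Union>m. A \<inter> {0..<real m}) = A"
  proof
    show "A \<subseteq> (\<Union>m. A \<inter> {0..<real m})"
    proof
      fix x assume x: "x \<in> A"
      obtain m where "x < real m" using reals_Archimedean2 by blast
      then show "x \<in> (\<Union>m. A \<inter> {0..<real m})" using x A(3) by auto
    qed
  qed auto
  have "(\<lambda>m. measure lebesgue (A \<inter> {0..<real m})) \<longlonglongrightarrow> measure lebesgue (\<Union>m. A \<inter> {0..<real m})"
  proof (rule Lim_measure_incseq)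
    show "incseq (\<lambda>m. A \<inter> {0..<real m})" by (auto simp: incseq_def)
    show "emeasure lebesgue (\<Union>m. A \<inter> {0..<real m}) \<noteq> \<infinity>" unfolding e infinity_ennreal_def by (rule fmeasurableD2[OF A(1)])
  qed (use A in auto)
  then show ?thesis using e by simp
qed

lemma AE_finite: assumes A: "A \<in> FM" shows "AE x in PN. finite (x \<inter> A)"
proof -
  define fin where "fin = (\<Union>k. cev A k)"
  have fs: "fin \<in> sets PN" unfolding fin_def sets_PN using A by auto
  have fin_iff: "x \<in> fin \<longleftrightarrow> finite (x \<inter> A)" if "x \<in> Cf" for x using that by (auto simp: fin_def cev_def)
  define \<mu> where "\<mu> = measure lebesgue A"
  have "exp (- \<mu> / real (Suc q)) \<le> measure PN fin" for q
  proof -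
    define u where "u = 1 - 1 / real (Suc q)"
    have u: "0 \<le> u" "u < 1" by (auto simp: u_def)
    define h where "h x = (if finite (x \<inter> A) then u ^ card (x \<inter> A) else 0)" for x
    have hm: "h \<in> borel_measurable PN"
    proof -
      have "(\<lambda>x. indicator fin x * u ^ card (x \<inter> A)) \<in> borel_measurable PN"
        using fs measurable_compose[OF card_measurable[OF A], of "\<lambda>k. u ^ k" borel] sets_PN
        by (intro borel_measurable_times borel_measurable_indicator) (auto cong: measurable_cong_sets)
      moreover have "indicator fin x * u ^ card (x \<inter> A) = h x" if "x \<in> space PN" for x
        using fin_iff[of x] that by (auto simp: h_def indicator_def)
      ultimately show ?thesis using measurable_cong[of PN "\<lambda>x. indicator fin x * u ^ card (x \<inter> A)" h borel] by blast
    qed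
    have "(\<lambda>m. \<integral>x. complex_of_real u ^ card (x \<inter> (A \<inter> {0..<real m})) \<partial>PN) \<longlonglongrightarrow> (\<integral>x. complex_of_real (h x) \<partial>PN)"
    proof (rule integral_dominated_convergence[where w = "\<lambda>_. 1"])
      show "AE x in PN. (\<lambda>m. complex_of_real u ^ card (x \<inter> (A \<inter> {0..<real m}))) \<longlonglongrightarrow> complex_of_real (h x)"
      proof (rule AE_I2)
        fix x assume "x \<in> space PN"
        then have x: "x \<in> Cf" by simp
        have A0: "A \<subseteq> {0..}" using A by (simp add: FM_def)
        show "(\<lambda>m. complex_of_real u ^ card (x \<inter> (A \<inter> {0..<real m}))) \<longlonglongrightarrow> complex_of_real (h x)"
        proof (cases "finite (x \<inter> A)")
          case True
          from card_trunc_ev[OF True A0] obtain m0 where m0: "\<forall>m\<ge>m0. card (x \<inter> A \<inter> {0..<real m}) = card (x \<inter> A)" by blast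
          have "\<forall>\<^sub>F m in sequentially. complex_of_real (h x) = complex_of_real u ^ card (x \<inter> (A \<inter> {0..<real m}))"
            unfolding eventually_sequentially using m0 True by (intro exI[of _ m0]) (simp add: h_def Int_assoc)
          then show ?thesis by (rule Lim_transform_eventually[rotated]) simp
        next
          case False
          have "filterlim (\<lambda>m. card (x \<inter> (A \<inter> {0..<real m}))) at_top sequentially"
            unfolding filterlim_at_top eventually_sequentially
            using card_trunc_infinite[OF x False A0] by (auto simp: Int_assoc)
          then have "(\<lambda>m. u ^ card (x \<inter> (A \<inter> {0..<real m}))) \<longlonglongrightarrow> 0"
            by (rule filterlim_compose[rotated]) (rule LIMSEQ_realpow_zero[OF u])
          then have "(\<lambda>m. complex_of_real (u ^ card (x \<inter> (A \<inter> {0..<real m})))) \<longlonglongrightarrow> complex_of_real 0"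
            by (rule tendsto_of_real)
          then show ?thesis using False by (simp add: h_def)
        qed
      qed
      show "(\<lambda>x. complex_of_real u ^ card (x \<inter> (A \<inter> {0..<real m}))) \<in> borel_measurable PN" for m
        using power_card_measurable[OF FM_trunc[OF A]] by (simp cong: measurable_cong_sets add: sets_PN)
      show "AE x in PN. norm (complex_of_real u ^ card (x \<inter> (A \<inter> {0..<real m}))) \<le> 1" for m
        using u by (auto simp: norm_power intro!: power_le_one)
    qed (use hm in auto)
    moreover have "(\<integral>x. complex_of_real u ^ card (x \<inter> (A \<inter> {0..<real m})) \<partial>PN) = exp ((complex_of_real u - 1) * measure lebesgue (A \<inter> {0..<real m}))" for m
      using gf_trunc[of 1 "\<lambda>_. A" "\<lambda>_. complex_of_real u" m] A u by (simp add: disjoint_family_on_def)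
    ultimately have "(\<lambda>m. exp ((complex_of_real u - 1) * measure lebesgue (A \<inter> {0..<real m}))) \<longlonglongrightarrow> (\<integral>x. complex_of_real (h x) \<partial>PN)" by simp
    moreover have "(\<lambda>m. exp ((complex_of_real u - 1) * measure lebesgue (A \<inter> {0..<real m}))) \<longlonglongrightarrow> exp ((complex_of_real u - 1) * \<mu>)"
      unfolding \<mu>_def by (intro tendsto_intros FM_measure_trunc[OF A])
    ultimately have "(\<integral>x. complex_of_real (h x) \<partial>PN) = exp ((complex_of_real u - 1) * \<mu>)" using LIMSEQ_unique by blast
    also have "\<dots> = complex_of_real (exp ((u - 1) * \<mu>))" by (simp flip: exp_of_real)
    finally have "(\<integral>x. h x \<partial>PN) = exp ((u - 1) * \<mu>)" by (simp only: integral_complex_of_real of_real_eq_iff)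
    moreover have "(\<integral>x. h x \<partial>PN) \<le> (\<integral>x. indicator fin x \<partial>PN)"
    proof (rule integral_mono)
      show "integrable PN h" by (rule PN.integrable_const_bound[of _ 1]) (use hm u in \<open>auto simp: h_def intro!: AE_I2 power_le_one\<close>)
      show "integrable PN (indicator fin :: _ \<Rightarrow> real)" using fs by (intro integrable_real_indicator) (auto simp: PN.emeasure_eq_measure)
      show "h x \<le> indicator fin x" if "x \<in> space PN" for x using that u fin_iff[of x] by (auto simp: h_def indicator_def intro: power_le_one)
    qed
    moreover have "(\<integral>x. indicator fin x \<partial>PN) = measure PN fin"
      using fs sets.sets_into_space[OF fs] by (simp add: Int_absorb2)
    ultimately show ?thesis by (simp add: u_def)
  qed
  moreover have "(\<lambda>q. exp (- \<mu> / real (Suc q))) \<longlonglongrightarrow> exp 0"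
  proof (intro tendsto_exp)
    have "(\<lambda>q. - \<mu> * inverse (real (Suc q))) \<longlonglongrightarrow> - \<mu> * 0" by (intro tendsto_intros LIMSEQ_inverse_real_of_nat)
    then show "(\<lambda>q. - \<mu> / real (Suc q)) \<longlonglongrightarrow> 0" by (simp add: divide_inverse)
  qed
  ultimately have "exp 0 \<le> measure PN fin" by (intro LIMSEQ_le_const2) auto
  then have "measure PN fin = 1" using PN.prob_le_1[of fin] by simp
  then have "AE x in PN. x \<in> fin" by (simp add: PN.AE_in_set_eq_1[OF fs])
  then show ?thesis using AE_space by eventually_elim (simp add: fin_iff)
qed

theorem gf:
  fixes u :: "nat \<Rightarrow> complex"
  assumes A: "\<And>l. l < p \<Longrightarrow> A l \<in> FM" and d: "disjoint_family_on A {..<p}"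
    and u: "\<And>l. l < p \<Longrightarrow> norm (u l) \<le> 1"
  shows "(\<integral>x. (\<Prod>l<p. u l ^ card (x \<inter> A l)) \<partial>PN) = exp (\<Sum>l<p. (u l - 1) * measure lebesgue (A l))"
proof -
  have "(\<lambda>m. \<integral>x. (\<Prod>l<p. u l ^ card (x \<inter> (A l \<inter> {0..<real m}))) \<partial>PN) \<longlonglongrightarrow> (\<integral>x. (\<Prod>l<p. u l ^ card (x \<inter> A l)) \<partial>PN)"
  proof (rule integral_dominated_convergence[where w = "\<lambda>_. 1"])
    have "AE x in PN. \<forall>l\<in>{..<p}. finite (x \<inter> A l)" using AE_finite A by (intro AE_finite_allI) auto
    then show "AE x in PN. (\<lambda>m. \<Prod>l<p. u l ^ card (x \<inter> (A l \<inter> {0..<real m}))) \<longlonglongrightarrow> (\<Prod>l<p. u l ^ card (x \<inter> A l))"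
    proof eventually_elim
      case (elim x)
      show ?case
      proof (rule tendsto_prod)
        fix l assume l: "l \<in> {..<p}"
        have A0: "A l \<subseteq> {0..}" using A l by (auto simp: FM_def)
        obtain m0 where m0: "\<forall>m\<ge>m0. card (x \<inter> A l \<inter> {0..<real m}) = card (x \<inter> A l)" using card_trunc_ev[OF _ A0] elim l by blast
        have "\<forall>\<^sub>F m in sequentially. u l ^ card (x \<inter> A l) = u l ^ card (x \<inter> (A l \<inter> {0..<real m}))"
          unfolding eventually_sequentially using m0 by (intro exI[of _ m0]) (simp add: Int_assoc)
        then show "(\<lambda>m. u l ^ card (x \<inter> (A l \<inter> {0..<real m}))) \<longlonglongrightarrow> u l ^ card (x \<inter> A l)"
          by (rule Lim_transform_eventually[rotated]) simp
      qed
    qed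
    show "(\<lambda>x. \<Prod>l<p. u l ^ card (x \<inter> A l)) \<in> borel_measurable PN"
      using power_card_measurable A by (intro borel_measurable_prod) (simp cong: measurable_cong_sets add: sets_PN)
    show "(\<lambda>x. \<Prod>l<p. u l ^ card (x \<inter> (A l \<inter> {0..<real m}))) \<in> borel_measurable PN" for m
      using power_card_measurable FM_trunc A by (intro borel_measurable_prod) (simp cong: measurable_cong_sets add: sets_PN)
    show "AE x in PN. norm (\<Prod>l<p. u l ^ card (x \<inter> (A l \<inter> {0..<real m}))) \<le> 1" for m
      using norm_prod_power_le[OF u] by auto
  qed auto
  moreover have "(\<lambda>m. exp (\<Sum>l<p. (u l - 1) * complex_of_real (measure lebesgue (A l \<inter> {0..<real m})))) \<longlonglongrightarrow> exp (\<Sum>l<p. (u l - 1) * measure lebesgue (A l))"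
    by (intro tendsto_intros FM_measure_trunc A) auto
  ultimately show ?thesis using gf_trunc[OF A d u] LIMSEQ_unique by simp
qed

lemma power_series_unique:
  fixes a b :: "nat \<Rightarrow> complex"
  assumes "\<And>z. norm z \<le> 1 \<Longrightarrow> (\<lambda>k. a k * z ^ k) sums s z" "\<And>z. norm z \<le> 1 \<Longrightarrow> (\<lambda>k. b k * z ^ k) sums s z"
  shows "a k = b k"
proof -
  have r: "0 < conv_radius a" "0 < conv_radius b"
    using conv_radius_geI[of a 1] conv_radius_geI[of b 1] assms[of 1] sums_summable
    by (metis ereal_less(2) norm_one order_less_le_trans order_refl zero_less_one)+
  have "Abs_fps a = Abs_fps b"
  proof (rule eval_fps_eqD)
    show "\<forall>\<^sub>F z in nhds 0. eval_fps (Abs_fps a) z = eval_fps (Abs_fps b) z"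
      unfolding eventually_nhds_metric
    proof (intro exI[of _ 1] conjI allI impI)
      fix z :: complex assume "dist z 0 < 1"
      then have "norm z \<le> 1" by simp
      then show "eval_fps (Abs_fps a) z = eval_fps (Abs_fps b) z"
        using assms[of z] by (simp add: eval_fps_def sums_iff)
    qed simp
  qed (use r in \<open>simp_all add: fps_conv_radius_def\<close>)
  then show ?thesis by (metis fps_nth_Abs_fps)
qed

lemma gf_coefficient:
  fixes w :: "'a \<Rightarrow> complex" and Y :: "'a \<Rightarrow> nat"
  assumes "prob_space M" and w: "w \<in> borel_measurable M" "\<And>x. norm (w x) \<le> 1"
    and Y: "Y \<in> M \<rightarrow>\<^sub>M count_space UNIV"
    and g: "\<And>u. norm u \<le> 1 \<Longrightarrow> (\<integral>x. u ^ Y x * w x \<partial>M) = c * exp ((u - 1) * of_real \<kappa>)"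
  shows "(\<integral>x. (if Y x = k then 1 else 0) * w x \<partial>M) = c * of_real (\<kappa> ^ k / fact k * exp (- \<kappa>))"
proof -
  interpret prob_space M by fact
  have pm: "(\<lambda>x. f (Y x)) \<in> borel_measurable M" for f :: "nat \<Rightarrow> complex" by (rule measurable_compose[OF Y]) simp
  have sums1: "(\<lambda>k. (\<integral>x. (if Y x = k then 1 else 0) * w x \<partial>M) * u ^ k) sums (c * exp ((u - 1) * of_real \<kappa>))"
    if u: "norm u \<le> 1" for u
  proof -
    have part: "(\<Sum>k<K. (\<integral>x. (if Y x = k then 1 else 0) * w x \<partial>M) * u ^ k) = (\<integral>x. (if Y x < K then u ^ Y x else 0) * w x \<partial>M)" for K
    proof -
      have int: "integrable M (\<lambda>x. (if Y x = k then 1 else 0) * w x)" for k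
        by (rule integrable_const_bound[of _ 1]) (use w pm[of "\<lambda>y. if y = k then 1 else 0"] in auto)
      have "(\<Sum>k<K. (\<integral>x. (if Y x = k then 1 else 0) * w x \<partial>M) * u ^ k) = (\<Sum>k<K. (\<integral>x. (if Y x = k then 1 else 0) * w x * u ^ k \<partial>M))"
        by (simp add: int)
      also have "\<dots> = (\<integral>x. (\<Sum>k<K. (if Y x = k then 1 else 0) * w x * u ^ k) \<partial>M)"
        by (rule Bochner_Integration.integral_sum[symmetric]) (intro integrable_mult_left int)
      also have "\<dots> = (\<integral>x. (if Y x < K then u ^ Y x else 0) * w x \<partial>M)"
      proof (rule Bochner_Integration.integral_cong[OF refl])
        fix x
        have "(\<Sum>k<K. (if Y x = k then 1 else 0) * w x * u ^ k) = (\<Sum>k<K. if k = Y x then w x * u ^ k else 0)"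
          by (rule sum.cong) auto
        then show "(\<Sum>k<K. (if Y x = k then 1 else 0) * w x * u ^ k) = (if Y x < K then u ^ Y x else 0) * w x"
          by (simp add: sum.delta)
      qed
      finally show ?thesis .
    qed
    have "(\<lambda>K. \<integral>x. (if Y x < K then u ^ Y x else 0) * w x \<partial>M) \<longlonglongrightarrow> (\<integral>x. u ^ Y x * w x \<partial>M)"
    proof (rule integral_dominated_convergence[where w = "\<lambda>_. 1"])
      show "AE x in M. (\<lambda>K. (if Y x < K then u ^ Y x else 0) * w x) \<longlonglongrightarrow> u ^ Y x * w x"
      proof (rule AE_I2)
        fix x
        have "\<forall>\<^sub>F K in sequentially. u ^ Y x * w x = (if Y x < K then u ^ Y x else 0) * w x"
          unfolding eventually_sequentially by (intro exI[of _ "Suc (Y x)"]) auto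
        then show "(\<lambda>K. (if Y x < K then u ^ Y x else 0) * w x) \<longlonglongrightarrow> u ^ Y x * w x"
          by (rule Lim_transform_eventually[rotated]) simp
      qed
      have b: "norm (u ^ Y x * w x) \<le> 1" for x
        unfolding norm_mult norm_power by (rule mult_le_one) (use u w in \<open>auto intro: power_le_one\<close>)
      then show "AE x in M. norm ((if Y x < K then u ^ Y x else 0) * w x) \<le> 1" for K by auto
    qed (use w pm[of "\<lambda>y. u ^ y"] pm[of "\<lambda>y. if y < _ then u ^ y else 0"] in auto)
    then show ?thesis unfolding sums_def part g[OF u, symmetric] .
  qed
  have sums2: "(\<lambda>k. c * of_real (\<kappa> ^ k / fact k * exp (- \<kappa>)) * u ^ k) sums (c * exp ((u - 1) * of_real \<kappa>))" for u :: complex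
  proof -
    have "(\<lambda>k. c * exp (- of_real \<kappa>) * ((u * of_real \<kappa>) ^ k /\<^sub>R fact k)) sums (c * exp (- of_real \<kappa>) * exp (u * of_real \<kappa>))"
      by (intro sums_mult exp_converges)
    moreover have "c * exp (- of_real \<kappa>) * ((u * of_real \<kappa>) ^ k /\<^sub>R fact k) = c * of_real (\<kappa> ^ k / fact k * exp (- \<kappa>)) * u ^ k" for k
      by (simp add: scaleR_conv_of_real power_mult_distrib divide_inverse exp_of_real[symmetric])
    moreover have "c * exp (- of_real \<kappa>) * exp (u * of_real \<kappa>) = c * exp ((u - 1) * of_real \<kappa>)"
      by (simp add: algebra_simps exp_add[symmetric])
    ultimately show ?thesis by simp
  qed
  show ?thesis by (rule power_series_unique[of _ "\<lambda>u. c * exp ((u - 1) * of_real \<kappa>)"]) (use sums1 sums2 in auto)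
qed

definition pois :: "real \<Rightarrow> nat \<Rightarrow> real" where "pois \<kappa> k = \<kappa> ^ k / fact k * exp (- \<kappa>)"

lemma joint_law_aux:
  fixes u :: "nat \<Rightarrow> complex"
  assumes A: "\<And>l. l < p \<Longrightarrow> A l \<in> FM" and d: "disjoint_family_on A {..<p}"
    and u: "\<And>l. l < p \<Longrightarrow> norm (u l) \<le> 1" and q: "q \<le> p"
  shows "(\<integral>x. (\<Prod>l<q. if card (x \<inter> A l) = k l then 1 else 0) * (\<Prod>l\<in>{q..<p}. u l ^ card (x \<inter> A l)) \<partial>PN)
    = (\<Prod>l<q. of_real (pois (measure lebesgue (A l)) (k l))) * exp (\<Sum>l\<in>{q..<p}. (u l - 1) * measure lebesgue (A l))"
  using q u
proof (induct q arbitrary: u)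
  case 0
  then show ?case using gf[OF A d, of u] by (simp add: atLeast0LessThan)
next
  case (Suc q)
  have qp: "q < p" using Suc by simp
  define w :: "real set \<Rightarrow> complex" where
    "w x = (\<Prod>l<q. if card (x \<inter> A l) = k l then 1 else 0) * (\<Prod>l\<in>{Suc q..<p}. u l ^ card (x \<inter> A l))" for x
  have cm: "(\<lambda>x. f (card (x \<inter> A l))) \<in> borel_measurable PN" if "l < p" for f :: "nat \<Rightarrow> complex" and l
    using measurable_compose[OF card_measurable[OF A[OF that]], of f borel] by (simp cong: measurable_cong_sets add: sets_PN)
  have wm: "w \<in> borel_measurable PN" unfolding w_def
  proof (intro borel_measurable_times borel_measurable_prod)
    show "(\<lambda>x. if card (x \<inter> A l) = k l then 1 else 0 :: complex) \<in> borel_measurable PN" if "l \<in> {..<q}" for l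
      using cm[of l "\<lambda>c. if c = k l then 1 else 0"] that qp by simp
    show "(\<lambda>x. u l ^ card (x \<inter> A l)) \<in> borel_measurable PN" if "l \<in> {Suc q..<p}" for l
      using cm[of l "\<lambda>c. u l ^ c"] that by simp
  qed
  have wb: "norm (w x) \<le> 1" for x
    unfolding w_def norm_mult prod_norm[symmetric] norm_power
    by (intro mult_le_one prod_le_1 conjI prod_nonneg) (use Suc.prems in \<open>auto intro: power_le_one\<close>)
  define c where "c = (\<Prod>l<q. complex_of_real (pois (measure lebesgue (A l)) (k l))) * exp (\<Sum>l\<in>{Suc q..<p}. (u l - 1) * measure lebesgue (A l))"
  have g: "(\<integral>x. z ^ card (x \<inter> A q) * w x \<partial>PN) = c * exp ((z - 1) * of_real (measure lebesgue (A q)))" if z: "norm z \<le> 1" for z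
  proof -
    have split: "{q..<p} = insert q {Suc q..<p}" using qp by auto
    have "(\<integral>x. (\<Prod>l<q. if card (x \<inter> A l) = k l then 1 else 0) * (\<Prod>l\<in>{q..<p}. (u(q := z)) l ^ card (x \<inter> A l)) \<partial>PN)
      = (\<Prod>l<q. of_real (pois (measure lebesgue (A l)) (k l))) * exp (\<Sum>l\<in>{q..<p}. ((u(q := z)) l - 1) * measure lebesgue (A l))"
      by (rule Suc.hyps) (use Suc.prems z in auto)
    moreover have "(\<Prod>l\<in>{Suc q..<p}. (u(q := z)) l ^ card (x \<inter> A l)) = (\<Prod>l\<in>{Suc q..<p}. u l ^ card (x \<inter> A l))" for x
      by (rule prod.cong) auto
    moreover have "(\<Sum>l\<in>{Suc q..<p}. ((u(q := z)) l - 1) * complex_of_real (measure lebesgue (A l))) = (\<Sum>l\<in>{Suc q..<p}. (u l - 1) * measure lebesgue (A l))"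
      by (rule sum.cong) auto
    ultimately show ?thesis by (simp add: split w_def c_def exp_add mult_ac)
  qed
  have Ym: "(\<lambda>x. card (x \<inter> A q)) \<in> PN \<rightarrow>\<^sub>M count_space UNIV"
    using card_measurable[OF A[OF qp]] by (simp cong: measurable_cong_sets add: sets_PN)
  have "(\<integral>x. (if card (x \<inter> A q) = k q then 1 else 0) * w x \<partial>PN) = c * of_real (pois (measure lebesgue (A q)) (k q))"
    unfolding pois_def by (rule gf_coefficient[OF prob_space_PN wm wb Ym g])
  then show ?case by (simp add: w_def c_def mult_ac)
qed

theorem joint_law:
  fixes A :: "nat \<Rightarrow> real set"
  assumes A: "\<And>l. l < p \<Longrightarrow> A l \<in> FM" and d: "disjoint_family_on A {..<p}" and p: "0 < p"
  shows "measure PN (\<Inter>l<p. cev (A l) (k l)) = (\<Prod>l<p. pois (measure lebesgue (A l)) (k l))"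
proof -
  let ?S = "\<Inter>l<p. cev (A l) (k l)"
  have S: "?S \<in> sets PN" using p A unfolding sets_PN by (intro sets.finite_INT) auto
  have "complex_of_real (measure PN ?S) = (\<integral>x. complex_of_real (indicator ?S x) \<partial>PN)"
    using S sets.sets_into_space[OF S] by (simp only: integral_complex_of_real) (simp add: Int_absorb2)
  also have "\<dots> = (\<integral>x. (\<Prod>l<p. if card (x \<inter> A l) = k l then 1 else 0) \<partial>PN)"
  proof (rule integral_cong_AE)
    show "(\<lambda>x. complex_of_real (indicator ?S x)) \<in> borel_measurable PN" using S by simp
    show "(\<lambda>x. \<Prod>l<p. if card (x \<inter> A l) = k l then 1 else 0 :: complex) \<in> borel_measurable PN"
    proof (rule borel_measurable_prod)
      fix l assume "l \<in> {..<p}"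
      then show "(\<lambda>x. if card (x \<inter> A l) = k l then 1 else 0 :: complex) \<in> borel_measurable PN"
        using measurable_compose[OF card_measurable[OF A], of l "\<lambda>c. if c = k l then 1 else 0 :: complex" borel]
        by (simp cong: measurable_cong_sets add: sets_PN)
    qed
    have "AE x in PN. \<forall>l\<in>{..<p}. finite (x \<inter> A l)" using AE_finite A by (intro AE_finite_allI) auto
    then show "AE x in PN. complex_of_real (indicator ?S x) = (\<Prod>l<p. if card (x \<inter> A l) = k l then 1 else 0)"
      using AE_space
    proof eventually_elim
      case (elim x)
      have "x \<in> ?S \<longleftrightarrow> (\<forall>l<p. card (x \<inter> A l) = k l)" using elim by (auto simp: cev_def)
      then show ?case by (auto simp: indicator_def intro!: prod.neutral[symmetric] prod_zero)
    qed
  qed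
  also have "\<dots> = (\<Prod>l<p. of_real (pois (measure lebesgue (A l)) (k l)))"
    using joint_law_aux[OF A d, of "\<lambda>_. 1" p k] by simp
  finally show ?thesis by (simp only: of_real_prod[symmetric] of_real_eq_iff)
qed

definition ncols :: "nat \<Rightarrow> nat" where "ncols j = j + 2"

primrec hgt :: "nat \<Rightarrow> nat" where
  "hgt 0 = 1"
| "hgt (Suc j) = 2 * hgt j * (4 ^ ncols j - 1)"

definition spc :: "nat \<Rightarrow> nat \<Rightarrow> nat" where "spc j i = hgt j * (6 * 4 ^ i - 1)"

definition colpos :: "nat \<Rightarrow> nat \<Rightarrow> nat" where "colpos j i = 2 * hgt j * (4 ^ i - 1)"

text \<open>The initial width is small enough for the principal branch of the logarithm in \<open>count_limit\<close>.\<close>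

primrec width :: "nat \<Rightarrow> real" where
  "width 0 = 1 / 10"
| "width (Suc j) = width j / real (ncols j)"

lemma ncols_ge [simp]: "2 \<le> ncols j" "0 < ncols j" "ncols j \<noteq> 0" by (auto simp: ncols_def)

lemma width_pos [simp]: "0 < width j" by (induct j) auto

lemma width_Suc': "width j = real (ncols j) * width (Suc j)" by simp

lemma hgt_pos [simp]: "0 < hgt j"
proof (induct j)
  case (Suc j)
  have "(1::nat) < 4 ^ ncols j" by (rule one_less_power) auto
  then show ?case using Suc by simp
qed simp

lemma colpos_0 [simp]: "colpos j 0 = 0" by (simp add: colpos_def)

lemma colpos_Suc: "colpos j (Suc i) = colpos j i + hgt j + spc j i"
proof -
  obtain t where t: "(4::nat) ^ i = Suc t" by (metis not0_implies_Suc power_not_zero zero_neq_numeral)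
  show ?thesis by (simp add: colpos_def spc_def t algebra_simps)
qed

lemma hgt_Suc_colpos: "hgt (Suc j) = colpos j (ncols j)" by (simp add: colpos_def)

lemma spc_ge: "hgt j \<le> spc j i"
proof -
  obtain t where t: "(4::nat) ^ i = Suc t" by (metis not0_implies_Suc power_not_zero zero_neq_numeral)
  show ?thesis by (simp add: spc_def t algebra_simps)
qed

lemma colpos_sum: "i * hgt j + (\<Sum>k<i. spc j k) = colpos j i"
  by (induct i) (auto simp: colpos_Suc)

lemma height_eq [simp]: "height ncols spc j = hgt j"
proof (induct j)
  case (Suc j)
  show ?case by (simp add: Suc colpos_sum hgt_Suc_colpos del: hgt.simps)
qed simp

lemma column_start_eq [simp]: "column_start ncols spc j i = colpos j i"
  by (simp add: column_start_def colpos_sum)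

lemma colpos_gap: "i < k \<Longrightarrow> colpos j i + 2 * hgt j \<le> colpos j k"
proof (induct k)
  case (Suc k)
  then show ?case using spc_ge[of j k] by (cases "i = k") (auto simp: colpos_Suc)
qed simp

lemma colpos_less: "i < k \<Longrightarrow> colpos j i < colpos j k"
  using colpos_gap[of i k j] hgt_pos[of j] by linarith

lemma colpos_less_iff: "colpos j i < colpos j k \<longleftrightarrow> i < k"
  by (metis colpos_less linorder_neqE_nat order_less_asym)

lemma colpos_end: "i < ncols j \<Longrightarrow> colpos j i + 2 * hgt j \<le> hgt (Suc j)"
  using colpos_gap[of i "ncols j" j] by (simp add: hgt_Suc_colpos del: hgt.simps)

lemma colpos_inject:
  assumes "colpos j i + l = colpos j i' + l'" "l < hgt j" "l' < hgt j"
  shows "i = i' \<and> l = l'"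
proof -
  have "i = i'"
  proof (rule ccontr)
    assume "i \<noteq> i'"
    then consider "i < i'" | "i' < i" by linarith
    then show False using assms colpos_gap[of i i' j] colpos_gap[of i' i j] by cases auto
  qed
  then show ?thesis using assms by auto
qed

lemma hgt_growth: "2 * (ncols j * hgt j) \<le> hgt (Suc j)"
proof -
  have "i * (2 * hgt j) \<le> colpos j i" for i
  proof (induct i)
    case (Suc i)
    then show ?case using spc_ge[of j i] by (simp add: colpos_Suc algebra_simps)
  qed simp
  from this[of "ncols j"] show ?thesis by (simp add: hgt_Suc_colpos algebra_simps del: hgt.simps)
qed

declare hgt.simps(2) [simp del] width.simps(2) [simp del]

section \<open>The rank-one construction\<close>

subsection \<open>Order of the floors\<close>

lemma extend_order:
  assumes "bij_betw p {..<hgt j} {..<hgt j}"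
  shows "\<exists>p'. bij_betw p' {..<hgt (Suc j)} {..<hgt (Suc j)} \<and>
    (\<forall>i<ncols j. \<forall>l<hgt j. p' (colpos j i + l) = ncols j * p l + i)"
proof -
  let ?r = "ncols j" and ?h = "hgt j" and ?h' = "hgt (Suc j)"
  let ?S = "{..<?r} \<times> {..<?h}"
  define c where "c = (\<lambda>(i,l). colpos j i + l)"
  define d where "d = (\<lambda>(i,l). ?r * p l + i)"
  have ic: "inj_on c ?S"
  proof (rule inj_onI)
    fix x y assume xy: "x \<in> ?S" "y \<in> ?S" "c x = c y"
    obtain i l i' l' where [simp]: "x = (i,l)" "y = (i',l')" by (cases x, cases y) auto
    show "x = y" using xy colpos_inject[of j i l i' l'] by (auto simp: c_def)
  qed
  have id: "inj_on d ?S"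
  proof (rule inj_onI)
    fix x y assume xy: "x \<in> ?S" "y \<in> ?S" "d x = d y"
    obtain i l i' l' where [simp]: "x = (i,l)" "y = (i',l')" by (cases x, cases y) auto
    have e: "?r * p l + i = ?r * p l' + i'" using xy by (simp add: d_def)
    have il: "i < ?r" "i' < ?r" using xy by auto
    have "(?r * p l + i) mod ?r = i" "(?r * p l' + i') mod ?r = i'" using il by auto
    then have "i = i'" using e by simp
    moreover have "(?r * p l + i) div ?r = p l" "(?r * p l' + i') div ?r = p l'" using il by auto
    then have "p l = p l'" using e by simp
    then have "l = l'" using assms xy by (auto simp: bij_betw_def inj_on_def)
    ultimately show "x = y" by simp
  qed
  have cs: "c ` ?S \<subseteq> {..<?h'}" using colpos_end[of _ j] by (fastforce simp: c_def )
  have ds: "d ` ?S \<subseteq> {..<?h'}"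
  proof
    fix y assume "y \<in> d ` ?S"
    then obtain i l where y: "i < ?r" "l < ?h" "y = ?r * p l + i" by (auto simp: d_def)
    have "p l < ?h" using assms y by (auto simp: bij_betw_def)
    then have "?r * (p l + 1) \<le> ?r * ?h" by (intro mult_le_mono2) simp
    then have "y < ?r * ?h" using y by (simp add: algebra_simps)
    then show "y \<in> {..<?h'}" using hgt_growth[of j] by (auto )
  qed
  have card: "card ({..<?h'} - c ` ?S) = card ({..<?h'} - d ` ?S)"
    using cs ds ic id by (simp add: card_Diff_subset card_image)
  obtain q where q: "bij_betw q ({..<?h'} - c ` ?S) ({..<?h'} - d ` ?S)"
    using finite_same_card_bij[OF _ _ card] by auto
  define p' where "p' x = (if x \<in> c ` ?S then d (inv_into ?S c x) else q x)" for x
  have pc: "p' (c z) = d z" if "z \<in> ?S" for z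
    using that ic by (simp add: p'_def)
  have b1: "bij_betw p' (c ` ?S) (d ` ?S)"
  proof -
    have "inj_on p' (c ` ?S)"
    proof (rule inj_onI)
      fix x y assume "x \<in> c ` ?S" "y \<in> c ` ?S" and e: "p' x = p' y"
      then obtain u v where uv: "u \<in> ?S" "v \<in> ?S" "x = c u" "y = c v" by blast
      then have "d u = d v" using e pc by simp
      then show "x = y" using id uv by (simp add: inj_on_eq_iff)
    qed
    moreover have "p' ` (c ` ?S) = d ` ?S" using pc by (force simp: image_image)
    ultimately show ?thesis by (simp add: bij_betw_def)
  qed
  have b2: "bij_betw p' ({..<?h'} - c ` ?S) ({..<?h'} - d ` ?S)"
    using q by (rule bij_betw_cong[THEN iffD1, rotated]) (auto simp: p'_def)
  have "bij_betw p' (c ` ?S \<union> ({..<?h'} - c ` ?S)) (d ` ?S \<union> ({..<?h'} - d ` ?S))"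
    by (rule bij_betw_combine[OF b1 b2]) auto
  then have "bij_betw p' {..<?h'} {..<?h'}" using cs ds by (simp add: Un_absorb1)
  moreover have "p' (colpos j i + l) = ?r * p l + i" if "i < ?r" "l < ?h" for i l
    using pc[of "(i,l)"] that by (simp add: c_def d_def)
  ultimately show ?thesis by blast
qed

lemma ex_place:
  "\<exists>p. \<forall>j. bij_betw (p j) {..<hgt j} {..<hgt j} \<and>
    (\<forall>i<ncols j. \<forall>l<hgt j. p (Suc j) (colpos j i + l) = ncols j * p j l + i)"
proof -
  have "\<exists>f. \<forall>n. bij_betw (f n) {..<hgt n} {..<hgt n} \<and>
     ((\<forall>i<ncols n. \<forall>l<hgt n. f (Suc n) (colpos n i + l) = ncols n * f n l + i))"
  proof (rule dependent_nat_choice[of "\<lambda>n p. bij_betw p {..<hgt n} {..<hgt n}"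
      "\<lambda>n p p'. \<forall>i<ncols n. \<forall>l<hgt n. p' (colpos n i + l) = ncols n * p l + i"])
    show "\<exists>x. bij_betw x {..<hgt 0} {..<hgt 0}" using bij_betw_id by blast
  qed (rule extend_order)
  then show ?thesis by blast
qed

text \<open>Floor \<open>l\<close> of stage \<open>j\<close> is the grid cell number \<open>place j l\<close> of length \<open>width j\<close>, so that every tower is an initial
  segment of the half-line.\<close>

definition place :: "nat \<Rightarrow> nat \<Rightarrow> nat" where
  "place = (SOME p. \<forall>j. bij_betw (p j) {..<hgt j} {..<hgt j} \<and>
    (\<forall>i<ncols j. \<forall>l<hgt j. p (Suc j) (colpos j i + l) = ncols j * p j l + i))"

lemma place_bij: "bij_betw (place j) {..<hgt j} {..<hgt j}"
  and place_Suc: "i < ncols j \<Longrightarrow> l < hgt j \<Longrightarrow> place (Suc j) (colpos j i + l) = ncols j * place j l + i"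
  using someI_ex[OF ex_place] unfolding place_def[symmetric] by blast+

lemma place_less: "l < hgt j \<Longrightarrow> place j l < hgt j"
  using place_bij[of j] by (auto simp: bij_betw_def)

lemma place_inj: "place j l = place j l' \<Longrightarrow> l < hgt j \<Longrightarrow> l' < hgt j \<Longrightarrow> l = l'"
  using place_bij[of j] by (auto simp: bij_betw_def inj_on_def)

lemma place_0 [simp]: "place j 0 = 0"
proof (induct j)
  case 0 then show ?case using place_less[of 0 0] by simp
next
  case (Suc j) then show ?case using place_Suc[of 0 j 0] by simp
qed

definition left_end :: "nat \<Rightarrow> nat \<Rightarrow> real" where "left_end j l = width j * real (place j l)"

abbreviation flo :: "nat \<Rightarrow> nat \<Rightarrow> real set" where "flo \<equiv> tower_floor width left_end"
abbreviation tow :: "nat \<Rightarrow> real set" where "tow \<equiv> tower ncols spc width left_end"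

lemma in_flo: "x \<in> flo j l \<longleftrightarrow> width j * real (place j l) \<le> x \<and> x < width j * (real (place j l) + 1)"
  by (simp add: tower_floor_def left_end_def algebra_simps)

lemma in_flo_floor: "x \<in> flo j l \<longleftrightarrow> \<lfloor>x / width j\<rfloor> = int (place j l)"
  unfolding in_flo floor_eq_iff by (simp add: field_simps)

lemma flo_unique: "x \<in> flo j l \<Longrightarrow> x \<in> flo j l' \<Longrightarrow> l < hgt j \<Longrightarrow> l' < hgt j \<Longrightarrow> l = l'"
  using place_inj by (simp add: in_flo_floor)

lemma in_tow: "x \<in> tow j \<longleftrightarrow> (\<exists>l<hgt j. x \<in> flo j l)"
  by (auto simp: tower_def)

lemma tow_eq: "tow j = {0 ..< width j * hgt j}"
proof (intro set_eqI iffI)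
  fix x assume "x \<in> tow j"
  then obtain l where l: "l < hgt j" "x \<in> flo j l" by (auto simp: in_tow)
  have "real (place j l) + 1 \<le> hgt j" using place_less[OF l(1)] by linarith
  then have "width j * (real (place j l) + 1) \<le> width j * hgt j" by (intro mult_left_mono) (auto simp: less_imp_le)
  moreover have "0 \<le> width j * real (place j l)" by (simp add: less_imp_le)
  ultimately show "x \<in> {0 ..< width j * hgt j}" using l(2) unfolding in_flo atLeastLessThan_iff by linarith
next
  fix x assume x: "x \<in> {0 ..< width j * hgt j}"
  define q where "q = nat \<lfloor>x / width j\<rfloor>"
  have q0: "int q = \<lfloor>x / width j\<rfloor>" using x by (simp add: q_def less_imp_le)
  have "x / width j < hgt j" using x by (simp add: field_simps)
  then have "q < hgt j" using q0 by linarith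
  then have "q \<in> place j ` {..<hgt j}" using place_bij[of j] by (simp add: bij_betw_def)
  then obtain l where "l < hgt j" "place j l = q" by auto
  then show "x \<in> tow j" using q0 by (auto simp: in_tow in_flo_floor)
qed

definition pos :: "nat \<Rightarrow> real \<Rightarrow> nat" where "pos j x = (THE l. l < hgt j \<and> x \<in> flo j l)"

lemma pos_eq: "l < hgt j \<Longrightarrow> x \<in> flo j l \<Longrightarrow> pos j x = l"
  unfolding pos_def by (rule the_equality) (auto dest: flo_unique)

lemma pos_tow: assumes "x \<in> tow j" shows "pos j x < hgt j" "x \<in> flo j (pos j x)"
  using assms pos_eq by (auto simp: in_tow)

lemma sub_floor:
  assumes "x \<in> flo j l" "l < hgt j"
  obtains i where "i < ncols j" "x \<in> flo (Suc j) (colpos j i + l)"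
proof -
  define i where "i = nat \<lfloor>(x - left_end j l) / width (Suc j)\<rfloor>"
  have x: "left_end j l \<le> x" "x < left_end j l + width j" using assms by (auto simp: tower_floor_def)
  have i0: "int i = \<lfloor>(x - left_end j l) / width (Suc j)\<rfloor>"
    using x width_pos[of "Suc j"] by (simp add: i_def less_imp_le del: width_pos)
  have "x - left_end j l < ncols j * width (Suc j)" using x width_Suc'[of j] by linarith
  then have "(x - left_end j l) / width (Suc j) < ncols j" using width_pos[of "Suc j"] by (simp add: pos_divide_less_eq del: width_pos)
  then have i: "i < ncols j" using i0 by linarith
  have "real i \<le> (x - left_end j l) / width (Suc j)" "(x - left_end j l) / width (Suc j) < i + 1"
    using i0 by linarith+
  then have b: "width (Suc j) * real i \<le> x - left_end j l" "x - left_end j l < width (Suc j) * (real i + 1)"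
    using width_pos[of "Suc j"] by (simp_all add: field_simps del: width_pos)
  have e: "width (Suc j) * real (place (Suc j) (colpos j i + l)) = left_end j l + width (Suc j) * real i"
    by (simp add: place_Suc[OF i assms(2)] left_end_def distrib_left) (simp add: field_simps width.simps)
  then have "x \<in> flo (Suc j) (colpos j i + l)" unfolding in_flo using b by (simp add: algebra_simps)
  then show ?thesis using i that by blast
qed

lemma left_end_Suc: assumes "i < ncols j" "l < hgt j"
  shows "left_end (Suc j) (colpos j i + l) = left_end j l + real i * width (Suc j)"
  by (simp add: place_Suc[OF assms] left_end_def distrib_left) (simp add: field_simps width.simps)

lemma flo_Suc_subset: assumes "i < ncols j" "l < hgt j" shows "flo (Suc j) (colpos j i + l) \<subseteq> flo j l"
proof
  fix x assume "x \<in> flo (Suc j) (colpos j i + l)"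
  then have x: "left_end j l + real i * width (Suc j) \<le> x" "x < left_end j l + real i * width (Suc j) + width (Suc j)"
    by (auto simp: tower_floor_def left_end_Suc[OF assms] )
  have "real i + 1 \<le> ncols j" using assms by linarith
  then have "(real i + 1) * width (Suc j) \<le> ncols j * width (Suc j)"
    by (intro mult_right_mono) (auto simp: less_imp_le )
  moreover have "0 \<le> real i * width (Suc j)" using width_pos[of "Suc j"] by (intro mult_nonneg_nonneg) linarith+
  moreover have "(real i + 1) * width (Suc j) = real i * width (Suc j) + width (Suc j)" by (simp only: distrib_right mult_1)
  ultimately have "left_end j l \<le> x" "x < left_end j l + width j" using x width_Suc'[of j] by linarith+
  then show "x \<in> flo j l" by (simp add: tower_floor_def)
qed

lemma colpos_bound: "i < ncols j \<Longrightarrow> l < hgt j \<Longrightarrow> colpos j i + l < hgt (Suc j)"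
  using colpos_end[of i j] by linarith

lemma tow_mono_Suc: "tow j \<subseteq> tow (Suc j)"
proof
  fix x assume "x \<in> tow j"
  then obtain l where l: "l < hgt j" "x \<in> flo j l" by (auto simp: in_tow)
  from sub_floor[OF l(2,1)] obtain i where "i < ncols j" "x \<in> flo (Suc j) (colpos j i + l)" .
  then show "x \<in> tow (Suc j)" using colpos_bound[OF _ l(1)] in_tow by blast
qed

lemma tow_mono: "j \<le> k \<Longrightarrow> tow j \<subseteq> tow k"
  by (rule lift_Suc_mono_le[of tow, OF tow_mono_Suc])

definition cix :: "nat \<Rightarrow> real \<Rightarrow> nat" where
  "cix j x = (THE i. i < ncols j \<and> pos (Suc j) x = colpos j i + pos j x)"

lemma pos_Suc: assumes "x \<in> tow j"
  shows "pos (Suc j) x = colpos j (cix j x) + pos j x" "cix j x < ncols j"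
proof -
  note p = pos_tow[OF assms]
  from sub_floor[OF p(2,1)] obtain i where i: "i < ncols j" "x \<in> flo (Suc j) (colpos j i + pos j x)" .
  have e: "pos (Suc j) x = colpos j i + pos j x" by (rule pos_eq[OF colpos_bound[OF i(1) p(1)] i(2)])
  have "cix j x = i" unfolding cix_def
    by (rule the_equality) (use i e colpos_inject[OF _ p(1) p(1)] in auto)
  then show "pos (Suc j) x = colpos j (cix j x) + pos j x" "cix j x < ncols j" using e i by auto
qed

lemma pos_Suc_iff: assumes "x \<in> tow (Suc j)"
  shows "x \<in> tow j \<longleftrightarrow> (\<exists>i<ncols j. \<exists>l<hgt j. pos (Suc j) x = colpos j i + l)"
proof
  assume "x \<in> tow j"
  then show "\<exists>i<ncols j. \<exists>l<hgt j. pos (Suc j) x = colpos j i + l"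
    using pos_Suc[of x j] pos_tow(1)[of x j] by blast
next
  assume "\<exists>i<ncols j. \<exists>l<hgt j. pos (Suc j) x = colpos j i + l"
  then obtain i l where il: "i < ncols j" "l < hgt j" "pos (Suc j) x = colpos j i + l" by blast
  then have "x \<in> flo j l" using pos_tow(2)[OF assms] flo_Suc_subset[OF il(1,2)] by auto
  then show "x \<in> tow j" using il in_tow by blast
qed

lemma rank_one_construction_ok: "rank_one_construction ncols spc width left_end"
proof -
  have "disjoint_family_on (flo j) {..<hgt j}" for j
    unfolding disjoint_family_on_def using flo_unique[of _ j] by fastforce
  then show ?thesis unfolding rank_one_construction_def by (auto simp: left_end_Suc width.simps(2))
qed


subsection \<open>The map\<close>

definition tmap :: "real \<Rightarrow> real" where
  "tmap x = (if \<exists>j l. Suc l < hgt j \<and> x \<in> flo j l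
     then x + (SOME d. \<exists>j l. Suc l < hgt j \<and> x \<in> flo j l \<and> d = left_end j (Suc l) - left_end j l) else x)"

lemma shift_refine:
  assumes "x \<in> flo j l" "Suc l < hgt j" "j \<le> k"
  shows "\<exists>l'. x \<in> flo k l' \<and> Suc l' < hgt k \<and> left_end k (Suc l') - left_end k l' = left_end j (Suc l) - left_end j l"
  using assms(3)
proof (induct k rule: dec_induct)
  case base then show ?case using assms by blast
next
  case (step k)
  then obtain l' where l': "x \<in> flo k l'" "Suc l' < hgt k" "left_end k (Suc l') - left_end k l' = left_end j (Suc l) - left_end j l"
    by blast
  from l'(2) have "l' < hgt k" by simp
  from sub_floor[OF l'(1) this] obtain i where i: "i < ncols k" "x \<in> flo (Suc k) (colpos k i + l')" .
  have "left_end (Suc k) (Suc (colpos k i + l')) - left_end (Suc k) (colpos k i + l') = left_end j (Suc l) - left_end j l"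
    using left_end_Suc[OF i(1) l'(2)] left_end_Suc[OF i(1) \<open>l' < hgt k\<close>] l'(3) by simp
  moreover have "Suc (colpos k i + l') < hgt (Suc k)" using colpos_bound[OF i(1) l'(2)] by simp
  ultimately show ?case using i(2) by blast
qed

lemma shift_unique:
  assumes "x \<in> flo j l" "Suc l < hgt j" "x \<in> flo j' l'" "Suc l' < hgt j'"
  shows "left_end j (Suc l) - left_end j l = left_end j' (Suc l') - left_end j' l'"
proof -
  define k where "k = max j j'"
  obtain u where u: "x \<in> flo k u" "Suc u < hgt k" "left_end k (Suc u) - left_end k u = left_end j (Suc l) - left_end j l"
    using shift_refine[OF assms(1,2), of k] by (auto simp: k_def)
  obtain v where v: "x \<in> flo k v" "Suc v < hgt k" "left_end k (Suc v) - left_end k v = left_end j' (Suc l') - left_end j' l'"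
    using shift_refine[OF assms(3,4), of k] by (auto simp: k_def)
  have "u = v" using flo_unique[OF u(1) v(1)] u(2) v(2) by simp
  then show ?thesis using u v by simp
qed

lemma tmap_eq:
  assumes "x \<in> flo j l" "Suc l < hgt j"
  shows "tmap x = x + (left_end j (Suc l) - left_end j l)"
proof -
  let ?Q = "\<lambda>d. \<exists>j l. Suc l < hgt j \<and> x \<in> flo j l \<and> d = left_end j (Suc l) - left_end j l"
  have "?Q (left_end j (Suc l) - left_end j l)" using assms by blast
  then have "?Q (SOME d. ?Q d)" by (rule someI)
  then have "(SOME d. ?Q d) = left_end j (Suc l) - left_end j l" using shift_unique[OF assms] by fastforce
  then show ?thesis using assms unfolding tmap_def by auto
qed

lemma rank_one_map_ok: "rank_one_map ncols spc width left_end tmap"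
  unfolding rank_one_map_def using rank_one_construction_ok tmap_eq by auto

lemma flo_shift: "x \<in> flo j l \<Longrightarrow> x + (left_end j l' - left_end j l) \<in> flo j l'"
  by (simp add: tower_floor_def)

lemma flo_pos: "x \<in> flo j l \<Longrightarrow> l < hgt j \<Longrightarrow> x \<in> tow j \<and> pos j x = l"
  using pos_eq in_tow by blast

lemma tmap_pow:
  assumes "x \<in> tow j" "pos j x + m < hgt j"
  shows "(tmap ^^ m) x = x + (left_end j (pos j x + m) - left_end j (pos j x)) \<and>
    (tmap ^^ m) x \<in> tow j \<and> pos j ((tmap ^^ m) x) = pos j x + m"
  using assms(2)
proof (induct m)
  case 0 then show ?case using assms by simp
next
  case (Suc m)
  let ?y = "(tmap ^^ m) x"
  have y: "?y = x + (left_end j (pos j x + m) - left_end j (pos j x))" "?y \<in> tow j" "pos j ?y = pos j x + m"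
    using Suc by auto
  have f: "?y \<in> flo j (pos j x + m)" using pos_tow(2)[OF y(2)] y(3) by simp
  have t: "tmap ?y = ?y + (left_end j (Suc (pos j x + m)) - left_end j (pos j x + m))"
    by (rule tmap_eq[OF f]) (use Suc in simp)
  have "tmap ?y \<in> flo j (Suc (pos j x + m))" unfolding t by (rule flo_shift[OF f])
  then have "tmap ?y \<in> tow j \<and> pos j (tmap ?y) = Suc (pos j x + m)" using Suc flo_pos by simp
  then show ?case using t y by simp
qed

lemma tmap_exit:
  assumes x: "x \<in> tow j" and m: "m \<le> hgt j" "hgt j \<le> pos j x + m"
  shows "(tmap ^^ m) x \<notin> tow j"
proof
  assume y: "(tmap ^^ m) x \<in> tow j"
  let ?i = "cix j x" and ?y = "(tmap ^^ m) x"
  have x': "x \<in> tow (Suc j)" using x tow_mono_Suc by blast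
  note p = pos_Suc[OF x]
  have lt: "pos j x < hgt j" using pos_tow(1)[OF x] .
  have "pos (Suc j) x + m < hgt (Suc j)" using p colpos_end[OF p(2)] lt m by linarith
  from tmap_pow[OF x' this] have "pos (Suc j) ?y = colpos j ?i + pos j x + m" using p by metis
  moreover obtain i' l' where i': "i' < ncols j" "l' < hgt j" "pos (Suc j) ?y = colpos j i' + l'"
    using pos_Suc[OF y] pos_tow(1)[OF y] by blast
  ultimately have e: "colpos j ?i + pos j x + m = colpos j i' + l'" by simp
  consider "i' \<le> ?i" | "?i < i'" by linarith
  then show False
  proof cases
    case 1
    then have "colpos j i' \<le> colpos j ?i" using colpos_less[of i' ?i j] by (cases "i' = ?i") auto
    then show ?thesis using e m i'(2) by linarith
  next
    case 2
    then show ?thesis using colpos_gap[of ?i i' j] e lt m by linarith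
  qed
qed

lemma tmap_return:
  assumes "x \<in> tow j" "(tmap ^^ m) x \<in> tow j" "m \<le> hgt j"
  shows "pos j x + m < hgt j" "pos j ((tmap ^^ m) x) = pos j x + m"
proof -
  show *: "pos j x + m < hgt j" using tmap_exit[OF assms(1,3)] assms(2) by force
  show "pos j ((tmap ^^ m) x) = pos j x + m" using tmap_pow[OF assms(1) *] by blast
qed

lemma tmap_return_columns:
  assumes x: "x \<in> tow j" and y: "(tmap ^^ m) x \<in> tow j" and m: "m \<le> hgt (Suc j)"
  shows "colpos j (cix j x) + pos j x + m = colpos j (cix j ((tmap ^^ m) x)) + pos j ((tmap ^^ m) x)"
proof -
  have "x \<in> tow (Suc j)" "(tmap ^^ m) x \<in> tow (Suc j)" using x y tow_mono_Suc by blast+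
  from tmap_return(2)[OF this m] show ?thesis using pos_Suc(1)[OF x] pos_Suc(1)[OF y] by simp
qed

subsection \<open>The phase space\<close>

lemma tow_size: "2 ^ j / 10 \<le> width j * hgt j"
proof (induct j)
  case 0 then show ?case by simp
next
  case (Suc j)
  have "width j * (2 * hgt j) \<le> width (Suc j) * hgt (Suc j)"
  proof -
    have "width j * (2 * hgt j) = width (Suc j) * real (2 * (ncols j * hgt j))" using width_Suc'[of j] by simp
    also have "\<dots> \<le> width (Suc j) * hgt (Suc j)"
      using hgt_growth[of j] width_pos[of "Suc j"] by (intro mult_left_mono) (auto simp: less_imp_le simp del: of_nat_mult)
    finally show ?thesis .
  qed
  then show ?case using Suc by simp
qed

lemma in_some_tow: assumes "0 \<le> x" shows "\<exists>j. x \<in> tow j"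
proof -
  obtain j where "10 * x < 2 ^ j" using real_arch_pow[of 2 "10 * x"] by auto
  then have "x < width j * hgt j" using tow_size[of j] by linarith
  then show ?thesis using assms by (auto simp: tow_eq)
qed

lemma phase_space_eq: "phase_space ncols spc width left_end = {0..}"
  unfolding phase_space_def using in_some_tow by (auto simp: tow_eq)

lemma in_tow_ge: "0 \<le> x \<Longrightarrow> \<exists>j0. \<forall>j\<ge>j0. x \<in> tow j"
  using in_some_tow tow_mono by blast

lemma not_top: assumes "x \<in> tow j" shows "x \<in> tow (Suc j)" "Suc (pos (Suc j) x) < hgt (Suc j)"
proof -
  show "x \<in> tow (Suc j)" using assms tow_mono_Suc by blast
  show "Suc (pos (Suc j) x) < hgt (Suc j)"
    using pos_Suc[OF assms] pos_tow(1)[OF assms] colpos_end[of "cix j x" j] by linarith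
qed

lemma tmap_nonneg: "0 \<le> x \<Longrightarrow> 0 < tmap x"
proof -
  assume "0 \<le> x"
  then obtain j where j: "x \<in> tow j" using in_some_tow by blast
  note t = not_top[OF j]
  have *: "tmap x \<in> tow (Suc j)" "pos (Suc j) (tmap x) = Suc (pos (Suc j) x)"
    using tmap_pow[OF t(1), of 1] t(2) by auto
  have "0 \<in> flo (Suc j) 0" using width_pos[of "Suc j"] by (simp add: in_flo del: width_pos)
  then have "pos (Suc j) 0 = 0" using pos_eq[of 0] by simp
  then have "tmap x \<noteq> 0" using *(2) by auto
  moreover have "0 \<le> tmap x" using *(1) by (simp add: tow_eq)
  ultimately show ?thesis by simp
qed

lemma tmap_inj: "inj_on tmap {0..}"
proof (rule inj_onI)
  fix x y :: real assume xy: "x \<in> {0..}" "y \<in> {0..}" "tmap x = tmap y"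
  obtain j where j: "x \<in> tow j" "y \<in> tow j"
    using in_tow_ge[of x] in_tow_ge[of y] xy by (metis atLeast_iff nle_le)
  note tx = not_top[OF j(1)] and ty = not_top[OF j(2)]
  have x: "tmap x = x + (left_end (Suc j) (Suc (pos (Suc j) x)) - left_end (Suc j) (pos (Suc j) x))"
    "pos (Suc j) (tmap x) = Suc (pos (Suc j) x)"
    using tmap_pow[OF tx(1), of 1] tx(2) by auto
  have y: "tmap y = y + (left_end (Suc j) (Suc (pos (Suc j) y)) - left_end (Suc j) (pos (Suc j) y))"
    "pos (Suc j) (tmap y) = Suc (pos (Suc j) y)"
    using tmap_pow[OF ty(1), of 1] ty(2) by auto
  have "pos (Suc j) x = pos (Suc j) y" using x(2) y(2) xy(3) by (metis Suc_inject)
  then have "tmap y - y = tmap x - x" using x(1) y(1) by (metis add_diff_cancel_left')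
  then show "x = y" using xy(3) by simp
qed

lemma width_tendsto: "width \<longlonglongrightarrow> 0"
proof -
  have "width j \<le> (1/2) ^ j" for j
  proof (induct j)
    case (Suc j)
    have "width (Suc j) \<le> width j / 2" unfolding width.simps by (rule divide_left_mono) (auto simp: less_imp_le ncols_def)
    then show ?case using Suc by simp
  qed simp
  moreover have "(\<lambda>j. (1/2::real) ^ j) \<longlonglongrightarrow> 0" by (rule LIMSEQ_power_zero) simp
  ultimately show ?thesis by (rule_tac tendsto_sandwich[of "\<lambda>_. 0"]) (auto simp: less_imp_le)
qed

lemma tmap_surj: assumes "0 < y" shows "\<exists>x\<ge>0. tmap x = y"
proof -
  obtain j0 where j0: "\<forall>j\<ge>j0. y \<in> tow j" using in_tow_ge[of y] assms by auto
  have "\<forall>\<^sub>F j in sequentially. width j < y" using width_tendsto assms by (rule order_tendstoD)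
  then obtain j where j: "y \<in> tow j" "width j < y"
    using j0 unfolding eventually_sequentially by (meson nle_le)
  let ?l = "pos j y"
  have l: "?l < hgt j" "y \<in> flo j ?l" using pos_tow[OF j(1)] by auto
  then have "?l \<noteq> 0" using j(2) by (metis in_flo place_0 add_0 mult.right_neutral of_nat_0 order_less_asym)
  then obtain l' where l': "?l = Suc l'" using not0_implies_Suc by blast
  define x where "x = y + (left_end j l' - left_end j ?l)"
  have x: "x \<in> flo j l'" unfolding x_def by (rule flo_shift[OF l(2)])
  have "x \<in> tow j" using x l(1) l' in_tow[of x j] by auto
  then have "0 \<le> x" by (simp add: tow_eq)
  moreover have "tmap x = y" using tmap_eq[OF x] l(1) l' by (simp add: x_def)
  ultimately show ?thesis by blast
qed

subsection \<open>Columns and the Sidon property\<close>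

abbreviation col :: "nat \<Rightarrow> nat \<Rightarrow> real set" where "col \<equiv> column ncols spc width left_end"

lemma col_eq: assumes "i < ncols j" shows "col j i = (\<Union>l<hgt j. flo (Suc j) (colpos j i + l))"
  unfolding column_def height_eq
proof (rule SUP_cong[OF refl])
  fix l assume l: "l \<in> {..<hgt j}"
  then have e: "left_end (Suc j) (colpos j i + l) = left_end j l + real i * width (Suc j)" using left_end_Suc[OF assms] by simp
  show "{left_end j l + real i * width (Suc j)..<left_end j l + real (Suc i) * width (Suc j)} = flo (Suc j) (colpos j i + l)"
    unfolding tower_floor_def e by (simp add: algebra_simps)
qed

lemma in_col: assumes "i < ncols j" shows "x \<in> col j i \<longleftrightarrow> x \<in> tow j \<and> cix j x = i"
proof
  assume "x \<in> col j i"
  then obtain l where l: "l < hgt j" "x \<in> flo (Suc j) (colpos j i + l)" by (auto simp: col_eq[OF assms])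
  then have f: "x \<in> flo j l" using flo_Suc_subset[OF assms] by blast
  then have t: "x \<in> tow j" "pos j x = l" using flo_pos l by auto
  have "pos (Suc j) x = colpos j i + l" by (rule pos_eq[OF colpos_bound[OF assms l(1)] l(2)])
  then have "cix j x = i" using pos_Suc[OF t(1)] t(2) by (simp add: colpos_less_iff) (metis colpos_less nat_neq_iff)
  then show "x \<in> tow j \<and> cix j x = i" using t by simp
next
  assume a: "x \<in> tow j \<and> cix j x = i"
  then have "x \<in> tow (Suc j)" using tow_mono_Suc by blast
  then have "x \<in> flo (Suc j) (colpos j i + pos j x)" using pos_tow(2)[of x "Suc j"] pos_Suc(1)[of x j] a by simp
  then show "x \<in> col j i" using col_eq[OF assms] pos_tow(1)[of x j] a by blast
qed

lemma powers4_unique: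
  fixes M N :: "nat multiset"
  assumes "(\<Sum>i\<in>#M. 4 ^ i) = (\<Sum>i\<in>#N. (4::nat) ^ i)" "size M \<le> 3" "size N \<le> 3"
  shows "M = N"
  using assms
proof (induct "size M" arbitrary: M N)
  case 0
  then show ?case by (cases N) auto
next
  case (Suc n)
  have bound: "(\<Sum>i\<in>#K. (4::nat) ^ i) < 4 ^ Suc (Max_mset K)" if "size K \<le> 3" "K \<noteq> {#}" for K :: "nat multiset"
  proof -
    have "(\<Sum>i\<in>#K. (4::nat) ^ i) \<le> (\<Sum>i\<in>#K. 4 ^ Max_mset K)"
      by (rule sum_mset_mono) (auto intro: power_increasing)
    also have "\<dots> = size K * 4 ^ Max_mset K" by simp
    also have "\<dots> \<le> 3 * 4 ^ Max_mset K" using that by simp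
    also have "\<dots> < 4 ^ Suc (Max_mset K)" by simp
    finally show ?thesis .
  qed
  have low: "(4::nat) ^ Max_mset K \<le> (\<Sum>i\<in>#K. 4 ^ i)" if "K \<noteq> {#}" for K :: "nat multiset"
  proof -
    have "Max_mset K \<in># K" using that by simp
    then have "K = add_mset (Max_mset K) (K - {#Max_mset K#})" by simp
    then have "(\<Sum>i\<in>#K. (4::nat) ^ i) = 4 ^ Max_mset K + (\<Sum>i\<in>#K - {#Max_mset K#}. 4 ^ i)"
      by (metis image_mset_add_mset sum_mset.add_mset)
    then show ?thesis by simp
  qed
  have M: "M \<noteq> {#}" using Suc(2) by auto
  have N: "N \<noteq> {#}" using low[OF M] Suc(3) by auto
  have "(4::nat) ^ Max_mset M < 4 ^ Suc (Max_mset N)" "(4::nat) ^ Max_mset N < 4 ^ Suc (Max_mset M)"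
    using low[OF M] low[OF N] bound[OF Suc(4) M] bound[OF Suc(5) N] Suc(3) by simp_all
  then have "Max_mset M < Suc (Max_mset N)" "Max_mset N < Suc (Max_mset M)"
    by (meson power_less_imp_less_exp one_less_numeral_iff semiring_norm(76))+
  then have e: "Max_mset M = Max_mset N" by simp
  define k where "k = Max_mset M"
  obtain M' where M': "M = add_mset k M'" using M by (metis Max_in finite_set_mset k_def mset_add set_mset_eq_empty_iff)
  obtain N' where N': "N = add_mset k N'" using N e by (metis Max_in finite_set_mset k_def mset_add set_mset_eq_empty_iff)
  have "M' = N'" by (rule Suc(1)) (use Suc(2-5) M' N' in auto)
  then show ?case using M' N' by simp
qed

lemma colpos_real: "real (colpos j i) = 2 * real (hgt j) * (4 ^ i - 1)"
proof -
  have "(1::nat) \<le> 4 ^ i" by simp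
  then show ?thesis unfolding colpos_def by (simp add: of_nat_diff)
qed

lemma colpos_near:
  assumes "colpos j b + l = colpos j a + l' + m" "2 * hgt j dvd m" "l < hgt j" "l' < hgt j"
  shows "l = l' \<and> colpos j b = colpos j a + m"
proof -
  obtain k where k: "m = 2 * hgt j * k" using assms(2) by auto
  let ?h = "2 * hgt j"
  have "(?h * (4 ^ b - 1) + l) mod ?h = l" "(?h * (4 ^ a - 1 + k) + l') mod ?h = l'" using assms(3,4) by auto
  moreover have "?h * (4 ^ b - 1) + l = ?h * (4 ^ a - 1 + k) + l'" 
    using assms(1) k unfolding colpos_def by (simp only: distrib_left)
  ultimately have "l = l'" by metis
  then show ?thesis using assms(1) by simp
qed

text \<open>The starts of the columns, in units of twice the height, form a Sidon set.\<close>

lemma colpos_diff_unique: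
  assumes "colpos j b + l1 + (colpos j a' + l4) = colpos j b' + l2 + (colpos j a + l3)"
    "l1 < hgt j" "l2 < hgt j" "l3 < hgt j" "l4 < hgt j" "a \<noteq> b"
  shows "b = b' \<and> a = a'"
proof -
  have "real_of_int (int l1 + int l4 - int l2 - int l3) = 2 * real (hgt j) * (4 ^ b' + 4 ^ a - 4 ^ b - 4 ^ a')"
    using assms(1)[THEN arg_cong[of _ _ real]] 
    by (simp only: of_nat_add of_int_add of_int_diff of_int_of_nat_eq colpos_real) (simp add: algebra_simps)
  also have "\<dots> = real_of_int (2 * int (hgt j) * (4 ^ b' + 4 ^ a - 4 ^ b - 4 ^ a'))" by simp
  finally have e: "int l1 + int l4 - int l2 - int l3 = 2 * int (hgt j) * (4 ^ b' + 4 ^ a - 4 ^ b - 4 ^ a')"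
    by (simp only: of_int_eq_iff)
  define z where "z = (4 ^ b' + 4 ^ a - 4 ^ b - 4 ^ a' :: int)"
  have bd: "\<bar>2 * int (hgt j) * z\<bar> < 2 * int (hgt j)" using e assms(2-5) unfolding z_def by linarith
  have "z = 0"
  proof (rule ccontr)
    assume "z \<noteq> 0"
    then have "1 \<le> \<bar>z\<bar>" by linarith
    then have "2 * int (hgt j) * 1 \<le> 2 * int (hgt j) * \<bar>z\<bar>" by (intro mult_left_mono) auto
    then show False using bd by (simp add: abs_mult)
  qed
  then have "int (4 ^ b' + 4 ^ a) = int (4 ^ b + 4 ^ a')" by (simp add: z_def)
  then have "(4::nat) ^ b' + 4 ^ a = 4 ^ b + 4 ^ a'" by (simp only: of_nat_eq_iff)
  then have "{#b', a#} = {#b, a'#}" by (intro powers4_unique) auto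
  then show ?thesis using assms(6) by (auto simp: add_eq_conv_ex)
qed

lemma sidon_source:
  assumes j: "x \<in> tow j" "(tmap ^^ m) x \<in> tow j" "y \<in> tow j" "(tmap ^^ m) y \<in> tow j"
    and m: "hgt j < m" "m \<le> hgt (Suc j)"
  shows "cix j x = cix j y \<and> cix j ((tmap ^^ m) x) = cix j ((tmap ^^ m) y)"
proof -
  note ex = tmap_return_columns[OF j(1,2) m(2)] and ey = tmap_return_columns[OF j(3,4) m(2)]
  have lt: "pos j x < hgt j" "pos j y < hgt j" "pos j ((tmap ^^ m) x) < hgt j" "pos j ((tmap ^^ m) y) < hgt j"
    using j pos_tow(1) by auto
  have "cix j x \<noteq> cix j ((tmap ^^ m) x)" using ex lt m by auto
  then show ?thesis
    using colpos_diff_unique[of j "cix j ((tmap ^^ m) x)" "pos j ((tmap ^^ m) x)" "cix j y" "pos j y"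
      "cix j ((tmap ^^ m) y)" "pos j ((tmap ^^ m) y)" "cix j x" "pos j x"] ex ey lt by simp
qed

lemma sidon_ok: "sidon ncols spc width left_end tmap"
  unfolding sidon_def height_eq
proof (intro allI impI)
  fix j m assume m: "hgt j < m \<and> m \<le> hgt (Suc j)"
  show "\<exists>i<ncols j. tow j \<inter> (tmap ^^ m) ` tow j \<subseteq> col j i"
  proof (cases "\<exists>x\<in>tow j. (tmap ^^ m) x \<in> tow j")
    case True
    then obtain x where x: "x \<in> tow j" "(tmap ^^ m) x \<in> tow j" by blast
    let ?i = "cix j ((tmap ^^ m) x)"
    have "?i < ncols j" using pos_Suc(2)[OF x(2)] .
    moreover have "tow j \<inter> (tmap ^^ m) ` tow j \<subseteq> col j ?i"
      using sidon_source[OF _ _ x] m in_col[OF \<open>?i < ncols j\<close>] by auto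
    ultimately show ?thesis by blast
  next
    case False
    then show ?thesis using ncols_ge(2)[of j] by blast
  qed
qed

subsection \<open>Preservation of Lebesgue measure\<close>

lemma measure_preserving_comp:
  assumes "measure_preserving M f" "measure_preserving M g"
  shows "measure_preserving M (\<lambda>x. g (f x))"
proof -
  have f: "f \<in> M \<rightarrow>\<^sub>M M" "distr M M f = M" and g: "g \<in> M \<rightarrow>\<^sub>M M" "distr M M g = M"
    using assms by (auto simp: measure_preserving_def)
  have "distr M M (\<lambda>x. g (f x)) = distr (distr M M f) M g"
    by (simp add: distr_distr[OF g(1) f(1)] comp_def)
  then show ?thesis using f g unfolding measure_preserving_def by (auto intro: measurable_compose)
qed

lemma measure_preserving_funpow: "measure_preserving M f \<Longrightarrow> measure_preserving M (f ^^ n)"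
proof (induct n)
  case 0
  then show ?case by (simp add: measure_preserving_def id_def)
next
  case (Suc n)
  then show ?case using measure_preserving_comp[of M "f ^^ n" f] by (simp add: comp_def)
qed

lemma emeasure_translation: "emeasure lebesgue ((\<lambda>x. x + c) ` S) = emeasure lebesgue (S :: real set)"
  using emeasure_lebesgue_affine[of 1 c S] by simp

lemma sets_translation: "S \<in> sets lebesgue \<Longrightarrow> (\<lambda>x. x + c) ` S \<in> sets lebesgue" for S :: "real set"
  using lebesgue_sets_translation[of S c] by (simp add: add.commute)

definition ddom :: "nat \<Rightarrow> real set" where "ddom j = (\<Union>l\<in>{l. Suc l < hgt j}. flo j l)"

lemma flo_sets [measurable]: "flo j l \<in> sets lebesgue" by (simp add: tower_floor_def)

lemma ddom_mono: "incseq ddom"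
proof (rule incseq_SucI)
  fix j show "ddom j \<subseteq> ddom (Suc j)"
  proof
    fix x assume "x \<in> ddom j"
    then obtain l where "Suc l < hgt j" "x \<in> flo j l" by (auto simp: ddom_def)
    then show "x \<in> ddom (Suc j)" using shift_refine[of x j l "Suc j"] by (auto simp: ddom_def)
  qed
qed

lemma ddom_Un: "(\<Union>j. ddom j) = {0..}"
proof
  show "(\<Union>j. ddom j) \<subseteq> {0..}"
  proof
    fix x assume "x \<in> (\<Union>j. ddom j)"
    then obtain j l where "Suc l < hgt j" "x \<in> flo j l" by (auto simp: ddom_def)
    then have "x \<in> tow j" using flo_pos[of x j l] by auto
    then show "x \<in> {0..}" by (simp add: tow_eq)
  qed
  show "{0..} \<subseteq> (\<Union>j. ddom j)"
  proof
    fix x :: real assume "x \<in> {0..}"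
    then obtain j where "x \<in> tow j" using in_some_tow[of x] by auto
    from not_top[OF this] have "x \<in> ddom (Suc j)" using pos_tow(2)[of x "Suc j"] by (auto simp: ddom_def)
    then show "x \<in> (\<Union>j. ddom j)" by blast
  qed
qed

lemma tmap_floor_image: assumes "Suc l < hgt j" "A \<subseteq> flo j l"
  shows "tmap ` A = (\<lambda>x. x + (left_end j (Suc l) - left_end j l)) ` A"
  by (rule image_cong[OF refl]) (use tmap_eq assms in blast)

lemma tmap_image_sets: assumes "A \<in> sets lebesgue" "A \<subseteq> {0..}" shows "tmap ` A \<in> sets lebesgue"
proof -
  have "tmap ` A = (\<Union>j. \<Union>l\<in>{l. Suc l < hgt j}. tmap ` (A \<inter> flo j l))"
  proof -
    have "A = A \<inter> (\<Union>j. ddom j)" using assms(2) ddom_Un by auto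
    also have "\<dots> = (\<Union>j. \<Union>l\<in>{l. Suc l < hgt j}. A \<inter> flo j l)" unfolding ddom_def by simp
    finally show ?thesis by (metis (no_types, lifting) SUP_cong image_UN)
  qed
  moreover have "tmap ` (A \<inter> flo j l) \<in> sets lebesgue" if "Suc l < hgt j" for j l
    unfolding tmap_floor_image[OF that Int_lower2] using assms(1) by (intro sets_translation) auto
  ultimately show ?thesis by (auto intro!: sets.countable_UN sets.countable_UN'')
qed

definition tpre :: "nat \<Rightarrow> real set \<Rightarrow> real set" where
  "tpre n B = {x. 0 \<le> x \<and> (tmap ^^ n) x \<in> B}"

lemma tmap_image_ddom: "tmap ` ddom j = (\<Union>l\<in>{l. Suc l < hgt j}. flo j (Suc l))"
proof -
  have "tmap ` flo j l = flo j (Suc l)" if "Suc l < hgt j" for l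
    unfolding tmap_floor_image[OF that subset_refl]
  proof
    show "(\<lambda>x. x + (left_end j (Suc l) - left_end j l)) ` flo j l \<subseteq> flo j (Suc l)" using flo_shift by blast
    show "flo j (Suc l) \<subseteq> (\<lambda>x. x + (left_end j (Suc l) - left_end j l)) ` flo j l"
      using flo_shift[of _ j "Suc l" l] by (force intro: image_eqI[where x="_ + (left_end j l - left_end j (Suc l))"])
  qed
  then show ?thesis by (auto simp: ddom_def image_UN)
qed

lemma shift1_ddom:
  assumes "B \<in> sets lebesgue"
  shows "tpre 1 B \<inter> ddom j \<in> sets lebesgue" 
    "emeasure lebesgue (tpre 1 B \<inter> ddom j) = emeasure lebesgue (B \<inter> tmap ` ddom j)"
proof -
  define I where "I = {l. Suc l < hgt j}"
  have fin: "finite I" unfolding I_def by (rule finite_subset[of _ "{..<hgt j}"]) auto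
  define F where "F l = (\<lambda>x. x + (left_end j l - left_end j (Suc l))) ` (B \<inter> flo j (Suc l))" for l
  have Fs: "F l \<in> sets lebesgue" for l unfolding F_def using assms by (intro sets_translation) auto
  have Fe: "F l = {x \<in> flo j l. tmap x \<in> B}" if "l \<in> I" for l
  proof (intro set_eqI iffI)
    fix x assume "x \<in> F l"
    then obtain y where y: "y \<in> B" "y \<in> flo j (Suc l)" "x = y + (left_end j l - left_end j (Suc l))" by (auto simp: F_def)
    then have "x \<in> flo j l" using flo_shift by blast
    moreover have "tmap x = y" using tmap_eq[OF \<open>x \<in> flo j l\<close>] that y by (simp add: I_def)
    ultimately show "x \<in> {x \<in> flo j l. tmap x \<in> B}" using y by simp
  next
    fix x assume "x \<in> {x \<in> flo j l. tmap x \<in> B}"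
    then have x: "x \<in> flo j l" "tmap x \<in> B" by auto
    have t: "tmap x = x + (left_end j (Suc l) - left_end j l)" using tmap_eq[OF x(1)] that by (simp add: I_def)
    then have "tmap x \<in> flo j (Suc l)" using flo_shift[OF x(1)] by simp
    then show "x \<in> F l" unfolding F_def using x t by (intro image_eqI[of _ _ "tmap x"]) auto
  qed
  have e: "tpre 1 B \<inter> ddom j = (\<Union>l\<in>I. F l)"
  proof -
    have "0 \<le> x" if "x \<in> ddom j" for x using that ddom_Un by auto
    then show ?thesis using Fe by (auto simp: tpre_def ddom_def I_def)
  qed
  show "tpre 1 B \<inter> ddom j \<in> sets lebesgue" unfolding e using fin Fs by (intro sets.finite_UN) auto
  have "disjoint_family_on F I"
    unfolding disjoint_family_on_def using Fe flo_unique by (fastforce simp: I_def)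
  then have "emeasure lebesgue (\<Union>l\<in>I. F l) = (\<Sum>l\<in>I. emeasure lebesgue (F l))"
    using fin Fs by (intro sum_emeasure[symmetric]) auto
  also have "\<dots> = (\<Sum>l\<in>I. emeasure lebesgue (B \<inter> flo j (Suc l)))"
    unfolding F_def emeasure_translation ..
  also have "\<dots> = emeasure lebesgue (\<Union>l\<in>I. B \<inter> flo j (Suc l))"
  proof (rule sum_emeasure)
    show "disjoint_family_on (\<lambda>l. B \<inter> flo j (Suc l)) I"
      unfolding disjoint_family_on_def using flo_unique[of _ j "Suc _" "Suc _"] by (fastforce simp: I_def)
  qed (use fin assms in auto)
  also have "(\<Union>l\<in>I. B \<inter> flo j (Suc l)) = B \<inter> tmap ` ddom j" unfolding tmap_image_ddom I_def by blast
  finally show "emeasure lebesgue (tpre 1 B \<inter> ddom j) = emeasure lebesgue (B \<inter> tmap ` ddom j)" using e by simp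
qed

lemma tmap_image: "tmap ` {0..} = {0<..}"
  using tmap_nonneg tmap_surj by force

lemma shift1:
  assumes "B \<in> sets lebesgue"
  shows "tpre 1 B \<in> sets lebesgue" "emeasure lebesgue (tpre 1 B) = emeasure lebesgue (B \<inter> {0..})"
proof -
  have e: "tpre 1 B = (\<Union>j. tpre 1 B \<inter> ddom j)" using ddom_Un by (auto simp: tpre_def)
  show "tpre 1 B \<in> sets lebesgue" by (subst e) (rule sets.countable_UN, use shift1_ddom(1)[OF assms] in auto)
  have ds: "tmap ` ddom j \<in> sets lebesgue" for j unfolding tmap_image_ddom
    by (rule sets.countable_UN'') auto
  have "emeasure lebesgue (tpre 1 B) = (SUP j. emeasure lebesgue (tpre 1 B \<inter> ddom j))"
    by (subst e, rule SUP_emeasure_incseq[symmetric])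
      (use shift1_ddom(1)[OF assms] ddom_mono in \<open>auto simp: incseq_def\<close>)
  also have "\<dots> = (SUP j. emeasure lebesgue (B \<inter> tmap ` ddom j))" unfolding shift1_ddom(2)[OF assms] ..
  also have "\<dots> = emeasure lebesgue (\<Union>j. B \<inter> tmap ` ddom j)"
  proof (rule SUP_emeasure_incseq)
    show "incseq (\<lambda>j. B \<inter> tmap ` ddom j)" unfolding incseq_def
      by (intro allI impI Int_mono image_mono incseqD[OF ddom_mono] subset_refl)
  qed (use ds assms in auto)
  also have "(\<Union>j. B \<inter> tmap ` ddom j) = B \<inter> {0<..}" using tmap_image ddom_Un by (auto simp flip: image_UN)
  also have "emeasure lebesgue (B \<inter> {0<..}) = emeasure lebesgue (B \<inter> {0..})"
  proof (rule emeasure_eq_AE)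
    show "AE x in lebesgue. (x \<in> B \<inter> {0<..}) = (x \<in> B \<inter> {0..})"
      by (rule AE_I'[of "{0}"]) auto
  qed (use assms in auto)
  finally show "emeasure lebesgue (tpre 1 B) = emeasure lebesgue (B \<inter> {0..})" .
qed

abbreviation "lebX \<equiv> lebesgue_on {0::real..}"

lemma lebX_sets: "A \<in> sets lebX \<longleftrightarrow> A \<in> sets lebesgue \<and> A \<subseteq> {0..}"
  by (auto simp: sets_restrict_space_iff)

lemma lebX_emeasure: "A \<subseteq> {0..} \<Longrightarrow> emeasure lebX A = emeasure lebesgue A"
  by (rule emeasure_restrict_space) auto

lemma measure_preserving_lebX_I:
  assumes "\<And>x. 0 \<le> x \<Longrightarrow> 0 \<le> f x"
    and "\<And>B. B \<in> sets lebesgue \<Longrightarrow> B \<subseteq> {0..} \<Longrightarrow> {x. 0 \<le> x \<and> f x \<in> B} \<in> sets lebesgue"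
    and "\<And>B. B \<in> sets lebesgue \<Longrightarrow> B \<subseteq> {0..} \<Longrightarrow> emeasure lebesgue {x. 0 \<le> x \<and> f x \<in> B} = emeasure lebesgue B"
  shows "measure_preserving lebX f"
proof -
  have v: "f -` B \<inter> space lebX = {x. 0 \<le> x \<and> f x \<in> B}" for B by auto
  have m: "f \<in> lebX \<rightarrow>\<^sub>M lebX"
  proof (rule measurableI)
    fix B assume "B \<in> sets lebX"
    then show "f -` B \<inter> space lebX \<in> sets lebX" unfolding v lebX_sets using assms(2)[of B] by auto
  qed (use assms(1) in auto)
  moreover have "distr lebX lebX f = lebX"
  proof (rule measure_eqI)
    fix B assume "B \<in> sets (distr lebX lebX f)"
    then have B: "B \<in> sets lebX" by simp
    then have B': "B \<in> sets lebesgue" "B \<subseteq> {0..}" by (auto simp: lebX_sets)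
    have "emeasure lebX {x. 0 \<le> x \<and> f x \<in> B} = emeasure lebX B"
      using assms(3)[OF B'] B'(2) by (subst (1 2) lebX_emeasure) auto
    then show "emeasure (distr lebX lebX f) B = emeasure lebX B"
      unfolding emeasure_distr[OF m B] v .
  qed simp
  ultimately show ?thesis by (simp add: measure_preserving_def)
qed

lemma tmap_measure_preserving: "measure_preserving lebX tmap"
proof (rule measure_preserving_lebX_I)
  fix B :: "real set" assume "B \<in> sets lebesgue" "B \<subseteq> {0..}"
  then show "{x. 0 \<le> x \<and> tmap x \<in> B} \<in> sets lebesgue"
    "emeasure lebesgue {x. 0 \<le> x \<and> tmap x \<in> B} = emeasure lebesgue B"
    using shift1[of B] by (simp_all add: tpre_def Int_absorb2)
qed (use tmap_nonneg in \<open>auto intro: less_imp_le\<close>)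

lemma shift_sets: assumes "B \<in> sets lebesgue" shows "tpre n B \<in> sets lebesgue"
  and emeasure_shift: "B \<subseteq> {0..} \<Longrightarrow> emeasure lebesgue (tpre n B) = emeasure lebesgue B"
proof -
  have mp: "measure_preserving lebX (tmap ^^ n)" by (rule measure_preserving_funpow[OF tmap_measure_preserving])
  then have m: "tmap ^^ n \<in> lebX \<rightarrow>\<^sub>M lebX" and d: "distr lebX lebX (tmap ^^ n) = lebX"
    by (auto simp: measure_preserving_def)
  define B' where "B' = B \<inter> {0..}"
  have B': "B' \<in> sets lebX" using assms by (auto simp: lebX_sets B'_def)
  have "0 \<le> (tmap ^^ n) x" if "0 \<le> x" for x using measurable_space[OF m, of x] that by simp
  then have v: "(tmap ^^ n) -` B' \<inter> space lebX = tpre n B" by (auto simp: tpre_def B'_def)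
  have s: "tpre n B \<in> sets lebX" using measurable_sets[OF m B'] v by simp
  then show "tpre n B \<in> sets lebesgue" by (simp add: lebX_sets)
  assume "B \<subseteq> {0..}"
  then have [simp]: "B' = B" by (auto simp: B'_def)
  have "emeasure lebX (tpre n B) = emeasure lebX B" using emeasure_distr[OF m B'] d v by simp
  then show "emeasure lebesgue (tpre n B) = emeasure lebesgue B"
    using lebX_emeasure[of "tpre n B"] lebX_emeasure[of B] \<open>B \<subseteq> {0..}\<close> by (simp add: tpre_def subset_iff)
qed

definition tinv :: "real \<Rightarrow> real" where
  "tinv x = (if x = 0 then 0 else inv_into {0..} tmap x)"

lemma tmap_tinv: "0 < x \<Longrightarrow> tmap (tinv x) = x \<and> 0 \<le> tinv x"
  unfolding tinv_def using f_inv_into_f[of x tmap "{0..}"] inv_into_into[of x tmap "{0..}"] tmap_image by auto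

lemma tinv_tmap: "0 \<le> x \<Longrightarrow> tinv (tmap x) = x"
  unfolding tinv_def using tmap_nonneg[of x] inv_into_f_f[OF tmap_inj, of x] by auto

lemma tinv_measure_preserving: "measure_preserving lebX tinv"
proof (rule measure_preserving_lebX_I)
  show "0 \<le> tinv x" if "0 \<le> x" for x using tmap_tinv[of x] that by (cases "x = 0") (auto simp: tinv_def)
  fix B :: "real set" assume B: "B \<in> sets lebesgue" "B \<subseteq> {0..}"
  have e: "{x. 0 \<le> x \<and> tinv x \<in> B} - {0} = tmap ` B"
  proof
    show "{x. 0 \<le> x \<and> tinv x \<in> B} - {0} \<subseteq> tmap ` B"
    proof
      fix x assume "x \<in> {x. 0 \<le> x \<and> tinv x \<in> B} - {0}"
      then show "x \<in> tmap ` B" using tmap_tinv[of x] by (intro image_eqI[of _ _ "tinv x"]) auto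
    qed
    show "tmap ` B \<subseteq> {x. 0 \<le> x \<and> tinv x \<in> B} - {0}" using B(2) tmap_nonneg tinv_tmap by (fastforce intro: less_imp_le)
  qed
  have s: "tmap ` B \<in> sets lebesgue" by (rule tmap_image_sets[OF B])
  have un: "{x. 0 \<le> x \<and> tinv x \<in> B} = tmap ` B \<union> ({x. 0 \<le> x \<and> tinv x \<in> B} \<inter> {0})" using e by blast
  have z: "{x. 0 \<le> x \<and> tinv x \<in> B} \<inter> {0} \<in> sets lebesgue" by (cases "tinv 0 \<in> B") (auto simp: Int_insert_right)
  show ss: "{x. 0 \<le> x \<and> tinv x \<in> B} \<in> sets lebesgue" by (subst un) (rule sets.Un[OF s z])
  have "emeasure lebesgue {x. 0 \<le> x \<and> tinv x \<in> B} = emeasure lebesgue (tmap ` B)"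
  proof (rule emeasure_eq_AE)
    show "AE x in lebesgue. (x \<in> {x. 0 \<le> x \<and> tinv x \<in> B}) = (x \<in> tmap ` B)"
      by (rule AE_I'[of "{0}"]) (use e in auto)
  qed (use s ss in auto)
  also have "\<dots> = emeasure lebesgue (tpre 1 (tmap ` B))"
    using shift1(2)[OF s] B(2) tmap_nonneg by (subst Int_absorb2[symmetric, of _ "{0..}"]) (auto intro: less_imp_le)
  also have "tpre 1 (tmap ` B) = B" using B(2) tmap_inj by (auto simp: tpre_def inj_on_def)
  finally show "emeasure lebesgue {x. 0 \<le> x \<and> tinv x \<in> B} = emeasure lebesgue B" .
qed

lemma automorphism_tmap: "automorphism lebX tmap"
  unfolding automorphism_def inverse_mod0_def
proof (intro exI conjI)
  show "AE x in lebX. tinv (tmap x) = x" by (rule AE_I2) (simp add: tinv_tmap)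
  show "AE x in lebX. tmap (tinv x) = x"
  proof (rule AE_I')
    show "{0} \<in> null_sets lebX" by (auto simp: null_sets_def lebX_sets lebX_emeasure)
    show "{x \<in> space lebX. tmap (tinv x) \<noteq> x} \<subseteq> {0}" using tmap_tinv by (auto simp: less_le)
  qed
qed (rule tmap_measure_preserving tinv_measure_preserving)+

lemma emeasure_phase_space: "emeasure lebesgue {0::real..} = \<infinity>"
proof (rule ccontr)
  assume "\<not> ?thesis"
  then obtain c where c: "emeasure lebesgue {0::real..} = ennreal c" "0 \<le> c" by (metis ennreal_cases infinity_ennreal_def)
  have "ennreal (c + 1) = emeasure lebesgue {0..c + 1}" using c by simp
  also have "\<dots> \<le> emeasure lebesgue {0::real..}" by (rule emeasure_mono) auto
  finally show False using c by simp
qed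

subsection \<open>Unions of floors\<close>

definition levels :: "nat \<Rightarrow> real set set" where
  "levels j = {A. \<exists>L\<subseteq>{..<hgt j}. A = {x \<in> tow j. pos j x \<in> L}}"

lemma level_UN: "L \<subseteq> {..<hgt j} \<Longrightarrow> {x \<in> tow j. pos j x \<in> L} = (\<Union>l\<in>L. flo j l)"
  using pos_tow(2) flo_pos by blast

lemma levels_subset: "A \<in> levels j \<Longrightarrow> A \<subseteq> tow j" by (auto simp: levels_def)

lemma levels_nonneg: "A \<in> levels j \<Longrightarrow> A \<subseteq> {0..}" using levels_subset[of A j] tow_eq[of j] by auto

lemma levels_pos: "A \<in> levels j \<Longrightarrow> x \<in> A \<Longrightarrow> y \<in> tow j \<Longrightarrow> pos j x = pos j y \<Longrightarrow> y \<in> A"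
  by (auto simp: levels_def)

lemma levels_tow: "tow j \<in> levels j"
  unfolding levels_def using pos_tow(1) by (intro CollectI exI[of _ "{..<hgt j}"]) auto

lemma levels_Suc: "levels j \<subseteq> levels (Suc j)"
proof
  fix A assume "A \<in> levels j"
  then obtain L where L: "L \<subseteq> {..<hgt j}" "A = {x \<in> tow j. pos j x \<in> L}" by (auto simp: levels_def)
  define L' where "L' = {colpos j i + l | i l. i < ncols j \<and> l \<in> L}"
  have "A = {x \<in> tow (Suc j). pos (Suc j) x \<in> L'}"
  proof (intro set_eqI iffI)
    fix x assume "x \<in> A"
    then have "x \<in> tow j" "pos j x \<in> L" using L by auto
    then show "x \<in> {x \<in> tow (Suc j). pos (Suc j) x \<in> L'}"
      using pos_Suc[of x j] tow_mono_Suc[of j] unfolding L'_def by blast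
  next
    fix x assume "x \<in> {x \<in> tow (Suc j). pos (Suc j) x \<in> L'}"
    then obtain i l where x: "x \<in> tow (Suc j)" "i < ncols j" "l \<in> L" "pos (Suc j) x = colpos j i + l"
      by (auto simp: L'_def)
    then have "l < hgt j" using L by auto
    then have t: "x \<in> tow j" using pos_Suc_iff[OF x(1)] x by blast
    then have "pos j x = l" using pos_Suc[OF t] x(4) colpos_inject \<open>l < hgt j\<close> pos_tow(1)[OF t] by metis
    then show "x \<in> A" using t x L by simp
  qed
  moreover have "L' \<subseteq> {..<hgt (Suc j)}" using L colpos_bound by (auto simp: L'_def)
  ultimately show "A \<in> levels (Suc j)" unfolding levels_def by blast
qed

lemma levels_mono: "j \<le> k \<Longrightarrow> levels j \<subseteq> levels k"
  by (rule lift_Suc_mono_le[of levels, OF levels_Suc])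

lemma flo_measure: "flo j l \<in> lmeasurable" "measure lebesgue (flo j l) = width j"
proof -
  show "measure lebesgue (flo j l) = width j" by (simp add: tower_floor_def less_imp_le)
  show "flo j l \<in> lmeasurable" unfolding tower_floor_def by (rule bounded_set_imp_lmeasurable) auto
qed

lemma levels_lmeasurable: "A \<in> levels j \<Longrightarrow> A \<in> lmeasurable"
proof -
  assume "A \<in> levels j"
  then obtain L where L: "L \<subseteq> {..<hgt j}" "A = (\<Union>l\<in>L. flo j l)" unfolding levels_def using level_UN by blast
  show ?thesis unfolding L(2)
    by (rule fmeasurable.finite_UN) (use flo_measure(1) finite_subset[OF L(1)] in auto)
qed

lemma measure_flo_UN:
  assumes "K \<subseteq> {..<hgt j}" shows "measure lebesgue (\<Union>l\<in>K. flo j l) = card K * width j"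
proof -
  have "measure lebesgue (\<Union>l\<in>K. flo j l) = (\<Sum>l\<in>K. measure lebesgue (flo j l))"
  proof (rule measure_finite_Union)
    show "finite K" using assms finite_subset by blast
    show "disjoint_family_on (flo j) K" unfolding disjoint_family_on_def using assms flo_unique by fastforce
    show "emeasure lebesgue (flo j i) \<noteq> \<infinity>" for i using flo_measure(1)[of j i] by (auto simp: fmeasurable_def)
  qed auto
  then show ?thesis by (simp add: flo_measure)
qed

lemma measure_level_col:
  assumes A: "A \<in> levels j" and i: "i < ncols j"
  shows "measure lebesgue (A \<inter> col j i) = measure lebesgue A / ncols j" "A \<inter> col j i \<in> lmeasurable"
proof -
  obtain L where L: "L \<subseteq> {..<hgt j}" "A = {x \<in> tow j. pos j x \<in> L}" using A by (auto simp: levels_def)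
  have e: "A \<inter> col j i = (\<Union>l\<in>(\<lambda>l. colpos j i + l) ` L. flo (Suc j) l)"
  proof (intro set_eqI iffI)
    fix x assume x: "x \<in> A \<inter> col j i"
    then have t: "x \<in> tow j" "cix j x = i" "pos j x \<in> L" using in_col[OF i] L by auto
    then have "x \<in> flo (Suc j) (colpos j i + pos j x)"
      using pos_tow(2)[of x "Suc j"] tow_mono_Suc[of j] pos_Suc(1)[OF t(1)] by auto
    then show "x \<in> (\<Union>l\<in>(\<lambda>l. colpos j i + l) ` L. flo (Suc j) l)" using t by blast
  next
    fix x assume "x \<in> (\<Union>l\<in>(\<lambda>l. colpos j i + l) ` L. flo (Suc j) l)"
    then obtain l where l: "l \<in> L" "x \<in> flo (Suc j) (colpos j i + l)" by auto
    then have lh: "l < hgt j" using L by auto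
    have "x \<in> col j i" using col_eq[OF i] l lh by blast
    moreover have "x \<in> flo j l" using flo_Suc_subset[OF i lh] l by blast
    then have "x \<in> A" using flo_pos[OF _ lh] l L by auto
    ultimately show "x \<in> A \<inter> col j i" by blast
  qed
  have "measure lebesgue (A \<inter> col j i) = card ((\<lambda>l. colpos j i + l) ` L) * width (Suc j)"
    unfolding e by (rule measure_flo_UN) (use L colpos_bound[OF i] in auto)
  also have "\<dots> = card L * width j / ncols j" by (simp add: card_image width.simps)
  also have "card L * width j = measure lebesgue A" using measure_flo_UN[OF L(1)] level_UN[OF L(1)] L(2) by simp
  finally show "measure lebesgue (A \<inter> col j i) = measure lebesgue A / ncols j" .
  show "A \<inter> col j i \<in> lmeasurable" unfolding e
    by (rule fmeasurable.finite_UN) (use L finite_subset flo_measure(1) in auto)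
qed

lemma colpos_dvd: "2 * hgt j dvd colpos j i" by (simp add: colpos_def)

lemma level_return:
  assumes A: "A \<in> levels j" and B: "B \<in> levels j" and m: "2 * hgt j dvd m" "m \<le> hgt (Suc j)"
    and z: "z \<in> A" "(tmap ^^ m) z \<in> B"
  shows "colpos j (cix j ((tmap ^^ m) z)) = colpos j (cix j z) + m \<and> z \<in> B"
proof -
  have t: "z \<in> tow j" "(tmap ^^ m) z \<in> tow j" using A B z levels_subset by blast+
  have "colpos j (cix j ((tmap ^^ m) z)) + pos j ((tmap ^^ m) z) = colpos j (cix j z) + pos j z + m"
    using tmap_return_columns[OF t m(2)] by simp
  from colpos_near[OF this m(1)] show ?thesis
    using pos_tow(1)[OF t(1)] pos_tow(1)[OF t(2)] levels_pos[OF B z(2) t(1)] by simp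
qed

lemma level_shift_column:
  assumes A: "A \<in> levels j" and B: "B \<in> levels j" and xy: "x < y" "y < ncols j"
  shows "A \<inter> tpre (colpos j y - colpos j x) B = A \<inter> B \<inter> col j x"
proof -
  define m where "m = colpos j y - colpos j x"
  have cm: "colpos j y = colpos j x + m" using colpos_less[OF xy(1)] by (simp add: m_def less_imp_le)
  have mh: "m \<le> hgt (Suc j)" using colpos_end[OF xy(2)] cm by linarith
  have md: "2 * hgt j dvd m" unfolding m_def using colpos_dvd by (intro dvd_diff_nat)
  have xr: "x < ncols j" using xy by simp
  show ?thesis unfolding m_def[symmetric]
  proof (intro set_eqI iffI)
    fix z assume "z \<in> A \<inter> tpre m B"
    then have z: "z \<in> A" "(tmap ^^ m) z \<in> B" by (auto simp: tpre_def)
    have t: "z \<in> tow j" using A z levels_subset by blast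
    note r = level_return[OF A B md mh z]
    have "colpos j (cix j ((tmap ^^ m) z)) + 0 + (colpos j x + 0) = colpos j y + 0 + (colpos j (cix j z) + 0)"
      using r cm by simp
    moreover have "cix j z \<noteq> cix j ((tmap ^^ m) z)" using r cm colpos_less[OF xy(1), of j] by auto
    ultimately have "cix j z = x" using colpos_diff_unique[of j _ 0 x 0 y 0 "cix j z" 0] by simp
    then show "z \<in> A \<inter> B \<inter> col j x" using in_col[OF xr] t z r by simp
  next
    fix z assume "z \<in> A \<inter> B \<inter> col j x"
    then have z: "z \<in> A" "z \<in> B" "z \<in> tow j" "cix j z = x" using in_col[OF xr] by auto
    have p: "pos (Suc j) z = colpos j x + pos j z" "pos j z < hgt j" using pos_Suc(1)[OF z(3)] z(4) pos_tow(1)[OF z(3)] by auto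
    have zs: "z \<in> tow (Suc j)" using z tow_mono_Suc by blast
    have "pos (Suc j) z + m < hgt (Suc j)" using p cm colpos_bound[OF xy(2) p(2)] by simp
    from tmap_pow[OF zs this] have y: "(tmap ^^ m) z \<in> tow (Suc j)" "pos (Suc j) ((tmap ^^ m) z) = colpos j y + pos j z"
      using p cm by auto
    then have yt: "(tmap ^^ m) z \<in> tow j" using pos_Suc_iff[OF y(1)] xy(2) p(2) by blast
    have "pos j ((tmap ^^ m) z) = pos j z"
      using pos_Suc(1)[OF yt] y(2) colpos_inject[OF _ _ p(2)] pos_tow(1)[OF yt] by metis
    then have "(tmap ^^ m) z \<in> B" using levels_pos[OF B z(2) yt] by simp
    then show "z \<in> A \<inter> tpre m B" using z by (auto simp: tpre_def tow_eq)
  qed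
qed

lemma level_shift_empty:
  assumes A: "A \<in> levels j" and B: "B \<in> levels j" and m: "2 * hgt j dvd m" "m \<le> hgt (Suc j)"
    and no: "\<And>x y. x < ncols j \<Longrightarrow> y < ncols j \<Longrightarrow> colpos j y \<noteq> colpos j x + m"
  shows "A \<inter> tpre m B = {}"
proof -
  { fix z assume z: "z \<in> A" "(tmap ^^ m) z \<in> B"
    then have "z \<in> tow j" "(tmap ^^ m) z \<in> tow j" using A B levels_subset by blast+
    then have False using level_return[OF A B m z] no pos_Suc(2) by blast }
  then show ?thesis by (auto simp: tpre_def)
qed

lemma level_shift_bound:
  assumes A: "A \<in> levels j" and B: "B \<in> levels j" and m: "hgt j < m" "m \<le> hgt (Suc j)"
  shows "measure lebesgue (A \<inter> tpre m B) \<le> measure lebesgue A / ncols j"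
proof (cases "A \<inter> tpre m B = {}")
  case True then show ?thesis by simp
next
  case False
  then obtain x where x: "x \<in> A" "(tmap ^^ m) x \<in> B" by (auto simp: tpre_def)
  have t: "x \<in> tow j" "(tmap ^^ m) x \<in> tow j" using x A B levels_subset by blast+
  note i = pos_Suc(2)[OF t(1)]
  have "A \<inter> tpre m B \<subseteq> A \<inter> col j (cix j x)"
  proof
    fix y assume y: "y \<in> A \<inter> tpre m B"
    then have "y \<in> tow j" "(tmap ^^ m) y \<in> tow j" using A B levels_subset by (auto simp: tpre_def)
    then show "y \<in> A \<inter> col j (cix j x)" using sidon_source[OF _ _ t m, of y] y in_col[OF i] by auto
  qed
  then have "measure lebesgue (A \<inter> tpre m B) \<le> measure lebesgue (A \<inter> col j (cix j x))"
    using measure_level_col(2)[OF A i] levels_lmeasurable[OF A] levels_lmeasurable[OF B]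
    by (intro measure_mono_fmeasurable) (auto intro!: sets.Int shift_sets)
  then show ?thesis using measure_level_col(1)[OF A i] by simp
qed

lemma levels_dense:
  assumes A: "A \<in> lmeasurable" "A \<subseteq> {0..}" and e: "0 < e"
  shows "\<exists>j. \<exists>B\<in>levels j. measure lebesgue (A - B) < e \<and> measure lebesgue (B - A) < e"
proof -
  obtain U where U: "open U" "A \<subseteq> U" "U - A \<in> lmeasurable" "emeasure lebesgue (U - A) < ennreal e"
    using sets_lebesgue_outer_open[OF fmeasurableD[OF A(1)] e] .
  define B where "B j = {x \<in> tow j. pos j x \<in> {l. l < hgt j \<and> flo j l \<subseteq> U}}" for j
  have Bl: "B j \<in> levels j" for j unfolding B_def levels_def
    by (intro CollectI exI[of _ "{l. l < hgt j \<and> flo j l \<subseteq> U}"] conjI refl) auto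
  have Bin: "x \<in> B j \<longleftrightarrow> x \<in> tow j \<and> flo j (pos j x) \<subseteq> U" for x j unfolding B_def using pos_tow(1) by auto
  have BU: "B j \<subseteq> U" for j using Bin pos_tow(2) by blast
  have inc: "incseq B"
  proof (rule incseq_SucI, rule subsetI)
    fix j x assume "x \<in> B j"
    then have x: "x \<in> tow j" "flo j (pos j x) \<subseteq> U" using Bin by auto
    then have "flo (Suc j) (pos (Suc j) x) \<subseteq> U"
      using pos_Suc[OF x(1)] flo_Suc_subset[OF pos_Suc(2)[OF x(1)] pos_tow(1)[OF x(1)]] by simp
    then show "x \<in> B (Suc j)" using Bin x tow_mono_Suc by blast
  qed
  have cover: "A \<subseteq> (\<Union>j. B j)"
  proof
    fix x assume x: "x \<in> A"
    then obtain d where d: "d > 0" "ball x d \<subseteq> U" using U by (meson open_contains_ball subset_iff)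
    obtain j0 where j0: "\<forall>j\<ge>j0. x \<in> tow j" using in_tow_ge[of x] A x by auto
    have "\<forall>\<^sub>F j in sequentially. width j < d" using width_tendsto d(1) by (rule order_tendstoD)
    then obtain j where j: "x \<in> tow j" "width j < d" using j0 unfolding eventually_sequentially by (meson nle_le)
    have "flo j (pos j x) \<subseteq> ball x d"
      using pos_tow(2)[OF j(1)] j(2) by (auto simp: tower_floor_def dist_real_def)
    then have "flo j (pos j x) \<subseteq> U" using d(2) by (rule subset_trans)
    then have "x \<in> B j" using Bin j(1) by simp
    then show "x \<in> (\<Union>j. B j)" by (rule UN_I[OF UNIV_I])
  qed
  have Bs: "B j \<in> sets lebesgue" for j using levels_lmeasurable[OF Bl] by auto
  have "(\<lambda>j. measure lebesgue (A - B j)) \<longlonglongrightarrow> measure lebesgue (\<Inter>j. A - B j)"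
  proof (rule Lim_measure_decseq)
    show "range (\<lambda>j. A - B j) \<subseteq> sets lebesgue" using Bs fmeasurableD[OF A(1)] by auto
    show "decseq (\<lambda>j. A - B j)" unfolding decseq_def using incseqD[OF inc] by blast
    show "emeasure lebesgue (A - B i) \<noteq> \<infinity>" for i
      using fmeasurableD2[OF fmeasurable_Diff[OF A(1) Bs[of i]]] by simp
  qed
  moreover have "(\<Inter>j. A - B j) = {}" using cover by blast
  ultimately have "(\<lambda>j. measure lebesgue (A - B j)) \<longlonglongrightarrow> 0" by (simp only: measure_empty)
  then have "\<forall>\<^sub>F j in sequentially. measure lebesgue (A - B j) < e" using e by (rule order_tendstoD)
  then obtain j where j: "measure lebesgue (A - B j) < e" by (auto simp: eventually_sequentially)
  have "measure lebesgue (B j - A) \<le> measure lebesgue (U - A)"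
    by (rule measure_mono_fmeasurable) (use BU[of j] U(3) sets.Diff[OF Bs[of j] fmeasurableD[OF A(1)]] in auto)
  also have "\<dots> < e"
  proof -
    have "emeasure lebesgue (U - A) = ennreal (measure lebesgue (U - A))" by (rule emeasure_eq_measure2[OF U(3)])
    then show ?thesis using U(4) by (simp add: ennreal_less_iff)
  qed
  finally show ?thesis using j Bl by blast
qed

text \<open>Three consecutive columns distinguish the two directions of time.\<close>

lemma triple_forward:
  assumes "A \<in> levels j" "Suc (Suc i) < ncols j"
  shows "A \<inter> tpre (colpos j (Suc i) - colpos j i) A \<inter> tpre (colpos j (Suc (Suc i)) - colpos j i) A = A \<inter> col j i"
  using level_shift_column[OF assms(1,1), of i "Suc i"] level_shift_column[OF assms(1,1), of i "Suc (Suc i)"] assms(2)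
  by auto

lemma triple_backward:
  assumes "A \<in> levels j" "Suc (Suc i) < ncols j"
  shows "A \<inter> tpre (colpos j (Suc (Suc i)) - colpos j (Suc i)) A \<inter> tpre (colpos j (Suc (Suc i)) - colpos j i) A = {}"
proof -
  have "col j (Suc i) \<inter> col j i = {}" using in_col[of i j] in_col[of "Suc i" j] assms(2) by auto
  moreover have "A \<inter> tpre (colpos j (Suc (Suc i)) - colpos j (Suc i)) A \<subseteq> col j (Suc i)"
    using level_shift_column[OF assms(1,1), of "Suc i" "Suc (Suc i)"] assms(2) by simp
  moreover have "A \<inter> tpre (colpos j (Suc (Suc i)) - colpos j i) A \<subseteq> col j i"
    using level_shift_column[OF assms(1,1), of i "Suc (Suc i)"] assms(2) by simp
  ultimately show ?thesis by (smt (verit) Int_iff disjoint_iff subset_iff)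
qed

section \<open>The suspension\<close>

subsection \<open>Void events generate the configuration space\<close>

abbreviation void :: "real set \<Rightarrow> real set set" where "void A \<equiv> cev A 0"

lemma in_void: "x \<in> void A \<longleftrightarrow> x \<in> Cf \<and> x \<inter> A = {}"
  by (auto simp: cev_def)

lemma void_Int: "void A \<inter> void B = void (A \<union> B)" by (auto simp: in_void)

lemma FM_Un: "A \<in> FM \<Longrightarrow> B \<in> FM \<Longrightarrow> A \<union> B \<in> FM" by (auto simp: FM_def)
lemma FM_Diff: "A \<in> FM \<Longrightarrow> B \<in> FM \<Longrightarrow> A - B \<in> FM" by (auto simp: FM_def intro: fmeasurable_Diff)
lemma FM_Int: "A \<in> FM \<Longrightarrow> B \<in> FM \<Longrightarrow> A \<inter> B \<in> FM" by (auto simp: FM_def intro: fmeasurable_Int_fmeasurable)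
lemma FM_empty: "{} \<in> FM" by (auto simp: FM_def)

lemma finite_separated:
  fixes F :: "real set" assumes "finite F"
  shows "\<exists>d>0. \<forall>y\<in>F. \<forall>z\<in>F. y \<noteq> z \<longrightarrow> d \<le> \<bar>y - z\<bar>"
proof -
  let ?D = "insert 1 {\<bar>y - z\<bar> | y z. y \<in> F \<and> z \<in> F \<and> y \<noteq> z}"
  have "{\<bar>y - z\<bar> | y z. y \<in> F \<and> z \<in> F \<and> y \<noteq> z} \<subseteq> (\<lambda>(y,z). \<bar>y - z\<bar>) ` (F \<times> F)" by auto
  from finite_subset[OF this] have f: "finite ?D" using assms by simp
  have "0 < Min ?D" using f by (subst Min_gr_iff) auto
  moreover have "Min ?D \<le> \<bar>y - z\<bar>" if "y \<in> F" "z \<in> F" "y \<noteq> z" for y z using f that by (intro Min_le) auto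
  ultimately show ?thesis by blast
qed

definition grid :: "nat \<Rightarrow> nat \<Rightarrow> real set" where "grid p q = {real q / 2 ^ p..<(real q + 1) / 2 ^ p}"

lemma in_grid: "0 \<le> y \<Longrightarrow> y \<in> grid p q \<longleftrightarrow> nat \<lfloor>y * 2 ^ p\<rfloor> = q"
proof -
  assume "0 \<le> y"
  then have "0 \<le> y * 2 ^ p" by simp
  then have "nat \<lfloor>y * 2 ^ p\<rfloor> = q \<longleftrightarrow> \<lfloor>y * 2 ^ p\<rfloor> = int q" by linarith
  also have "\<dots> \<longleftrightarrow> y \<in> grid p q" unfolding floor_eq_iff grid_def by (simp add: field_simps)
  finally show ?thesis by simp
qed

lemma grid_count:
  assumes F: "finite F" "F \<subseteq> {0..<real m}"
  shows "\<exists>p0. \<forall>p\<ge>p0. card {q. q < m * 2 ^ p \<and> F \<inter> grid p q \<noteq> {}} = card F"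
proof -
  obtain d where d: "0 < d" "\<forall>y\<in>F. \<forall>z\<in>F. y \<noteq> z \<longrightarrow> d \<le> \<bar>y - z\<bar>" using finite_separated[OF F(1)] by blast
  obtain p0 where p0: "1 / d < 2 ^ p0" using real_arch_pow[of 2 "1 / d"] by auto
  have "card {q. q < m * 2 ^ p \<and> F \<inter> grid p q \<noteq> {}} = card F" if p: "p0 \<le> p" for p
  proof -
    define f where "f y = nat \<lfloor>y * 2 ^ p\<rfloor>" for y :: real
    have "(2::real) ^ p0 \<le> 2 ^ p" using p by (intro power_increasing) auto
    then have "d * 2 ^ p0 \<le> d * 2 ^ p" using d(1) by (intro mult_left_mono) auto
    moreover have "1 < d * 2 ^ p0" using p0 d(1) by (simp add: field_simps)
    ultimately have dp: "1 < d * 2 ^ p" by linarith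
    have inj: "inj_on f F"
    proof (rule inj_onI, rule ccontr)
      fix y z assume yz: "y \<in> F" "z \<in> F" "f y = f z" "y \<noteq> z"
      then have "d \<le> \<bar>y - z\<bar>" using d by blast
      then have "d * 2 ^ p \<le> \<bar>y - z\<bar> * 2 ^ p" by (intro mult_right_mono) auto
      also have "\<dots> = \<bar>y * 2 ^ p - z * 2 ^ p\<bar>" by (simp add: abs_mult flip: left_diff_distrib)
      finally have "1 < \<bar>y * 2 ^ p - z * 2 ^ p\<bar>" using dp by linarith
      moreover have "0 \<le> y * 2 ^ p" "0 \<le> z * 2 ^ p" using yz F by auto
      then have "\<lfloor>y * 2 ^ p\<rfloor> = \<lfloor>z * 2 ^ p\<rfloor>" using yz(3) by (simp add: f_def eq_nat_nat_iff)
      ultimately show False by linarith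
    qed
    have "{q. q < m * 2 ^ p \<and> F \<inter> grid p q \<noteq> {}} = f ` F"
    proof (intro set_eqI iffI)
      fix q assume "q \<in> {q. q < m * 2 ^ p \<and> F \<inter> grid p q \<noteq> {}}"
      then obtain y where y: "y \<in> F" "y \<in> grid p q" by auto
      then have "0 \<le> y" using F by auto
      then have "q = f y" using in_grid[of y p q] y(2) by (simp add: f_def)
      then show "q \<in> f ` F" using y(1) by blast
    next
      fix q assume "q \<in> f ` F"
      then obtain y where y: "y \<in> F" "q = f y" by auto
      then have y0: "0 \<le> y" "y < real m" using F by auto
      then have "y * 2 ^ p < real m * 2 ^ p" "0 \<le> y * 2 ^ p" by auto
      then have "real q < real m * 2 ^ p" unfolding y(2) f_def by linarith
      then have "real q < real (m * 2 ^ p)" by simp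
      then have "q < m * 2 ^ p" by (simp only: of_nat_less_iff)
      then show "q \<in> {q. q < m * 2 ^ p \<and> F \<inter> grid p q \<noteq> {}}" using in_grid[of y p q] y y0 by (auto simp: f_def)
    qed
    then show ?thesis using inj by (simp add: card_image)
  qed
  then show ?thesis by blast
qed

lemma void_sub: "{void A | A. A \<in> FM} \<subseteq> Pow Cf" by (auto simp: cev_def)

lemma sets_conf_void: "sets conf_sigma = sigma_sets Cf {void A | A. A \<in> FM}"
proof
  define V where "V = sigma Cf {void A | A. A \<in> FM}"
  have spV: "space V = Cf" unfolding V_def using void_sub by (rule space_measure_of)
  have seV: "sets V = sigma_sets Cf {void A | A. A \<in> FM}" unfolding V_def using void_sub by (rule sets_measure_of)
  have seC: "sets conf_sigma = sigma_sets Cf {cev A k | A k. A \<in> FM}" unfolding conf_sigma_def using cev_sub by (rule sets_measure_of)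
  show "sigma_sets Cf {void A | A. A \<in> FM} \<subseteq> sets conf_sigma"
    unfolding seC by (rule sigma_sets_mono') blast
  have vs: "void A \<in> sets V" if "A \<in> FM" for A unfolding seV using that by blast
  have bd: "{x \<in> space V. card (x \<inter> A \<inter> {0..<real m}) = k} \<in> sets V" if A: "A \<in> FM" for A m k
  proof -
    define cp where "cp p x = card {q. q < m * 2 ^ p \<and> (x \<inter> A \<inter> {0..<real m}) \<inter> grid p q \<noteq> {}}" for p and x :: "real set"
    have e: "card (x \<inter> A \<inter> {0..<real m}) = k \<longleftrightarrow> (\<exists>p0. \<forall>p\<ge>p0. cp p x = k)" if x: "x \<in> Cf" for x
    proof -
      have "finite (x \<inter> {0..<real m})" using x by (simp add: Cf_def)
      then have "finite (x \<inter> A \<inter> {0..<real m})" by (rule rev_finite_subset) auto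
      from grid_count[OF this, of m] obtain p0 where "\<forall>p\<ge>p0. cp p x = card (x \<inter> A \<inter> {0..<real m})"
        unfolding cp_def by blast
      then show ?thesis by (metis nle_le)
    qed
    have m: "cp p \<in> V \<rightarrow>\<^sub>M count_space UNIV" for p
    proof -
      have a: "cp p = (\<lambda>x. \<Sum>q<m * 2 ^ p. if (x \<inter> A \<inter> {0..<real m}) \<inter> grid p q \<noteq> {} then 1 else 0)"
        unfolding cp_def by (rule ext, subst sum.inter_filter[symmetric]) (auto intro: arg_cong[of _ _ card])
      have "Measurable.pred V (\<lambda>x. (x \<inter> A \<inter> {0..<real m}) \<inter> grid p q \<noteq> {})" for q
      proof -
        have B: "A \<inter> {0..<real m} \<inter> grid p q \<in> FM"
          using FM_trunc[OF A, of m] by (auto simp: FM_def grid_def intro!: fmeasurable_Int_fmeasurable)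
        have "{x \<in> space V. (x \<inter> A \<inter> {0..<real m}) \<inter> grid p q \<noteq> {}} = space V - void (A \<inter> {0..<real m} \<inter> grid p q)"
          by (auto simp: in_void spV disjoint_iff)
        then show ?thesis unfolding pred_def using vs[OF B] by auto
      qed
      then have "(\<lambda>x. (\<Sum>q<m * 2 ^ p. if (x \<inter> A \<inter> {0..<real m}) \<inter> grid p q \<noteq> {} then 1 else 0 :: nat)) \<in> V \<rightarrow>\<^sub>M count_space UNIV"
        by measurable
      then show ?thesis unfolding a .
    qed
    have "{x \<in> space V. card (x \<inter> A \<inter> {0..<real m}) = k} = {x \<in> space V. \<exists>p0. \<forall>p\<ge>p0. cp p x = k}"
      using e spV by auto
    also have "\<dots> \<in> sets V"
    proof -
      have [measurable]: "Measurable.pred V (\<lambda>x. cp p x = k)" for p using m[of p] by measurable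
      show ?thesis by measurable
    qed
    finally show ?thesis .
  qed
  have "cev A k \<in> sets V" if A: "A \<in> FM" for A k
  proof -
    have "cev A k = {x \<in> space V. \<exists>m0. \<forall>m\<ge>m0. card (x \<inter> A \<inter> {0..<real m}) = k}"
      using cev_trunc[of _ A k] A by (auto simp: spV FM_def cev_def)
    also have "\<dots> \<in> sets V"
    proof -
      have [measurable]: "Measurable.pred V (\<lambda>x. card (x \<inter> A \<inter> {0..<real m}) = k)" for m
        unfolding pred_def using bd[OF A] .
      show ?thesis by measurable
    qed
    finally show ?thesis .
  qed
  then show "sets conf_sigma \<subseteq> sigma_sets Cf {void A | A. A \<in> FM}"
    unfolding seC seV[symmetric] using sets.sigma_sets_subset[of "{cev A k | A k. A \<in> FM}" V] spV by auto
qed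

lemma prob_void: assumes "A \<in> FM" shows "measure PN (void A) = exp (- measure lebesgue A)"
  using joint_law[of 1 "\<lambda>_. A" "\<lambda>_. 0"] assms by (simp add: pois_def disjoint_family_on_def lessThan_Suc)

lemma PN_unique:
  assumes M: "prob_space M" "sets M = sets conf_sigma"
    and v: "\<And>A. A \<in> FM \<Longrightarrow> measure M (void A) = exp (- measure lebesgue A)"
  shows "M = PN"
proof (rule measure_eqI_generator_eq[where A = "\<lambda>_. Cf" and E = "{void A | A. A \<in> FM}" and \<Omega> = Cf])
  interpret M: prob_space M by fact
  show "Int_stable {void A | A. A \<in> FM}" unfolding Int_stable_def using void_Int FM_Un by blast
  show "{void A | A. A \<in> FM} \<subseteq> Pow Cf" by (rule void_sub)
  show "emeasure M X = emeasure PN X" if "X \<in> {void A | A. A \<in> FM}" for X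
    using that v prob_void by (auto simp: M.emeasure_eq_measure PN.emeasure_eq_measure)
  have "Cf = void {}" by (auto simp: in_void)
  then show "range (\<lambda>_::nat. Cf) \<subseteq> {void A | A. A \<in> FM}" using FM_empty by auto
  show "emeasure M Cf \<noteq> \<infinity>" by (simp add: M.emeasure_eq_measure)
qed (use M sets_conf_void sets_PN in auto)

subsection \<open>Suspensions\<close>

abbreviation M\<^sub>0 :: "real set measure" where "M\<^sub>0 \<equiv> completion PN"

lemma prob_space_M0: "prob_space M\<^sub>0"
proof (rule prob_spaceI)
  have "Cf \<in> sets PN" using sets.top[of PN] by simp
  then have "emeasure M\<^sub>0 (space PN) = emeasure PN (space PN)" by simp
  then show "emeasure M\<^sub>0 (space M\<^sub>0) = 1" using PN.emeasure_space_1 by (simp only: space_completion)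
qed

interpretation M0: prob_space M\<^sub>0 by (rule prob_space_M0)

lemma measure_preserving_completion:
  assumes f': "f' \<in> N \<rightarrow>\<^sub>M N" "distr N N f' = N" and ae: "AE x in N. f x = f' x"
    and sp: "\<And>x. x \<in> space N \<Longrightarrow> f x \<in> space N"
  shows "measure_preserving (completion N) f"
proof -
  have key: "f -` A \<inter> space N \<in> sets (completion N) \<and> emeasure (completion N) (f -` A \<inter> space N) = emeasure (completion N) A"
    if A: "A \<in> sets (completion N)" for A
  proof -
    let ?B = "main_part N A"
    have B: "?B \<in> sets N" using A by (rule main_part_sets)
    have "AE x in N. x \<in> A \<longleftrightarrow> x \<in> ?B"
    proof -
      obtain N' where N': "N' \<in> null_sets N" "null_part N A \<subseteq> N'" using null_part[OF A] by blast
      have "{x \<in> space N. \<not> (x \<in> A \<longleftrightarrow> x \<in> ?B)} \<subseteq> N'" using main_part_null_part_Un[OF A] N' by blast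
      then show ?thesis using N'(1) by (rule AE_I'[rotated])
    qed
    then have "AE x in distr N N f'. x \<in> A \<longleftrightarrow> x \<in> ?B" by (simp only: f'(2))
    then have "AE x in N. f' x \<in> A \<longleftrightarrow> f' x \<in> ?B" by (rule AE_distrD[OF f'(1)])
    then have "AE x in N. x \<in> f' -` ?B \<inter> space N \<longleftrightarrow> x \<in> f -` A \<inter> space N" using ae AE_space by eventually_elim auto
    then have e: "AE x in completion N. x \<in> f' -` ?B \<inter> space N \<longleftrightarrow> x \<in> f -` A \<inter> space N" by (rule AE_completion)
    have s': "f' -` ?B \<inter> space N \<in> sets N" using measurable_sets[OF f'(1) B] .
    then have s: "f -` A \<inter> space N \<in> sets (completion N)"
      using completion.in_sets_AE[OF e] by simp
    have "emeasure (completion N) (f -` A \<inter> space N) = emeasure (completion N) (f' -` ?B \<inter> space N)"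
      by (rule emeasure_eq_AE) (use e s s' in auto)
    also have "\<dots> = emeasure N (f' -` ?B \<inter> space N)" using s' by simp
    also have "\<dots> = emeasure N ?B" using emeasure_distr[OF f'(1) B] f'(2) by simp
    also have "\<dots> = emeasure (completion N) A" using A by (simp add: emeasure_completion)
    finally show ?thesis using s by blast
  qed
  have m: "f \<in> completion N \<rightarrow>\<^sub>M completion N"
    by (rule measurableI) (use sp key in auto)
  moreover have "distr (completion N) (completion N) f = completion N"
  proof (rule measure_eqI)
    fix A assume "A \<in> sets (distr (completion N) (completion N) f)"
    then have A: "A \<in> sets (completion N)" by simp
    then show "emeasure (distr (completion N) (completion N) f) A = emeasure (completion N) A"
      unfolding emeasure_distr[OF m A] space_completion using key[OF A] by blast
  qed simp
  ultimately show ?thesis by (simp add: measure_preserving_def)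
qed

definition susp :: "(real \<Rightarrow> real) \<Rightarrow> real set \<Rightarrow> real set" where
  "susp R x = (if R ` x \<in> Cf then R ` x else x)"

definition pre :: "(real \<Rightarrow> real) \<Rightarrow> real set \<Rightarrow> real set \<Rightarrow> real set" where
  "pre R Z A = {x. 0 \<le> x \<and> x \<notin> Z \<and> R x \<in> A}"

lemma susp_preserving:
  assumes Z: "Z \<in> null_sets lebesgue" "Z \<subseteq> {0..}"
    and R: "\<And>x. 0 \<le> x \<Longrightarrow> x \<notin> Z \<Longrightarrow> 0 \<le> R x" "inj_on R ({0..} - Z)"
    and pre: "\<And>A. A \<in> FM \<Longrightarrow> pre R Z A \<in> FM \<and> measure lebesgue (pre R Z A) = measure lebesgue A"
  shows "AE x in PN. x \<inter> Z = {} \<and> R ` x \<in> Cf" (is ?AE)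
    and "measure_preserving M\<^sub>0 (susp R)"
proof -
  define G where "G = void Z \<inter> (\<Inter>m. \<Union>k. cev (pre R Z {0..<real m}) k)"
  have ZF: "Z \<in> FM" using Z by (auto simp: FM_def fmeasurable_def null_sets_def)
  have mF: "{0..<real m} \<in> FM" for m by (auto simp: FM_def intro: bounded_set_imp_lmeasurable)
  have Gs: "G \<in> sets PN" unfolding G_def sets_PN using ZF pre[OF mF] by (intro sets.Int sets.countable_INT sets.countable_UN) auto
  have "AE x in PN. x \<in> void Z"
  proof (subst PN.AE_in_set_eq_1)
    show "PN.prob (void Z) = 1" using prob_void[OF ZF] Z by (simp add: null_sets_def measure_def)
  qed (use ZF sets_PN in auto)
  moreover have "AE x in PN. \<forall>m. finite (x \<inter> pre R Z {0..<real m})"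
    by (subst AE_all_countable) (use AE_finite pre[OF mF] in auto)
  ultimately have AG: "AE x in PN. x \<in> G" using AE_space
    by eventually_elim (auto simp: G_def cev_def)
  have G: "R ` x \<in> Cf" "x \<inter> Z = {}" "x \<in> Cf" if "x \<in> G" for x
  proof -
    show z: "x \<inter> Z = {}" "x \<in> Cf" using that by (auto simp: G_def in_void)
    have x0: "x \<subseteq> {0..} - Z" using z by (auto simp: Cf_def)
    show "R ` x \<in> Cf" unfolding Cf_def
    proof (intro CollectI conjI allI)
      show "R ` x \<subseteq> {0..}" using x0 R(1) by auto
      have "inj_on R x" using R(2) x0 by (rule inj_on_subset)
      then show "infinite (R ` x)" using z(2) by (simp add: finite_image_iff Cf_def)
      fix m :: nat
      have "finite (x \<inter> pre R Z {0..<real m})" using that by (auto simp: G_def cev_def)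
      moreover have "R ` x \<inter> {0..<real m} \<subseteq> R ` (x \<inter> pre R Z {0..<real m})" using x0 by (auto simp: pre_def)
      ultimately show "finite (R ` x \<inter> {0..<real m})" using finite_subset by blast
    qed
  qed
  show ?AE using AG by eventually_elim (use G in auto)
  define f where "f x = (if x \<in> G then R ` x else x)" for x
  have void_pre: "R ` x \<in> void A \<longleftrightarrow> x \<in> void (pre R Z A)" if "x \<in> G" for x A
    using G[OF that] by (auto simp: in_void pre_def Cf_def)
  have fm: "f \<in> PN \<rightarrow>\<^sub>M conf_sigma"
  proof -
    have "f \<in> PN \<rightarrow>\<^sub>M sigma Cf {void A | A. A \<in> FM}"
    proof (rule measurable_measure_of[OF void_sub])
      show "f \<in> space PN \<rightarrow> Cf" using G by (auto simp: f_def)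
      fix y assume "y \<in> {void A | A. A \<in> FM}"
      then obtain A where A: "A \<in> FM" "y = void A" by blast
      have "f -` y \<inter> space PN = (G \<inter> void (pre R Z A)) \<union> (void A - G)"
      proof (intro set_eqI)
        fix x
        show "x \<in> f -` y \<inter> space PN \<longleftrightarrow> x \<in> (G \<inter> void (pre R Z A)) \<union> (void A - G)"
          using void_pre[of x A] G(3)[of x] by (cases "x \<in> G") (auto simp: f_def A(2) cev_def)
      qed
      then show "f -` y \<inter> space PN \<in> sets PN"
        using Gs A pre[OF A(1)] sets_PN by (metis cev_sets sets.Int sets.Un sets.Diff)
    qed
    moreover have "sets (sigma Cf {void A | A. A \<in> FM}) = sets conf_sigma"
      unfolding sets_conf_void using void_sub by (rule sets_measure_of)
    ultimately show ?thesis using measurable_cong_sets by blast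
  qed
  then have fm': "f \<in> PN \<rightarrow>\<^sub>M PN" using measurable_cong_sets[OF refl sets_PN] by blast
  have "distr PN PN f = PN"
  proof (rule PN_unique)
    show "prob_space (distr PN PN f)" by (rule PN.prob_space_distr[OF fm'])
    show "sets (distr PN PN f) = sets conf_sigma" using sets_PN by simp
    fix A assume A: "A \<in> FM"
    have "measure (distr PN PN f) (void A) = measure PN (f -` void A \<inter> space PN)"
      by (rule measure_distr[OF fm']) (use A sets_PN in auto)
    also have "\<dots> = measure PN (void (pre R Z A))"
    proof (rule measure_eq_AE)
      show "AE x in PN. (x \<in> f -` void A \<inter> space PN) = (x \<in> void (pre R Z A))"
        using AG by eventually_elim (use void_pre G in \<open>auto simp: f_def\<close>)
    qed (use A pre[OF A] sets_PN measurable_sets[OF fm'] in auto)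
    finally show "measure (distr PN PN f) (void A) = exp (- measure lebesgue A)" using prob_void pre[OF A] by simp
  qed
  then show "measure_preserving M\<^sub>0 (susp R)"
  proof (rule measure_preserving_completion[OF fm'])
    show "AE x in PN. susp R x = f x" using AG by eventually_elim (use G in \<open>auto simp: susp_def f_def\<close>)
    show "susp R x \<in> space PN" if "x \<in> space PN" for x using that by (auto simp: susp_def)
  qed
qed

subsection \<open>Square-integrable functions\<close>

definition sqi :: "'a measure \<Rightarrow> ('a \<Rightarrow> real) \<Rightarrow> bool" where
  "sqi M f \<longleftrightarrow> f \<in> borel_measurable M \<and> integrable M (\<lambda>x. (f x)\<^sup>2)"

definition nrm :: "'a measure \<Rightarrow> ('a \<Rightarrow> real) \<Rightarrow> real" where
  "nrm M f = sqrt (\<integral>x. (f x)\<^sup>2 \<partial>M)"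

lemma sqi_meas: "sqi M f \<Longrightarrow> f \<in> borel_measurable M" by (simp add: sqi_def)

lemma sqi_mult: assumes "sqi M f" "sqi M g" shows "integrable M (\<lambda>x. f x * g x)"
proof (rule Bochner_Integration.integrable_bound)
  show "integrable M (\<lambda>x. (f x)\<^sup>2 + (g x)\<^sup>2)" using assms by (simp add: sqi_def)
  show "AE x in M. norm (f x * g x) \<le> norm ((f x)\<^sup>2 + (g x)\<^sup>2)"
  proof (rule AE_I2)
    fix x
    have "0 \<le> (\<bar>f x\<bar> - \<bar>g x\<bar>)\<^sup>2" by simp
    then have "2 * (\<bar>f x\<bar> * \<bar>g x\<bar>) \<le> (f x)\<^sup>2 + (g x)\<^sup>2" by (simp add: power2_diff)
    moreover have "0 \<le> \<bar>f x\<bar> * \<bar>g x\<bar>" by simp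
    ultimately have "\<bar>f x\<bar> * \<bar>g x\<bar> \<le> (f x)\<^sup>2 + (g x)\<^sup>2" by linarith
    then show "norm (f x * g x) \<le> norm ((f x)\<^sup>2 + (g x)\<^sup>2)" by (simp add: abs_mult)
  qed
qed (use assms in \<open>auto simp: sqi_def\<close>)

lemma sqi_add: assumes "sqi M f" "sqi M g" shows "sqi M (\<lambda>x. f x + g x)"
proof -
  have "integrable M (\<lambda>x. (f x)\<^sup>2 + (g x)\<^sup>2 + 2 * (f x * g x))" using assms sqi_mult[OF assms] by (simp add: sqi_def)
  then show ?thesis using assms by (auto simp: sqi_def power2_sum mult_ac)
qed

lemma sqi_scale: "sqi M f \<Longrightarrow> sqi M (\<lambda>x. c * f x)" by (auto simp: sqi_def power_mult_distrib)

lemma sqi_uminus: "sqi M f \<Longrightarrow> sqi M (\<lambda>x. - f x)" using sqi_scale[of M f "-1"] by simp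

lemma sqi_diff: "sqi M f \<Longrightarrow> sqi M g \<Longrightarrow> sqi M (\<lambda>x. f x - g x)"
  using sqi_add[OF _ sqi_uminus, of M f g] by simp

lemma sqi_zero: "sqi M (\<lambda>x. 0)" by (simp add: sqi_def)

lemma sqi_sum: "(\<And>i. i \<in> I \<Longrightarrow> sqi M (f i)) \<Longrightarrow> sqi M (\<lambda>x. \<Sum>i\<in>I. f i x)"
  by (induct I rule: infinite_finite_induct) (auto intro: sqi_add sqi_zero)

lemma (in prob_space) sqi_bounded: "f \<in> borel_measurable M \<Longrightarrow> (\<And>x. \<bar>f x\<bar> \<le> B) \<Longrightarrow> sqi M f"
proof -
  assume f: "f \<in> borel_measurable M" "\<And>x. \<bar>f x\<bar> \<le> B"
  have "integrable M (\<lambda>x. (f x)\<^sup>2)"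
  proof (rule integrable_const_bound[of _ "B\<^sup>2"])
    show "AE x in M. norm ((f x)\<^sup>2) \<le> B\<^sup>2"
      using f(2) by (auto intro!: AE_I2 simp: abs_le_square_iff[symmetric] abs_of_nonneg[OF order_trans[OF abs_ge_zero f(2)]])
  qed (use f in measurable)
  then show ?thesis using f by (simp add: sqi_def)
qed

lemma (in prob_space) sqi_const: "sqi M (\<lambda>x. c)" by (simp add: sqi_def)

lemma (in prob_space) sqi_integrable: "sqi M f \<Longrightarrow> integrable M f"
  using sqi_mult[OF _ sqi_const, of f 1] by simp

lemma nrm_nonneg [simp]: "0 \<le> nrm M f" by (simp add: nrm_def)

lemma nrm_sq: "(nrm M f)\<^sup>2 = (\<integral>x. (f x)\<^sup>2 \<partial>M)" by (simp add: nrm_def)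

lemma nrm_sq': "(nrm M f)\<^sup>2 = (\<integral>x. f x * f x \<partial>M)" unfolding nrm_sq by (simp only: power2_eq_square)

lemma nrm_quadratic:
  assumes "sqi M f" "sqi M g"
  shows "(nrm M (\<lambda>x. f x + t * g x))\<^sup>2 = (nrm M f)\<^sup>2 + 2 * t * (\<integral>x. f x * g x \<partial>M) + t\<^sup>2 * (nrm M g)\<^sup>2"
proof -
  have i: "integrable M (\<lambda>x. (f x)\<^sup>2)" "integrable M (\<lambda>x. (g x)\<^sup>2)" using assms by (auto simp: sqi_def)
  have "(nrm M (\<lambda>x. f x + t * g x))\<^sup>2 = (\<integral>x. (f x)\<^sup>2 + (2 * t) * (f x * g x) + t\<^sup>2 * (g x)\<^sup>2 \<partial>M)"
    unfolding nrm_sq by (rule Bochner_Integration.integral_cong) (auto simp: power2_eq_square algebra_simps)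
  also have "\<dots> = (\<integral>x. (f x)\<^sup>2 \<partial>M) + (2 * t) * (\<integral>x. f x * g x \<partial>M) + t\<^sup>2 * (\<integral>x. (g x)\<^sup>2 \<partial>M)"
    using i sqi_mult[OF assms] by simp
  finally show ?thesis by (simp add: nrm_sq)
qed

lemma nrm_CS: assumes "sqi M f" "sqi M g" shows "\<bar>\<integral>x. f x * g x \<partial>M\<bar> \<le> nrm M f * nrm M g"
proof -
  define a b c where "a = (nrm M g)\<^sup>2" and "b = (\<integral>x. f x * g x \<partial>M)" and "c = (nrm M f)\<^sup>2"
  have q: "0 \<le> c + 2 * t * b + t\<^sup>2 * a" for t
    unfolding a_def b_def c_def nrm_quadratic[OF assms, symmetric] by simp
  have "b\<^sup>2 \<le> c * a"
  proof (cases "a = 0")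
    case True
    have "b = 0"
    proof (rule ccontr)
      assume "b \<noteq> 0"
      then have "c + 2 * (- (c + 1) / (2 * b)) * b + (- (c + 1) / (2 * b))\<^sup>2 * a = -1" using True by (simp add: field_simps)
      then show False using q[of "- (c + 1) / (2 * b)"] by simp
    qed
    then show ?thesis using True by simp
  next
    case False
    then have a: "0 < a" by (simp add: a_def)
    have "0 \<le> c + 2 * (- b / a) * b + (- b / a)\<^sup>2 * a" by (rule q)
    also have "\<dots> = c - b\<^sup>2 / a" using a by (simp add: power2_eq_square field_simps)
    finally show ?thesis using a by (simp add: field_simps)
  qed
  then have "b\<^sup>2 \<le> (nrm M f * nrm M g)\<^sup>2" by (simp add: a_def c_def power_mult_distrib)
  then have "\<bar>b\<bar> \<le> \<bar>nrm M f * nrm M g\<bar>" unfolding abs_le_square_iff .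
  then show ?thesis by (simp add: b_def abs_mult)
qed

lemma nrm_triangle: assumes "sqi M f" "sqi M g" shows "nrm M (\<lambda>x. f x + g x) \<le> nrm M f + nrm M g"
proof (rule power2_le_imp_le)
  have "(nrm M (\<lambda>x. f x + g x))\<^sup>2 = (nrm M f)\<^sup>2 + 2 * (\<integral>x. f x * g x \<partial>M) + (nrm M g)\<^sup>2"
    using nrm_quadratic[OF assms, of 1] by simp
  also have "\<dots> \<le> (nrm M f + nrm M g)\<^sup>2" using nrm_CS[OF assms] by (simp add: power2_sum)
  finally show "(nrm M (\<lambda>x. f x + g x))\<^sup>2 \<le> (nrm M f + nrm M g)\<^sup>2" .
qed simp

lemma nrm_scale: "nrm M (\<lambda>x. c * f x) = \<bar>c\<bar> * nrm M f"
  by (simp add: nrm_def power_mult_distrib real_sqrt_mult)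

lemma nrm_minus_commute: "nrm M (\<lambda>x. f x - g x) = nrm M (\<lambda>x. g x - f x)"
  unfolding nrm_def by (simp add: power2_commute)

lemma nrm_diff_triangle: assumes "sqi M f" "sqi M g" "sqi M h"
  shows "nrm M (\<lambda>x. f x - h x) \<le> nrm M (\<lambda>x. f x - g x) + nrm M (\<lambda>x. g x - h x)"
  using nrm_triangle[OF sqi_diff[OF assms(1,2)] sqi_diff[OF assms(2,3)]] by simp

lemma nrm_cong_AE: assumes "AE x in M. f x = g x" "f \<in> borel_measurable M" "g \<in> borel_measurable M"
  shows "nrm M f = nrm M g"
proof -
  have "(\<integral>x. (f x)\<^sup>2 \<partial>M) = (\<integral>x. (g x)\<^sup>2 \<partial>M)"
    by (rule integral_cong_AE) (use assms in auto)
  then show ?thesis by (simp add: nrm_def)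
qed

lemma nrm_zero_AE: assumes "sqi M f" "nrm M f = 0" shows "AE x in M. f x = 0"
proof -
  have "(\<integral>x. (f x)\<^sup>2 \<partial>M) = 0" using assms(2) by (simp add: nrm_def)
  then have "AE x in M. (f x)\<^sup>2 = 0" using assms(1) by (subst (asm) integral_nonneg_eq_0_iff_AE) (auto simp: sqi_def)
  then show ?thesis by simp
qed

lemma (in prob_space) integral_le_nrm: "sqi M f \<Longrightarrow> \<bar>\<integral>x. f x \<partial>M\<bar> \<le> nrm M f"
  using nrm_CS[OF _ sqi_const, of f 1] by (simp add: nrm_def prob_space)

lemma (in prob_space) nrm_centre: assumes "sqi M f" shows "nrm M (\<lambda>x. f x - (\<integral>x. f x \<partial>M)) \<le> nrm M f"
proof (rule power2_le_imp_le)
  let ?e = "\<integral>x. f x \<partial>M"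
  have "(nrm M (\<lambda>x. f x + (- ?e) * 1))\<^sup>2 = (nrm M f)\<^sup>2 + 2 * (- ?e) * ?e + (- ?e)\<^sup>2 * (nrm M (\<lambda>x. 1))\<^sup>2"
    using nrm_quadratic[OF assms sqi_const[of 1], of "- ?e"] by simp
  also have "(nrm M (\<lambda>x. 1))\<^sup>2 = 1" by (simp add: nrm_sq prob_space)
  finally have "(nrm M (\<lambda>x. f x - ?e))\<^sup>2 = (nrm M f)\<^sup>2 - ?e\<^sup>2" by (simp add: power2_eq_square)
  then show "(nrm M (\<lambda>x. f x - ?e))\<^sup>2 \<le> (nrm M f)\<^sup>2" by simp
qed simp

lemma mp_integral:
  assumes "measure_preserving M T" "(f :: 'a \<Rightarrow> real) \<in> borel_measurable M" shows "(\<integral>x. f (T x) \<partial>M) = (\<integral>x. f x \<partial>M)"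
  using integral_distr[of T M M f] assms by (simp add: measure_preserving_def)

lemma mp_integrable:
  assumes "measure_preserving M T" "(f :: 'a \<Rightarrow> real) \<in> borel_measurable M" shows "integrable M (\<lambda>x. f (T x)) \<longleftrightarrow> integrable M f"
  using integrable_distr_eq[of T M M f] assms by (simp add: measure_preserving_def)

lemma mp_meas: "measure_preserving M T \<Longrightarrow> f \<in> borel_measurable M \<Longrightarrow> (\<lambda>x. f (T x)) \<in> borel_measurable M"
  by (auto simp: measure_preserving_def intro: measurable_compose)

lemma mp_sqi: "measure_preserving M T \<Longrightarrow> sqi M f \<Longrightarrow> sqi M (\<lambda>x. f (T x))"
  using mp_integrable[of M T "\<lambda>x. (f x)\<^sup>2"] mp_meas[of M T f] by (auto simp: sqi_def)

lemma mp_nrm: "measure_preserving M T \<Longrightarrow> sqi M f \<Longrightarrow> nrm M (\<lambda>x. f (T x)) = nrm M f"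
  using mp_integral[of M T "\<lambda>x. (f x)\<^sup>2"] by (auto simp: sqi_def nrm_def)

lemma mp_AE: "measure_preserving M T \<Longrightarrow> AE x in M. Q x \<Longrightarrow> AE x in M. Q (T x)"
  using AE_distrD[of T M M Q] unfolding measure_preserving_def by metis

subsection \<open>Second moments of the counts\<close>

lemma pois_sums: assumes "0 \<le> t" shows "(\<lambda>k. 1 * pois t k) sums 1" "(\<lambda>k. real k * pois t k) sums t"
  "(\<lambda>k. (real k)\<^sup>2 * pois t k) sums (t + t\<^sup>2)"
proof -
  have "(\<lambda>k. exp (-t) * (t ^ k /\<^sub>R fact k)) sums (exp (-t) * exp t)" by (intro sums_mult exp_converges)
  then show 0: "(\<lambda>k. 1 * pois t k) sums 1" by (simp add: pois_def divide_inverse mult_ac exp_minus)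
  have s: "real (Suc k) * pois t (Suc k) = t * pois t k" for k by (simp add: pois_def field_simps del: of_nat_Suc)
  have "(\<lambda>k. real (Suc k) * pois t (Suc k)) sums (t * 1)" unfolding s using sums_mult[OF 0, of t] by simp
  then show 1: "(\<lambda>k. real k * pois t k) sums t" using sums_Suc[of "\<lambda>k. real k * pois t k"] by simp
  have "(real (Suc k))\<^sup>2 * pois t (Suc k) = t * (real k * pois t k) + t * pois t k" for k
    using s[of k] by (simp add: power2_eq_square mult.assoc) (simp add: algebra_simps)
  moreover have "(\<lambda>k. t * (real k * pois t k) + t * pois t k) sums (t * t + t * 1)"
    using sums_add[OF sums_mult[OF 1] sums_mult[OF 0]] by simp
  ultimately have "(\<lambda>k. (real (Suc k))\<^sup>2 * pois t (Suc k)) sums (t * t + t)" by simp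
  then show "(\<lambda>k. (real k)\<^sup>2 * pois t k) sums (t + t\<^sup>2)"
    using sums_Suc[of "\<lambda>k. (real k)\<^sup>2 * pois t k"] by (simp add: power2_eq_square add.commute)
qed

lemma law_moment:
  fixes Y :: "'a \<Rightarrow> nat"
  assumes "prob_space M" and W: "W \<in> sets M" and Y: "Y \<in> M \<rightarrow>\<^sub>M count_space UNIV"
    and P: "\<And>k. measure M (W \<inter> (Y -` {k} \<inter> space M)) = c * pois t k" and c: "0 \<le> c" "0 \<le> t"
    and g: "\<And>k. 0 \<le> g k" "(\<lambda>k. g k * pois t k) sums s"
  shows "has_bochner_integral M (\<lambda>x. indicator W x * g (Y x)) (c * s)"
proof -
  interpret prob_space M by fact
  have p0: "0 \<le> pois t k" for k using c by (simp add: pois_def)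
  have Sk: "W \<inter> (Y -` {k} \<inter> space M) \<in> sets M" for k using W measurable_sets[OF Y, of "{k}"] by auto
  have gm: "(\<lambda>x. g (Y x)) \<in> borel_measurable M" by (rule measurable_compose[OF Y]) simp
  have s0: "0 \<le> s" using sums_le[OF _ sums_zero g(2)] g(1) p0 by simp
  have "(\<integral>\<^sup>+x. ennreal (indicator W x * g (Y x)) \<partial>M)
     = (\<integral>\<^sup>+x. (\<Sum>k. ennreal (g k) * indicator (W \<inter> (Y -` {k} \<inter> space M)) x) \<partial>M)"
  proof (rule nn_integral_cong)
    fix x assume x: "x \<in> space M"
    have "(\<Sum>k. ennreal (g k) * indicator (W \<inter> (Y -` {k} \<inter> space M)) x) = (\<Sum>k\<in>{Y x}. ennreal (g k) * indicator (W \<inter> (Y -` {k} \<inter> space M)) x)"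
      by (rule suminf_finite) auto
    then show "ennreal (indicator W x * g (Y x)) = (\<Sum>k. ennreal (g k) * indicator (W \<inter> (Y -` {k} \<inter> space M)) x)"
      using x by (auto simp: indicator_def)
  qed
  also have "\<dots> = (\<Sum>k. \<integral>\<^sup>+x. ennreal (g k) * indicator (W \<inter> (Y -` {k} \<inter> space M)) x \<partial>M)"
    by (rule nn_integral_suminf) (use Sk in auto)
  also have "\<dots> = (\<Sum>k. ennreal (c * (g k * pois t k)))"
  proof (rule suminf_cong)
    fix k
    have "(\<integral>\<^sup>+x. ennreal (g k) * indicator (W \<inter> (Y -` {k} \<inter> space M)) x \<partial>M) = ennreal (g k) * ennreal (c * pois t k)"
      using Sk[of k] P[of k] by (simp add: nn_integral_cmult_indicator emeasure_eq_measure)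
    also have "\<dots> = ennreal (c * (g k * pois t k))" using g(1)[of k] p0[of k] c by (simp add: ennreal_mult[symmetric] mult_ac)
    finally show "(\<integral>\<^sup>+x. ennreal (g k) * indicator (W \<inter> (Y -` {k} \<inter> space M)) x \<partial>M) = ennreal (c * (g k * pois t k))" .
  qed
  also have "\<dots> = ennreal (c * s)"
    by (rule suminf_ennreal_eq) (use g p0 c sums_mult in auto)
  finally have e: "(\<integral>\<^sup>+x. ennreal (indicator W x * g (Y x)) \<partial>M) = ennreal (c * s)" .
  show ?thesis
    by (rule has_bochner_integral_nn_integral) (use e W gm g c s0 in \<open>auto simp: indicator_def\<close>)
qed

abbreviation mu :: "real set \<Rightarrow> real" where "mu \<equiv> measure lebesgue"

definition cnt :: "real set \<Rightarrow> real set \<Rightarrow> real" where "cnt A x = real (card (x \<inter> A))"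
definition void_ind :: "real set \<Rightarrow> real set \<Rightarrow> real" where "void_ind A x = indicator (void A) x"
definition ccount :: "real set \<Rightarrow> real set \<Rightarrow> real" where "ccount A x = cnt A x - mu A"

lemma M0_measurable: "f \<in> conf_sigma \<rightarrow>\<^sub>M N \<Longrightarrow> f \<in> M\<^sub>0 \<rightarrow>\<^sub>M N"
  by (rule measurable_completion) (simp cong: measurable_cong_sets add: sets_PN)

lemma M0_sets: "A \<in> sets conf_sigma \<Longrightarrow> A \<in> sets M\<^sub>0" using sets_PN by auto

lemma M0_AE: "AE x in PN. Q x \<Longrightarrow> AE x in M\<^sub>0. Q x" by (rule AE_completion)

lemma void_M0 [simp]: "A \<in> FM \<Longrightarrow> void A \<in> sets M\<^sub>0" using M0_sets cev_sets by blast

lemma prob_M0: "A \<in> sets conf_sigma \<Longrightarrow> measure M\<^sub>0 A = measure PN A" using sets_PN by simp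

lemma cnt_M0: "A \<in> FM \<Longrightarrow> cnt A \<in> borel_measurable M\<^sub>0"
  unfolding cnt_def using measurable_compose[OF card_measurable, of A real borel] by (intro M0_measurable) simp

lemma void_ind_M0: "A \<in> FM \<Longrightarrow> void_ind A \<in> borel_measurable M\<^sub>0" unfolding void_ind_def[abs_def] by (rule borel_measurable_indicator[OF void_M0])

lemma void_ind_sqi: "A \<in> FM \<Longrightarrow> sqi M\<^sub>0 (void_ind A)"
  by (rule M0.sqi_bounded[OF void_ind_M0, of _ 1]) (auto simp: void_ind_def indicator_def)

lemma law_cnt:
  assumes A: "A \<in> FM" and B: "B \<in> FM" "A \<inter> B = {}"
  shows "measure M\<^sub>0 (void A \<inter> ((\<lambda>x. card (x \<inter> B)) -` {k} \<inter> space M\<^sub>0)) = exp (- mu A) * pois (mu B) k"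
proof -
  have S: "(\<lambda>x. card (x \<inter> B)) -` {k} \<inter> space M\<^sub>0 \<in> sets M\<^sub>0"
    using measurable_sets[OF M0_measurable[OF card_measurable[OF B(1)]], of "{k}"] by simp
  have "measure M\<^sub>0 (void A \<inter> ((\<lambda>x. card (x \<inter> B)) -` {k} \<inter> space M\<^sub>0)) = measure M\<^sub>0 (void A \<inter> cev B k)"
  proof (rule measure_eq_AE)
    show "AE x in M\<^sub>0. (x \<in> void A \<inter> ((\<lambda>x. card (x \<inter> B)) -` {k} \<inter> space M\<^sub>0)) = (x \<in> void A \<inter> cev B k)"
      using M0_AE[OF AE_finite[OF B(1)]] by eventually_elim (auto simp: cev_def)
    show "void A \<inter> ((\<lambda>x. card (x \<inter> B)) -` {k} \<inter> space M\<^sub>0) \<in> sets M\<^sub>0" by (rule sets.Int[OF void_M0[OF A] S])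
    show "void A \<inter> cev B k \<in> sets M\<^sub>0" by (rule sets.Int[OF void_M0[OF A] M0_sets[OF cev_sets[OF B(1)]]])
  qed
  also have "\<dots> = measure PN (void A \<inter> cev B k)"
    by (rule prob_M0) (rule sets.Int[OF cev_sets[OF A] cev_sets[OF B(1)]])
  also have "\<dots> = measure PN (\<Inter>l<(2::nat). cev (if l = 0 then A else B) (if l = 0 then 0 else k))"
  proof -
    have e: "{..<2::nat} = {0, 1}" by auto
    show ?thesis unfolding e by simp
  qed
  also have "\<dots> = (\<Prod>l<(2::nat). pois (mu (if l = 0 then A else B)) (if l = 0 then 0 else k))"
  proof (rule joint_law)
    show "(if l = 0 then A else B) \<in> FM" for l :: nat using A B by simp
    show "disjoint_family_on (\<lambda>l::nat. if l = 0 then A else B) {..<2}"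
      unfolding disjoint_family_on_def using B(2) by (auto simp: Int_commute[of B A] less_2_cases_iff)
  qed simp
  also have "\<dots> = exp (- mu A) * pois (mu B) k" by (simp add: numeral_2_eq_2 lessThan_Suc pois_def)
  finally show ?thesis .
qed

lemma void_ind_cnt_disjoint:
  assumes A: "A \<in> FM" and B: "B \<in> FM" "A \<inter> B = {}"
  shows "has_bochner_integral M\<^sub>0 (\<lambda>x. void_ind A x * cnt B x) (exp (- mu A) * mu B)"
    "has_bochner_integral M\<^sub>0 (\<lambda>x. void_ind A x * (cnt B x)\<^sup>2) (exp (- mu A) * (mu B + (mu B)\<^sup>2))"
proof -
  note h = law_moment[OF prob_space_M0 void_M0[OF A] M0_measurable[OF card_measurable[OF B(1)]] law_cnt[OF assms]]
  show "has_bochner_integral M\<^sub>0 (\<lambda>x. void_ind A x * cnt B x) (exp (- mu A) * mu B)"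
    unfolding void_ind_def cnt_def by (rule h) (use pois_sums[of "mu B"] in auto)
  show "has_bochner_integral M\<^sub>0 (\<lambda>x. void_ind A x * (cnt B x)\<^sup>2) (exp (- mu A) * (mu B + (mu B)\<^sup>2))"
    unfolding void_ind_def cnt_def by (rule h[where g = "\<lambda>k. (real k)\<^sup>2"]) (use pois_sums[of "mu B"] in auto)
qed

lemma void_ind_empty: "x \<in> space M\<^sub>0 \<Longrightarrow> void_ind {} x = 1" by (simp add: void_ind_def in_void)

lemma cnt_moments:
  assumes A: "A \<in> FM" shows "sqi M\<^sub>0 (cnt A)" "(\<integral>x. cnt A x \<partial>M\<^sub>0) = mu A" "(\<integral>x. (cnt A x)\<^sup>2 \<partial>M\<^sub>0) = mu A + (mu A)\<^sup>2"
proof -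
  note h = void_ind_cnt_disjoint[OF FM_empty A]
  have e: "has_bochner_integral M\<^sub>0 (cnt A) (mu A)"
    using h(1) by (subst has_bochner_integral_cong[OF refl _ refl, of _ _ "\<lambda>x. void_ind {} x * cnt A x"]) (auto simp: void_ind_empty)
  have e2: "has_bochner_integral M\<^sub>0 (\<lambda>x. (cnt A x)\<^sup>2) (mu A + (mu A)\<^sup>2)"
    using h(2) by (subst has_bochner_integral_cong[OF refl _ refl, of _ _ "\<lambda>x. void_ind {} x * (cnt A x)\<^sup>2"]) (auto simp: void_ind_empty)
  show "sqi M\<^sub>0 (cnt A)" using e2 cnt_M0[OF A] by (simp add: sqi_def has_bochner_integral_iff)
  show "(\<integral>x. cnt A x \<partial>M\<^sub>0) = mu A" "(\<integral>x. (cnt A x)\<^sup>2 \<partial>M\<^sub>0) = mu A + (mu A)\<^sup>2"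
    using e e2 by (auto simp: has_bochner_integral_iff)
qed

lemma FM_lmeas: "A \<in> FM \<Longrightarrow> A \<in> lmeasurable" by (simp add: FM_def)

lemma mu_Un_disjoint: "A \<in> FM \<Longrightarrow> B \<in> FM \<Longrightarrow> A \<inter> B = {} \<Longrightarrow> mu (A \<union> B) = mu A + mu B"
  using measure_Un3[of A lebesgue B] by (simp add: FM_lmeas)

lemma cnt_Un_disjoint:
  assumes "A \<in> FM" "B \<in> FM" "A \<inter> B = {}" shows "AE x in M\<^sub>0. cnt (A \<union> B) x = cnt A x + cnt B x"
  using M0_AE[OF AE_finite[OF assms(1)]] M0_AE[OF AE_finite[OF assms(2)]]
proof eventually_elim
  case (elim x)
  have "card ((x \<inter> A) \<union> (x \<inter> B)) = card (x \<inter> A) + card (x \<inter> B)"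
    by (rule card_Un_disjoint) (use elim assms(3) in auto)
  then show ?case by (simp add: cnt_def Int_Un_distrib)
qed

lemma ccount_sqi: "A \<in> FM \<Longrightarrow> sqi M\<^sub>0 (ccount A)"
  unfolding ccount_def[abs_def] by (intro sqi_diff cnt_moments M0.sqi_const)

lemma ccount_mean: "A \<in> FM \<Longrightarrow> (\<integral>x. ccount A x \<partial>M\<^sub>0) = 0"
  using M0.sqi_integrable[OF cnt_moments(1)] cnt_moments(2) M0.prob_space by (simp add: ccount_def)

lemma ccount_var: assumes "A \<in> FM" shows "(\<integral>x. ccount A x * ccount A x \<partial>M\<^sub>0) = mu A"
proof -
  have "(\<integral>x. ccount A x * ccount A x \<partial>M\<^sub>0) = (\<integral>x. (cnt A x)\<^sup>2 - (2 * mu A) * cnt A x + (mu A)\<^sup>2 \<partial>M\<^sub>0)"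
    by (rule Bochner_Integration.integral_cong) (auto simp: ccount_def power2_eq_square algebra_simps)
  also have "\<dots> = (\<integral>x. (cnt A x)\<^sup>2 \<partial>M\<^sub>0) - (2 * mu A) * (\<integral>x. cnt A x \<partial>M\<^sub>0) + (mu A)\<^sup>2"
    using cnt_moments(1)[OF assms] M0.sqi_integrable[OF cnt_moments(1)[OF assms]] M0.prob_space by (simp add: sqi_def)
  finally show ?thesis unfolding cnt_moments[OF assms] by (simp add: power2_eq_square)
qed

lemma ccount_Un_disjoint:
  assumes "A \<in> FM" "B \<in> FM" "A \<inter> B = {}" shows "AE x in M\<^sub>0. ccount (A \<union> B) x = ccount A x + ccount B x"
  using cnt_Un_disjoint[OF assms] by eventually_elim (simp add: ccount_def mu_Un_disjoint[OF assms])

lemma ccount_cov_disjoint: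
  assumes "A \<in> FM" "B \<in> FM" "A \<inter> B = {}" shows "(\<integral>x. ccount A x * ccount B x \<partial>M\<^sub>0) = 0"
proof -
  note s = ccount_sqi[OF assms(1)] ccount_sqi[OF assms(2)]
  have "mu A + mu B = (\<integral>x. ccount (A \<union> B) x * ccount (A \<union> B) x \<partial>M\<^sub>0)"
    using ccount_var[OF FM_Un[OF assms(1,2)]] mu_Un_disjoint[OF assms] by simp
  also have "\<dots> = (\<integral>x. (ccount A x + ccount B x) * (ccount A x + ccount B x) \<partial>M\<^sub>0)"
    by (rule integral_cong_AE)
      (use ccount_Un_disjoint[OF assms] ccount_sqi[OF FM_Un[OF assms(1,2)]] s in \<open>auto simp: sqi_def\<close>)
  also have "\<dots> = (\<integral>x. ccount A x * ccount A x + 2 * (ccount A x * ccount B x) + ccount B x * ccount B x \<partial>M\<^sub>0)"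
    by (rule Bochner_Integration.integral_cong) (auto simp: algebra_simps)
  also have "\<dots> = mu A + 2 * (\<integral>x. ccount A x * ccount B x \<partial>M\<^sub>0) + mu B"
    using sqi_mult[OF s(1) s(1)] sqi_mult[OF s] sqi_mult[OF s(2) s(2)] ccount_var assms by simp
  finally show ?thesis by simp
qed

lemma ccount_cov: assumes A: "A \<in> FM" and B: "B \<in> FM" shows "(\<integral>x. ccount A x * ccount B x \<partial>M\<^sub>0) = mu (A \<inter> B)"
proof -
  let ?C = "A \<inter> B" and ?D = "A - B" and ?E = "B - A"
  have F: "?C \<in> FM" "?D \<in> FM" "?E \<in> FM" using FM_Int FM_Diff A B by auto
  note s = ccount_sqi[OF F(1)] ccount_sqi[OF F(2)] ccount_sqi[OF F(3)]
  have u: "?C \<union> ?D = A" "?C \<union> ?E = B" "?C \<inter> ?D = {}" "?C \<inter> ?E = {}" by blast+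
  have a: "AE x in M\<^sub>0. ccount A x = ccount ?C x + ccount ?D x" using ccount_Un_disjoint[OF F(1,2) u(3)] unfolding u .
  have b: "AE x in M\<^sub>0. ccount B x = ccount ?C x + ccount ?E x" using ccount_Un_disjoint[OF F(1,3) u(4)] unfolding u .
  have "(\<integral>x. ccount A x * ccount B x \<partial>M\<^sub>0) = (\<integral>x. (ccount ?C x + ccount ?D x) * (ccount ?C x + ccount ?E x) \<partial>M\<^sub>0)"
    by (rule integral_cong_AE) (use a b ccount_sqi[OF A] ccount_sqi[OF B] s in \<open>auto simp: sqi_def\<close>)
  also have "\<dots> = (\<integral>x. ccount ?C x * ccount ?C x + ccount ?C x * ccount ?E x + ccount ?D x * ccount ?C x + ccount ?D x * ccount ?E x \<partial>M\<^sub>0)"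
    by (rule Bochner_Integration.integral_cong) (auto simp: algebra_simps)
  also have "\<dots> = mu ?C"
  proof -
    have "?C \<inter> ?E = {}" "?D \<inter> ?C = {}" "?D \<inter> ?E = {}" by auto
    then show ?thesis
      using sqi_mult[OF s(1) s(1)] sqi_mult[OF s(1) s(3)] sqi_mult[OF s(2) s(1)] sqi_mult[OF s(2) s(3)]
        ccount_var[OF F(1)] ccount_cov_disjoint[OF F(1,3)] ccount_cov_disjoint[OF F(2,1)] ccount_cov_disjoint[OF F(2,3)] by simp
  qed
  finally show ?thesis .
qed

lemma void_ind_mean: "A \<in> FM \<Longrightarrow> (\<integral>x. void_ind A x \<partial>M\<^sub>0) = exp (- mu A)"
  using prob_void[of A] sets.sets_into_space[OF void_M0, of A] sets_PN cev_sets[of A 0]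
  by (simp add: void_ind_def[abs_def] Int_absorb2)

lemma void_ind_mult: "void_ind A x * void_ind B x = void_ind (A \<union> B) x"
  unfolding void_ind_def void_Int[symmetric] by (simp add: indicator_inter_arith)

lemma void_ind_ccount: assumes A: "A \<in> FM" and B: "B \<in> FM" shows "(\<integral>x. void_ind A x * ccount B x \<partial>M\<^sub>0) = - exp (- mu A) * mu (A \<inter> B)"
proof -
  have F: "B - A \<in> FM" "A \<inter> B \<in> FM" using FM_Int FM_Diff A B by auto
  have e: "void_ind A x * cnt B x = void_ind A x * cnt (B - A) x" for x
  proof (cases "x \<in> void A")
    case True
    then have "x \<inter> B = x \<inter> (B - A)" by (auto simp: in_void)
    then show ?thesis by (simp add: cnt_def)
  qed (simp add: void_ind_def)
  have h: "has_bochner_integral M\<^sub>0 (\<lambda>x. void_ind A x * cnt B x) (exp (- mu A) * mu (B - A))"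
    unfolding e by (rule void_ind_cnt_disjoint(1)[OF A F(1)]) auto
  have "(\<integral>x. void_ind A x * ccount B x \<partial>M\<^sub>0) = (\<integral>x. void_ind A x * cnt B x - mu B * void_ind A x \<partial>M\<^sub>0)"
    by (rule Bochner_Integration.integral_cong) (auto simp: ccount_def algebra_simps)
  also have "\<dots> = exp (- mu A) * mu (B - A) - mu B * exp (- mu A)"
    using h void_ind_mean[OF A] M0.sqi_integrable[OF void_ind_sqi[OF A]] by (simp add: has_bochner_integral_iff)
  also have "mu B = mu (B - A) + mu (A \<inter> B)"
  proof -
    have u: "(B - A) \<union> (A \<inter> B) = B" "(B - A) \<inter> (A \<inter> B) = {}" by blast+
    show ?thesis using mu_Un_disjoint[OF F u(2)] unfolding u(1) .
  qed
  finally show ?thesis by (simp add: algebra_simps)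
qed

subsection \<open>The suspension and cylinder functions\<close>

abbreviation PP :: "real set \<Rightarrow> real set" where "PP \<equiv> susp tmap"

lemma tpre_FM: assumes "A \<in> FM" shows "tpre n A \<in> FM" "mu (tpre n A) = mu A"
proof -
  have A: "A \<in> lmeasurable" "A \<in> sets lebesgue" "A \<subseteq> {0..}" using assms by (auto simp: FM_def)
  have e: "emeasure lebesgue (tpre n A) = emeasure lebesgue A" by (rule emeasure_shift[OF A(2,3)])
  have "emeasure lebesgue A < \<infinity>" using A(1) unfolding fmeasurable_def by blast
  then show "tpre n A \<in> FM" using shift_sets[OF A(2), of n] e unfolding FM_def fmeasurable_def by (auto simp: tpre_def)
  show "mu (tpre n A) = mu A" using e by (simp only: measure_def)
qed

lemma PP_susp: "AE x in PN. x \<inter> {} = {} \<and> tmap ` x \<in> Cf" "measure_preserving M\<^sub>0 PP"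
proof -
  have 1: "pre tmap {} A = tpre 1 A" for A by (simp add: pre_def tpre_def)
  have a: "0 \<le> tmap x" if "0 \<le> x" for x using tmap_nonneg[OF that] by simp
  have b: "inj_on tmap ({0..} - {})" using tmap_inj by simp
  have c: "pre tmap {} A \<in> FM \<and> mu (pre tmap {} A) = mu A" if "A \<in> FM" for A unfolding 1 using tpre_FM[OF that] by blast
  show "AE x in PN. x \<inter> {} = {} \<and> tmap ` x \<in> Cf" by (rule susp_preserving(1)[OF _ _ a b c]) auto
  show "measure_preserving M\<^sub>0 PP" by (rule susp_preserving(2)[of "{}" tmap, OF _ _ a b c]) auto
qed

lemma PPn_mp: "measure_preserving M\<^sub>0 (PP ^^ n)" by (rule measure_preserving_funpow[OF PP_susp(2)])

lemma AE_PP: "AE x in M\<^sub>0. PP x = tmap ` x"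
  using M0_AE[OF PP_susp(1)] by eventually_elim (simp add: susp_def)

lemma AE_PPn: "AE x in M\<^sub>0. (PP ^^ n) x = (tmap ^^ n) ` x"
proof (induct n)
  case (Suc n)
  have "AE x in M\<^sub>0. PP ((PP ^^ n) x) = tmap ` ((PP ^^ n) x)" by (rule mp_AE[OF PPn_mp AE_PP])
  then show ?case using Suc by eventually_elim (simp add: image_image)
qed simp

lemma PPn_Cf: "x \<in> Cf \<Longrightarrow> (PP ^^ n) x \<in> Cf"
  using measurable_space[of "PP ^^ n" M\<^sub>0 M\<^sub>0 x] PPn_mp[of n] by (simp add: measure_preserving_def)

lemma tmap_pow_nonneg: "0 \<le> x \<Longrightarrow> 0 \<le> (tmap ^^ n) x"
  by (induct n) (auto intro: less_imp_le tmap_nonneg)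

lemma tmap_pow_inj: "inj_on (tmap ^^ n) {0..}"
proof (induct n)
  case (Suc n)
  have "inj_on tmap ((tmap ^^ n) ` {0..})" by (rule inj_on_subset[OF tmap_inj]) (auto intro: tmap_pow_nonneg)
  then show ?case using comp_inj_on[OF Suc] by (simp add: comp_def)
qed simp

lemma shift_counts:
  assumes "A \<in> FM"
  shows "AE x in M\<^sub>0. cnt A ((PP ^^ n) x) = cnt (tpre n A) x \<and> void_ind A ((PP ^^ n) x) = void_ind (tpre n A) x"
  using AE_PPn[of n] AE_space
proof eventually_elim
  case (elim x)
  then have x: "x \<in> Cf" "x \<subseteq> {0..}" by (auto simp: Cf_def)
  have e: "(tmap ^^ n) ` x \<inter> A = (tmap ^^ n) ` (x \<inter> tpre n A)" using x(2) by (auto simp: tpre_def)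
  have "inj_on (tmap ^^ n) (x \<inter> tpre n A)" by (rule inj_on_subset[OF tmap_pow_inj]) (use x in auto)
  then have "card ((tmap ^^ n) ` x \<inter> A) = card (x \<inter> tpre n A)" unfolding e by (rule card_image)
  moreover have "(PP ^^ n) x \<in> void A \<longleftrightarrow> x \<in> void (tpre n A)"
    using e PPn_Cf[OF x(1), of n] x(1) unfolding in_void elim(1) by simp
  ultimately show ?case unfolding cnt_def void_ind_def indicator_def elim(1) by simp
qed

lemma levels_FM: "A \<in> levels j \<Longrightarrow> A \<in> FM"
  using levels_lmeasurable levels_nonneg by (auto simp: FM_def)

definition void_span :: "(real set \<Rightarrow> real) set" where
  "void_span = {f. \<exists>q F c. finite F \<and> F \<subseteq> levels q \<and> f = (\<lambda>x. \<Sum>A\<in>F. c A * void_ind A x)}"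

lemma void_span_sqi: "f \<in> void_span \<Longrightarrow> sqi M\<^sub>0 f"
  unfolding void_span_def by (auto intro!: sqi_sum sqi_scale void_ind_sqi levels_FM)

lemma void_span_scale: "f \<in> void_span \<Longrightarrow> (\<lambda>x. a * f x) \<in> void_span"
proof -
  assume "f \<in> void_span"
  then obtain q F c where f: "finite F" "F \<subseteq> levels q" "f = (\<lambda>x. \<Sum>A\<in>F. c A * void_ind A x)" by (auto simp: void_span_def)
  have "(\<lambda>x. a * f x) = (\<lambda>x. \<Sum>A\<in>F. (a * c A) * void_ind A x)" by (simp add: f(3) sum_distrib_left mult_ac)
  then show ?thesis unfolding void_span_def using f(1,2) by (intro CollectI exI[of _ q] exI[of _ F] exI[of _ "\<lambda>A. a * c A"]) auto
qed

lemma void_span_add: assumes "f \<in> void_span" "g \<in> void_span" shows "(\<lambda>x. f x + g x) \<in> void_span"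
proof -
  obtain q F c where f: "finite F" "F \<subseteq> levels q" "f = (\<lambda>x. \<Sum>A\<in>F. c A * void_ind A x)" using assms(1) by (auto simp: void_span_def)
  obtain p G d where g: "finite G" "G \<subseteq> levels p" "g = (\<lambda>x. \<Sum>A\<in>G. d A * void_ind A x)" using assms(2) by (auto simp: void_span_def)
  define e where "e A = (if A \<in> F then c A else 0) + (if A \<in> G then d A else 0)" for A
  have "f x + g x = (\<Sum>A\<in>F \<union> G. e A * void_ind A x)" for x
  proof -
    have "(\<Sum>A\<in>F. c A * void_ind A x) = (\<Sum>A\<in>F \<union> G. (if A \<in> F then c A else 0) * void_ind A x)"
      by (rule sum.mono_neutral_cong_left) (use f g in auto)
    moreover have "(\<Sum>A\<in>G. d A * void_ind A x) = (\<Sum>A\<in>F \<union> G. (if A \<in> G then d A else 0) * void_ind A x)"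
      by (rule sum.mono_neutral_cong_left) (use f g in auto)
    ultimately show ?thesis by (simp add: f(3) g(3) e_def distrib_right sum.distrib)
  qed
  moreover have "F \<union> G \<subseteq> levels (max q p)" using f(2) g(2) levels_mono[of q "max q p"] levels_mono[of p "max q p"] by auto
  ultimately show ?thesis unfolding void_span_def using f(1) g(1)
    by (intro CollectI exI[of _ "max q p"] exI[of _ "F \<union> G"] exI[of _ e]) auto
qed

definition approximable :: "(real set \<Rightarrow> real) \<Rightarrow> bool" where
  "approximable g \<longleftrightarrow> sqi M\<^sub>0 g \<and> (\<forall>e>0. \<exists>f\<in>void_span. nrm M\<^sub>0 (\<lambda>x. g x - f x) < e)"

lemma approximable_sqi: "approximable g \<Longrightarrow> sqi M\<^sub>0 g" by (simp add: approximable_def)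

lemma approximable_limit:
  assumes g: "sqi M\<^sub>0 g" and h: "\<And>e. 0 < e \<Longrightarrow> \<exists>h. approximable h \<and> nrm M\<^sub>0 (\<lambda>x. g x - h x) < e"
  shows "approximable g"
  unfolding approximable_def
proof (intro conjI allI impI)
  fix e :: real assume e: "0 < e"
  obtain h where h: "approximable h" "nrm M\<^sub>0 (\<lambda>x. g x - h x) < e / 2" using h[of "e/2"] e by auto
  obtain f where f: "f \<in> void_span" "nrm M\<^sub>0 (\<lambda>x. h x - f x) < e / 2" using h(1) e unfolding approximable_def by (meson half_gt_zero)
  have "nrm M\<^sub>0 (\<lambda>x. g x - f x) < e"
    using nrm_diff_triangle[OF g approximable_sqi[OF h(1)] void_span_sqi[OF f(1)]] h(2) f(2) by linarith
  then show "\<exists>f\<in>void_span. nrm M\<^sub>0 (\<lambda>x. g x - f x) < e" using f(1) by blast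
qed (rule g)

lemma approximable_add: assumes "approximable g" "approximable h" shows "approximable (\<lambda>x. g x + h x)"
  unfolding approximable_def
proof (intro conjI allI impI)
  show "sqi M\<^sub>0 (\<lambda>x. g x + h x)" using assms by (intro sqi_add approximable_sqi)
  fix e :: real assume e: "0 < e"
  obtain f where f: "f \<in> void_span" "nrm M\<^sub>0 (\<lambda>x. g x - f x) < e / 2" using assms(1) e unfolding approximable_def by (meson half_gt_zero)
  obtain f' where f': "f' \<in> void_span" "nrm M\<^sub>0 (\<lambda>x. h x - f' x) < e / 2" using assms(2) e unfolding approximable_def by (meson half_gt_zero)
  have "nrm M\<^sub>0 (\<lambda>x. (g x - f x) + (h x - f' x)) \<le> nrm M\<^sub>0 (\<lambda>x. g x - f x) + nrm M\<^sub>0 (\<lambda>x. h x - f' x)"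
    by (intro nrm_triangle sqi_diff approximable_sqi void_span_sqi assms f f')
  moreover have "(\<lambda>x. (g x - f x) + (h x - f' x)) = (\<lambda>x. (g x + h x) - (f x + f' x))" by auto
  ultimately have "nrm M\<^sub>0 (\<lambda>x. (g x + h x) - (f x + f' x)) < e" using f f' by simp
  then show "\<exists>f\<in>void_span. nrm M\<^sub>0 (\<lambda>x. g x + h x - f x) < e" using void_span_add[OF f(1) f'(1)] by (intro bexI[of _ "\<lambda>x. f x + f' x"])
qed

lemma approximable_scale: assumes "approximable g" shows "approximable (\<lambda>x. a * g x)"
  unfolding approximable_def
proof (intro conjI allI impI)
  show "sqi M\<^sub>0 (\<lambda>x. a * g x)" using assms by (intro sqi_scale approximable_sqi)
  fix e :: real assume e: "0 < e"
  then have "0 < e / (\<bar>a\<bar> + 1)" by simp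
  then obtain f where f: "f \<in> void_span" "nrm M\<^sub>0 (\<lambda>x. g x - f x) < e / (\<bar>a\<bar> + 1)" using assms unfolding approximable_def by blast
  have "nrm M\<^sub>0 (\<lambda>x. a * g x - a * f x) = \<bar>a\<bar> * nrm M\<^sub>0 (\<lambda>x. g x - f x)"
    unfolding nrm_scale[symmetric] by (simp add: right_diff_distrib)
  also have "\<dots> \<le> (\<bar>a\<bar> + 1) * nrm M\<^sub>0 (\<lambda>x. g x - f x)" by (intro mult_right_mono) auto
  also have "\<dots> < e" using f(2) by (simp add: field_simps)
  finally show "\<exists>f\<in>void_span. nrm M\<^sub>0 (\<lambda>x. a * g x - f x) < e" using void_span_scale[OF f(1), of a] by (intro bexI[of _ "\<lambda>x. a * f x"])
qed

lemma approximable_cong_AE: assumes "approximable g" "AE x in M\<^sub>0. g x = h x" "h \<in> borel_measurable M\<^sub>0" shows "approximable h"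
proof (rule approximable_limit)
  have g: "sqi M\<^sub>0 g" using assms by (simp add: approximable_sqi)
  then have "integrable M\<^sub>0 (\<lambda>x. (g x)\<^sup>2) \<longleftrightarrow> integrable M\<^sub>0 (\<lambda>x. (h x)\<^sup>2)"
    using assms by (intro integrable_cong_AE) (auto simp: sqi_def)
  then show h: "sqi M\<^sub>0 h" using g assms by (auto simp: sqi_def)
  fix e :: real assume "0 < e"
  moreover have "nrm M\<^sub>0 (\<lambda>x. h x - g x) = nrm M\<^sub>0 (\<lambda>x. 0)"
    by (rule nrm_cong_AE) (use assms g in \<open>auto simp: sqi_def\<close>)
  ultimately show "\<exists>g. approximable g \<and> nrm M\<^sub>0 (\<lambda>x. h x - g x) < e" using assms(1) by (intro exI[of _ g]) (simp add: nrm_def)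
qed

lemma exp_diff_le: "0 \<le> a \<Longrightarrow> 0 \<le> b \<Longrightarrow> exp (- a) - exp (- (a + b)) \<le> (b::real)"
proof -
  assume "0 \<le> a" "0 \<le> b"
  have "exp (- a) - exp (- (a + b)) = exp (- a) * (1 - exp (- b))" by (simp add: algebra_simps flip: exp_add)
  also have "\<dots> \<le> 1 * b" using exp_ge_add_one_self[of "- b"] \<open>0 \<le> a\<close> \<open>0 \<le> b\<close> by (intro mult_mono) auto
  finally show ?thesis by simp
qed

lemma mu_Un_Diff: "A \<in> FM \<Longrightarrow> B \<in> FM \<Longrightarrow> mu (A \<union> B) = mu A + mu (B - A)"
  using mu_Un_disjoint[OF _ FM_Diff, of A B A] by (simp add: Diff_disjoint)

lemma approximable_void_ind: assumes A: "A \<in> FM" shows "approximable (void_ind A)"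
  unfolding approximable_def
proof (intro conjI allI impI void_ind_sqi[OF A])
  fix e :: real assume e: "0 < e"
  then have "0 < e\<^sup>2 / 2" by simp
  then obtain j B where B: "B \<in> levels j" "mu (A - B) < e\<^sup>2 / 2" "mu (B - A) < e\<^sup>2 / 2"
    using levels_dense[of A "e\<^sup>2 / 2"] A by (auto simp: FM_def)
  have BF: "B \<in> FM" by (rule levels_FM[OF B(1)])
  note i = M0.sqi_integrable[OF void_ind_sqi]
  have "(nrm M\<^sub>0 (\<lambda>x. void_ind A x - void_ind B x))\<^sup>2 = (\<integral>x. void_ind A x - 2 * void_ind (A \<union> B) x + void_ind B x \<partial>M\<^sub>0)"
  proof -
    have "(void_ind A x - void_ind B x)\<^sup>2 = void_ind A x - 2 * void_ind (A \<union> B) x + void_ind B x" for x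
    proof -
      have "(void_ind A x - void_ind B x)\<^sup>2 = void_ind A x * void_ind A x - 2 * (void_ind A x * void_ind B x) + void_ind B x * void_ind B x"
        by (simp add: power2_eq_square algebra_simps)
      then show ?thesis by (simp only: void_ind_mult Un_absorb)
    qed
    then show ?thesis by (simp add: nrm_sq)
  qed
  also have "\<dots> = exp (- mu A) - 2 * exp (- mu (A \<union> B)) + exp (- mu B)"
    using i[OF A] i[OF BF] i[OF FM_Un[OF A BF]] by (simp add: void_ind_mean A BF FM_Un)
  also have "\<dots> = (exp (- mu A) - exp (- (mu A + mu (B - A)))) + (exp (- mu B) - exp (- (mu B + mu (A - B))))"
    using mu_Un_Diff[OF A BF] mu_Un_Diff[OF BF A] by (simp add: Un_commute)
  also have "\<dots> \<le> mu (B - A) + mu (A - B)" by (intro add_mono exp_diff_le) auto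
  also have "\<dots> < e\<^sup>2" using B by simp
  finally have "nrm M\<^sub>0 (\<lambda>x. void_ind A x - void_ind B x) < e" using e by (simp add: power2_less_imp_less)
  moreover have "void_ind B \<in> void_span" unfolding void_span_def
    by (intro CollectI exI[of _ j] exI[of _ "{B}"] exI[of _ "\<lambda>_. 1"]) (use B in auto)
  ultimately show "\<exists>f\<in>void_span. nrm M\<^sub>0 (\<lambda>x. void_ind A x - f x) < e" by blast
qed

lemma approximable_sum: "finite I \<Longrightarrow> (\<And>i. i \<in> I \<Longrightarrow> approximable (f i)) \<Longrightarrow> approximable (\<lambda>x. \<Sum>i\<in>I. f i x)"
proof (induct I rule: finite_induct)
  case empty
  have "approximable (\<lambda>x. 0 * void_ind {} x)" by (intro approximable_scale approximable_void_ind FM_empty)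
  then show ?case by simp
qed (auto intro: approximable_add)

lemma nrm_indicator: "C \<in> sets M\<^sub>0 \<Longrightarrow> (nrm M\<^sub>0 (indicator C))\<^sup>2 = measure M\<^sub>0 C"
proof -
  assume C: "C \<in> sets M\<^sub>0"
  have "(indicator C x)\<^sup>2 = (indicator C x :: real)" for x by (simp add: indicator_def)
  then show ?thesis using sets.sets_into_space[OF C] C by (simp add: nrm_sq Int_absorb2)
qed

lemma sqi_indicator: "C \<in> sets M\<^sub>0 \<Longrightarrow> sqi M\<^sub>0 (indicator C)"
  by (rule M0.sqi_bounded[of _ 1]) (auto simp: indicator_def)

lemma approximable_indicator_PN: assumes "C \<in> sets PN" shows "approximable (indicator C)"
proof -
  have C: "C \<in> sigma_sets Cf {void A | A. A \<in> FM}" using assms sets_PN sets_conf_void by simp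
  have st: "Int_stable {void A | A. A \<in> FM}" unfolding Int_stable_def using void_Int FM_Un by blast
  show ?thesis
    using st void_sub C
  proof (induct rule: sigma_sets_induct_disjoint)
    case (basic A)
    then obtain B where "A = void B" "B \<in> FM" by auto
    then show ?case using approximable_void_ind[of B] by (simp add: void_ind_def[abs_def])
  next
    case empty
    have "approximable (\<lambda>x. 0 * void_ind {} x)" by (intro approximable_scale approximable_void_ind FM_empty)
    then show ?case by simp
  next
    case (compl A)
    have "approximable (\<lambda>x. void_ind {} x + (-1) * indicator A x)" by (intro approximable_add approximable_scale approximable_void_ind FM_empty compl)
    then show ?case
    proof (rule approximable_cong_AE)
      have "A \<in> sets PN" using compl sets_PN sets_conf_void by simp
      then have "Cf - A \<in> sets PN" using sets.compl_sets[of A PN] by simp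
      then show "indicator (Cf - A) \<in> borel_measurable M\<^sub>0" by (intro borel_measurable_indicator) simp
    qed (rule AE_I2, simp add: void_ind_def in_void indicator_def)
  next
    case (union A)
    have As: "A i \<in> sets M\<^sub>0" for i
    proof (rule sets_completionI_sets)
      have "A i \<in> sigma_sets Cf {void A | A. A \<in> FM}" using union(2) by blast
      then show "A i \<in> sets PN" unfolding sets_PN sets_conf_void .
    qed
    have Us: "(\<Union>i. A i) \<in> sets M\<^sub>0" using As by auto
    show ?case
    proof (rule approximable_limit[OF sqi_indicator[OF Us]])
      fix e :: real assume e: "0 < e"
      have "(\<lambda>n. measure M\<^sub>0 (\<Union>i<n. A i)) \<longlonglongrightarrow> measure M\<^sub>0 (\<Union>n. \<Union>i<n. A i)"
        by (rule M0.finite_Lim_measure_incseq) (use As in \<open>auto simp: incseq_def intro: order_less_le_trans\<close>)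
      moreover have "(\<Union>n. \<Union>i<n. A i) = (\<Union>i. A i)" by auto
      ultimately have "(\<lambda>n. measure M\<^sub>0 (\<Union>i<n. A i)) \<longlonglongrightarrow> measure M\<^sub>0 (\<Union>i. A i)" by simp
      moreover have "measure M\<^sub>0 (\<Union>i. A i) - e\<^sup>2 < measure M\<^sub>0 (\<Union>i. A i)" using e by simp
      ultimately have "\<forall>\<^sub>F n in sequentially. measure M\<^sub>0 (\<Union>i. A i) - e\<^sup>2 < measure M\<^sub>0 (\<Union>i<n. A i)"
        by (rule order_tendstoD)
      then obtain n where n: "measure M\<^sub>0 (\<Union>i. A i) - e\<^sup>2 < measure M\<^sub>0 (\<Union>i<n. A i)" by (auto simp: eventually_sequentially)
      have fs: "(\<Union>i<n. A i) \<in> sets M\<^sub>0" using As by auto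
      have ind: "indicator (\<Union>i<n. A i) x = (\<Sum>i<n. indicator (A i) x :: real)" for x
        using union(1) by (intro indicator_UN_disjoint) (auto simp: disjoint_family_on_def)
      have "(\<lambda>x. indicator (\<Union>i. A i) x - (\<Sum>i<n. indicator (A i) x) :: real) = indicator ((\<Union>i. A i) - (\<Union>i<n. A i))"
        unfolding ind[symmetric] by (auto simp: indicator_def fun_eq_iff)
      then have "(nrm M\<^sub>0 (\<lambda>x. indicator (\<Union>i. A i) x - (\<Sum>i<n. indicator (A i) x)))\<^sup>2 = measure M\<^sub>0 ((\<Union>i. A i) - (\<Union>i<n. A i))"
        using nrm_indicator[OF sets.Diff[OF Us fs]] by simp
      also have "\<dots> = measure M\<^sub>0 (\<Union>i. A i) - measure M\<^sub>0 (\<Union>i<n. A i)"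
        by (rule M0.finite_measure_Diff[OF Us fs]) auto
      also have "\<dots> < e\<^sup>2" using n by simp
      finally have "nrm M\<^sub>0 (\<lambda>x. indicator (\<Union>i. A i) x - (\<Sum>i<n. indicator (A i) x)) < e"
        using e by (simp add: power2_less_imp_less)
      moreover have "approximable (\<lambda>x. \<Sum>i<n. indicator (A i) x)" using union(3) by (intro approximable_sum) auto
      ultimately show "\<exists>h. approximable h \<and> nrm M\<^sub>0 (\<lambda>x. indicator (\<Union>i. A i) x - h x) < e" by blast
    qed
  qed
qed

lemma approximable_indicator: assumes C: "C \<in> sets M\<^sub>0" shows "approximable (indicator C)"
proof (rule approximable_cong_AE[OF approximable_indicator_PN[OF main_part_sets[OF C]]])
  obtain N' where N': "N' \<in> null_sets PN" "null_part PN C \<subseteq> N'" using null_part[OF C] by blast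
  have "{x \<in> space PN. \<not> (x \<in> main_part PN C \<longleftrightarrow> x \<in> C)} \<subseteq> N'" using main_part_null_part_Un[OF C] N' by blast
  then have "AE x in PN. x \<in> main_part PN C \<longleftrightarrow> x \<in> C" using N'(1) by (rule AE_I'[rotated])
  then show "AE x in M\<^sub>0. indicator (main_part PN C) x = indicator C x"
    by (rule AE_completion[THEN eventually_mono]) (simp add: indicator_def)
qed (use C in simp)

subsection \<open>Mixing\<close>

lemma hgt_less: "hgt j < hgt (Suc j)"
proof -
  have "2 * hgt j \<le> ncols j * hgt j" by (rule mult_le_mono1) simp
  then show ?thesis using hgt_growth[of j] hgt_pos[of j] by linarith
qed

lemma ex_stage: assumes "hgt j0 < m" shows "\<exists>j\<ge>j0. hgt j < m \<and> m \<le> hgt (Suc j)"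
proof -
  have "strict_mono hgt" by (rule strict_mono_Suc_iff[THEN iffD2]) (use hgt_less in auto)
  then have "m \<le> hgt m" by (rule strict_mono_imp_increasing)
  define k where "k = (LEAST k. m \<le> hgt k)"
  have k: "m \<le> hgt k" unfolding k_def by (rule LeastI[of _ m]) fact
  have l: "hgt i < m" if "i < k" for i using not_less_Least[of i "\<lambda>k. m \<le> hgt k"] that by (simp add: k_def)
  have "j0 < k"
  proof (rule ccontr)
    assume "\<not> j0 < k"
    then have "hgt k \<le> hgt j0" using strict_mono_less_eq[OF \<open>strict_mono hgt\<close>] by simp
    then show False using k assms by simp
  qed
  then obtain j where "k = Suc j" "j0 \<le> j" by (metis Suc_leD gr0_implies_Suc less_Suc_eq_le not_less_zero not_gr_zero)
  then show ?thesis using k l[of j] by auto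
qed

lemma level_corr_tendsto:
  assumes A: "A \<in> levels q" and B: "B \<in> levels q" shows "(\<lambda>m. mu (A \<inter> tpre m B)) \<longlonglongrightarrow> 0"
proof (rule LIMSEQ_I)
  fix e :: real assume e: "0 < e"
  obtain N :: nat where N: "mu A / e < real N" using reals_Archimedean2 by blast
  define j0 where "j0 = max q N"
  have "norm (mu (A \<inter> tpre m B) - 0) < e" if m: "Suc (hgt j0) \<le> m" for m
  proof -
    obtain j where j: "j \<ge> j0" "hgt j < m" "m \<le> hgt (Suc j)" using ex_stage[of j0 m] m by auto
    have "mu (A \<inter> tpre m B) \<le> mu A / ncols j"
      by (rule level_shift_bound[OF _ _ j(2,3)]) (use A B levels_mono[of q j] j(1) in \<open>auto simp: j0_def\<close>)
    also have "\<dots> < e"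
    proof -
      have "real N < real (ncols j)" using j(1) by (simp add: j0_def ncols_def)
      then have "mu A / e < real (ncols j)" using N by linarith
      then show ?thesis using e by (simp add: field_simps)
    qed
    finally show ?thesis by simp
  qed
  then show "\<exists>no. \<forall>n\<ge>no. norm (mu (A \<inter> tpre n B) - 0) < e" by blast
qed

lemma void_ind_corr: assumes A: "A \<in> FM" and B: "B \<in> FM"
  shows "(\<integral>x. void_ind A x * void_ind B ((PP ^^ n) x) \<partial>M\<^sub>0) = exp (- mu A - mu B + mu (A \<inter> tpre n B))"
proof -
  note t = tpre_FM[OF B, of n]
  have "(\<integral>x. void_ind A x * void_ind B ((PP ^^ n) x) \<partial>M\<^sub>0) = (\<integral>x. void_ind (A \<union> tpre n B) x \<partial>M\<^sub>0)"
  proof (rule integral_cong_AE)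
    show "AE x in M\<^sub>0. void_ind A x * void_ind B ((PP ^^ n) x) = void_ind (A \<union> tpre n B) x"
      using shift_counts[OF B, of n] by eventually_elim (simp add: void_ind_mult)
  qed (use void_ind_M0[OF A] void_ind_M0[OF FM_Un[OF A t(1)]] mp_meas[OF PPn_mp void_ind_M0[OF B], of n] in auto)
  also have "\<dots> = exp (- mu (A \<union> tpre n B))" by (rule void_ind_mean[OF FM_Un[OF A t(1)]])
  also have "mu (A \<union> tpre n B) = mu A + mu B - mu (A \<inter> tpre n B)"
    using measure_Un3[OF FM_lmeas[OF A] FM_lmeas[OF t(1)]] t(2) by simp
  finally show ?thesis by (simp add: algebra_simps)
qed

lemma void_span_mixing: assumes "f \<in> void_span" "g \<in> void_span"
  shows "(\<lambda>n. \<integral>x. f x * g ((PP ^^ n) x) \<partial>M\<^sub>0) \<longlonglongrightarrow> (\<integral>x. f x \<partial>M\<^sub>0) * (\<integral>x. g x \<partial>M\<^sub>0)"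
proof -
  obtain q F c where f: "finite F" "F \<subseteq> levels q" "f = (\<lambda>x. \<Sum>A\<in>F. c A * void_ind A x)" using assms(1) by (auto simp: void_span_def)
  obtain p G d where g: "finite G" "G \<subseteq> levels p" "g = (\<lambda>x. \<Sum>A\<in>G. d A * void_ind A x)" using assms(2) by (auto simp: void_span_def)
  have i: "integrable M\<^sub>0 (\<lambda>x. c A * void_ind A x)" if "A \<in> F" for A
    using that f(2) M0.sqi_integrable[OF sqi_scale[OF void_ind_sqi[OF levels_FM]]] by blast
  have i': "integrable M\<^sub>0 (\<lambda>x. d A * void_ind A x)" if "A \<in> G" for A
    using that g(2) M0.sqi_integrable[OF sqi_scale[OF void_ind_sqi[OF levels_FM]]] by blast
  have ii: "integrable M\<^sub>0 (\<lambda>x. (c A * d B) * (void_ind A x * void_ind B ((PP ^^ n) x)))" if "A \<in> F" "B \<in> G" for A B n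
    using that f(2) g(2) levels_FM by (intro integrable_mult_right sqi_mult void_ind_sqi mp_sqi[OF PPn_mp]) auto
  have "(\<integral>x. f x * g ((PP ^^ n) x) \<partial>M\<^sub>0) = (\<integral>x. (\<Sum>A\<in>F. \<Sum>B\<in>G. (c A * d B) * (void_ind A x * void_ind B ((PP ^^ n) x))) \<partial>M\<^sub>0)" for n
    by (rule Bochner_Integration.integral_cong) (auto simp: f(3) g(3) sum_product mult_ac)
  also have "\<And>n. \<dots> n = (\<Sum>A\<in>F. \<Sum>B\<in>G. (c A * d B) * (\<integral>x. void_ind A x * void_ind B ((PP ^^ n) x) \<partial>M\<^sub>0))"
    using ii by (subst Bochner_Integration.integral_sum, force, intro sum.cong refl, subst Bochner_Integration.integral_sum) auto
  also have "\<And>n. \<dots> n = (\<Sum>A\<in>F. \<Sum>B\<in>G. (c A * d B) * exp (- mu A - mu B + mu (A \<inter> tpre n B)))"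
    using void_ind_corr[OF levels_FM[OF subsetD[OF f(2)]] levels_FM[OF subsetD[OF g(2)]]] by simp
  finally have e: "(\<integral>x. f x * g ((PP ^^ n) x) \<partial>M\<^sub>0) = (\<Sum>A\<in>F. \<Sum>B\<in>G. (c A * d B) * exp (- mu A - mu B + mu (A \<inter> tpre n B)))" for n .
  have m: "(\<integral>x. f x \<partial>M\<^sub>0) = (\<Sum>A\<in>F. c A * exp (- mu A))"
    unfolding f(3) using i f(2) by (subst Bochner_Integration.integral_sum) (auto intro!: sum.cong simp: void_ind_mean levels_FM subset_iff)
  have m': "(\<integral>x. g x \<partial>M\<^sub>0) = (\<Sum>A\<in>G. d A * exp (- mu A))"
    unfolding g(3) using i' g(2) by (subst Bochner_Integration.integral_sum) (auto intro!: sum.cong simp: void_ind_mean levels_FM subset_iff)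
  have "(\<lambda>n. \<Sum>A\<in>F. \<Sum>B\<in>G. (c A * d B) * exp (- mu A - mu B + mu (A \<inter> tpre n B))) \<longlonglongrightarrow> (\<Sum>A\<in>F. \<Sum>B\<in>G. (c A * d B) * exp (- mu A - mu B + 0))"
  proof (intro tendsto_sum tendsto_mult tendsto_const tendsto_exp tendsto_add)
    fix A B assume "A \<in> F" "B \<in> G"
    then show "(\<lambda>n. mu (A \<inter> tpre n B)) \<longlonglongrightarrow> 0"
      using f(2) g(2) levels_mono[of q "max q p"] levels_mono[of p "max q p"] by (intro level_corr_tendsto[of _ "max q p"]) auto
  qed
  also have "(\<Sum>A\<in>F. \<Sum>B\<in>G. (c A * d B) * exp (- mu A - mu B + 0)) = (\<integral>x. f x \<partial>M\<^sub>0) * (\<integral>x. g x \<partial>M\<^sub>0)"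
    unfolding m m' sum_product by (intro sum.cong refl) (simp add: exp_diff exp_minus divide_inverse mult_ac)
  finally show ?thesis unfolding e .
qed

lemma approximable_mixing: assumes "approximable f" "approximable g"
  shows "(\<lambda>n. \<integral>x. f x * g ((PP ^^ n) x) \<partial>M\<^sub>0) \<longlonglongrightarrow> (\<integral>x. f x \<partial>M\<^sub>0) * (\<integral>x. g x \<partial>M\<^sub>0)"
proof (rule LIMSEQ_I)
  fix e :: real assume e: "0 < e"
  define K where "K = nrm M\<^sub>0 f + nrm M\<^sub>0 g + 1"
  have K: "1 \<le> K" by (simp add: K_def)
  define d where "d = min 1 (e / (6 * K))"
  have d: "0 < d" "d \<le> 1" "6 * K * d \<le> e" using e K by (auto simp: d_def min_def field_simps)
  obtain f' where f': "f' \<in> void_span" "nrm M\<^sub>0 (\<lambda>x. f x - f' x) < d" using assms(1) d unfolding approximable_def by blast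
  obtain g' where g': "g' \<in> void_span" "nrm M\<^sub>0 (\<lambda>x. g x - g' x) < d" using assms(2) d unfolding approximable_def by blast
  note s = approximable_sqi[OF assms(1)] approximable_sqi[OF assms(2)] void_span_sqi[OF f'(1)] void_span_sqi[OF g'(1)]
  have g'n: "nrm M\<^sub>0 g' \<le> K"
  proof -
    have "nrm M\<^sub>0 g' \<le> nrm M\<^sub>0 (\<lambda>x. g' x - g x) + nrm M\<^sub>0 g"
      using nrm_triangle[OF sqi_diff[OF s(4) s(2)] s(2)] by simp
    then show ?thesis
      using g'(2) d nrm_minus_commute[of M\<^sub>0 g g'] nrm_nonneg[of M\<^sub>0 f] unfolding K_def by linarith
  qed
  have fn: "nrm M\<^sub>0 f \<le> K" by (simp add: K_def)
  have cor: "\<bar>(\<integral>x. f x * g (T x) \<partial>M\<^sub>0) - (\<integral>x. f' x * g' (T x) \<partial>M\<^sub>0)\<bar> \<le> 2 * K * d" if T: "measure_preserving M\<^sub>0 T" for T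
  proof -
    note t = mp_sqi[OF T s(2)] mp_sqi[OF T s(4)] mp_sqi[OF T sqi_diff[OF s(2) s(4)]]
    have "(\<integral>x. f x * g (T x) \<partial>M\<^sub>0) - (\<integral>x. f' x * g' (T x) \<partial>M\<^sub>0)
       = (\<integral>x. f x * g (T x) - f' x * g' (T x) \<partial>M\<^sub>0)"
      using sqi_mult[OF s(1) t(1)] sqi_mult[OF s(3) t(2)] by simp
    also have "\<dots> = (\<integral>x. f x * (g (T x) - g' (T x)) + (f x - f' x) * g' (T x) \<partial>M\<^sub>0)"
      by (rule Bochner_Integration.integral_cong) (auto simp: algebra_simps)
    also have "\<dots> = (\<integral>x. f x * (g (T x) - g' (T x)) \<partial>M\<^sub>0) + (\<integral>x. (f x - f' x) * g' (T x) \<partial>M\<^sub>0)"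
      by (rule Bochner_Integration.integral_add[OF sqi_mult[OF s(1) t(3)] sqi_mult[OF sqi_diff[OF s(1,3)] t(2)]])
    finally have "\<bar>(\<integral>x. f x * g (T x) \<partial>M\<^sub>0) - (\<integral>x. f' x * g' (T x) \<partial>M\<^sub>0)\<bar>
      \<le> \<bar>\<integral>x. f x * (g (T x) - g' (T x)) \<partial>M\<^sub>0\<bar> + \<bar>\<integral>x. (f x - f' x) * g' (T x) \<partial>M\<^sub>0\<bar>" by linarith
    also have "\<dots> \<le> nrm M\<^sub>0 f * nrm M\<^sub>0 (\<lambda>x. g x - g' x) + nrm M\<^sub>0 (\<lambda>x. f x - f' x) * nrm M\<^sub>0 g'"
      using nrm_CS[OF s(1) t(3)] nrm_CS[OF sqi_diff[OF s(1,3)] t(2)] mp_nrm[OF T s(4)] mp_nrm[OF T sqi_diff[OF s(2) s(4)]]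
      by (intro add_mono) auto
    also have "\<dots> \<le> K * d + d * K" using f'(2) g'(2) g'n fn K d by (intro add_mono mult_mono) auto
    finally show ?thesis by simp
  qed
  have mean: "\<bar>(\<integral>x. f x \<partial>M\<^sub>0) * (\<integral>x. g x \<partial>M\<^sub>0) - (\<integral>x. f' x \<partial>M\<^sub>0) * (\<integral>x. g' x \<partial>M\<^sub>0)\<bar> \<le> 2 * K * d"
  proof -
    have a: "\<bar>(\<integral>x. f x \<partial>M\<^sub>0) - (\<integral>x. f' x \<partial>M\<^sub>0)\<bar> \<le> d" "\<bar>(\<integral>x. g x \<partial>M\<^sub>0) - (\<integral>x. g' x \<partial>M\<^sub>0)\<bar> \<le> d"
      using M0.integral_le_nrm[OF sqi_diff[OF s(1,3)]] M0.integral_le_nrm[OF sqi_diff[OF s(2,4)]] f'(2) g'(2)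
        M0.sqi_integrable[OF s(1)] M0.sqi_integrable[OF s(2)] M0.sqi_integrable[OF s(3)] M0.sqi_integrable[OF s(4)] by auto
    have b: "\<bar>\<integral>x. f x \<partial>M\<^sub>0\<bar> \<le> K" "\<bar>\<integral>x. g' x \<partial>M\<^sub>0\<bar> \<le> K"
      using M0.integral_le_nrm[OF s(1)] M0.integral_le_nrm[OF s(4)] fn g'n by auto
    have "(\<integral>x. f x \<partial>M\<^sub>0) * (\<integral>x. g x \<partial>M\<^sub>0) - (\<integral>x. f' x \<partial>M\<^sub>0) * (\<integral>x. g' x \<partial>M\<^sub>0)
      = (\<integral>x. f x \<partial>M\<^sub>0) * ((\<integral>x. g x \<partial>M\<^sub>0) - (\<integral>x. g' x \<partial>M\<^sub>0)) + ((\<integral>x. f x \<partial>M\<^sub>0) - (\<integral>x. f' x \<partial>M\<^sub>0)) * (\<integral>x. g' x \<partial>M\<^sub>0)"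
      by (simp add: algebra_simps)
    also have "\<bar>\<dots>\<bar> \<le> \<bar>\<integral>x. f x \<partial>M\<^sub>0\<bar> * \<bar>(\<integral>x. g x \<partial>M\<^sub>0) - (\<integral>x. g' x \<partial>M\<^sub>0)\<bar> + \<bar>(\<integral>x. f x \<partial>M\<^sub>0) - (\<integral>x. f' x \<partial>M\<^sub>0)\<bar> * \<bar>\<integral>x. g' x \<partial>M\<^sub>0\<bar>"
      unfolding abs_mult[symmetric] by (rule abs_triangle_ineq)
    also have "\<dots> \<le> K * d + d * K" using a b d K by (intro add_mono mult_mono) auto
    finally show ?thesis by simp
  qed
  have "0 < K * d" using K d by simp
  then obtain no where no: "\<forall>n\<ge>no. norm ((\<integral>x. f' x * g' ((PP ^^ n) x) \<partial>M\<^sub>0) - (\<integral>x. f' x \<partial>M\<^sub>0) * (\<integral>x. g' x \<partial>M\<^sub>0)) < K * d"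
    using LIMSEQ_D[OF void_span_mixing[OF f'(1) g'(1)]] by blast
  have "norm ((\<integral>x. f x * g ((PP ^^ n) x) \<partial>M\<^sub>0) - (\<integral>x. f x \<partial>M\<^sub>0) * (\<integral>x. g x \<partial>M\<^sub>0)) < e" if "no \<le> n" for n
  proof -
    have "norm ((\<integral>x. f' x * g' ((PP ^^ n) x) \<partial>M\<^sub>0) - (\<integral>x. f' x \<partial>M\<^sub>0) * (\<integral>x. g' x \<partial>M\<^sub>0)) < K * d" using no that by blast
    then show ?thesis using cor[OF PPn_mp[of n]] mean d(3) \<open>0 < K * d\<close> by (simp only: real_norm_def mult.assoc)
  qed
  then show "\<exists>no. \<forall>n\<ge>no. norm ((\<integral>x. f x * g ((PP ^^ n) x) \<partial>M\<^sub>0) - (\<integral>x. f x \<partial>M\<^sub>0) * (\<integral>x. g x \<partial>M\<^sub>0)) < e" by blast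
qed

lemma mixing_PP: "mixing M\<^sub>0 PP"
  unfolding mixing_def
proof (intro ballI)
  fix C C' assume C: "C \<in> sets M\<^sub>0" "C' \<in> sets M\<^sub>0"
  have m: "(\<integral>x. indicator D x \<partial>M\<^sub>0) = measure M\<^sub>0 D" if "D \<in> sets M\<^sub>0" for D
    using that sets.sets_into_space[OF that] by (simp add: Int_absorb2)
  have "(\<integral>x. indicator C x * indicator C' ((PP ^^ n) x) \<partial>M\<^sub>0) = (measure M\<^sub>0 (C \<inter> ((PP ^^ n) -` C' \<inter> space M\<^sub>0)) :: real)" for n
  proof -
    have s: "(PP ^^ n) -` C' \<inter> space M\<^sub>0 \<in> sets M\<^sub>0"
      using PPn_mp[of n] C(2) measurable_sets unfolding measure_preserving_def by blast
    have "(\<integral>x. indicator C x * indicator C' ((PP ^^ n) x) \<partial>M\<^sub>0) = (\<integral>x. (indicator (C \<inter> ((PP ^^ n) -` C' \<inter> space M\<^sub>0)) x :: real) \<partial>M\<^sub>0)"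
      by (rule Bochner_Integration.integral_cong) (auto simp: indicator_def)
    then show ?thesis using m[OF sets.Int[OF C(1) s]] by simp
  qed
  then show "(\<lambda>n. measure M\<^sub>0 (C \<inter> ((PP ^^ n) -` C' \<inter> space M\<^sub>0))) \<longlonglongrightarrow> measure M\<^sub>0 C * measure M\<^sub>0 C'"
    using approximable_mixing[OF approximable_indicator[OF C(1)] approximable_indicator[OF C(2)]] m[OF C(1)] m[OF C(2)] by simp
qed

section \<open>Functions with the autocorrelations of a count\<close>

subsection \<open>Isolating the first chaos\<close>

definition column_pairs :: "nat \<Rightarrow> (nat \<times> nat) set" where "column_pairs j = {(a, b). a < b \<and> b < ncols j}"

definition column_diff :: "nat \<Rightarrow> nat \<times> nat \<Rightarrow> nat" where "column_diff j p = colpos j (snd p) - colpos j (fst p)"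

definition nat_dist :: "nat \<Rightarrow> nat \<Rightarrow> nat" where "nat_dist m n = (if m \<le> n then n - m else m - n)"

definition is_column_diff :: "nat \<Rightarrow> nat \<Rightarrow> bool" where "is_column_diff j n \<longleftrightarrow> n \<in> column_diff j ` column_pairs j"

lemma column_pairs_Sigma: "column_pairs j = prod.swap ` (SIGMA b:{..<ncols j}. {..<b})"
  by (force simp: column_pairs_def image_iff)

lemma column_pairs_finite [simp]: "finite (column_pairs j)" unfolding column_pairs_Sigma by simp

lemma column_pairs_card: "real (card (column_pairs j)) = real (ncols j) * (real (ncols j) - 1) / 2"
proof -
  have "card (column_pairs j) = card (SIGMA b:{..<ncols j}. {..<b})"
    unfolding column_pairs_Sigma by (rule card_image) (auto simp: inj_on_def)
  also have "\<dots> = (\<Sum>b<ncols j. b)" by simp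
  finally have "real (card (column_pairs j)) = (\<Sum>b<ncols j. real b)" by simp
  also have "(\<Sum>b<n. real b) = real n * (real n - 1) / 2" for n by (induct n) (auto simp: field_simps)
  finally show ?thesis .
qed

lemma column_diff_add: "p \<in> column_pairs j \<Longrightarrow> colpos j (snd p) = colpos j (fst p) + column_diff j p"
  using colpos_less[of "fst p" "snd p" j] by (auto simp: column_pairs_def column_diff_def)

lemma colpos_powers: "colpos j a + colpos j b + colpos j c = colpos j x + colpos j y + colpos j z \<Longrightarrow>
  {#a, b, c#} = {#x, y, z#}"
proof -
  assume "colpos j a + colpos j b + colpos j c = colpos j x + colpos j y + colpos j z"
  then have "real (colpos j a) + real (colpos j b) + real (colpos j c) = real (colpos j x) + real (colpos j y) + real (colpos j z)"
    by (simp only: of_nat_add[symmetric])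
  then have "2 * real (hgt j) * (4 ^ a + 4 ^ b + 4 ^ c) = 2 * real (hgt j) * (4 ^ x + 4 ^ y + 4 ^ z)"
    unfolding colpos_real by (simp add: algebra_simps)
  then have "(4::real) ^ a + 4 ^ b + 4 ^ c = 4 ^ x + 4 ^ y + 4 ^ z" using hgt_pos[of j] by simp
  then have "real (4 ^ a + 4 ^ b + 4 ^ c) = real (4 ^ x + 4 ^ y + 4 ^ z)" by simp
  then have "(4::nat) ^ a + 4 ^ b + 4 ^ c = 4 ^ x + 4 ^ y + 4 ^ z" by (simp only: of_nat_eq_iff)
  then show ?thesis by (intro powers4_unique) (auto simp: add_ac)
qed

lemma column_diff_inj: assumes p: "p \<in> column_pairs j" "q \<in> column_pairs j" and e: "column_diff j p = column_diff j q" shows "p = q"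
proof -
  have "colpos j (snd p) + colpos j (fst q) + colpos j 0 = colpos j (snd q) + colpos j (fst p) + colpos j 0"
    using column_diff_add[OF p(1)] column_diff_add[OF p(2)] e by simp
  from colpos_powers[OF this] have "{#snd p, fst q#} = {#snd q, fst p#}" by (simp add: add_mset_commute)
  moreover have "fst p \<noteq> snd p" using p by (auto simp: column_pairs_def)
  ultimately have "snd p = snd q \<and> fst q = fst p" by (auto simp: add_eq_conv_ex)
  then show ?thesis by (simp add: prod_eq_iff)
qed

lemma is_column_diff_share_aux:
  assumes p: "p \<in> column_pairs j" "q \<in> column_pairs j" and le: "column_diff j p \<le> column_diff j q" and d: "is_column_diff j (column_diff j q - column_diff j p)"
  shows "fst p = fst q \<or> snd p = snd q"
proof -
  obtain z where z: "z \<in> column_pairs j" "column_diff j q - column_diff j p = column_diff j z" using d by (auto simp: is_column_diff_def)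
  have "colpos j (snd q) + colpos j (fst p) + colpos j (fst z) = colpos j (fst q) + colpos j (snd p) + colpos j (snd z)"
    using column_diff_add[OF p(1)] column_diff_add[OF p(2)] column_diff_add[OF z(1)] z(2) le by simp
  from colpos_powers[OF this] have m: "{#snd q, fst p, fst z#} = {#fst q, snd p, snd z#}" .
  have "snd q \<in># {#fst q, snd p, snd z#}" "fst p \<in># {#fst q, snd p, snd z#}" unfolding m[symmetric] by auto
  then have a: "snd q = snd p \<or> snd q = snd z" "fst p = fst q \<or> fst p = snd z" using p by (auto simp: column_pairs_def)
  show ?thesis
  proof (rule ccontr)
    assume n: "\<not> ?thesis"
    then have "snd q = snd z" "fst p = snd z" using a by auto
    then have "{#fst p, fst z#} = {#fst q, snd p#}" using m by (simp add: add_mset_commute)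
    then have "fst p \<in># {#fst q, snd p#}" by (metis union_single_eq_member add_mset_add_single)
    then show False using n p by (auto simp: column_pairs_def)
  qed
qed

lemma is_column_diff_share:
  assumes "p \<in> column_pairs j" "q \<in> column_pairs j" "is_column_diff j (nat_dist (column_diff j p) (column_diff j q))"
  shows "fst p = fst q \<or> snd p = snd q"
  using is_column_diff_share_aux[of p j q] is_column_diff_share_aux[of q j p] assms by (auto simp: nat_dist_def split: if_splits)

lemma column_diff_dvd: "2 * hgt j dvd column_diff j p" unfolding column_diff_def using colpos_dvd by (intro dvd_diff_nat)

lemma column_diff_le: "p \<in> column_pairs j \<Longrightarrow> column_diff j p \<le> hgt (Suc j)"
  using column_diff_add[of p j] colpos_end[of "snd p" j] by (auto simp: column_pairs_def)

lemma column_diff_pos: "p \<in> column_pairs j \<Longrightarrow> 0 < column_diff j p"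
  using column_diff_add[of p j] colpos_less[of "fst p" "snd p" j] by (auto simp: column_pairs_def)

definition autocorr :: "(real set \<Rightarrow> real) \<Rightarrow> nat \<Rightarrow> real" where
  "autocorr g n = (\<integral>x. g ((PP ^^ n) x) * g x \<partial>M\<^sub>0)"

lemma autocorr_0: "autocorr g 0 = (nrm M\<^sub>0 g)\<^sup>2" by (simp only: autocorr_def nrm_sq' funpow_0)

lemma PP_add: "(PP ^^ (m + n)) x = (PP ^^ m) ((PP ^^ n) x)" by (simp add: funpow_add)

lemma autocorr_pair: assumes g: "sqi M\<^sub>0 g"
  shows "(\<integral>x. g ((PP ^^ m) x) * g ((PP ^^ n) x) \<partial>M\<^sub>0) = autocorr g (nat_dist m n)"
proof -
  have *: "(\<integral>x. g ((PP ^^ m) x) * g ((PP ^^ n) x) \<partial>M\<^sub>0) = autocorr g (m - n)" if "n \<le> m" for m n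
  proof -
    have "(\<integral>x. g ((PP ^^ (m - n)) ((PP ^^ n) x)) * g ((PP ^^ n) x) \<partial>M\<^sub>0) = autocorr g (m - n)"
      unfolding autocorr_def
      by (rule mp_integral[OF PPn_mp, of "\<lambda>x. g ((PP ^^ (m - n)) x) * g x" n])
        (use g mp_meas[OF PPn_mp, of g "m - n"] in \<open>auto simp: sqi_def\<close>)
    then show ?thesis using PP_add[of "m - n" n] that by simp
  qed
  show ?thesis using *[of n m] *[of m n] by (cases "n \<le> m") (auto simp: nat_dist_def mult.commute)
qed

lemma nrm_sum_shift: assumes g: "sqi M\<^sub>0 g"
  shows "(nrm M\<^sub>0 (\<lambda>x. \<Sum>p\<in>I. g ((PP ^^ k p) x)))\<^sup>2 = (\<Sum>p\<in>I. \<Sum>q\<in>I. autocorr g (nat_dist (k p) (k q)))"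
proof -
  have i: "integrable M\<^sub>0 (\<lambda>x. g ((PP ^^ k p) x) * g ((PP ^^ k q) x))" for p q
    by (intro sqi_mult mp_sqi[OF PPn_mp] g)
  have "(nrm M\<^sub>0 (\<lambda>x. \<Sum>p\<in>I. g ((PP ^^ k p) x)))\<^sup>2 = (\<integral>x. (\<Sum>p\<in>I. \<Sum>q\<in>I. g ((PP ^^ k p) x) * g ((PP ^^ k q) x)) \<partial>M\<^sub>0)"
    unfolding nrm_sq' by (simp add: sum_product)
  also have "\<dots> = (\<Sum>p\<in>I. \<Sum>q\<in>I. (\<integral>x. g ((PP ^^ k p) x) * g ((PP ^^ k q) x) \<partial>M\<^sub>0))"
    using i by (simp add: Bochner_Integration.integral_sum)
  finally show ?thesis by (simp only: autocorr_pair[OF g])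
qed

definition corr_stage :: "nat \<Rightarrow> (real set \<Rightarrow> real) \<Rightarrow> real \<Rightarrow> bool" where
  "corr_stage j g \<theta> \<longleftrightarrow> (\<forall>n. 0 < n \<longrightarrow> 2 * hgt j dvd n \<longrightarrow> n \<le> hgt (Suc j) \<longrightarrow>
     autocorr g n = (if is_column_diff j n then \<theta> else 0))"

lemma corr_double_sum:
  assumes c: "corr_stage j g \<theta>"
  shows "(\<Sum>p\<in>column_pairs j. \<Sum>q\<in>column_pairs j. autocorr g (nat_dist (column_diff j p) (column_diff j q)))
    \<le> (real (ncols j))\<^sup>2 * (autocorr g 0 / 2 + real (ncols j) * \<bar>\<theta>\<bar>)"
proof -
  let ?r = "real (ncols j)"
  have row: "(\<Sum>q\<in>column_pairs j. autocorr g (nat_dist (column_diff j p) (column_diff j q))) \<le> autocorr g 0 + 2 * ?r * \<bar>\<theta>\<bar>" if p: "p \<in> column_pairs j" for p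
  proof -
    let ?S = "{q \<in> column_pairs j. fst p = fst q \<or> snd p = snd q}"
    have "(\<Sum>q\<in>column_pairs j. autocorr g (nat_dist (column_diff j p) (column_diff j q))) \<le> (\<Sum>q\<in>column_pairs j. (if q = p then autocorr g 0 else 0) + (if q \<in> ?S then \<bar>\<theta>\<bar> else 0))"
    proof (rule sum_mono)
      fix q assume q: "q \<in> column_pairs j"
      let ?n = "nat_dist (column_diff j p) (column_diff j q)"
      show "autocorr g ?n \<le> (if q = p then autocorr g 0 else 0) + (if q \<in> ?S then \<bar>\<theta>\<bar> else 0)"
      proof (cases "q = p")
        case True
        then show ?thesis by (simp add: nat_dist_def)
      next
        case False
        then have "column_diff j p \<noteq> column_diff j q" using column_diff_inj[OF p q] by auto
        then have "0 < ?n" by (auto simp: nat_dist_def)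
        moreover have "2 * hgt j dvd ?n" using column_diff_dvd by (auto simp: nat_dist_def intro!: dvd_diff_nat)
        moreover have "?n \<le> hgt (Suc j)" using column_diff_le[OF p] column_diff_le[OF q] by (auto simp: nat_dist_def)
        ultimately have "autocorr g ?n = (if is_column_diff j ?n then \<theta> else 0)" using c unfolding corr_stage_def by blast
        then show ?thesis using False q is_column_diff_share[OF p q] by auto
      qed
    qed
    also have "\<dots> = autocorr g 0 + real (card ?S) * \<bar>\<theta>\<bar>"
    proof -
      have "(\<Sum>q\<in>column_pairs j. if q \<in> ?S then \<bar>\<theta>\<bar> else 0) = (\<Sum>q\<in>?S. \<bar>\<theta>\<bar>)"
        by (rule sum.mono_neutral_cong_right) auto
      then show ?thesis using p by (simp add: sum.distrib sum.delta)
    qed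
    also have "card ?S \<le> 2 * ncols j"
    proof -
      have "?S \<subseteq> ({fst p} \<times> {..<ncols j}) \<union> ({..<ncols j} \<times> {snd p})" by (auto simp: column_pairs_def)
      then have "card ?S \<le> card (({fst p} \<times> {..<ncols j}) \<union> ({..<ncols j} \<times> {snd p}))" by (intro card_mono) auto
      also have "\<dots> \<le> card ({fst p} \<times> {..<ncols j}) + card ({..<ncols j} \<times> {snd p})" by (rule card_Un_le)
      finally show ?thesis by simp
    qed
    then have "autocorr g 0 + real (card ?S) * \<bar>\<theta>\<bar> \<le> autocorr g 0 + 2 * ?r * \<bar>\<theta>\<bar>" by (intro add_left_mono mult_right_mono) auto
    finally show ?thesis .
  qed
  have "(\<Sum>p\<in>column_pairs j. \<Sum>q\<in>column_pairs j. autocorr g (nat_dist (column_diff j p) (column_diff j q))) \<le> (\<Sum>p\<in>column_pairs j. autocorr g 0 + 2 * ?r * \<bar>\<theta>\<bar>)"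
    by (rule sum_mono) (rule row)
  also have "\<dots> = real (card (column_pairs j)) * (autocorr g 0 + 2 * ?r * \<bar>\<theta>\<bar>)" by simp
  also have "\<dots> \<le> (?r\<^sup>2 / 2) * (autocorr g 0 + 2 * ?r * \<bar>\<theta>\<bar>)"
    unfolding column_pairs_card by (intro mult_right_mono) (auto simp: autocorr_0 power2_eq_square field_simps)
  also have "\<dots> = ?r\<^sup>2 * (autocorr g 0 / 2 + ?r * \<bar>\<theta>\<bar>)" by (simp add: field_simps)
  finally show ?thesis .
qed

lemma corr_nrm:
  assumes g: "sqi M\<^sub>0 g" and c: "corr_stage j g \<theta>"
  shows "nrm M\<^sub>0 (\<lambda>x. \<Sum>p\<in>column_pairs j. g ((PP ^^ column_diff j p) x)) \<le> real (ncols j) * sqrt (autocorr g 0 / 2 + real (ncols j) * \<bar>\<theta>\<bar>)"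
    "nrm M\<^sub>0 (\<lambda>x. \<Sum>p\<in>column_pairs j. g ((PP ^^ (hgt (Suc j) - column_diff j p)) x)) \<le> real (ncols j) * sqrt (autocorr g 0 / 2 + real (ncols j) * \<bar>\<theta>\<bar>)"
proof -
  have r: "a \<le> real (ncols j) * sqrt (autocorr g 0 / 2 + real (ncols j) * \<bar>\<theta>\<bar>)"
    if "a\<^sup>2 \<le> (real (ncols j))\<^sup>2 * (autocorr g 0 / 2 + real (ncols j) * \<bar>\<theta>\<bar>)" for a
  proof (rule power2_le_imp_le)
    show "a\<^sup>2 \<le> (real (ncols j) * sqrt (autocorr g 0 / 2 + real (ncols j) * \<bar>\<theta>\<bar>))\<^sup>2"
      using that by (simp add: power_mult_distrib autocorr_0)
  qed (simp add: autocorr_0)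
  show "nrm M\<^sub>0 (\<lambda>x. \<Sum>p\<in>column_pairs j. g ((PP ^^ column_diff j p) x)) \<le> real (ncols j) * sqrt (autocorr g 0 / 2 + real (ncols j) * \<bar>\<theta>\<bar>)"
    by (rule r) (use corr_double_sum[OF c] nrm_sum_shift[OF g, of "column_diff j" "column_pairs j"] in simp)
  have "nat_dist (hgt (Suc j) - column_diff j p) (hgt (Suc j) - column_diff j q) = nat_dist (column_diff j p) (column_diff j q)" if "p \<in> column_pairs j" "q \<in> column_pairs j" for p q
    using column_diff_le[OF that(1)] column_diff_le[OF that(2)] by (auto simp: nat_dist_def)
  then have "(\<Sum>p\<in>column_pairs j. \<Sum>q\<in>column_pairs j. autocorr g (nat_dist (hgt (Suc j) - column_diff j p) (hgt (Suc j) - column_diff j q)))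
    = (\<Sum>p\<in>column_pairs j. \<Sum>q\<in>column_pairs j. autocorr g (nat_dist (column_diff j p) (column_diff j q)))" by (intro sum.cong refl) simp
  then show "nrm M\<^sub>0 (\<lambda>x. \<Sum>p\<in>column_pairs j. g ((PP ^^ (hgt (Suc j) - column_diff j p)) x)) \<le> real (ncols j) * sqrt (autocorr g 0 / 2 + real (ncols j) * \<bar>\<theta>\<bar>)"
    by (intro r) (use corr_double_sum[OF c] nrm_sum_shift[OF g, of "\<lambda>p. hgt (Suc j) - column_diff j p" "column_pairs j"] in simp)
qed

lemma corr_single_sum:
  assumes c: "corr_stage j g \<theta>"
  shows "(\<Sum>p\<in>column_pairs j. autocorr g (column_diff j p)) = real (ncols j) * (real (ncols j) - 1) / 2 * \<theta>"
proof -
  have "autocorr g (column_diff j p) = \<theta>" if p: "p \<in> column_pairs j" for p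
  proof -
    have "is_column_diff j (column_diff j p)" using p by (auto simp: is_column_diff_def)
    then show ?thesis using c column_diff_pos[OF p] column_diff_dvd column_diff_le[OF p] unfolding corr_stage_def by metis
  qed
  then have "(\<Sum>p\<in>column_pairs j. autocorr g (column_diff j p)) = real (card (column_pairs j)) * \<theta>" by simp
  then show ?thesis unfolding column_pairs_card .
qed

lemma levels_Int: "A \<in> levels j \<Longrightarrow> B \<in> levels j \<Longrightarrow> A \<inter> B \<in> levels j"
proof -
  assume "A \<in> levels j" "B \<in> levels j"
  then obtain L K where "L \<subseteq> {..<hgt j}" "A = {x \<in> tow j. pos j x \<in> L}"
    "K \<subseteq> {..<hgt j}" "B = {x \<in> tow j. pos j x \<in> K}" by (auto simp: levels_def)
  then show ?thesis unfolding levels_def by (intro CollectI exI[of _ "L \<inter> K"]) auto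
qed

lemma level_corr:
  assumes A: "A \<in> levels j" and B: "B \<in> levels j" and n: "0 < n" "2 * hgt j dvd n" "n \<le> hgt (Suc j)"
  shows "mu (A \<inter> tpre n B) = (if is_column_diff j n then mu (A \<inter> B) / real (ncols j) else 0)"
proof (cases "is_column_diff j n")
  case True
  then obtain a b where ab: "a < b" "b < ncols j" "n = colpos j b - colpos j a" by (auto simp: is_column_diff_def column_diff_def column_pairs_def)
  have "A \<inter> tpre n B = A \<inter> B \<inter> col j a" unfolding ab(3) by (rule level_shift_column[OF A B ab(1,2)])
  then show ?thesis using measure_level_col(1)[OF levels_Int[OF A B], of a] ab True by simp
next
  case False
  have "A \<inter> tpre n B = {}"
  proof (rule level_shift_empty[OF A B n(2,3)])
    fix x y assume xy: "x < ncols j" "y < ncols j"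
    show "colpos j y \<noteq> colpos j x + n"
    proof
      assume e: "colpos j y = colpos j x + n"
      then have "x < y" using n(1) colpos_less_iff[of j x y] by simp
      then have "n = column_diff j (x, y)" "(x, y) \<in> column_pairs j" using e xy by (auto simp: column_diff_def column_pairs_def)
      then show False using False by (auto simp: is_column_diff_def)
    qed
  qed
  then show ?thesis using False by simp
qed

lemma autocorr_ccount: assumes E: "E \<in> FM" shows "autocorr (ccount E) n = mu (E \<inter> tpre n E)"
proof -
  note t = tpre_FM[OF E, of n]
  have "autocorr (ccount E) n = (\<integral>x. ccount (tpre n E) x * ccount E x \<partial>M\<^sub>0)" unfolding autocorr_def
  proof (rule integral_cong_AE)
    show "AE x in M\<^sub>0. ccount E ((PP ^^ n) x) * ccount E x = ccount (tpre n E) x * ccount E x"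
      using shift_counts[OF E, of n] by eventually_elim (simp add: ccount_def t(2))
  qed (use ccount_sqi[OF E] ccount_sqi[OF t(1)] mp_meas[OF PPn_mp, of "ccount E" n] in \<open>auto simp: sqi_def\<close>)
  then show ?thesis using ccount_cov[OF t(1) E] by (simp add: Int_commute)
qed

definition centred_void :: "real set \<Rightarrow> real set \<Rightarrow> real" where "centred_void A x = void_ind A x - exp (- mu A)"

lemma centred_void_sqi: "A \<in> FM \<Longrightarrow> sqi M\<^sub>0 (centred_void A)"
  unfolding centred_void_def[abs_def] by (intro sqi_diff void_ind_sqi M0.sqi_const)

lemma centred_void_corr: assumes A: "A \<in> FM" and B: "B \<in> FM"
  shows "(\<integral>x. centred_void B ((PP ^^ n) x) * centred_void A x \<partial>M\<^sub>0) = exp (- mu A - mu B) * (exp (mu (A \<inter> tpre n B)) - 1)"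
proof -
  let ?VB = "\<lambda>x. void_ind B ((PP ^^ n) x)"
  have sB: "sqi M\<^sub>0 ?VB" by (rule mp_sqi[OF PPn_mp void_ind_sqi[OF B]])
  have iB: "(\<integral>x. ?VB x \<partial>M\<^sub>0) = exp (- mu B)" using mp_integral[OF PPn_mp void_ind_M0[OF B], of n] void_ind_mean[OF B] by simp
  have "(\<integral>x. centred_void B ((PP ^^ n) x) * centred_void A x \<partial>M\<^sub>0)
    = (\<integral>x. void_ind A x * ?VB x - exp (- mu B) * void_ind A x - exp (- mu A) * ?VB x + exp (- mu A) * exp (- mu B) \<partial>M\<^sub>0)"
    by (rule Bochner_Integration.integral_cong) (auto simp: centred_void_def algebra_simps)
  also have "\<dots> = (\<integral>x. void_ind A x * ?VB x \<partial>M\<^sub>0) - exp (- mu B) * (\<integral>x. void_ind A x \<partial>M\<^sub>0) - exp (- mu A) * (\<integral>x. ?VB x \<partial>M\<^sub>0) + exp (- mu A) * exp (- mu B)"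
    using sqi_mult[OF void_ind_sqi[OF A] sB] M0.sqi_integrable[OF void_ind_sqi[OF A]] M0.sqi_integrable[OF sB] M0.prob_space by simp
  also have "\<dots> = exp (- mu A - mu B) * (exp (mu (A \<inter> tpre n B)) - 1)"
    unfolding void_ind_corr[OF A B] void_ind_mean[OF A] iB by (simp add: exp_add exp_diff exp_minus field_simps)
  finally show ?thesis .
qed

lemma centred_void_ccount: assumes A: "A \<in> FM" and B: "B \<in> FM"
  shows "(\<integral>x. centred_void A x * ccount B x \<partial>M\<^sub>0) = - exp (- mu A) * mu (A \<inter> B)"
proof -
  have "(\<integral>x. centred_void A x * ccount B x \<partial>M\<^sub>0) = (\<integral>x. void_ind A x * ccount B x - exp (- mu A) * ccount B x \<partial>M\<^sub>0)"
    by (rule Bochner_Integration.integral_cong) (auto simp: centred_void_def algebra_simps)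
  also have "\<dots> = - exp (- mu A) * mu (A \<inter> B)"
    using sqi_mult[OF void_ind_sqi[OF A] ccount_sqi[OF B]] M0.sqi_integrable[OF ccount_sqi[OF B]] void_ind_ccount[OF A B] ccount_mean[OF B] by simp
  finally show ?thesis .
qed

lemma exp_scaled_limit: assumes "0 \<le> c" shows "(\<lambda>j. real (ncols j) * (exp (c / real (ncols j)) - 1)) \<longlonglongrightarrow> c"
proof (rule tendsto_sandwich[of "\<lambda>_. c" _ _ "\<lambda>j. c * exp (c / real (ncols j))"])
  have "c \<le> real (ncols j) * (exp (c / real (ncols j)) - 1)" for j
  proof -
    have "c / real (ncols j) \<le> exp (c / real (ncols j)) - 1"
      using exp_ge_add_one_self[of "c / real (ncols j)"] by linarith
    then have "real (ncols j) * (c / real (ncols j)) \<le> real (ncols j) * (exp (c / real (ncols j)) - 1)"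
      by (rule mult_left_mono) simp
    then show ?thesis by simp
  qed
  then show "\<forall>\<^sub>F j in sequentially. c \<le> real (ncols j) * (exp (c / real (ncols j)) - 1)" by simp
  have "real (ncols j) * (exp (c / real (ncols j)) - 1) \<le> c * exp (c / real (ncols j))" for j
  proof -
    define t where "t = c / real (ncols j)"
    have "exp t * (1 - t) \<le> exp t * exp (- t)" using exp_ge_add_one_self[of "- t"] by (intro mult_left_mono) auto
    then have "exp t - 1 \<le> t * exp t" by (simp add: algebra_simps flip: exp_add)
    then have "real (ncols j) * (exp t - 1) \<le> real (ncols j) * (t * exp t)" by (intro mult_left_mono) auto
    then show ?thesis by (simp add: t_def)
  qed
  then show "\<forall>\<^sub>F j in sequentially. real (ncols j) * (exp (c / real (ncols j)) - 1) \<le> c * exp (c / real (ncols j))" by simp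
  have "(\<lambda>j. c / real (ncols j)) \<longlonglongrightarrow> 0"
    unfolding ncols_def by (rule LIMSEQ_ignore_initial_segment) (rule lim_const_over_n)
  then have "(\<lambda>j. c * exp (c / real (ncols j))) \<longlonglongrightarrow> c * exp 0" by (intro tendsto_intros)
  then show "(\<lambda>j. c * exp (c / real (ncols j))) \<longlonglongrightarrow> c" by simp
qed simp

locale cylinder =
  fixes q :: nat and F :: "real set set" and c :: "real set \<Rightarrow> real"
  assumes fin: "finite F" and lev: "F \<subseteq> levels q"
begin

definition g where "g x = (\<Sum>A\<in>F. c A * centred_void A x)"
definition L where "L x = (\<Sum>A\<in>F. - (c A * exp (- mu A)) * ccount A x)"
definition K where "K A B = c A * c B * exp (- mu A - mu B)"
definition \<theta> where "\<theta> j = (\<Sum>A\<in>F. \<Sum>B\<in>F. K A B * (exp (mu (A \<inter> B) / real (ncols j)) - 1))"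
definition \<Lambda> where "\<Lambda> = (\<Sum>A\<in>F. \<Sum>B\<in>F. K A B * mu (A \<inter> B))"

lemma FM: "A \<in> F \<Longrightarrow> A \<in> FM" using lev levels_FM by blast

lemma g_sqi: "sqi M\<^sub>0 g" unfolding g_def[abs_def] by (intro sqi_sum sqi_scale centred_void_sqi FM)
lemma L_sqi: "sqi M\<^sub>0 L" unfolding L_def[abs_def] by (intro sqi_sum sqi_scale ccount_sqi FM)

lemma double_integral:
  assumes "\<And>A. A \<in> F \<Longrightarrow> sqi M\<^sub>0 (u A)" "\<And>A. A \<in> F \<Longrightarrow> sqi M\<^sub>0 (v A)"
  shows "(\<integral>x. (\<Sum>A\<in>F. a A * u A x) * (\<Sum>A\<in>F. b A * v A x) \<partial>M\<^sub>0) = (\<Sum>A\<in>F. \<Sum>B\<in>F. a A * b B * (\<integral>x. u A x * v B x \<partial>M\<^sub>0))"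
proof -
  have i: "integrable M\<^sub>0 (\<lambda>x. a A * b B * (u A x * v B x))" if "A \<in> F" "B \<in> F" for A B
    by (intro integrable_mult_right sqi_mult assms that)
  have "(\<integral>x. (\<Sum>A\<in>F. a A * u A x) * (\<Sum>A\<in>F. b A * v A x) \<partial>M\<^sub>0) = (\<integral>x. (\<Sum>A\<in>F. \<Sum>B\<in>F. a A * b B * (u A x * v B x)) \<partial>M\<^sub>0)"
    by (rule Bochner_Integration.integral_cong) (auto simp: sum_product mult_ac)
  also have "\<dots> = (\<Sum>A\<in>F. (\<integral>x. (\<Sum>B\<in>F. a A * b B * (u A x * v B x)) \<partial>M\<^sub>0))"
    by (rule Bochner_Integration.integral_sum) (intro Bochner_Integration.integrable_sum i)
  also have "\<dots> = (\<Sum>A\<in>F. \<Sum>B\<in>F. (\<integral>x. a A * b B * (u A x * v B x) \<partial>M\<^sub>0))"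
    by (intro sum.cong refl Bochner_Integration.integral_sum i)
  finally show ?thesis by simp
qed

lemma autocorr_g: "autocorr g n = (\<Sum>A\<in>F. \<Sum>B\<in>F. K A B * (exp (mu (B \<inter> tpre n A)) - 1))"
proof -
  have "autocorr g n = (\<Sum>A\<in>F. \<Sum>B\<in>F. c A * c B * (\<integral>x. centred_void A ((PP ^^ n) x) * centred_void B x \<partial>M\<^sub>0))"
    unfolding autocorr_def g_def by (rule double_integral) (intro mp_sqi[OF PPn_mp] centred_void_sqi FM; assumption)+
  then show ?thesis unfolding K_def using centred_void_corr FM by (auto intro!: sum.cong simp: mult_ac add_ac)
qed

lemma corr_g: assumes "q \<le> j" shows "corr_stage j g (\<theta> j)"
  unfolding corr_stage_def
proof (intro allI impI)
  fix n assume n: "0 < n" "2 * hgt j dvd n" "n \<le> hgt (Suc j)"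
  have l: "A \<in> levels j" if "A \<in> F" for A using that lev levels_mono[OF assms] by blast
  have "autocorr g n = (\<Sum>A\<in>F. \<Sum>B\<in>F. K A B * (exp (if is_column_diff j n then mu (B \<inter> A) / real (ncols j) else 0) - 1))"
    unfolding autocorr_g by (intro sum.cong refl) (simp only: level_corr[OF l l n])
  then show "autocorr g n = (if is_column_diff j n then \<theta> j else 0)" by (simp add: \<theta>_def Int_commute)
qed

lemma \<Lambda>_eq: "\<Lambda> = (nrm M\<^sub>0 L)\<^sup>2" "\<Lambda> = (\<integral>x. g x * L x \<partial>M\<^sub>0)"
proof -
  have "(nrm M\<^sub>0 L)\<^sup>2 = (\<Sum>A\<in>F. \<Sum>B\<in>F. (- (c A * exp (- mu A))) * (- (c B * exp (- mu B))) * (\<integral>x. ccount A x * ccount B x \<partial>M\<^sub>0))"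
    unfolding nrm_sq' L_def by (rule double_integral) (intro ccount_sqi FM; assumption)+
  also have "\<dots> = \<Lambda>" unfolding \<Lambda>_def K_def by (intro sum.cong refl) (simp add: ccount_cov FM exp_diff exp_minus field_simps)
  finally show "\<Lambda> = (nrm M\<^sub>0 L)\<^sup>2" by simp
  have "(\<integral>x. g x * L x \<partial>M\<^sub>0) = (\<Sum>A\<in>F. \<Sum>B\<in>F. c A * (- (c B * exp (- mu B))) * (\<integral>x. centred_void A x * ccount B x \<partial>M\<^sub>0))"
    unfolding g_def L_def by (rule double_integral) (intro ccount_sqi centred_void_sqi FM; assumption)+
  also have "\<dots> = \<Lambda>" unfolding \<Lambda>_def K_def
    by (intro sum.cong refl, subst centred_void_ccount[OF FM FM]) (auto simp: exp_diff exp_minus field_simps)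
  finally show "\<Lambda> = (\<integral>x. g x * L x \<partial>M\<^sub>0)" by simp
qed

lemma nrm_g_L: "(nrm M\<^sub>0 (\<lambda>x. g x - L x))\<^sup>2 = (nrm M\<^sub>0 g)\<^sup>2 - \<Lambda>"
  using nrm_quadratic[OF g_sqi L_sqi, of "-1"] \<Lambda>_eq by simp

lemma \<Lambda>_le: "0 \<le> \<Lambda>" "\<Lambda> \<le> (nrm M\<^sub>0 g)\<^sup>2"
proof -
  show "0 \<le> \<Lambda>" by (simp add: \<Lambda>_eq(1))
  have "0 \<le> (nrm M\<^sub>0 (\<lambda>x. g x - L x))\<^sup>2" by simp
  then show "\<Lambda> \<le> (nrm M\<^sub>0 g)\<^sup>2" unfolding nrm_g_L by simp
qed

lemma \<theta>_limit: "(\<lambda>j. real (ncols j) * \<theta> j) \<longlonglongrightarrow> \<Lambda>"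
proof -
  have "(\<lambda>j. \<Sum>A\<in>F. \<Sum>B\<in>F. K A B * (real (ncols j) * (exp (mu (A \<inter> B) / real (ncols j)) - 1))) \<longlonglongrightarrow> \<Lambda>"
    unfolding \<Lambda>_def by (intro tendsto_sum tendsto_mult tendsto_const exp_scaled_limit) simp
  then show ?thesis unfolding \<theta>_def sum_distrib_left by (simp only: mult.left_commute)
qed

end

lemma average_ip:
  assumes h: "sqi M\<^sub>0 h"
  shows "(\<integral>x. (\<Sum>p\<in>I. h ((PP ^^ k p) x)) * h x \<partial>M\<^sub>0) = (\<Sum>p\<in>I. autocorr h (k p))"
proof -
  have i: "integrable M\<^sub>0 (\<lambda>x. h ((PP ^^ k p) x) * h x)" for p by (intro sqi_mult mp_sqi[OF PPn_mp] h)
  have "(\<integral>x. (\<Sum>p\<in>I. h ((PP ^^ k p) x)) * h x \<partial>M\<^sub>0) = (\<integral>x. (\<Sum>p\<in>I. h ((PP ^^ k p) x) * h x) \<partial>M\<^sub>0)"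
    by (simp only: sum_distrib_right)
  also have "\<dots> = (\<Sum>p\<in>I. \<integral>x. h ((PP ^^ k p) x) * h x \<partial>M\<^sub>0)" by (rule Bochner_Integration.integral_sum) (rule i)
  finally show ?thesis by (simp only: autocorr_def)
qed

lemma average_adjoint:
  assumes u: "sqi M\<^sub>0 u" and g: "sqi M\<^sub>0 g" and k: "\<And>p. p \<in> I \<Longrightarrow> k p \<le> D"
  shows "(\<integral>x. (\<Sum>p\<in>I. u ((PP ^^ k p) x)) * g x \<partial>M\<^sub>0) = (\<integral>x. u ((PP ^^ D) x) * (\<Sum>p\<in>I. g ((PP ^^ (D - k p)) x)) \<partial>M\<^sub>0)"
proof -
  have i: "integrable M\<^sub>0 (\<lambda>x. u ((PP ^^ m) x) * g ((PP ^^ n) x))" for m n by (intro sqi_mult mp_sqi[OF PPn_mp] u g)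
  have "(\<integral>x. u ((PP ^^ k p) x) * g x \<partial>M\<^sub>0) = (\<integral>x. u ((PP ^^ D) x) * g ((PP ^^ (D - k p)) x) \<partial>M\<^sub>0)" if "p \<in> I" for p
  proof -
    have "(\<integral>x. u ((PP ^^ k p) ((PP ^^ (D - k p)) x)) * g ((PP ^^ (D - k p)) x) \<partial>M\<^sub>0) = (\<integral>x. u ((PP ^^ k p) x) * g x \<partial>M\<^sub>0)"
      by (rule mp_integral[OF PPn_mp, of "\<lambda>x. u ((PP ^^ k p) x) * g x"])
        (use g mp_meas[OF PPn_mp, of u "k p"] u in \<open>auto simp: sqi_def\<close>)
    then show ?thesis using PP_add[of "k p" "D - k p"] k[OF that] by simp
  qed
  note e = this
  have "(\<integral>x. (\<Sum>p\<in>I. u ((PP ^^ k p) x)) * g x \<partial>M\<^sub>0) = (\<Sum>p\<in>I. \<integral>x. u ((PP ^^ k p) x) * g x \<partial>M\<^sub>0)"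
    unfolding sum_distrib_right by (rule Bochner_Integration.integral_sum) (use i[of _ 0] in simp)
  also have "\<dots> = (\<Sum>p\<in>I. \<integral>x. u ((PP ^^ D) x) * g ((PP ^^ (D - k p)) x) \<partial>M\<^sub>0)" by (rule sum.cong[OF refl e])
  also have "\<dots> = (\<integral>x. u ((PP ^^ D) x) * (\<Sum>p\<in>I. g ((PP ^^ (D - k p)) x)) \<partial>M\<^sub>0)"
    unfolding sum_distrib_left by (rule Bochner_Integration.integral_sum[symmetric]) (rule i)
  finally show ?thesis .
qed

context cylinder
begin

lemma stage_comparison:
  assumes h: "sqi M\<^sub>0 h" and d: "nrm M\<^sub>0 (\<lambda>x. h x - g x) \<le> d" and j: "q \<le> j" and c: "corr_stage j h t"
  defines "r \<equiv> real (ncols j)"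
  shows "\<bar>r * (r - 1) / 2 * t - r * (r - 1) / 2 * \<theta> j\<bar>
    \<le> d * (r * sqrt (autocorr h 0 / 2 + r * \<bar>t\<bar>)) + d * (r * sqrt (autocorr g 0 / 2 + r * \<bar>\<theta> j\<bar>))"
proof -
  let ?u = "\<lambda>x. h x - g x" and ?I = "column_pairs j" and ?k = "column_diff j" and ?D = "hgt (Suc j)"
  have u: "sqi M\<^sub>0 ?u" by (rule sqi_diff[OF h g_sqi])
  have s: "sqi M\<^sub>0 (\<lambda>x. \<Sum>p\<in>?I. f ((PP ^^ k p) x))" if "sqi M\<^sub>0 f" for f k
    by (intro sqi_sum mp_sqi[OF PPn_mp] that)
  have d0: "0 \<le> d" using d nrm_nonneg order_trans by blast
  have "r * (r - 1) / 2 * t - r * (r - 1) / 2 * \<theta> j = (\<Sum>p\<in>?I. autocorr h (?k p)) - (\<Sum>p\<in>?I. autocorr g (?k p))"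
    unfolding r_def corr_single_sum[OF c] corr_single_sum[OF corr_g[OF j]] ..
  also have "\<dots> = (\<integral>x. (\<Sum>p\<in>?I. h ((PP ^^ ?k p) x)) * h x \<partial>M\<^sub>0) - (\<integral>x. (\<Sum>p\<in>?I. g ((PP ^^ ?k p) x)) * g x \<partial>M\<^sub>0)"
    unfolding average_ip[OF h] average_ip[OF g_sqi] ..
  also have "\<dots> = (\<integral>x. (\<Sum>p\<in>?I. h ((PP ^^ ?k p) x)) * h x - (\<Sum>p\<in>?I. g ((PP ^^ ?k p) x)) * g x \<partial>M\<^sub>0)"
    using sqi_mult[OF s[OF h] h] sqi_mult[OF s[OF g_sqi] g_sqi] by simp
  also have "\<dots> = (\<integral>x. (\<Sum>p\<in>?I. h ((PP ^^ ?k p) x)) * ?u x + (\<Sum>p\<in>?I. ?u ((PP ^^ ?k p) x)) * g x \<partial>M\<^sub>0)"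
    by (rule Bochner_Integration.integral_cong) (auto simp: algebra_simps sum_subtractf)
  also have "\<dots> = (\<integral>x. (\<Sum>p\<in>?I. h ((PP ^^ ?k p) x)) * ?u x \<partial>M\<^sub>0) + (\<integral>x. (\<Sum>p\<in>?I. ?u ((PP ^^ ?k p) x)) * g x \<partial>M\<^sub>0)"
    by (rule Bochner_Integration.integral_add[OF sqi_mult[OF s[OF h] u] sqi_mult[OF s[OF u] g_sqi]])
  finally have "\<bar>r * (r - 1) / 2 * t - r * (r - 1) / 2 * \<theta> j\<bar>
    \<le> \<bar>\<integral>x. (\<Sum>p\<in>?I. h ((PP ^^ ?k p) x)) * ?u x \<partial>M\<^sub>0\<bar> + \<bar>\<integral>x. (\<Sum>p\<in>?I. ?u ((PP ^^ ?k p) x)) * g x \<partial>M\<^sub>0\<bar>" by linarith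
  also have "\<bar>\<integral>x. (\<Sum>p\<in>?I. h ((PP ^^ ?k p) x)) * ?u x \<partial>M\<^sub>0\<bar> \<le> nrm M\<^sub>0 (\<lambda>x. \<Sum>p\<in>?I. h ((PP ^^ ?k p) x)) * nrm M\<^sub>0 ?u"
    by (rule nrm_CS[OF s[OF h] u])
  also have "\<dots> \<le> (r * sqrt (autocorr h 0 / 2 + r * \<bar>t\<bar>)) * d"
    unfolding r_def by (rule mult_mono[OF corr_nrm(1)[OF h c] d]) (auto simp: autocorr_0)
  also have "(\<integral>x. (\<Sum>p\<in>?I. ?u ((PP ^^ ?k p) x)) * g x \<partial>M\<^sub>0) = (\<integral>x. ?u ((PP ^^ ?D) x) * (\<Sum>p\<in>?I. g ((PP ^^ (?D - ?k p)) x)) \<partial>M\<^sub>0)"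
    by (rule average_adjoint[OF u g_sqi column_diff_le])
  also have "\<bar>\<dots>\<bar> \<le> nrm M\<^sub>0 (\<lambda>x. ?u ((PP ^^ ?D) x)) * nrm M\<^sub>0 (\<lambda>x. \<Sum>p\<in>?I. g ((PP ^^ (?D - ?k p)) x))"
    by (rule nrm_CS[OF mp_sqi[OF PPn_mp u] s[OF g_sqi]])
  also have "nrm M\<^sub>0 (\<lambda>x. ?u ((PP ^^ ?D) x)) = nrm M\<^sub>0 ?u" by (rule mp_nrm[OF PPn_mp u])
  also have "nrm M\<^sub>0 ?u * nrm M\<^sub>0 (\<lambda>x. \<Sum>p\<in>?I. g ((PP ^^ (?D - ?k p)) x)) \<le> d * (r * sqrt (autocorr g 0 / 2 + r * \<bar>\<theta> j\<bar>))"
    unfolding r_def by (rule mult_mono[OF d corr_nrm(2)[OF g_sqi corr_g[OF j]] d0]) simp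
  finally show ?thesis by (simp add: mult.commute)
qed

lemma limit_comparison:
  assumes h: "sqi M\<^sub>0 h" and d: "nrm M\<^sub>0 (\<lambda>x. h x - g x) \<le> d"
    and c: "\<And>j. q0 \<le> j \<Longrightarrow> corr_stage j h (lam / real (ncols j))" and l: "autocorr h 0 = lam"
  shows "\<bar>lam - \<Lambda>\<bar> / 2 \<le> d * sqrt (3 / 2 * lam) + d * sqrt ((nrm M\<^sub>0 g)\<^sup>2 / 2 + \<Lambda>)"
proof (rule LIMSEQ_le)
  define r where "r j = real (ncols j)" for j
  have r: "0 < r j" for j by (simp add: r_def)
  have l0: "0 \<le> lam" unfolding l[symmetric] autocorr_0 by simp
  have ratio: "(\<lambda>j. (r j - 1) / r j) \<longlonglongrightarrow> 1"
  proof -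
    have "(\<lambda>j. 1 - 1 / real (ncols j)) \<longlonglongrightarrow> 1 - 0"
      unfolding ncols_def by (intro tendsto_diff tendsto_const LIMSEQ_ignore_initial_segment[OF lim_const_over_n])
    then show ?thesis using r by (simp add: r_def diff_divide_distrib)
  qed
  have th: "(\<lambda>j. r j * \<theta> j) \<longlonglongrightarrow> \<Lambda>" unfolding r_def by (rule \<theta>_limit)
  show "(\<lambda>j. \<bar>(r j - 1) / r j * lam - (r j - 1) / r j * (r j * \<theta> j)\<bar> / 2) \<longlonglongrightarrow> \<bar>lam - \<Lambda>\<bar> / 2"
  proof -
    have "(\<lambda>j. \<bar>(r j - 1) / r j * lam - (r j - 1) / r j * (r j * \<theta> j)\<bar> / 2) \<longlonglongrightarrow> \<bar>1 * lam - 1 * \<Lambda>\<bar> / 2"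
      by (intro tendsto_intros ratio th) auto
    then show ?thesis by simp
  qed
  have "(\<lambda>j. d * sqrt (3 / 2 * lam) + d * sqrt ((nrm M\<^sub>0 g)\<^sup>2 / 2 + \<bar>r j * \<theta> j\<bar>)) \<longlonglongrightarrow> d * sqrt (3 / 2 * lam) + d * sqrt ((nrm M\<^sub>0 g)\<^sup>2 / 2 + \<bar>\<Lambda>\<bar>)"
    by (intro tendsto_intros th)
  then show "(\<lambda>j. d * sqrt (3 / 2 * lam) + d * sqrt ((nrm M\<^sub>0 g)\<^sup>2 / 2 + \<bar>r j * \<theta> j\<bar>)) \<longlonglongrightarrow> d * sqrt (3 / 2 * lam) + d * sqrt ((nrm M\<^sub>0 g)\<^sup>2 / 2 + \<Lambda>)"
    using \<Lambda>_le(1) by simp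
  show "\<exists>N. \<forall>j\<ge>N. \<bar>(r j - 1) / r j * lam - (r j - 1) / r j * (r j * \<theta> j)\<bar> / 2 \<le> d * sqrt (3 / 2 * lam) + d * sqrt ((nrm M\<^sub>0 g)\<^sup>2 / 2 + \<bar>r j * \<theta> j\<bar>)"
  proof (intro exI[of _ "max q q0"] allI impI)
    fix j assume j: "max q q0 \<le> j"
    then have "q \<le> j" "q0 \<le> j" by auto
    from stage_comparison[OF h d this(1) c[OF this(2)]]
    have "\<bar>r j * (r j - 1) / 2 * (lam / r j) - r j * (r j - 1) / 2 * \<theta> j\<bar>
      \<le> d * (r j * sqrt (lam / 2 + r j * \<bar>lam / r j\<bar>)) + d * (r j * sqrt ((nrm M\<^sub>0 g)\<^sup>2 / 2 + r j * \<bar>\<theta> j\<bar>))"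
      by (simp only: r_def l autocorr_0[of g])
    also have "r j * \<bar>lam / r j\<bar> = lam" using r[of j] l0 by simp
    also have "lam / 2 + lam = 3 / 2 * lam" by simp
    also have "r j * \<bar>\<theta> j\<bar> = \<bar>r j * \<theta> j\<bar>" using r[of j] by (simp add: abs_mult)
    also have "r j * (r j - 1) / 2 * (lam / r j) - r j * (r j - 1) / 2 * \<theta> j
      = r j * (((r j - 1) / r j * lam - (r j - 1) / r j * (r j * \<theta> j)) / 2)" using r[of j] by (simp add: field_simps)
    also have "\<bar>\<dots>\<bar> = r j * (\<bar>(r j - 1) / r j * lam - (r j - 1) / r j * (r j * \<theta> j)\<bar> / 2)" using r[of j] by (simp add: abs_mult)
    also have "d * (r j * sqrt (3 / 2 * lam)) + d * (r j * sqrt ((nrm M\<^sub>0 g)\<^sup>2 / 2 + \<bar>r j * \<theta> j\<bar>))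
      = r j * (d * sqrt (3 / 2 * lam) + d * sqrt ((nrm M\<^sub>0 g)\<^sup>2 / 2 + \<bar>r j * \<theta> j\<bar>))" by (simp add: algebra_simps)
    finally show "\<bar>(r j - 1) / r j * lam - (r j - 1) / r j * (r j * \<theta> j)\<bar> / 2 \<le> d * sqrt (3 / 2 * lam) + d * sqrt ((nrm M\<^sub>0 g)\<^sup>2 / 2 + \<bar>r j * \<theta> j\<bar>)"
      using r[of j] by (simp only: mult_le_cancel_left_pos)
  qed
qed

end

text \<open>In the average over the column differences of a stage only the linear part \<open>L\<close> of a cylinder function survives.
  The autocorrelations of \<open>h\<close> make this average as large as it is for the count of \<open>E\<close>, so \<open>L\<close> carries almost all
  of the norm of an approximation of \<open>h\<close>.\<close>

lemma first_chaos:
  assumes h: "approximable h" "(\<integral>x. h x \<partial>M\<^sub>0) = 0" and E: "E \<in> levels q0"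
    and autocorr: "\<And>n. autocorr h n = mu (E \<inter> tpre n E)" and e: "0 < e"
  shows "\<exists>q F c. finite F \<and> F \<subseteq> levels q \<and> nrm M\<^sub>0 (\<lambda>x. h x - (\<Sum>A\<in>F. c A * ccount A x)) < e"
proof -
  define l where "l = mu E"
  define s where "s = sqrt l"
  have s: "0 \<le> s" "s\<^sup>2 = l" by (simp_all add: s_def l_def)
  have hs: "sqi M\<^sub>0 h" by (rule approximable_sqi[OF h(1)])
  have EF: "E \<in> FM" by (rule levels_FM[OF E])
  have "E \<inter> tpre 0 E = E" using levels_nonneg[OF E] by (auto simp: tpre_def)
  then have r0: "autocorr h 0 = l" using autocorr[of 0] by (simp add: l_def)
  have hn: "nrm M\<^sub>0 h = s" using r0 unfolding autocorr_0 s_def by (metis nrm_nonneg real_sqrt_unique)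
  define d where "d = min 1 (min (e / 4) (e\<^sup>2 / (44 * (s + 1))))"
  have s1: "0 < 44 * (s + 1)" using s by simp
  have d: "0 < d" "d \<le> 1" "d \<le> e / 4" "d \<le> e\<^sup>2 / (44 * (s + 1))"
    unfolding d_def using divide_pos_pos[OF zero_less_power[OF e, of 2] s1] e by (simp_all only: min_less_iff_conj min.cobounded1 min.coboundedI2) simp_all
  then have d: "0 < d" "d \<le> 1" "d \<le> e / 4" "d * (44 * (s + 1)) \<le> e\<^sup>2"
    unfolding pos_le_divide_eq[OF s1] by simp_all
  obtain g0 where g0: "g0 \<in> void_span" "nrm M\<^sub>0 (\<lambda>x. h x - g0 x) < d" using h(1) d(1) unfolding approximable_def by blast
  then obtain q F c where F: "finite F" "F \<subseteq> levels q" "g0 = (\<lambda>x. \<Sum>A\<in>F. c A * void_ind A x)" by (auto simp: void_span_def)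
  interpret cylinder q F c by unfold_locales (use F in auto)
  have gs: "sqi M\<^sub>0 g0" by (rule void_span_sqi[OF g0(1)])
  have mean: "(\<integral>x. g0 x \<partial>M\<^sub>0) = (\<Sum>A\<in>F. c A * exp (- mu A))"
  proof -
    have "integrable M\<^sub>0 (\<lambda>x. c A * void_ind A x)" if "A \<in> F" for A
      using M0.sqi_integrable[OF void_ind_sqi[OF FM[OF that]]] by simp
    then have "(\<integral>x. g0 x \<partial>M\<^sub>0) = (\<Sum>A\<in>F. \<integral>x. c A * void_ind A x \<partial>M\<^sub>0)" unfolding F(3) by (rule Bochner_Integration.integral_sum)
    then show ?thesis by (simp add: void_ind_mean FM)
  qed
  have gg: "g x = g0 x - (\<integral>x. g0 x \<partial>M\<^sub>0)" for x
    unfolding mean by (simp add: g_def F(3) centred_void_def right_diff_distrib sum_subtractf)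
  have hg: "nrm M\<^sub>0 (\<lambda>x. h x - g x) \<le> d"
  proof -
    have "(\<integral>x. h x - g0 x \<partial>M\<^sub>0) = - (\<integral>x. g0 x \<partial>M\<^sub>0)"
      using M0.sqi_integrable[OF hs] M0.sqi_integrable[OF gs] h(2) by simp
    then have "nrm M\<^sub>0 (\<lambda>x. h x - g x) \<le> nrm M\<^sub>0 (\<lambda>x. h x - g0 x)"
      using M0.nrm_centre[OF sqi_diff[OF hs gs]] by (simp add: gg algebra_simps)
    then show ?thesis using g0(2) by simp
  qed
  have gn: "nrm M\<^sub>0 g \<le> s + d"
    using nrm_triangle[OF sqi_diff[OF g_sqi hs] hs] hg nrm_minus_commute[of M\<^sub>0 h g] hn by simp
  have cs: "corr_stage j h (l / real (ncols j))" if "q0 \<le> j" for j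
  proof -
    have "E \<in> levels j" using E levels_mono[OF that] by blast
    then show ?thesis unfolding corr_stage_def autocorr l_def using level_corr[of E j E] by simp
  qed
  have cmp: "\<bar>l - \<Lambda>\<bar> / 2 \<le> d * sqrt (3 / 2 * l) + d * sqrt ((nrm M\<^sub>0 g)\<^sup>2 / 2 + \<Lambda>)"
    by (rule limit_comparison[OF hs hg cs r0])
  have a1: "sqrt (3 / 2 * l) \<le> 2 * (s + 1)"
  proof -
    have "3 / 2 * l \<le> (2 * s)\<^sup>2" unfolding power_mult_distrib s(2) by (simp add: l_def)
    then have "sqrt (3 / 2 * l) \<le> 2 * s" using s by (intro real_le_lsqrt) (auto simp: l_def)
    then show ?thesis by simp
  qed
  have a2: "sqrt ((nrm M\<^sub>0 g)\<^sup>2 / 2 + \<Lambda>) \<le> 2 * (s + 1)"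
  proof -
    have "(nrm M\<^sub>0 g)\<^sup>2 / 2 + \<Lambda> \<le> (2 * nrm M\<^sub>0 g)\<^sup>2" using \<Lambda>_le(2) zero_le_power2[of "nrm M\<^sub>0 g"] unfolding power_mult_distrib power2_eq_square[of "2::real"] by linarith
    then have "sqrt ((nrm M\<^sub>0 g)\<^sup>2 / 2 + \<Lambda>) \<le> 2 * nrm M\<^sub>0 g" by (intro real_le_lsqrt) auto
    moreover have "2 * nrm M\<^sub>0 g \<le> 2 * (s + 1)" using gn d(2) by simp
    ultimately show ?thesis by (rule order_trans)
  qed
  have "d * sqrt (3 / 2 * l) + d * sqrt ((nrm M\<^sub>0 g)\<^sup>2 / 2 + \<Lambda>) \<le> d * (2 * (s + 1)) + d * (2 * (s + 1))"
    using a1 a2 d(1) by (intro add_mono mult_left_mono) auto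
  then have "\<bar>l - \<Lambda>\<bar> / 2 \<le> d * (2 * (s + 1)) + d * (2 * (s + 1))" by (rule order_trans[OF cmp])
  then have "l - \<Lambda> \<le> 8 * d * (s + 1)" by (simp add: algebra_simps abs_le_iff)
  then have low: "l - 8 * d * (s + 1) \<le> \<Lambda>" by simp
  have "(nrm M\<^sub>0 (\<lambda>x. g x - L x))\<^sup>2 = (nrm M\<^sub>0 g)\<^sup>2 - \<Lambda>" by (rule nrm_g_L)
  also have "\<dots> \<le> (s + d)\<^sup>2 - l + 8 * d * (s + 1)"
    using gn low power_mono[OF gn, of 2] by simp
  also have "\<dots> = 2 * s * d + d * d + 8 * d * (s + 1)" unfolding s(2)[symmetric] by (simp add: power2_eq_square algebra_simps)
  also have "\<dots> \<le> 11 * (d * (s + 1))"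
  proof -
    have "d * d \<le> 1 * d" using d(1,2) by (intro mult_right_mono) auto
    moreover have "0 \<le> s * d" using s d(1) by simp
    moreover have "11 * (d * (s + 1)) - (2 * s * d + d * d + 8 * d * (s + 1)) = s * d + (1 * d - d * d) + 2 * d" by (simp add: algebra_simps)
    ultimately show ?thesis using d(1) by linarith
  qed
  also have "\<dots> \<le> (e / 2)\<^sup>2" using d(4) by (simp add: power_divide algebra_simps)
  finally have "nrm M\<^sub>0 (\<lambda>x. g x - L x) \<le> e / 2" by (rule power2_le_imp_le) (use e in simp)
  then have "nrm M\<^sub>0 (\<lambda>x. h x - L x) < e"
    using nrm_diff_triangle[OF hs g_sqi L_sqi] hg d(3) e by simp
  then show ?thesis unfolding L_def using F by (intro exI[of _ q] exI[of _ F] exI[of _ "\<lambda>A. - (c A * exp (- mu A))"]) simp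
qed

subsection \<open>Step functions\<close>

definition St :: "nat \<Rightarrow> (nat \<Rightarrow> real) \<Rightarrow> real set \<Rightarrow> real" where
  "St q \<phi> x = (\<Sum>l<hgt q. \<phi> l * ccount (flo q l) x)"

lemma flo_level: "l < hgt q \<Longrightarrow> flo q l \<in> levels q"
  unfolding levels_def using level_UN[of "{l}" q] by (intro CollectI exI[of _ "{l}"]) auto

lemma flo_FM: "l < hgt q \<Longrightarrow> flo q l \<in> FM" using flo_level levels_FM by blast

lemma flo_disjoint: "l < hgt q \<Longrightarrow> l' < hgt q \<Longrightarrow> l \<noteq> l' \<Longrightarrow> flo q l \<inter> flo q l' = {}"
  using flo_unique by blast

lemma UN_flo_level: "I \<subseteq> {..<hgt q} \<Longrightarrow> (\<Union>l\<in>I. flo q l) \<in> levels q"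
  unfolding levels_def using level_UN[of I q] by (intro CollectI exI[of _ I]) auto

lemma ccount_UN_floors:
  assumes "I \<subseteq> {..<hgt q}" shows "AE x in M\<^sub>0. ccount (\<Union>l\<in>I. flo q l) x = (\<Sum>l\<in>I. ccount (flo q l) x)"
proof -
  have "finite I" using assms finite_subset by blast
  then show ?thesis using assms
  proof (induct I rule: finite_induct)
    case empty
    then show ?case by (simp add: ccount_def cnt_def)
  next
    case (insert l I)
    have d: "flo q l \<inter> (\<Union>l\<in>I. flo q l) = {}" using flo_disjoint insert by fastforce
    have I: "(\<Union>l\<in>I. flo q l) \<in> FM" using UN_flo_level[of I q] levels_FM insert by blast
    have "AE x in M\<^sub>0. ccount (flo q l \<union> (\<Union>l\<in>I. flo q l)) x = ccount (flo q l) x + ccount (\<Union>l\<in>I. flo q l) x"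
      by (rule ccount_Un_disjoint[OF flo_FM I d]) (use insert in simp)
    moreover have "AE x in M\<^sub>0. ccount (\<Union>l\<in>I. flo q l) x = (\<Sum>l\<in>I. ccount (flo q l) x)" using insert by simp
    ultimately show ?case by eventually_elim (use insert in simp)
  qed
qed

lemma ccount_St:
  assumes "I \<subseteq> {..<hgt q}"
  shows "AE x in M\<^sub>0. ccount (\<Union>l\<in>I. flo q l) x = St q (indicator I) x"
  using ccount_UN_floors[OF assms]
proof eventually_elim
  case (elim x)
  have "(\<Sum>l\<in>I. ccount (flo q l) x) = (\<Sum>l<hgt q. indicator I l * ccount (flo q l) x)"
    by (rule sum.mono_neutral_cong_left) (use assms in \<open>auto simp: indicator_def\<close>)
  then show ?case using elim by (simp add: St_def)
qed

lemma level_St: assumes "A \<in> levels q" obtains I where "I \<subseteq> {..<hgt q}" "A = (\<Union>l\<in>I. flo q l)"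
  using assms level_UN unfolding levels_def by blast

lemma St_sqi: "sqi M\<^sub>0 (St q \<phi>)" unfolding St_def[abs_def] by (intro sqi_sum sqi_scale ccount_sqi flo_FM) simp

lemma St_diff: "St q \<phi> x - St q \<psi> x = St q (\<lambda>l. \<phi> l - \<psi> l) x"
  by (simp add: St_def left_diff_distrib sum_subtractf)

lemma St_nrm: "(nrm M\<^sub>0 (St q \<phi>))\<^sup>2 = width q * (\<Sum>l<hgt q. (\<phi> l)\<^sup>2)"
proof -
  have i: "integrable M\<^sub>0 (\<lambda>x. \<phi> l * \<phi> m * (ccount (flo q l) x * ccount (flo q m) x))" if "l < hgt q" "m < hgt q" for l m
    by (intro integrable_mult_right sqi_mult ccount_sqi flo_FM that)
  have "(nrm M\<^sub>0 (St q \<phi>))\<^sup>2 = (\<integral>x. (\<Sum>l<hgt q. \<Sum>m<hgt q. \<phi> l * \<phi> m * (ccount (flo q l) x * ccount (flo q m) x)) \<partial>M\<^sub>0)"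
    unfolding nrm_sq' St_def by (rule Bochner_Integration.integral_cong) (auto simp: sum_product mult_ac)
  also have "\<dots> = (\<Sum>l<hgt q. (\<integral>x. (\<Sum>m<hgt q. \<phi> l * \<phi> m * (ccount (flo q l) x * ccount (flo q m) x)) \<partial>M\<^sub>0))"
    by (rule Bochner_Integration.integral_sum) (intro Bochner_Integration.integrable_sum i; simp)
  also have "\<dots> = (\<Sum>l<hgt q. \<Sum>m<hgt q. (\<integral>x. \<phi> l * \<phi> m * (ccount (flo q l) x * ccount (flo q m) x) \<partial>M\<^sub>0))"
    by (intro sum.cong refl Bochner_Integration.integral_sum i) auto
  also have "\<dots> = (\<Sum>l<hgt q. \<Sum>m<hgt q. if m = l then width q * (\<phi> l)\<^sup>2 else 0)"
  proof (intro sum.cong refl)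
    fix l m assume lm: "l \<in> {..<hgt q}" "m \<in> {..<hgt q}"
    have "(\<integral>x. \<phi> l * \<phi> m * (ccount (flo q l) x * ccount (flo q m) x) \<partial>M\<^sub>0) = \<phi> l * \<phi> m * mu (flo q l \<inter> flo q m)"
      using ccount_cov[OF flo_FM flo_FM, of l q m q] lm by simp
    then show "(\<integral>x. \<phi> l * \<phi> m * (ccount (flo q l) x * ccount (flo q m) x) \<partial>M\<^sub>0) = (if m = l then width q * (\<phi> l)\<^sup>2 else 0)"
      using flo_disjoint[of l q m] lm flo_measure(2)[of q l] by (auto simp: power2_eq_square)
  qed
  also have "\<dots> = width q * (\<Sum>l<hgt q. (\<phi> l)\<^sup>2)" by (simp add: sum.delta sum_distrib_left)
  finally show ?thesis .
qed

lemma combination_St: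
  assumes F: "finite F" "F \<subseteq> levels q"
  shows "\<exists>\<phi>. AE x in M\<^sub>0. (\<Sum>A\<in>F. c A * ccount A x) = St q \<phi> x"
proof -
  have "\<exists>\<phi>. AE x in M\<^sub>0. c A * ccount A x = St q \<phi> x" if A: "A \<in> levels q" for A
  proof -
    obtain I where I: "I \<subseteq> {..<hgt q}" "A = (\<Union>l\<in>I. flo q l)" using level_St[OF A] .
    have "AE x in M\<^sub>0. c A * ccount A x = St q (\<lambda>l. c A * indicator I l) x"
      using ccount_St[OF I(1)]
    proof eventually_elim
      case (elim x)
      have "St q (\<lambda>l. c A * indicator I l) x = c A * St q (indicator I) x"
        by (simp only: St_def sum_distrib_left mult.assoc)
      then show ?case using elim I(2) by simp
    qed
    then show ?thesis by blast
  qed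
  then obtain \<phi> where \<phi>: "\<And>A. A \<in> levels q \<Longrightarrow> AE x in M\<^sub>0. c A * ccount A x = St q (\<phi> A) x" by metis
  have "AE x in M\<^sub>0. \<forall>A\<in>F. c A * ccount A x = St q (\<phi> A) x" using F \<phi> by (intro AE_finite_allI) auto
  then have "AE x in M\<^sub>0. (\<Sum>A\<in>F. c A * ccount A x) = St q (\<lambda>l. \<Sum>A\<in>F. \<phi> A l) x"
  proof eventually_elim
    case (elim x)
    then have "(\<Sum>A\<in>F. c A * ccount A x) = (\<Sum>A\<in>F. St q (\<phi> A) x)" by simp
    also have "\<dots> = St q (\<lambda>l. \<Sum>A\<in>F. \<phi> A l) x" unfolding St_def sum_distrib_right by (rule sum.swap)
    finally show ?case .
  qed
  then show ?thesis by blast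
qed

subsection \<open>Characteristic functions at pi\<close>

lemma sin_bounds: "\<bar>sin x - x\<bar> \<le> x\<^sup>2 / 2" "\<bar>sin x - x\<bar> \<le> \<bar>x\<bar> ^ 3 / 6" for x :: real
proof -
  have c: "sin_coeff 0 = (0::real)" "sin_coeff 1 = (1::real)" "sin_coeff 2 = (0::real)" by (simp_all add: sin_coeff_def)
  have "(\<Sum>m<2. sin_coeff m * x ^ m) = x" using c by (simp add: numeral_2_eq_2 lessThan_Suc)
  then show "\<bar>sin x - x\<bar> \<le> x\<^sup>2 / 2" using Maclaurin_sin_bound[of x 2] by (simp add: fact_numeral)
  have "(\<Sum>m<3. sin_coeff m * x ^ m) = x" using c by (simp add: numeral_3_eq_3 numeral_2_eq_2 lessThan_Suc)
  then show "\<bar>sin x - x\<bar> \<le> \<bar>x\<bar> ^ 3 / 6" using Maclaurin_sin_bound[of x 3] by (simp add: fact_numeral)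
qed

lemma pi_less_16_5: "pi < 16 / 5"
proof (rule ccontr)
  assume "\<not> ?thesis"
  then have "8 / 5 \<le> pi / 2" by simp
  then have pos: "0 \<le> cos (8 / 5 :: real)" by (intro cos_ge_zero) auto
  obtain t :: real where t: "cos (8/5) = (\<Sum>m<4. cos_coeff m * (8/5) ^ m) + (cos (t + 1/2 * real 4 * pi) / fact 4) * (8/5) ^ 4"
    using Maclaurin_cos_expansion[of "8/5" 4] by blast
  have "(\<Sum>m<4. cos_coeff m * (8/5) ^ m) = (1 - (8/5)\<^sup>2 / 2 :: real)"
  proof -
    have "{..<4} = {0, 1, 2, 3 :: nat}" by auto
    moreover have "cos_coeff 0 = (1 :: real)" "cos_coeff 1 = (0 :: real)" "cos_coeff 2 = (- 1 / 2 :: real)" "cos_coeff 3 = (0 :: real)"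
      by (simp_all add: cos_coeff_def fact_numeral)
    ultimately show ?thesis by simp
  qed
  moreover have "(cos (t + 1/2 * real 4 * pi) / fact 4) * (8/5) ^ 4 \<le> (1 / fact 4) * (8/5) ^ 4"
    by (intro mult_right_mono divide_right_mono cos_le_one) auto
  ultimately have "cos (8/5::real) \<le> 1 - (8/5)\<^sup>2 / 2 + (1 / fact 4) * (8/5) ^ 4" using t by linarith
  also have "\<dots> < 0" by (simp add: fact_numeral power2_eq_square eval_nat_numeral)
  finally show False using pos by simp
qed

text \<open>A nonnegative combination of \<open>x\<^sup>2\<close> and \<open>sin (\<pi> x) - \<pi> x\<close> that vanishes only at 0 and 1.\<close>

definition penalty :: "real \<Rightarrow> real" where "penalty x = x\<^sup>2 + (sin (pi * x) - pi * x) / pi"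

lemma penalty_flip: "penalty (1 - x) = penalty x"
proof -
  have "sin (pi * (1 - x)) = sin (pi * x)" by (simp add: right_diff_distrib)
  then show ?thesis by (simp add: penalty_def power2_eq_square field_simps)
qed

lemma penalty_lower_half: assumes "x \<le> 1 / 2" shows "x\<^sup>2 \<le> 8 * penalty x"
proof (cases "x \<le> 0")
  case True
  have "\<bar>sin (pi * x)\<bar> \<le> \<bar>pi * x\<bar>" by (rule abs_sin_x_le_abs_x)
  then have "pi * x \<le> sin (pi * x)" using True by (simp add: abs_mult abs_le_iff)
  then have "0 \<le> (sin (pi * x) - pi * x) / pi" by simp
  moreover have "x\<^sup>2 \<le> 8 * (x\<^sup>2 + y)" if "0 \<le> y" for y using zero_le_power2[of x] that by (simp add: distrib_left)
  ultimately show ?thesis unfolding penalty_def by blast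
next
  case False
  then have x: "0 < x" by simp
  have "\<bar>sin (pi * x) - pi * x\<bar> \<le> (pi * x) ^ 3 / 6" using sin_bounds(2)[of "pi * x"] x by (simp add: abs_mult)
  then have "- ((pi * x) ^ 3 / 6) \<le> sin (pi * x) - pi * x" by linarith
  then have "- ((pi * x) ^ 3 / 6) / pi \<le> (sin (pi * x) - pi * x) / pi" by (intro divide_right_mono) auto
  then have "x\<^sup>2 - ((pi * x) ^ 3 / 6) / pi \<le> penalty x" by (simp add: penalty_def)
  also have "((pi * x) ^ 3 / 6) / pi = pi\<^sup>2 * x * x\<^sup>2 / 6" by (simp add: power2_eq_square power3_eq_cube)
  finally have k: "x\<^sup>2 - pi\<^sup>2 * x * x\<^sup>2 / 6 \<le> penalty x" .
  have "pi\<^sup>2 \<le> (16 / 5)\<^sup>2" using pi_less_16_5 by (intro power_mono) auto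
  then have "pi\<^sup>2 * x \<le> (16 / 5)\<^sup>2 * (1 / 2)" using assms x by (intro mult_mono) auto
  then have "pi\<^sup>2 * x * x\<^sup>2 \<le> (16 / 5)\<^sup>2 * (1 / 2) * x\<^sup>2" by (intro mult_right_mono) auto
  moreover have "a \<le> 8 * b" if "c \<le> (16/5)\<^sup>2 * (1/2) * a" "a - c / 6 \<le> b" "0 \<le> a" for a b c :: real
    using that by (simp add: power2_eq_square)
  ultimately show ?thesis using k zero_le_power2 by blast
qed

lemma penalty_bound: "(x - (if 1 / 2 < x then 1 else 0))\<^sup>2 \<le> 8 * penalty x"
proof (cases "1 / 2 < x")
  case True
  then have "(1 - x)\<^sup>2 \<le> 8 * penalty (1 - x)" by (intro penalty_lower_half) simp
  then show ?thesis using True by (simp add: penalty_flip power2_commute)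
qed (simp add: penalty_lower_half)

definition cexpo :: "nat \<Rightarrow> (nat \<Rightarrow> real) \<Rightarrow> complex" where
  "cexpo q \<phi> = width q * (\<Sum>l<hgt q. cis (pi * \<phi> l) - 1 - \<i> * of_real (pi * \<phi> l))"

lemma Im_cexpo: "Im (cexpo q \<phi>) = width q * (\<Sum>l<hgt q. sin (pi * \<phi> l) - pi * \<phi> l)"
  by (simp add: cexpo_def)

lemma char_St: "(\<integral>x. cis (pi * St q \<phi> x) \<partial>M\<^sub>0) = exp (cexpo q \<phi>)"
proof -
  define u where "u l = cis (pi * \<phi> l)" for l
  have disj: "disjoint_family_on (flo q) {..<hgt q}" unfolding disjoint_family_on_def using flo_disjoint by blast
  have m: "(\<lambda>x. \<Prod>l<hgt q. u l ^ card (x \<inter> flo q l)) \<in> borel_measurable PN"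
    using power_card_measurable[OF flo_FM] by (intro borel_measurable_prod) (simp cong: measurable_cong_sets add: sets_PN)
  have g: "(\<integral>x. (\<Prod>l<hgt q. u l ^ card (x \<inter> flo q l)) \<partial>M\<^sub>0) = exp (\<Sum>l<hgt q. (u l - 1) * width q)"
    unfolding integral_completion[OF m] using gf[OF flo_FM disj, of u] by (simp add: u_def flo_measure)
  have e: "cis (pi * St q \<phi> x) = exp (- (\<i> * of_real (pi * (\<Sum>l<hgt q. \<phi> l * width q)))) * (\<Prod>l<hgt q. u l ^ card (x \<inter> flo q l))" for x
  proof -
    have cp: "cis (\<Sum>l\<in>I. f l) = (\<Prod>l\<in>I. cis (f l))" if "finite I" for I :: "nat set" and f :: "nat \<Rightarrow> real"
      using that by (induct I rule: finite_induct) (auto simp: cis_mult[symmetric])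
    have "pi * St q \<phi> x = - (pi * (\<Sum>l<hgt q. \<phi> l * width q)) + (\<Sum>l<hgt q. real (card (x \<inter> flo q l)) * (pi * \<phi> l))"
      by (simp add: St_def ccount_def cnt_def flo_measure sum_subtractf right_diff_distrib sum_distrib_left mult_ac)
    then have "cis (pi * St q \<phi> x) = cis (- (pi * (\<Sum>l<hgt q. \<phi> l * width q))) * (\<Prod>l<hgt q. cis (real (card (x \<inter> flo q l)) * (pi * \<phi> l)))"
      by (simp only: cis_mult[symmetric] cp[OF finite_lessThan])
    then show ?thesis unfolding u_def Complex.DeMoivre by (simp only: cis_conv_exp[of "- _"] of_real_minus mult_minus_right)
  qed
  have "(\<integral>x. cis (pi * St q \<phi> x) \<partial>M\<^sub>0) = exp (- (\<i> * of_real (pi * (\<Sum>l<hgt q. \<phi> l * width q)))) * exp (\<Sum>l<hgt q. (u l - 1) * width q)"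
    unfolding e using g by simp
  also have "\<dots> = exp (cexpo q \<phi>)"
    unfolding exp_add[symmetric] cexpo_def u_def
    by (rule arg_cong[of _ _ exp]) (simp add: sum_subtractf sum.distrib sum_distrib_left sum_distrib_right algebra_simps)
  finally show ?thesis .
qed

lemma cis_lipschitz: "norm (cis a - cis b) \<le> \<bar>a - b\<bar>"
proof -
  have "(norm (cis a - cis b))\<^sup>2 = (cos a - cos b)\<^sup>2 + (sin a - sin b)\<^sup>2" by (simp add: cmod_power2)
  also have "\<dots> = 2 - 2 * (cos a * cos b + sin a * sin b)"
    by (simp add: power2_diff sin_squared_eq algebra_simps)
  also have "cos a * cos b + sin a * sin b = cos (2 * ((a - b) / 2))" unfolding cos_diff[symmetric] by (rule arg_cong[of _ _ cos]) (simp add: field_simps)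
  also have "2 - 2 * cos (2 * ((a - b) / 2)) = (2 * sin ((a - b) / 2))\<^sup>2" unfolding cos_double_sin by (simp add: power2_eq_square)
  finally have "norm (cis a - cis b) = \<bar>2 * sin ((a - b) / 2)\<bar>" by (metis abs_norm_cancel power2_eq_iff_nonneg abs_ge_zero norm_ge_zero power2_abs)
  also have "\<dots> \<le> \<bar>a - b\<bar>" using abs_sin_x_le_abs_x[of "(a - b) / 2"] by (simp add: abs_mult)
  finally show ?thesis .
qed

lemma cis_integral_diff:
  assumes "sqi M\<^sub>0 f" "sqi M\<^sub>0 g"
  shows "norm ((\<integral>x. cis (pi * f x) \<partial>M\<^sub>0) - (\<integral>x. cis (pi * g x) \<partial>M\<^sub>0)) \<le> pi * nrm M\<^sub>0 (\<lambda>x. f x - g x)"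
proof -
  have cm: "(\<lambda>x. cis (pi * f x)) \<in> borel_measurable M\<^sub>0" if "sqi M\<^sub>0 f" for f
  proof -
    have [measurable]: "f \<in> borel_measurable M\<^sub>0" using that by (simp add: sqi_def)
    show ?thesis unfolding cis_conv_exp by measurable
  qed
  have ci: "integrable M\<^sub>0 (\<lambda>x. cis (pi * f x))" if "sqi M\<^sub>0 f" for f
    by (rule M0.integrable_const_bound[of _ 1]) (use cm[OF that] in auto)
  have d: "sqi M\<^sub>0 (\<lambda>x. f x - g x)" by (rule sqi_diff[OF assms])
  have da: "sqi M\<^sub>0 (\<lambda>x. \<bar>f x - g x\<bar>)" using d by (auto simp: sqi_def)
  have "(\<integral>x. cis (pi * f x) \<partial>M\<^sub>0) - (\<integral>x. cis (pi * g x) \<partial>M\<^sub>0) = (\<integral>x. cis (pi * f x) - cis (pi * g x) \<partial>M\<^sub>0)"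
    using ci assms by simp
  also have "norm \<dots> \<le> (\<integral>x. norm (cis (pi * f x) - cis (pi * g x)) \<partial>M\<^sub>0)" by (rule integral_norm_bound)
  also have "\<dots> \<le> (\<integral>x. pi * \<bar>f x - g x\<bar> \<partial>M\<^sub>0)"
  proof (rule integral_mono)
    show "integrable M\<^sub>0 (\<lambda>x. norm (cis (pi * f x) - cis (pi * g x)))" using ci assms by simp
    show "integrable M\<^sub>0 (\<lambda>x. pi * \<bar>f x - g x\<bar>)" using M0.sqi_integrable[OF da] by simp
    show "norm (cis (pi * f x) - cis (pi * g x)) \<le> pi * \<bar>f x - g x\<bar>" for x
      using cis_lipschitz[of "pi * f x" "pi * g x"] by (simp add: abs_mult flip: right_diff_distrib)
  qed
  also have "\<dots> = pi * (\<integral>x. \<bar>f x - g x\<bar> \<partial>M\<^sub>0)" by simp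
  also have "(\<integral>x. \<bar>f x - g x\<bar> \<partial>M\<^sub>0) \<le> nrm M\<^sub>0 (\<lambda>x. \<bar>f x - g x\<bar>)" using M0.integral_le_nrm[OF da] by simp
  also have "nrm M\<^sub>0 (\<lambda>x. \<bar>f x - g x\<bar>) = nrm M\<^sub>0 (\<lambda>x. f x - g x)" by (simp add: nrm_def)
  finally show ?thesis by simp
qed

lemma Ln_limit:
  assumes "(\<lambda>n. exp (z n)) \<longlonglongrightarrow> exp w" "\<And>n. n0 \<le> n \<Longrightarrow> \<bar>Im (z n)\<bar> < pi" "\<bar>Im w\<bar> < pi"
  shows "z \<longlonglongrightarrow> w"
proof -
  have "exp w \<notin> \<real>\<^sub>\<le>\<^sub>0"
  proof
    assume "exp w \<in> \<real>\<^sub>\<le>\<^sub>0"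
    then have i: "Re (exp w) \<le> 0" "Im (exp w) = 0" by (simp_all add: complex_nonpos_Reals_iff)
    moreover have "Re (exp w) \<noteq> 0" using i(2) by (metis complex_eqI exp_not_eq_zero zero_complex.sel)
    ultimately have "Im (Ln (exp w)) = pi" using Im_Ln_eq_pi[of "exp w"] by simp
    then show False using assms(3) by (simp add: abs_less_iff)
  qed
  then have "(\<lambda>n. Ln (exp (z n))) \<longlonglongrightarrow> Ln (exp w)" using assms(1) by (intro tendsto_Ln)
  moreover have "Ln (exp w) = w" using assms(3) by (intro Ln_exp) (auto simp: abs_less_iff)
  moreover have "\<forall>\<^sub>F n in sequentially. Ln (exp (z n)) = z n"
    unfolding eventually_sequentially
  proof (intro exI[of _ n0] allI impI)
    fix n assume "n0 \<le> n"
    then have "\<bar>Im (z n)\<bar> < pi" by (rule assms(2))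
    then show "Ln (exp (z n)) = z n" by (intro Ln_exp) (auto simp: abs_less_iff)
  qed
  ultimately show ?thesis using tendsto_cong[of "\<lambda>n. Ln (exp (z n))" z] by simp
qed

lemma count_limit:
  assumes E: "E \<in> levels q0" "mu E \<le> 1 / 10" and h: "sqi M\<^sub>0 h" "nrm M\<^sub>0 h = sqrt (mu E)"
    and ch: "(\<integral>x. cis (pi * h x) \<partial>M\<^sub>0) = (\<integral>x. cis (pi * ccount E x) \<partial>M\<^sub>0)"
    and span: "\<And>e. 0 < e \<Longrightarrow> \<exists>q F c. finite F \<and> F \<subseteq> levels q \<and> nrm M\<^sub>0 (\<lambda>x. h x - (\<Sum>A\<in>F. c A * ccount A x)) < e"
    and e: "0 < e"
  shows "\<exists>B\<in>FM. nrm M\<^sub>0 (\<lambda>x. h x - ccount B x) < e"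
proof -
  define l where "l = mu E"
  have l: "0 \<le> l" "l \<le> 1 / 10" using E(2) by (simp_all add: l_def)
  have "\<exists>q \<phi>. nrm M\<^sub>0 (\<lambda>x. h x - St q \<phi> x) < 1 / real (Suc n)" for n
  proof -
    obtain q F c where F: "finite F" "F \<subseteq> levels q" "nrm M\<^sub>0 (\<lambda>x. h x - (\<Sum>A\<in>F. c A * ccount A x)) < 1 / real (Suc n)"
      using span[of "1 / real (Suc n)"] by auto
    obtain \<phi> where \<phi>: "AE x in M\<^sub>0. (\<Sum>A\<in>F. c A * ccount A x) = St q \<phi> x" using combination_St[OF F(1,2)] by blast
    have "sqi M\<^sub>0 (\<lambda>x. \<Sum>A\<in>F. c A * ccount A x)" using F(2) levels_FM by (intro sqi_sum sqi_scale ccount_sqi) auto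
    then have "nrm M\<^sub>0 (\<lambda>x. h x - St q \<phi> x) = nrm M\<^sub>0 (\<lambda>x. h x - (\<Sum>A\<in>F. c A * ccount A x))"
      using \<phi> h(1) St_sqi[of q \<phi>] by (intro nrm_cong_AE) (auto simp: sqi_def)
    then show ?thesis using F(3) by (intro exI[of _ q] exI[of _ \<phi>]) (simp only:)
  qed
  then obtain q \<phi> where q: "\<And>n. nrm M\<^sub>0 (\<lambda>x. h x - St (q n) (\<phi> n) x) < 1 / real (Suc n)" by metis
  have lim0: "(\<lambda>n. nrm M\<^sub>0 (\<lambda>x. h x - St (q n) (\<phi> n) x)) \<longlonglongrightarrow> 0"
  proof (rule tendsto_sandwich[OF _ _ tendsto_const LIMSEQ_inverse_real_of_nat])
    show "\<forall>\<^sub>F n in sequentially. nrm M\<^sub>0 (\<lambda>x. h x - St (q n) (\<phi> n) x) \<le> inverse (real (Suc n))"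
      using q by (intro always_eventually allI less_imp_le) (simp add: inverse_eq_divide del: of_nat_Suc)
  qed simp
  have nlim: "(\<lambda>n. nrm M\<^sub>0 (St (q n) (\<phi> n))) \<longlonglongrightarrow> sqrt l"
  proof (rule LIM_zero_cancel, rule tendsto_rabs_zero_cancel, rule tendsto_sandwich[OF _ _ tendsto_const lim0])
    show "\<forall>\<^sub>F n in sequentially. \<bar>nrm M\<^sub>0 (St (q n) (\<phi> n)) - sqrt l\<bar> \<le> nrm M\<^sub>0 (\<lambda>x. h x - St (q n) (\<phi> n) x)"
    proof (intro always_eventually allI)
      fix n
      let ?S = "St (q n) (\<phi> n)"
      have "nrm M\<^sub>0 h \<le> nrm M\<^sub>0 (\<lambda>x. h x - ?S x) + nrm M\<^sub>0 ?S"
        using nrm_triangle[OF sqi_diff[OF h(1) St_sqi] St_sqi, of "q n" "\<phi> n" "q n" "\<phi> n"] by simp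
      moreover have "nrm M\<^sub>0 ?S \<le> nrm M\<^sub>0 (\<lambda>x. ?S x - h x) + nrm M\<^sub>0 h"
        using nrm_triangle[OF sqi_diff[OF St_sqi h(1)] h(1), of "q n" "\<phi> n"] by simp
      ultimately show "\<bar>nrm M\<^sub>0 ?S - sqrt l\<bar> \<le> nrm M\<^sub>0 (\<lambda>x. h x - ?S x)"
        using nrm_minus_commute[of M\<^sub>0 ?S h] h(2) by (simp add: l_def abs_le_iff)
    qed
  qed simp
  then have n2: "(\<lambda>n. (nrm M\<^sub>0 (St (q n) (\<phi> n)))\<^sup>2) \<longlonglongrightarrow> l" using tendsto_power[OF nlim, of 2] l by simp
  define w where "w = of_real l * (-2 - \<i> * of_real pi)"
  have wE: "(\<integral>x. cis (pi * ccount E x) \<partial>M\<^sub>0) = exp w"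
  proof -
    obtain I where I: "I \<subseteq> {..<hgt q0}" "E = (\<Union>l\<in>I. flo q0 l)" using level_St[OF E(1)] .
    have EF: "E \<in> FM" by (rule levels_FM[OF E(1)])
    have cm: "(\<lambda>x. cis (pi * f x)) \<in> borel_measurable M\<^sub>0" if "sqi M\<^sub>0 f" for f
    proof -
      have [measurable]: "f \<in> borel_measurable M\<^sub>0" using that by (simp add: sqi_def)
      show ?thesis unfolding cis_conv_exp by measurable
    qed
    have "(\<integral>x. cis (pi * ccount E x) \<partial>M\<^sub>0) = (\<integral>x. cis (pi * St q0 (indicator I) x) \<partial>M\<^sub>0)"
      by (rule integral_cong_AE) (use ccount_St[OF I(1)] I(2) cm[OF ccount_sqi[OF EF]] cm[OF St_sqi] in auto)
    also have "\<dots> = exp (cexpo q0 (indicator I))" by (rule char_St)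
    also have "cexpo q0 (indicator I) = w"
    proof -
      have fI: "finite I" using I(1) finite_subset by blast
      have "(\<Sum>l<hgt q0. cis (pi * indicator I l) - 1 - \<i> * of_real (pi * indicator I l)) = (\<Sum>l\<in>I. (-2 - \<i> * of_real pi))"
        by (rule sum.mono_neutral_cong_right) (use I(1) in \<open>auto simp: indicator_def cis.ctr complex_eq_iff\<close>)
      also have "\<dots> = of_nat (card I) * (-2 - \<i> * of_real pi)" by simp
      finally have "cexpo q0 (indicator I) = of_real (width q0 * card I) * (-2 - \<i> * of_real pi)" by (simp add: cexpo_def mult_ac)
      also have "width q0 * card I = l" unfolding l_def I(2) measure_flo_UN[OF I(1)] by simp
      finally show ?thesis by (simp add: w_def)
    qed
    finally show ?thesis .
  qed
  define z where "z n = cexpo (q n) (\<phi> n)" for n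
  have zl: "(\<lambda>n. exp (z n)) \<longlonglongrightarrow> exp w"
  proof (rule LIM_zero_cancel, rule tendsto_norm_zero_cancel, rule tendsto_sandwich[OF _ _ tendsto_const])
    show "(\<lambda>n. pi * nrm M\<^sub>0 (\<lambda>x. h x - St (q n) (\<phi> n) x)) \<longlonglongrightarrow> 0" using tendsto_mult_right_zero[OF lim0] by simp
    show "\<forall>\<^sub>F n in sequentially. norm (exp (z n) - exp w) \<le> pi * nrm M\<^sub>0 (\<lambda>x. h x - St (q n) (\<phi> n) x)"
      using cis_integral_diff[OF h(1) St_sqi] unfolding ch wE char_St z_def
      by (intro always_eventually allI) (simp add: norm_minus_commute)
  qed simp
  have Imz: "\<bar>Im (z n)\<bar> \<le> pi\<^sup>2 / 2 * (nrm M\<^sub>0 (St (q n) (\<phi> n)))\<^sup>2" for n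
  proof -
    have "\<bar>\<Sum>l<hgt (q n). sin (pi * \<phi> n l) - pi * \<phi> n l\<bar> \<le> (\<Sum>l<hgt (q n). \<bar>sin (pi * \<phi> n l) - pi * \<phi> n l\<bar>)" by (rule sum_abs)
    also have "\<dots> \<le> (\<Sum>l<hgt (q n). pi\<^sup>2 / 2 * (\<phi> n l)\<^sup>2)"
      by (rule sum_mono) (use sin_bounds(1)[of "pi * \<phi> n _"] in \<open>simp add: power_mult_distrib\<close>)
    finally have s: "\<bar>\<Sum>l<hgt (q n). sin (pi * \<phi> n l) - pi * \<phi> n l\<bar> \<le> pi\<^sup>2 / 2 * (\<Sum>l<hgt (q n). (\<phi> n l)\<^sup>2)" by (simp add: sum_distrib_left)
    have "\<bar>Im (z n)\<bar> = width (q n) * \<bar>\<Sum>l<hgt (q n). sin (pi * \<phi> n l) - pi * \<phi> n l\<bar>"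
      unfolding z_def Im_cexpo by (simp add: abs_mult less_imp_le)
    also have "\<dots> \<le> width (q n) * (pi\<^sup>2 / 2 * (\<Sum>l<hgt (q n). (\<phi> n l)\<^sup>2))" by (intro mult_left_mono s) (simp add: less_imp_le)
    finally show ?thesis unfolding St_nrm by (simp add: mult_ac)
  qed
  have "\<forall>\<^sub>F n in sequentially. (nrm M\<^sub>0 (St (q n) (\<phi> n)))\<^sup>2 < 2 / 10" using n2 l by (intro order_tendstoD(2)) auto
  then obtain n0 where n0: "\<And>n. n0 \<le> n \<Longrightarrow> (nrm M\<^sub>0 (St (q n) (\<phi> n)))\<^sup>2 < 2 / 10" by (auto simp: eventually_sequentially)
  have "z \<longlonglongrightarrow> w"
  proof (rule Ln_limit[OF zl])
    fix n assume "n0 \<le> n"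
    have "(nrm M\<^sub>0 (St (q n) (\<phi> n)))\<^sup>2 \<le> 2 / 10" using n0[OF \<open>n0 \<le> n\<close>] by simp
    then have "pi\<^sup>2 / 2 * (nrm M\<^sub>0 (St (q n) (\<phi> n)))\<^sup>2 \<le> pi\<^sup>2 / 2 * (2 / 10)" by (rule mult_left_mono) simp
    then have "\<bar>Im (z n)\<bar> \<le> pi\<^sup>2 / 2 * (2 / 10)" by (rule order_trans[OF Imz])
    also have "\<dots> = pi * (pi / 10)" by (simp add: power2_eq_square)
    also have "\<dots> < pi * 1" using pi_less_4 by (intro mult_strict_left_mono) auto
    finally show "\<bar>Im (z n)\<bar> < pi" by simp
  next
    have "\<bar>Im w\<bar> = l * pi" using l by (simp add: w_def abs_mult)
    also have "\<dots> \<le> (1 / 10) * pi" using l by (intro mult_right_mono) auto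
    finally show "\<bar>Im w\<bar> < pi" using pi_gt_zero by linarith
  qed
  then have Imlim: "(\<lambda>n. Im (z n)) \<longlonglongrightarrow> - (l * pi)" using tendsto_Im[of z w] by (simp add: w_def)
  have "(\<lambda>n. (nrm M\<^sub>0 (St (q n) (\<phi> n)))\<^sup>2 + Im (z n) / pi) \<longlonglongrightarrow> l + (- (l * pi)) / pi"
    by (intro tendsto_intros n2 Imlim) simp
  moreover have "(nrm M\<^sub>0 (St (q n) (\<phi> n)))\<^sup>2 + Im (z n) / pi = width (q n) * (\<Sum>m<hgt (q n). penalty (\<phi> n m))" for n
    unfolding St_nrm z_def Im_cexpo penalty_def by (simp add: sum.distrib sum_divide_distrib[symmetric] distrib_left)
  ultimately have kl: "(\<lambda>n. width (q n) * (\<Sum>m<hgt (q n). penalty (\<phi> n m))) \<longlonglongrightarrow> 0" by simp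
  define I where "I n = {m. m < hgt (q n) \<and> 1 / 2 < \<phi> n m}" for n
  define B where "B n = (\<Union>m\<in>I n. flo (q n) m)" for n
  have IB: "I n \<subseteq> {..<hgt (q n)}" for n by (auto simp: I_def)
  have BF: "B n \<in> FM" for n unfolding B_def using UN_flo_level[OF IB] levels_FM by blast
  have bd: "(nrm M\<^sub>0 (\<lambda>x. St (q n) (\<phi> n) x - ccount (B n) x))\<^sup>2 \<le> 8 * (width (q n) * (\<Sum>m<hgt (q n). penalty (\<phi> n m)))" for n
  proof -
    have "nrm M\<^sub>0 (\<lambda>x. St (q n) (\<phi> n) x - ccount (B n) x) = nrm M\<^sub>0 (St (q n) (\<lambda>m. \<phi> n m - indicator (I n) m))"
    proof (rule nrm_cong_AE)
      show "AE x in M\<^sub>0. St (q n) (\<phi> n) x - ccount (B n) x = St (q n) (\<lambda>m. \<phi> n m - indicator (I n) m) x"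
        using ccount_St[OF IB[of n]] by eventually_elim (simp add: B_def St_diff)
    qed (use sqi_diff[OF St_sqi ccount_sqi[OF BF[of n]]] St_sqi in \<open>auto simp: sqi_def\<close>)
    then have "(nrm M\<^sub>0 (\<lambda>x. St (q n) (\<phi> n) x - ccount (B n) x))\<^sup>2 = width (q n) * (\<Sum>m<hgt (q n). (\<phi> n m - indicator (I n) m)\<^sup>2)"
      by (simp add: St_nrm)
    also have "\<dots> \<le> width (q n) * (\<Sum>m<hgt (q n). 8 * penalty (\<phi> n m))"
    proof (intro mult_left_mono sum_mono)
      fix m assume "m \<in> {..<hgt (q n)}"
      then show "(\<phi> n m - indicator (I n) m)\<^sup>2 \<le> 8 * penalty (\<phi> n m)" using penalty_bound[of "\<phi> n m"] by (auto simp: I_def indicator_def split: if_splits)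
    qed (simp add: less_imp_le)
    finally show ?thesis by (simp add: sum_distrib_left mult_ac)
  qed
  have "(\<lambda>n. 8 * (width (q n) * (\<Sum>m<hgt (q n). penalty (\<phi> n m)))) \<longlonglongrightarrow> 0" using tendsto_mult_right_zero[OF kl] by simp
  moreover have "0 < (e / 2)\<^sup>2" using e by simp
  ultimately have "\<forall>\<^sub>F n in sequentially. 8 * (width (q n) * (\<Sum>m<hgt (q n). penalty (\<phi> n m))) < (e / 2)\<^sup>2" by (rule order_tendstoD(2))
  moreover have "\<forall>\<^sub>F n in sequentially. nrm M\<^sub>0 (\<lambda>x. h x - St (q n) (\<phi> n) x) < e / 2" using e by (intro order_tendstoD(2)[OF lim0]) simp
  ultimately have "\<forall>\<^sub>F n in sequentially. 8 * (width (q n) * (\<Sum>m<hgt (q n). penalty (\<phi> n m))) < (e / 2)\<^sup>2 \<and> nrm M\<^sub>0 (\<lambda>x. h x - St (q n) (\<phi> n) x) < e / 2"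
    by (rule eventually_conj)
  then obtain n where n: "8 * (width (q n) * (\<Sum>m<hgt (q n). penalty (\<phi> n m))) < (e / 2)\<^sup>2" "nrm M\<^sub>0 (\<lambda>x. h x - St (q n) (\<phi> n) x) < e / 2"
    by (auto simp: eventually_sequentially)
  have "nrm M\<^sub>0 (\<lambda>x. St (q n) (\<phi> n) x - ccount (B n) x) < e / 2"
    by (rule power2_less_imp_less) (use bd[of n] n(1) e in auto)
  then have "nrm M\<^sub>0 (\<lambda>x. h x - ccount (B n) x) < e"
    using nrm_diff_triangle[OF h(1) St_sqi[of "q n" "\<phi> n"] ccount_sqi[OF BF[of n]]] n(2) by simp
  then show ?thesis using BF by blast
qed

subsection \<open>Limits of counts\<close>

lemma ccount_diff_nrm: assumes "A \<in> FM" "B \<in> FM"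
  shows "(nrm M\<^sub>0 (\<lambda>x. ccount A x - ccount B x))\<^sup>2 = mu (A - B) + mu (B - A)"
proof -
  have "(nrm M\<^sub>0 (ccount C))\<^sup>2 = mu C" if "C \<in> FM" for C unfolding nrm_sq' by (rule ccount_var[OF that])
  then have "(nrm M\<^sub>0 (\<lambda>x. ccount A x + (-1) * ccount B x))\<^sup>2 = mu A - 2 * mu (A \<inter> B) + mu B"
    unfolding nrm_quadratic[OF ccount_sqi ccount_sqi, OF assms] ccount_cov[OF assms] using assms by simp
  moreover have "mu C = mu (C - D) + mu (C \<inter> D)" if "C \<in> FM" "D \<in> FM" for C D
  proof -
    have "(C - D) \<union> (C \<inter> D) = C" "(C - D) \<inter> (C \<inter> D) = {}" by auto
    then show ?thesis using mu_Un_disjoint[OF FM_Diff FM_Int, OF that that] by simp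
  qed
  from this[OF assms] this[OF assms(2,1)] have "mu A = mu (A - B) + mu (A \<inter> B)" "mu B = mu (B - A) + mu (A \<inter> B)"
    by (simp_all add: Int_commute)
  ultimately show ?thesis by simp
qed

lemma complete_counts:
  assumes h: "sqi M\<^sub>0 h" and B: "\<And>e. 0 < e \<Longrightarrow> \<exists>B\<in>FM. nrm M\<^sub>0 (\<lambda>x. h x - ccount B x) < e"
  shows "\<exists>G\<in>FM. AE x in M\<^sub>0. h x = ccount G x"
proof -
  have "\<exists>B\<in>FM. nrm M\<^sub>0 (\<lambda>x. h x - ccount B x) < (1/2) ^ n" for n :: nat by (rule B) simp
  then obtain B where B: "\<And>n. B n \<in> FM" "\<And>n. nrm M\<^sub>0 (\<lambda>x. h x - ccount (B n) x) < (1/2) ^ n" by metis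
  define D where "D n = (B n - B (Suc n)) \<union> (B (Suc n) - B n)" for n
  have DF: "D n \<in> FM" for n unfolding D_def by (intro FM_Un FM_Diff B)
  have Dm: "mu (D n) \<le> 4 * (1/2) ^ n" for n
  proof -
    have "mu (D n) = (nrm M\<^sub>0 (\<lambda>x. ccount (B n) x - ccount (B (Suc n)) x))\<^sup>2"
      unfolding ccount_diff_nrm[OF B(1) B(1)] D_def by (rule mu_Un_disjoint[OF FM_Diff FM_Diff]) (use B in auto)
    also have "\<dots> \<le> (2 * (1/2) ^ n)\<^sup>2"
    proof (rule power_mono)
      have "(1/2::real) ^ Suc n \<le> (1/2) ^ n" by simp
      then show "nrm M\<^sub>0 (\<lambda>x. ccount (B n) x - ccount (B (Suc n)) x) \<le> 2 * (1/2) ^ n"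
        using nrm_diff_triangle[OF ccount_sqi[OF B(1)] h ccount_sqi[OF B(1)], of n "Suc n"] B(2)[of n] B(2)[of "Suc n"]
          nrm_minus_commute[of M\<^sub>0 h "ccount (B n)"] by linarith
    qed simp
    also have "\<dots> = 4 * ((1/2) ^ n * (1/2) ^ n)" by (simp add: power2_eq_square)
    also have "\<dots> \<le> 4 * ((1/2) ^ n * 1)" by (intro mult_left_mono power_le_one) auto
    finally show ?thesis by simp
  qed
  define R where "R N = (\<Union>n. D (N + n))" for N
  have Rs: "R N \<in> sets lebesgue" "R N \<subseteq> {0..}" for N unfolding R_def using DF by (auto simp: FM_def subset_iff)
  have Re: "emeasure lebesgue (R N) \<le> ennreal (8 * (1/2) ^ N)" for N
  proof -
    have "emeasure lebesgue (R N) \<le> (\<Sum>n. emeasure lebesgue (D (N + n)))"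
      unfolding R_def by (rule emeasure_subadditive_countably) (use DF in \<open>auto simp: FM_def\<close>)
    also have "\<dots> \<le> (\<Sum>n. ennreal (4 * (1/2) ^ (N + n)))"
    proof (intro suminf_le summableI)
      fix n
      have "emeasure lebesgue (D (N + n)) = ennreal (mu (D (N + n)))" by (rule emeasure_eq_measure2[OF FM_lmeas[OF DF]])
      then show "emeasure lebesgue (D (N + n)) \<le> ennreal (4 * (1/2) ^ (N + n))" using Dm[of "N + n"] by (simp add: ennreal_leI)
    qed
    also have "\<dots> = ennreal (8 * (1/2) ^ N)"
    proof (rule suminf_ennreal_eq)
      have "(\<lambda>n. 4 * (1/2) ^ N * (1/2) ^ n) sums (4 * (1/2) ^ N * (1 / (1 - 1/2 :: real)))"
        by (intro sums_mult geometric_sums) simp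
      then show "(\<lambda>n. 4 * (1/2) ^ (N + n)) sums (8 * (1/2) ^ N :: real)" by (simp add: power_add mult_ac)
    qed simp
    finally show ?thesis .
  qed
  have RF: "R N \<in> FM" for N
    using Re[of N] Rs[of N] unfolding FM_def fmeasurable_def by (auto intro: order_le_less_trans simp: ennreal_less_top)
  have Rm: "mu (R N) \<le> 8 * (1/2) ^ N" for N
    using Re[of N] emeasure_eq_measure2[OF FM_lmeas[OF RF[of N]]] by (simp add: ennreal_le_iff)
  define G where "G = (\<Inter>N. \<Union>n. B (N + n))"
  have stay: "x \<in> B (N + n) \<longleftrightarrow> x \<in> B N" if "x \<notin> R N" for x N n
  proof (induct n)
    case (Suc n)
    have "x \<notin> D (N + n)" using that by (auto simp: R_def)
    then show ?case using Suc by (auto simp: D_def)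
  qed simp
  have GB: "x \<in> G \<longleftrightarrow> x \<in> B N" if x: "x \<notin> R N" for x N
  proof
    assume "x \<in> G"
    then obtain n where "x \<in> B (N + n)" by (auto simp: G_def)
    then show "x \<in> B N" using stay[OF x] by simp
  next
    assume "x \<in> B N"
    then have "x \<in> B (N + K)" for K using stay[OF x] by simp
    then have "x \<in> B (K + N)" for K by (simp add: add.commute)
    then show "x \<in> G" by (auto simp: G_def)
  qed
  have Gs: "G \<in> sets lebesgue" unfolding G_def using B(1) by (auto simp: FM_def)
  have Gsub: "G \<subseteq> B 0 \<union> R 0" using GB[of _ 0] by blast
  have GF: "G \<in> FM"
  proof -
    have "B 0 \<union> R 0 \<in> FM" by (intro FM_Un B RF)
    then show ?thesis using Gs Gsub unfolding FM_def by (auto intro: fmeasurableI2)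
  qed
  have "nrm M\<^sub>0 (\<lambda>x. h x - ccount G x) \<le> (1/2) ^ N + sqrt (16 * (1/2) ^ N)" for N
  proof -
    have "mu (B N - G) \<le> mu (R N)" "mu (G - B N) \<le> mu (R N)"
        using GB[of _ N] by (auto intro!: measure_mono_fmeasurable fmeasurableD FM_lmeas FM_Diff B GF RF)
    then have "(nrm M\<^sub>0 (\<lambda>x. ccount (B N) x - ccount G x))\<^sup>2 \<le> 16 * (1/2) ^ N"
      unfolding ccount_diff_nrm[OF B(1) GF] using Rm[of N] by simp
    then have "nrm M\<^sub>0 (\<lambda>x. ccount (B N) x - ccount G x) \<le> sqrt (16 * (1/2) ^ N)" by (rule real_le_rsqrt)
    then show ?thesis using nrm_diff_triangle[OF h ccount_sqi[OF B(1)] ccount_sqi[OF GF], of N] B(2)[of N] by linarith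
  qed
  moreover have "(\<lambda>N. (1/2) ^ N + sqrt (16 * (1/2::real) ^ N)) \<longlonglongrightarrow> 0 + sqrt (16 * 0)"
    by (intro tendsto_intros LIMSEQ_power_zero) auto
  ultimately have "nrm M\<^sub>0 (\<lambda>x. h x - ccount G x) \<le> 0 + sqrt (16 * 0)" by (intro LIMSEQ_le_const) auto
  then have "nrm M\<^sub>0 (\<lambda>x. h x - ccount G x) = 0" using nrm_nonneg[of M\<^sub>0 "\<lambda>x. h x - ccount G x"] by simp
  from nrm_zero_AE[OF sqi_diff[OF h ccount_sqi[OF GF]] this] show ?thesis using GF by (intro bexI[of _ G]) simp_all
qed

section \<open>Asymmetry\<close>

subsection \<open>Transport of counts by a reversing map\<close>

lemma approximable_cnt:
  assumes A: "A \<in> FM" and S: "measure_preserving M\<^sub>0 S" shows "approximable (\<lambda>x. cnt A (S x))"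
proof (rule approximable_limit)
  show "sqi M\<^sub>0 (\<lambda>x. cnt A (S x))" by (rule mp_sqi[OF S cnt_moments(1)[OF A]])
  fix e :: real assume e: "0 < e"
  define Q where "Q k = (\<lambda>x. card (x \<inter> A)) -` {k} \<inter> space M\<^sub>0" for k
  have Q: "Q k \<in> sets M\<^sub>0" for k
    unfolding Q_def using measurable_sets[OF M0_measurable[OF card_measurable[OF A]], of "{k}"] by simp
  have SQ: "S -` Q k \<inter> space M\<^sub>0 \<in> sets M\<^sub>0" for k using S Q unfolding measure_preserving_def by (intro measurable_sets) auto
  define D where "D K x = cnt A x - (\<Sum>k<K. real k * indicator (Q k) x)" for K x
  have D: "D K x = (if card (x \<inter> A) < K then 0 else cnt A x)" if "x \<in> space M\<^sub>0" for K x
  proof -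
    have "(\<Sum>k<K. real k * indicator (Q k) x) = (\<Sum>k<K. if k = card (x \<inter> A) then real k else 0)"
      using that by (intro sum.cong) (auto simp: Q_def indicator_def)
    then show ?thesis by (simp add: D_def cnt_def)
  qed
  have Dm: "D K \<in> borel_measurable M\<^sub>0" for K
    unfolding D_def[abs_def] using Q cnt_M0[OF A] by (intro borel_measurable_diff borel_measurable_sum borel_measurable_times) auto
  have cm2: "sqi M\<^sub>0 (cnt A)" by (rule cnt_moments(1)[OF A])
  have "(\<lambda>K. \<integral>x. (D K x)\<^sup>2 \<partial>M\<^sub>0) \<longlonglongrightarrow> (\<integral>x. 0 \<partial>M\<^sub>0)"
  proof (rule integral_dominated_convergence)
    show "integrable M\<^sub>0 (\<lambda>x. (cnt A x)\<^sup>2)" using cm2 by (simp add: sqi_def)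
    show "AE x in M\<^sub>0. norm ((D K x)\<^sup>2) \<le> (cnt A x)\<^sup>2" for K by (rule AE_I2) (simp add: D)
    show "AE x in M\<^sub>0. (\<lambda>K. (D K x)\<^sup>2) \<longlonglongrightarrow> 0"
    proof (rule AE_I2)
      fix x assume x: "x \<in> space M\<^sub>0"
      have "\<forall>\<^sub>F K in sequentially. (D K x)\<^sup>2 = 0"
        unfolding eventually_sequentially by (intro exI[of _ "Suc (card (x \<inter> A))"]) (simp add: D[OF x])
      then show "(\<lambda>K. (D K x)\<^sup>2) \<longlonglongrightarrow> 0" by (rule tendsto_eventually)
    qed
  qed (use Dm in measurable)
  then have "(\<lambda>K. nrm M\<^sub>0 (D K)) \<longlonglongrightarrow> 0" unfolding nrm_def using tendsto_real_sqrt by fastforce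
  then have "\<forall>\<^sub>F K in sequentially. nrm M\<^sub>0 (D K) < e" using e by (rule order_tendstoD(2))
  then obtain K where K: "nrm M\<^sub>0 (D K) < e" by (auto simp: eventually_sequentially)
  define g where "g x = (\<Sum>k<K. real k * indicator (S -` Q k \<inter> space M\<^sub>0) x)" for x
  have Ds: "sqi M\<^sub>0 (D K)"
    unfolding D_def[abs_def] using Q by (intro sqi_diff cm2 sqi_sum sqi_scale sqi_indicator)
  have gs: "approximable g" unfolding g_def[abs_def] using SQ by (intro approximable_sum approximable_scale approximable_indicator) auto
  have "nrm M\<^sub>0 (\<lambda>x. cnt A (S x) - g x) = nrm M\<^sub>0 (\<lambda>x. D K (S x))"
  proof (rule nrm_cong_AE)
    show "AE x in M\<^sub>0. cnt A (S x) - g x = D K (S x)" by (rule AE_I2) (simp add: g_def D_def indicator_def)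
    show "(\<lambda>x. cnt A (S x) - g x) \<in> borel_measurable M\<^sub>0"
      using mp_meas[OF S cnt_M0[OF A]] approximable_sqi[OF gs] by (intro borel_measurable_diff) (auto simp: sqi_def)
  qed (rule mp_meas[OF S Dm])
  also have "\<dots> < e" using mp_nrm[OF S Ds] K by simp
  finally show "\<exists>h. approximable h \<and> nrm M\<^sub>0 (\<lambda>x. cnt A (S x) - h x) < e" using gs by blast
qed

lemma mp_Cf: "measure_preserving M\<^sub>0 S \<Longrightarrow> x \<in> Cf \<Longrightarrow> S x \<in> Cf"
  using measurable_space[of S M\<^sub>0 M\<^sub>0 x] by (simp add: measure_preserving_def)

lemma measure_Int3:
  assumes F: "A \<in> FM" "B \<in> FM" "C \<in> FM"
  shows "mu (A \<inter> B \<inter> C) = mu A + mu B + mu C - mu (A \<union> B) - mu (A \<union> C) - mu (B \<union> C) + mu (A \<union> B \<union> C)"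
proof -
  have u: "mu (X \<union> Y) = mu X + mu Y - mu (X \<inter> Y)" if "X \<in> FM" "Y \<in> FM" for X Y
    using measure_Un3[OF FM_lmeas FM_lmeas, OF that] .
  have "(A \<union> B) \<inter> C = (A \<inter> C) \<union> (B \<inter> C)" "(A \<inter> C) \<inter> (B \<inter> C) = A \<inter> B \<inter> C" by auto
  then show ?thesis
    using u[OF F(1,2)] u[OF F(1,3)] u[OF F(2,3)] u[OF FM_Un[OF F(1,2)] F(3)] u[OF FM_Int[OF F(1,3)] FM_Int[OF F(2,3)]] by simp
qed

lemma tpre_add: "0 \<le> x \<Longrightarrow> x \<in> tpre (m + n) A \<longleftrightarrow> (tmap ^^ n) x \<in> tpre m A"
  using tmap_pow_nonneg[of x n] by (simp add: tpre_def funpow_add)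

locale reversing =
  fixes S :: "real set \<Rightarrow> real set"
  assumes mp: "measure_preserving M\<^sub>0 S" and rev: "AE x in M\<^sub>0. S x = PP (S (PP x))"
begin

lemma rev_pow: "AE x in M\<^sub>0. S x = (PP ^^ n) (S ((PP ^^ n) x))"
proof (induct n)
  case (Suc n)
  have "AE x in M\<^sub>0. S ((PP ^^ n) x) = PP (S (PP ((PP ^^ n) x)))" by (rule mp_AE[OF PPn_mp rev])
  with Suc show ?case
  proof eventually_elim
    case (elim x)
    show ?case unfolding elim(1) unfolding elim(2) by (simp add: funpow_swap1)
  qed
qed simp

lemma rev_shift: assumes "p \<le> q" shows "AE x in M\<^sub>0. S ((PP ^^ p) x) = (PP ^^ (q - p)) (S ((PP ^^ q) x))"
  using mp_AE[OF PPn_mp[of p] rev_pow[of "q - p"]]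
proof eventually_elim
  case (elim x)
  have "(PP ^^ (q - p)) ((PP ^^ p) x) = (PP ^^ q) x" using PP_add[of "q - p" p x] assms by simp
  then show ?case using elim by simp
qed

lemma mp_pow: "measure_preserving M\<^sub>0 (\<lambda>x. S ((PP ^^ n) x))"
  by (rule measure_preserving_comp[OF PPn_mp mp])

lemma autocorr_S: assumes E: "E \<in> FM" shows "autocorr (\<lambda>x. ccount E (S x)) n = mu (E \<inter> tpre n E)"
proof -
  have s: "sqi M\<^sub>0 (ccount E)" by (rule ccount_sqi[OF E])
  note m = sqi_meas[OF s]
  have "autocorr (\<lambda>x. ccount E (S x)) n = (\<integral>x. (\<lambda>y. ccount E y * ccount E ((PP ^^ n) y)) (S ((PP ^^ n) x)) \<partial>M\<^sub>0)"
    unfolding autocorr_def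
  proof (rule integral_cong_AE)
    show "AE x in M\<^sub>0. ccount E (S ((PP ^^ n) x)) * ccount E (S x) = ccount E (S ((PP ^^ n) x)) * ccount E ((PP ^^ n) (S ((PP ^^ n) x)))"
      using rev_pow[of n] by eventually_elim simp
    show "(\<lambda>x. ccount E (S ((PP ^^ n) x)) * ccount E (S x)) \<in> borel_measurable M\<^sub>0"
      by (intro borel_measurable_times mp_meas[OF mp_pow m] mp_meas[OF mp m])
    show "(\<lambda>x. ccount E (S ((PP ^^ n) x)) * ccount E ((PP ^^ n) (S ((PP ^^ n) x)))) \<in> borel_measurable M\<^sub>0"
      by (intro borel_measurable_times mp_meas[OF mp_pow m] mp_meas[OF mp_pow mp_meas[OF PPn_mp m]])
  qed
  also have "\<dots> = (\<integral>y. ccount E y * ccount E ((PP ^^ n) y) \<partial>M\<^sub>0)"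
    by (rule mp_integral[OF mp_pow]) (intro borel_measurable_times m mp_meas[OF PPn_mp m])
  also have "\<dots> = autocorr (ccount E) n" unfolding autocorr_def by (simp only: mult.commute)
  finally show ?thesis using autocorr_ccount[OF E] by simp
qed

lemma transported_level:
  assumes E: "E \<in> levels q0" "mu E \<le> 1 / 10"
  obtains G where "G \<in> FM" "mu G = mu E" "AE x in M\<^sub>0. void_ind E (S x) = void_ind G x"
proof -
  define h where "h x = ccount E (S x)" for x
  have EF: "E \<in> FM" by (rule levels_FM[OF E(1)])
  have s: "sqi M\<^sub>0 (ccount E)" by (rule ccount_sqi[OF EF])
  have hs: "sqi M\<^sub>0 h" unfolding h_def[abs_def] by (rule mp_sqi[OF mp s])
  have ha: "approximable h"
  proof (rule approximable_cong_AE)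
    show "approximable (\<lambda>x. cnt E (S x) + (- mu E) * void_ind {} x)" by (intro approximable_add approximable_scale approximable_cnt approximable_void_ind EF mp FM_empty)
    show "AE x in M\<^sub>0. cnt E (S x) + (- mu E) * void_ind {} x = h x" by (rule AE_I2) (simp add: void_ind_empty h_def ccount_def)
  qed (rule sqi_meas[OF hs])
  have mean: "(\<integral>x. h x \<partial>M\<^sub>0) = 0" unfolding h_def using mp_integral[OF mp sqi_meas[OF s]] ccount_mean[OF EF] by simp
  have r: "autocorr h n = mu (E \<inter> tpre n E)" for n unfolding h_def[abs_def] by (rule autocorr_S[OF EF])
  have sq: "(nrm M\<^sub>0 (ccount C))\<^sup>2 = mu C" if "C \<in> FM" for C unfolding nrm_sq' by (rule ccount_var[OF that])
  have hn: "nrm M\<^sub>0 h = nrm M\<^sub>0 (ccount E)" unfolding h_def[abs_def] by (rule mp_nrm[OF mp s])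
  then have hn': "nrm M\<^sub>0 h = sqrt (mu E)" using sq[OF EF] real_sqrt_unique[of "nrm M\<^sub>0 (ccount E)"] by simp
  have ch: "(\<integral>x. cis (pi * h x) \<partial>M\<^sub>0) = (\<integral>x. cis (pi * ccount E x) \<partial>M\<^sub>0)"
  proof -
    have [measurable]: "ccount E \<in> borel_measurable M\<^sub>0" by (rule sqi_meas[OF s])
    have "(\<lambda>x. cis (pi * ccount E x)) \<in> borel_measurable M\<^sub>0" unfolding cis_conv_exp by measurable
    then show ?thesis using integral_distr[of S M\<^sub>0 M\<^sub>0 "\<lambda>x. cis (pi * ccount E x)"] mp unfolding h_def measure_preserving_def by simp
  qed
  have "\<exists>q F c. finite F \<and> F \<subseteq> levels q \<and> nrm M\<^sub>0 (\<lambda>x. h x - (\<Sum>A\<in>F. c A * ccount A x)) < e" if "0 < e" for e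
    by (rule first_chaos[OF ha mean E(1) r that])
  then have "\<exists>B\<in>FM. nrm M\<^sub>0 (\<lambda>x. h x - ccount B x) < e" if "0 < e" for e
    by (rule count_limit[OF E hs hn' ch _ that])
  from complete_counts[OF hs this] obtain G where G: "G \<in> FM" "AE x in M\<^sub>0. h x = ccount G x" by blast
  have "nrm M\<^sub>0 h = nrm M\<^sub>0 (ccount G)" using G(2) sqi_meas[OF hs] sqi_meas[OF ccount_sqi[OF G(1)]] by (rule nrm_cong_AE)
  then have m: "mu G = mu E" using sq[OF G(1)] sq[OF EF] hn by simp
  have "AE x in M\<^sub>0. void_ind E (S x) = void_ind G x"
    using G(2) mp_AE[OF mp M0_AE[OF AE_finite[OF EF]]] M0_AE[OF AE_finite[OF G(1)]] AE_space
  proof eventually_elim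
    case (elim x)
    then have "card (S x \<inter> E) = card (x \<inter> G)" by (simp add: h_def ccount_def m cnt_def)
    then have "S x \<inter> E = {} \<longleftrightarrow> x \<inter> G = {}" using elim by (metis card_0_eq card.empty)
    moreover have "x \<in> Cf" "S x \<in> Cf" using elim mp_Cf[OF mp] by auto
    ultimately show ?case by (simp add: void_ind_def indicator_def in_void)
  qed
  then show ?thesis using that G(1) m by blast
qed

lemma reversed_unions:
  assumes E: "E \<in> FM" and G: "G \<in> FM" "AE x in M\<^sub>0. void_ind E (S x) = void_ind G x" and pq: "p \<le> q"
  shows "mu (G \<union> tpre p G \<union> tpre q G) = mu (E \<union> tpre (q - p) E \<union> tpre q E)"
proof -
  have one: "(\<integral>x. void_ind C x * void_ind C ((PP ^^ m) x) * void_ind C ((PP ^^ n) x) \<partial>M\<^sub>0) = exp (- mu (C \<union> tpre m C \<union> tpre n C))"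
    if C: "C \<in> FM" for C m n
  proof -
    have F: "C \<union> tpre m C \<union> tpre n C \<in> FM" by (intro FM_Un tpre_FM(1) C)
    have "(\<integral>x. void_ind C x * void_ind C ((PP ^^ m) x) * void_ind C ((PP ^^ n) x) \<partial>M\<^sub>0) = (\<integral>x. void_ind (C \<union> tpre m C \<union> tpre n C) x \<partial>M\<^sub>0)"
    proof (rule integral_cong_AE)
      show "AE x in M\<^sub>0. void_ind C x * void_ind C ((PP ^^ m) x) * void_ind C ((PP ^^ n) x) = void_ind (C \<union> tpre m C \<union> tpre n C) x"
        using shift_counts[OF C, of m] shift_counts[OF C, of n] by eventually_elim (simp add: void_ind_mult)
    qed (intro borel_measurable_times void_ind_M0 mp_meas[OF PPn_mp void_ind_M0] C F)+
    then show ?thesis using void_ind_mean[OF F] by simp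
  qed
  define f where "f y = void_ind E y * void_ind E ((PP ^^ (q - p)) y) * void_ind E ((PP ^^ q) y)" for y
  have fm: "f \<in> borel_measurable M\<^sub>0" unfolding f_def[abs_def]
    by (intro borel_measurable_times void_ind_M0 mp_meas[OF PPn_mp void_ind_M0] E)
  have "exp (- mu (G \<union> tpre p G \<union> tpre q G)) = (\<integral>x. void_ind G x * void_ind G ((PP ^^ p) x) * void_ind G ((PP ^^ q) x) \<partial>M\<^sub>0)"
    by (rule one[OF G(1), symmetric])
  also have "\<dots> = (\<integral>x. f (S ((PP ^^ q) x)) \<partial>M\<^sub>0)"
  proof (rule integral_cong_AE)
    show "AE x in M\<^sub>0. void_ind G x * void_ind G ((PP ^^ p) x) * void_ind G ((PP ^^ q) x) = f (S ((PP ^^ q) x))"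
      using G(2) mp_AE[OF PPn_mp[of p] G(2)] mp_AE[OF PPn_mp[of q] G(2)] rev_pow[of q] rev_shift[OF pq]
    proof eventually_elim
      case (elim x)
      show ?case unfolding f_def elim(4,5)[symmetric] elim(1-3)[symmetric] by simp
    qed
  qed (intro borel_measurable_times void_ind_M0 mp_meas[OF PPn_mp void_ind_M0] mp_meas[OF mp_pow fm] G)+
  also have "\<dots> = (\<integral>y. f y \<partial>M\<^sub>0)" by (rule mp_integral[OF mp_pow fm])
  also have "\<dots> = exp (- mu (E \<union> tpre (q - p) E \<union> tpre q E))" unfolding f_def by (rule one[OF E])
  finally show ?thesis by simp
qed

lemma reversed_triple:
  assumes E: "E \<in> FM" and G: "G \<in> FM" "AE x in M\<^sub>0. void_ind E (S x) = void_ind G x" "mu G = mu E" and pq: "p \<le> q"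
  shows "mu (G \<inter> tpre p G \<inter> tpre q G) = mu (E \<inter> tpre (q - p) E \<inter> tpre q E)"
proof -
  have z: "tpre 0 A = A" if "A \<in> FM" for A using that by (auto simp: tpre_def FM_def)
  have pair: "mu (G \<union> tpre n G) = mu (E \<union> tpre n E)" for n
    using reversed_unions[OF E G(1,2), of 0 n] z[OF G(1)] by (simp add: Un_assoc)
  have mid: "mu (tpre m A \<union> tpre (m + n) A) = mu (A \<union> tpre n A)" if A: "A \<in> FM" for A m n
  proof -
    have "tpre m A \<union> tpre (m + n) A = tpre m (A \<union> tpre n A)"
      using tpre_add[of _ n m A] tmap_pow_nonneg[of _ m] by (auto simp: tpre_def add.commute[of m n] funpow_add)
    then show ?thesis using tpre_FM(2)[OF FM_Un[OF A tpre_FM(1)[OF A]]] by simp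
  qed
  have m1: "mu (tpre p G \<union> tpre q G) = mu (G \<union> tpre (q - p) G)" using mid[OF G(1), of p "q - p"] pq by simp
  have m2: "mu (tpre (q - p) E \<union> tpre q E) = mu (E \<union> tpre p E)" using mid[OF E, of "q - p" p] pq by simp
  show ?thesis
    unfolding measure_Int3[OF G(1) tpre_FM(1)[OF G(1)] tpre_FM(1)[OF G(1)]] measure_Int3[OF E tpre_FM(1)[OF E] tpre_FM(1)[OF E]]
      tpre_FM(2)[OF E] tpre_FM(2)[OF G(1)] reversed_unions[OF E G(1,2) pq] m1 m2 pair G(3) by simp
qed

end

subsection \<open>Triple returns separate the two directions of time\<close>

lemma col_shift:
  assumes z: "z \<in> col j x" and xy: "x < y" "y < ncols j"
  shows "(tmap ^^ (colpos j y - colpos j x)) z \<in> col j y"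
proof -
  define m where "m = colpos j y - colpos j x"
  have cm: "colpos j y = colpos j x + m" using colpos_less[OF xy(1)] by (simp add: m_def less_imp_le)
  have xr: "x < ncols j" using xy by simp
  have t: "z \<in> tow j" "cix j z = x" using z in_col[OF xr] by auto
  have p: "pos (Suc j) z = colpos j x + pos j z" "pos j z < hgt j" using pos_Suc(1)[OF t(1)] t(2) pos_tow(1)[OF t(1)] by auto
  have zs: "z \<in> tow (Suc j)" using t tow_mono_Suc by blast
  have "pos (Suc j) z + m < hgt (Suc j)" using p cm colpos_bound[OF xy(2) p(2)] by simp
  from tmap_pow[OF zs this] have "(tmap ^^ m) z \<in> tow (Suc j)" "pos (Suc j) ((tmap ^^ m) z) = colpos j y + pos j z"
    using p cm by auto
  then have "(tmap ^^ m) z \<in> flo (Suc j) (colpos j y + pos j z)" using pos_tow(2) by metis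
  then show ?thesis unfolding m_def[symmetric] col_eq[OF xy(2)] using p(2) by blast
qed

lemma col_lmeasurable: assumes "i < ncols j" shows "col j i \<in> lmeasurable"
  unfolding col_eq[OF assms] by (rule fmeasurable.finite_UN) (auto simp: flo_measure)

lemma sum_columns:
  assumes D: "D \<in> FM" and n: "n \<le> ncols j"
  shows "(\<Sum>i<n. mu (D \<inter> col j i)) \<le> mu D"
proof -
  have F: "D \<inter> col j i \<in> FM" if "i < ncols j" for i
    using D col_lmeasurable[OF that] by (auto simp: FM_def intro: fmeasurable_Int_fmeasurable)
  have "(\<Sum>i<n. mu (D \<inter> col j i)) = mu (D \<inter> (\<Union>i<n. col j i)) \<and> D \<inter> (\<Union>i<n. col j i) \<in> FM"
    using n
  proof (induct n)
    case (Suc n)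
    have "D \<inter> (\<Union>i<Suc n. col j i) = (D \<inter> (\<Union>i<n. col j i)) \<union> (D \<inter> col j n)" by (auto simp: lessThan_Suc)
    moreover have "(D \<inter> (\<Union>i<n. col j i)) \<inter> (D \<inter> col j n) = {}" using in_col Suc(2) by fastforce
    ultimately show ?case using Suc mu_Un_disjoint[OF _ F] FM_Un[OF _ F] by simp
  qed (simp add: FM_empty)
  moreover have "mu (D \<inter> (\<Union>i<n. col j i)) \<le> mu D"
    by (rule measure_mono_fmeasurable) (use calculation D in \<open>auto simp: FM_def\<close>)
  ultimately show ?thesis by simp
qed

lemma no_triple_returns:
  assumes G: "G \<in> FM" "mu G = 1 / 10"
    and none: "\<And>j i. Suc (Suc i) < ncols j \<Longrightarrow>
      mu (G \<inter> tpre (colpos j (Suc i) - colpos j i) G \<inter> tpre (colpos j (Suc (Suc i)) - colpos j i) G) = 0"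
  shows False
proof -
  obtain j0 F where F: "F \<in> levels j0" "mu (G - F) < 1 / 1000" "mu (F - G) < 1 / 1000"
    using levels_dense[of G "1 / 1000"] G(1) by (auto simp: FM_def)
  define j where "j = max j0 2"
  have FL: "F \<in> levels j" using F(1) levels_mono[of j0 j] by (auto simp: j_def)
  have FF: "F \<in> FM" by (rule levels_FM[OF FL])
  define D where "D = F - G"
  have DF: "D \<in> FM" unfolding D_def by (rule FM_Diff[OF FF G(1)])
  have DcF: "D \<inter> col j i \<in> FM" if "i < ncols j" for i
    using DF col_lmeasurable[OF that] by (auto simp: FM_def intro: fmeasurable_Int_fmeasurable)
  define n where "n = ncols j - 2"
  have n: "ncols j = n + 2" "2 \<le> n" by (auto simp: n_def ncols_def j_def)
  have step: "mu F / ncols j \<le> mu (D \<inter> col j i) + mu (D \<inter> col j (Suc i)) + mu (D \<inter> col j (Suc (Suc i)))" if i: "i < n" for i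
  proof -
    define p where "p = colpos j (Suc i) - colpos j i"
    define q where "q = colpos j (Suc (Suc i)) - colpos j i"
    have r: "i < ncols j" "Suc i < ncols j" "Suc (Suc i) < ncols j" using i n by auto
    have T: "G \<inter> tpre p G \<inter> tpre q G \<in> FM" by (intro FM_Int tpre_FM(1) G)
    note d = DcF[OF r(1)] tpre_FM(1)[OF DcF[OF r(2)], of p] tpre_FM(1)[OF DcF[OF r(3)], of q]
    have "F \<inter> col j i \<subseteq> ((G \<inter> tpre p G \<inter> tpre q G \<union> D \<inter> col j i) \<union> tpre p (D \<inter> col j (Suc i))) \<union> tpre q (D \<inter> col j (Suc (Suc i)))"
    proof
      fix x assume x: "x \<in> F \<inter> col j i"
      then have "x \<in> F \<inter> tpre p F \<inter> tpre q F" using triple_forward[OF FL r(3)] unfolding p_def q_def by blast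
      then have f: "x \<in> F" "0 \<le> x" "(tmap ^^ p) x \<in> F" "(tmap ^^ q) x \<in> F" by (auto simp: tpre_def)
      have "(tmap ^^ p) x \<in> col j (Suc i)" "(tmap ^^ q) x \<in> col j (Suc (Suc i))"
        unfolding p_def q_def using x col_shift r by auto
      then show "x \<in> ((G \<inter> tpre p G \<inter> tpre q G \<union> D \<inter> col j i) \<union> tpre p (D \<inter> col j (Suc i))) \<union> tpre q (D \<inter> col j (Suc (Suc i)))"
        using f x by (auto simp: D_def tpre_def)
    qed
    then have "mu (F \<inter> col j i) \<le> mu (((G \<inter> tpre p G \<inter> tpre q G \<union> D \<inter> col j i) \<union> tpre p (D \<inter> col j (Suc i))) \<union> tpre q (D \<inter> col j (Suc (Suc i))))"
      using measure_level_col(2)[OF FL r(1)] FM_Un[OF FM_Un[OF FM_Un[OF T d(1)] d(2)] d(3)]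
      by (intro measure_mono_fmeasurable) (auto simp: FM_def)
    also have "\<dots> \<le> ((mu (G \<inter> tpre p G \<inter> tpre q G) + mu (D \<inter> col j i)) + mu (tpre p (D \<inter> col j (Suc i)))) + mu (tpre q (D \<inter> col j (Suc (Suc i))))"
      using FM_Un[OF FM_Un[OF T d(1)] d(2)] FM_Un[OF T d(1)] T d
      by (intro order_trans[OF measure_Un_le] add_mono order_refl) (auto simp: FM_def)
    finally show ?thesis
      using measure_level_col(1)[OF FL r(1)] none[OF r(3)] tpre_FM(2)[OF DcF[OF r(2)]] tpre_FM(2)[OF DcF[OF r(3)]]
      unfolding p_def q_def by simp
  qed
  define a where "a i = mu (D \<inter> col j i)" for i
  have tail: "(\<Sum>i<n. a (i + k)) \<le> mu D" if "k \<le> 2" for k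
  proof -
    have "(\<Sum>i<n. a (i + k)) = sum a ((\<lambda>i. i + k) ` {..<n})" by (simp add: sum.reindex)
    also have "\<dots> \<le> sum a {..<ncols j}" by (rule sum_mono2) (use that n in \<open>auto simp: a_def\<close>)
    also have "\<dots> \<le> mu D" unfolding a_def by (rule sum_columns[OF DF order_refl])
    finally show ?thesis .
  qed
  have "(\<Sum>i<n. mu F / ncols j) \<le> (\<Sum>i<n. a (i + 0) + a (i + 1) + a (i + 2))"
    using step by (intro sum_mono) (simp add: a_def)
  also have "\<dots> \<le> mu D + mu D + mu D" unfolding sum.distrib by (intro add_mono tail) auto
  also have "\<dots> < 3 / 1000" using F(3) by (simp add: D_def)
  finally have up: "real n * (mu F / ncols j) < 3 / 1000" by simp
  have "mu G \<le> mu (F \<union> (G - F))"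
    by (intro measure_mono_fmeasurable) (use G FM_Un[OF FF FM_Diff[OF G(1) FF]] in \<open>auto simp: FM_def\<close>)
  also have "\<dots> = mu F + mu (G - F)" by (rule mu_Un_disjoint[OF FF FM_Diff[OF G(1) FF]]) auto
  finally have low: "99 / 1000 < mu F" using G(2) F(2) by simp
  have "1 / 2 * mu F \<le> real n / ncols j * mu F"
    by (rule mult_right_mono) (use n in \<open>auto simp: field_simps\<close>)
  then show False using up low by simp
qed

lemma mu_tow_0: "mu (tow 0) = 1 / 10" by (simp add: tow_eq)

lemma (in reversing) no_reversal: False
proof -
  have E: "tow 0 \<in> levels 0" by (rule levels_tow)
  have EF: "tow 0 \<in> FM" by (rule levels_FM[OF E])
  obtain G where G: "G \<in> FM" "mu G = mu (tow 0)" "AE x in M\<^sub>0. void_ind (tow 0) (S x) = void_ind G x"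
    by (rule transported_level[OF E]) (simp add: mu_tow_0)
  show False
  proof (rule no_triple_returns[OF G(1)])
    show "mu G = 1 / 10" using G(2) mu_tow_0 by simp
    fix j i assume i: "Suc (Suc i) < ncols j"
    define p where "p = colpos j (Suc i) - colpos j i"
    define q where "q = colpos j (Suc (Suc i)) - colpos j i"
    have l: "colpos j i < colpos j (Suc i)" "colpos j (Suc i) < colpos j (Suc (Suc i))" by (rule colpos_less, simp)+
    then have pq: "p \<le> q" "q - p = colpos j (Suc (Suc i)) - colpos j (Suc i)" by (auto simp: p_def q_def)
    have Ej: "tow 0 \<in> levels j" using E levels_mono[of 0 j] by blast
    have "mu (G \<inter> tpre p G \<inter> tpre q G) = mu (tow 0 \<inter> tpre (q - p) (tow 0) \<inter> tpre q (tow 0))"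
      by (rule reversed_triple[OF EF G(1,3,2) pq(1)])
    also have "\<dots> = 0" unfolding pq(2) unfolding q_def triple_backward[OF Ej i] by simp
    finally show "mu (G \<inter> tpre (colpos j (Suc i) - colpos j i) G \<inter> tpre (colpos j (Suc (Suc i)) - colpos j i) G) = 0"
      by (simp only: p_def q_def)
  qed
qed

subsection \<open>The inverse of the suspension\<close>

abbreviation QQ :: "real set \<Rightarrow> real set" where "QQ \<equiv> susp (inv_into {0..} tmap)"

lemma pre_inv: "pre (inv_into {0..} tmap) {0} A = {x. 0 \<le> x \<and> tinv x \<in> A} - {0}"
  by (auto simp: pre_def tinv_def)

lemma pre_inv_FM:
  assumes A: "A \<in> FM"
  shows "pre (inv_into {0..} tmap) {0} A \<in> FM \<and> mu (pre (inv_into {0..} tmap) {0} A) = mu A"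
proof -
  let ?P = "{x. 0 \<le> x \<and> tinv x \<in> A}"
  have As: "A \<in> sets lebesgue" "A \<subseteq> {0..}" "A \<in> sets lebX" using A by (auto simp: FM_def lebX_sets)
  have m: "tinv \<in> lebX \<rightarrow>\<^sub>M lebX" "distr lebX lebX tinv = lebX" using tinv_measure_preserving by (auto simp: measure_preserving_def)
  have v: "tinv -` A \<inter> space lebX = ?P" by auto
  have s: "?P \<in> sets lebesgue" using measurable_sets[OF m(1) As(3)] unfolding v lebX_sets by blast
  have e: "emeasure lebesgue ?P = emeasure lebesgue A"
  proof -
    have "?P \<subseteq> {0..}" by auto
    then show ?thesis using emeasure_distr[OF m(1) As(3)] lebX_emeasure[of ?P] lebX_emeasure[OF As(2)] unfolding m(2) v by simp
  qed
  have d: "emeasure lebesgue (?P - {0}) = emeasure lebesgue ?P" by (rule emeasure_Diff_null_set) (use s in auto)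
  have "emeasure lebesgue A < \<infinity>" using A unfolding FM_def fmeasurable_def by blast
  then have "?P - {0} \<in> FM" using s d e by (auto simp: FM_def fmeasurable_def)
  moreover have "mu (?P - {0}) = mu A" unfolding measure_def d e ..
  ultimately show ?thesis unfolding pre_inv by blast
qed

lemma inv_tmap_nonneg: "0 \<le> x \<Longrightarrow> x \<notin> {0} \<Longrightarrow> 0 \<le> inv_into {0..} tmap x"
  using inv_into_into[of x tmap "{0..}"] tmap_image by auto

lemma inj_inv_tmap: "inj_on (inv_into {0..} tmap) ({0..} - {0})"
  by (rule inj_on_inv_into) (auto simp: tmap_image)

lemma QQ_susp: "AE x in M\<^sub>0. x \<inter> {0} = {} \<and> QQ x = inv_into {0..} tmap ` x" "measure_preserving M\<^sub>0 QQ"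
proof -
  have z: "{0} \<in> null_sets lebesgue" "{0} \<subseteq> {0::real..}" by auto
  have s: "AE x in PN. x \<inter> {0} = {} \<and> inv_into {0..} tmap ` x \<in> Cf"
    by (rule susp_preserving(1)[OF z]; (rule inv_tmap_nonneg inj_inv_tmap pre_inv_FM; assumption?))
  show "AE x in M\<^sub>0. x \<inter> {0} = {} \<and> QQ x = inv_into {0..} tmap ` x"
    using M0_AE[OF s] by eventually_elim (simp add: susp_def)
  show "measure_preserving M\<^sub>0 QQ"
    by (rule susp_preserving(2)[OF z]; (rule inv_tmap_nonneg inj_inv_tmap pre_inv_FM; assumption?))
qed

lemma inverse_PP: "inverse_mod0 M\<^sub>0 PP QQ"
  unfolding inverse_mod0_def
proof (intro conjI)
  show "AE x in M\<^sub>0. QQ (PP x) = x" using AE_PP mp_AE[OF PP_susp(2) QQ_susp(1)] AE_space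
  proof eventually_elim
    case (elim x)
    then have "x \<subseteq> {0..}" by (simp add: Cf_def)
    then have "inv_into {0..} tmap ` tmap ` x = x" using tmap_inj by (intro inv_into_image_cancel) auto
    then show ?case using elim by simp
  qed
  show "AE x in M\<^sub>0. PP (QQ x) = x" using QQ_susp(1) mp_AE[OF QQ_susp(2) AE_PP] AE_space
  proof eventually_elim
    case (elim x)
    then have "x \<subseteq> tmap ` {0..}" unfolding tmap_image by (auto simp: Cf_def less_le)
    then show ?case using elim image_inv_into_cancel[OF refl, of x tmap "{0..}"] by simp
  qed
qed (rule PP_susp QQ_susp)+

lemma asymmetric_PP: "asymmetric M\<^sub>0 PP"
  unfolding asymmetric_def isomorphic_mod0_def
proof (intro exI[of _ QQ] conjI notI inverse_PP)
  assume "\<exists>S S'. inverse_mod0 M\<^sub>0 S S' \<and> (AE x in M\<^sub>0. S (PP (S' x)) = QQ x)"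
  then obtain S S' where S: "inverse_mod0 M\<^sub>0 S S'" "AE x in M\<^sub>0. S (PP (S' x)) = QQ x" by blast
  then have mp: "measure_preserving M\<^sub>0 S" and i: "AE x in M\<^sub>0. S' (S x) = x" by (auto simp: inverse_mod0_def)
  have q: "AE x in M\<^sub>0. PP (QQ x) = x" using inverse_PP by (simp add: inverse_mod0_def)
  have "AE x in M\<^sub>0. S x = PP (S (PP x))"
    using mp_AE[OF mp S(2)] mp_AE[OF mp q] i by eventually_elim simp
  then interpret reversing S using mp by unfold_locales
  show False by (rule no_reversal)
qed

subsection \<open>The phase space and its intervals\<close>

abbreviation ivs :: "real set set" where "ivs \<equiv> phase_intervals ncols spc width left_end"

lemma ivs_cases: assumes "I \<in> ivs" obtains j where "I \<subseteq> tow j"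
proof -
  have s: "flo j l \<subseteq> tow j" if "l < hgt j" for j l using in_tow that by blast
  have "I = flo 0 0 \<or> (\<exists>j l. I = flo (Suc j) l \<and> l < hgt (Suc j))"
    using assms unfolding phase_intervals_def insert_iff mem_Collect_eq height_eq by blast
  then show ?thesis
  proof (elim disjE exE conjE)
    assume a: "I = flo 0 0"
    show ?thesis by (rule that, unfold a, rule s, rule hgt_pos)
  next
    fix j l assume a: "I = flo (Suc j) l" "l < hgt (Suc j)"
    show ?thesis by (rule that, unfold a(1), rule s, rule a(2))
  qed
qed

lemma tow_cover: "\<exists>F\<subseteq>ivs. finite F \<and> tow j \<subseteq> \<Union>F"
proof (induct j)
  case 0
  have "tow 0 \<subseteq> flo 0 0" using in_tow[of _ 0] by auto
  then show ?case by (intro exI[of _ "{flo 0 0}"]) (simp add: phase_intervals_def)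
next
  case (Suc j)
  then obtain F where F: "F \<subseteq> ivs" "finite F" "tow j \<subseteq> \<Union>F" by blast
  define K where "K = {l. l < hgt (Suc j) \<and> flo (Suc j) l \<inter> tow j = {}}"
  have sub: "x \<in> tow j" if x: "x \<in> flo (Suc j) l" "l < hgt (Suc j)" "l \<notin> K" for x l
  proof -
    obtain y where y: "y \<in> flo (Suc j) l" "y \<in> tow j" using x(2,3) unfolding K_def by blast
    have "x \<in> tow (Suc j)" "pos (Suc j) x = l" "y \<in> tow (Suc j)" "pos (Suc j) y = l"
      using flo_pos[OF x(1,2)] flo_pos[OF y(1) x(2)] by auto
    then show ?thesis using pos_Suc_iff[of x j] pos_Suc_iff[of y j] y(2) by simp
  qed
  have "tow (Suc j) \<subseteq> \<Union>(F \<union> flo (Suc j) ` K)"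
  proof
    fix x assume "x \<in> tow (Suc j)"
    then obtain l where l: "l < hgt (Suc j)" "x \<in> flo (Suc j) l" using in_tow by blast
    then show "x \<in> \<Union>(F \<union> flo (Suc j) ` K)" using sub[OF l(2,1)] F(3) by blast
  qed
  moreover have "flo (Suc j) ` K \<subseteq> ivs" unfolding phase_intervals_def K_def height_eq by blast
  then have "F \<union> flo (Suc j) ` K \<subseteq> ivs" using F(1) by blast
  moreover have "finite (F \<union> flo (Suc j) ` K)" using F(2) by (simp add: K_def)
  ultimately show ?case by blast
qed

lemma ivs_Union: "\<Union>ivs = {0..}"
proof
  show "\<Union>ivs \<subseteq> {0..}"
  proof (rule Union_least)
    fix I assume "I \<in> ivs"
    then obtain j where "I \<subseteq> tow j" by (rule ivs_cases)
    then show "I \<subseteq> {0..}" unfolding tow_eq by auto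
  qed
  show "{0..} \<subseteq> \<Union>ivs"
  proof
    fix x :: real assume "x \<in> {0..}"
    then obtain j where j: "x \<in> tow j" using in_some_tow[of x] by auto
    obtain F where "F \<subseteq> ivs" "tow j \<subseteq> \<Union>F" using tow_cover[of j] by blast
    then show "x \<in> \<Union>ivs" using j by blast
  qed
qed

lemma configurations_ivs: "configurations ivs = Cf"
proof (intro set_eqI iffI)
  fix x assume x: "x \<in> configurations ivs"
  have "finite (x \<inter> {0..<real m})" for m
  proof -
    have "\<exists>j. 10 * real m < 2 ^ j" by (rule real_arch_pow) simp
    then obtain j where "10 * real m < 2 ^ j" by blast
    then have "real m < 2 ^ j / 10" by simp
    then have m: "real m \<le> width j * hgt j" using tow_size[of j] by linarith
    have "{0..<real m} \<subseteq> tow j"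
    proof
      fix y assume "y \<in> {0..<real m}"
      then show "y \<in> tow j" unfolding tow_eq atLeastLessThan_iff using m by linarith
    qed
    moreover obtain F where F: "F \<subseteq> ivs" "finite F" "tow j \<subseteq> \<Union>F" using tow_cover[of j] by blast
    ultimately have "x \<inter> {0..<real m} \<subseteq> (\<Union>I\<in>F. x \<inter> I)" by blast
    moreover have "finite (\<Union>I\<in>F. x \<inter> I)" using F(1,2) x unfolding configurations_def by (intro finite_UN_I) auto
    ultimately show ?thesis by (rule finite_subset)
  qed
  then show "x \<in> Cf" using x by (auto simp: configurations_def Cf_def ivs_Union)
next
  fix x assume x: "x \<in> Cf"
  have e: "x = (\<Union>m. x \<inter> {0..<real m})"
    using x reals_Archimedean2 by (fastforce simp: Cf_def)
  have "countable (\<Union>m. x \<inter> {0..<real m})" by (rule countable_UN[OF countableI_type], rule countable_finite) (use x in \<open>auto simp: Cf_def\<close>)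
  then have c: "countable x" using e by simp
  have "finite (x \<inter> I)" if I: "I \<in> ivs" for I
  proof -
    obtain j where "I \<subseteq> tow j" using ivs_cases[OF I] .
    moreover obtain m where "width j * hgt j < real m" using reals_Archimedean2 by blast
    ultimately have "x \<inter> I \<subseteq> x \<inter> {0..<real m}" unfolding tow_eq by auto
    then show ?thesis using x finite_subset unfolding Cf_def by blast
  qed
  then show "x \<in> configurations ivs" using x c by (auto simp: configurations_def Cf_def ivs_Union)
qed

lemma count_event_ivs: "count_event ivs A k = cev A k"
  by (simp add: count_event_def cev_def configurations_ivs)

lemma suspension_ivs: "suspension ivs R = susp R"
  by (rule ext) (simp add: suspension_def susp_def configurations_ivs)

lemma FM_lebX: "fmeasurable lebX = FM"
  by (auto simp: fmeasurable_def FM_def lebX_sets lebX_emeasure)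

lemma poisson_space_M0: "poisson_space ivs M\<^sub>0"
  unfolding poisson_space_def configurations_ivs count_event_ivs ivs_Union FM_lebX
proof (intro conjI allI impI)
  show "\<exists>N. M\<^sub>0 = completion N \<and> prob_space N \<and> space N = Cf \<and> sets N = sigma_sets Cf {cev A k |A k. A \<in> FM}"
  proof (intro exI[of _ PN] conjI refl prob_space_PN space_PN)
    show "sets PN = sigma_sets Cf {cev A k |A k. A \<in> FM}"
      unfolding sets_PN conf_sigma_def by (rule sets_measure_of[OF cev_sub])
  qed
  fix n :: nat and A :: "nat \<Rightarrow> real set" and k
  assume a: "0 < n \<and> disjoint_family_on A {..<n} \<and> (\<forall>i<n. A i \<in> FM)"
  then have "(\<Inter>i<n. cev (A i) (k i)) \<in> sets conf_sigma" by (intro sets.finite_INT) auto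
  then have "measure M\<^sub>0 (\<Inter>i<n. cev (A i) (k i)) = measure PN (\<Inter>i<n. cev (A i) (k i))" by (rule prob_M0)
  also have "\<dots> = (\<Prod>i<n. pois (mu (A i)) (k i))" by (rule joint_law) (use a in auto)
  finally show "measure M\<^sub>0 (\<Inter>i<n. cev (A i) (k i)) = (\<Prod>i<n. mu (A i) ^ k i / fact (k i) * exp (- mu (A i)))"
    by (simp add: pois_def)
qed

theorem theorem4:
  shows "\<exists>(r :: nat \<Rightarrow> nat) (s :: nat \<Rightarrow> nat \<Rightarrow> nat) (w :: nat \<Rightarrow> real) (a :: nat \<Rightarrow> nat \<Rightarrow> real)
           (T :: real \<Rightarrow> real) (M :: real set measure).
    let X = phase_space r s w a;
        \<I> = phase_intervals r s w a;
        P = suspension \<I> T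
    in rank_one_map r s w a T \<and>
       automorphism (lebesgue_on X) T \<and>
       emeasure lebesgue X = \<infinity> \<and>
       sidon r s w a T \<and>
       poisson_space \<I> M \<and>
       inverse_mod0 M P (suspension \<I> (inv_into X T)) \<and>
       mixing M P \<and>
       asymmetric M P"
proof (intro exI)
  show "let X = phase_space ncols spc width left_end;
        \<I> = phase_intervals ncols spc width left_end;
        P = suspension \<I> tmap
    in rank_one_map ncols spc width left_end tmap \<and>
       automorphism (lebesgue_on X) tmap \<and>
       emeasure lebesgue X = \<infinity> \<and>
       sidon ncols spc width left_end tmap \<and>
       poisson_space \<I> M\<^sub>0 \<and>
       inverse_mod0 M\<^sub>0 P (suspension \<I> (inv_into X tmap)) \<and>
       mixing M\<^sub>0 P \<and>
       asymmetric M\<^sub>0 P"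
    unfolding Let_def suspension_ivs phase_space_eq
    by (intro conjI rank_one_map_ok automorphism_tmap emeasure_phase_space sidon_ok poisson_space_M0 inverse_PP mixing_PP asymmetric_PP)
qed

end
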